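(* Let $V_1(n)$, $n\ge 0$, be the integers defined by $$\sum_{n\ge 0}\frac{q^{n(n+1)/2}}{(-q^2;q^2)_n}=\sum_{n\ge 0}V_1(n)q^n .$$ Then: (a) (Andrews' Conjecture 4) For almost all $n$, among the four numbers $V_1(n),V_1(n+1),V_1(n+2),V_1(n+3)$ exactly two are positive and exactly two are negative. (b) (Andrews' Conjecture 3, in modified form) $|V_1(n)|\to\infty$ as $n\to\infty$ away from a set of density $0$; that is, there is a set $E\subset\mathbb N$ of natural density $0$ such that $|V_1(n)|\to\infty$ as $n\to\infty$ with $n\notin E$.
   Context: Here $(a;q)_n=\prod_{j=0}^{n-1}(1-aq^j)$, so $(-q^2;q^2)_n=\prod_{j=1}^n(1+q^{2j})$, and the series is expanded as a power series in $q$ with $|q|<1$. "For almost all $n$" means for all $n$ outside a set of natural density $0$, where a set $E\subset\mathbb N$ has natural density $0$ if $\#(E\cap[1,N])/N\to 0$ as $N\to\infty$. *)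

theory Defs
  imports "HOL-Analysis.Analysis" "HOL-Computational_Algebra.Formal_Power_Series"
begin

definition q_pochhammer :: "'a::comm_ring_1 \<Rightarrow> 'a \<Rightarrow> nat \<Rightarrow> 'a" where
  "q_pochhammer a q n = (\<Prod>j<n. 1 - a * q ^ j)"

text \<open>The summand $q^{n(n+1)/2} / (-q^2;q^2)_n$, expanded as a power series in $q$. The
  coefficients are taken in the rationals only because division of power series needs a field;
  they are shown to be integers below.\<close>

definition V1_term :: "nat \<Rightarrow> rat fps" where
  "V1_term n = fps_X ^ (n * (n + 1) div 2) / q_pochhammer (- (fps_X ^ 2)) (fps_X ^ 2) n"

text \<open>The infinite sum is the limit in the usual topology of formal power series;
  it converges by \<open>summable_V1_term\<close> below.\<close>

definition V1_gf :: "rat fps" where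
  "V1_gf = (\<Sum>n. V1_term n)"

text \<open>The floor only changes the type: \<open>of_int_V1\<close> below shows that the coefficients are
  integers.\<close>

definition V1 :: "nat \<Rightarrow> int" where
  "V1 n = \<lfloor>fps_nth V1_gf n\<rfloor>"

definition natural_density_0 :: "nat set \<Rightarrow> bool" where
  "natural_density_0 E \<longleftrightarrow> (\<lambda>N. real (card (E \<inter> {1..N})) / real N) \<longlonglongrightarrow> 0"

definition for_almost_all :: "(nat \<Rightarrow> bool) \<Rightarrow> bool" where
  "for_almost_all P \<longleftrightarrow> (\<exists>E. natural_density_0 E \<and> (\<forall>n. n \<notin> E \<longrightarrow> P n))"

lemma q_pochhammer_neg: "q_pochhammer (- (q ^ 2)) (q ^ 2) n = (\<Prod>j=1..n. 1 + q ^ (2 * j))"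
proof -
  have "(\<Prod>j=1..n. 1 + q ^ (2 * j)) = (\<Prod>j<n. 1 + q ^ (2 * Suc j))"
    by (rule prod.reindex_bij_witness[of _ Suc "\<lambda>j. j - 1"]) auto
  also have "\<dots> = q_pochhammer (- (q ^ 2)) (q ^ 2) n"
    unfolding q_pochhammer_def by (simp add: power_mult power_add power2_eq_square mult.assoc)
  finally show ?thesis ..
qed

lemma q_pochhammer_nth_0:
  "fps_nth (q_pochhammer (- (fps_X ^ 2)) (fps_X ^ 2) n :: 'a::comm_ring_1 fps) 0 = 1"
  by (induction n) (auto simp: q_pochhammer_def)

lemma V1_term_altdef:
  "V1_term n = fps_X ^ (n * (n + 1) div 2) *
     inverse (q_pochhammer (- (fps_X ^ 2)) (fps_X ^ 2) n)"
  unfolding V1_term_def by (rule fps_divide_unit) (simp add: q_pochhammer_nth_0)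

lemma V1_term_nth_eq_0:
  assumes "k < n"
  shows "fps_nth (V1_term n) k = 0"
proof -
  have "2 * n \<le> n * (n + 1)"
    using assms by (cases n) auto
  then have "k < n * (n + 1) div 2"
    using assms by linarith
  then show ?thesis
    by (simp add: V1_term_altdef fps_X_power_mult_nth)
qed

lemma V1_term_sums: "V1_term sums Abs_fps (\<lambda>k. \<Sum>n\<le>k. fps_nth (V1_term n) k)"
  unfolding sums_def tendsto_fps_iff
proof
  fix k
  have "fps_nth (\<Sum>n<N. V1_term n) k = (\<Sum>n\<le>k. fps_nth (V1_term n) k)" if "N > k" for N
    unfolding fps_sum_nth
    by (rule sum.mono_neutral_right) (use that V1_term_nth_eq_0 in auto)
  then show "\<forall>\<^sub>F N in sequentially. fps_nth (\<Sum>n<N. V1_term n) k =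
      fps_nth (Abs_fps (\<lambda>k. \<Sum>n\<le>k. fps_nth (V1_term n) k)) k"
    by (intro eventually_mono[OF eventually_gt_at_top[of k]]) auto
qed

lemma summable_V1_term: "summable V1_term"
  using V1_term_sums by (rule sums_summable)

lemma V1_gf_nth: "fps_nth V1_gf k = (\<Sum>n\<le>k. fps_nth (V1_term n) k)"
  using sums_unique[OF V1_term_sums] by (metis V1_gf_def fps_nth_Abs_fps)

lemma fps_mult_Ints:
  fixes f g :: "rat fps"
  assumes "\<And>n. fps_nth f n \<in> \<int>" "\<And>n. fps_nth g n \<in> \<int>"
  shows "fps_nth (f * g) n \<in> \<int>"
  unfolding fps_mult_nth using assms by (intro Ints_sum Ints_mult)

lemma fps_inverse_Ints:
  fixes f :: "rat fps"
  assumes "\<And>n. fps_nth f n \<in> \<int>" "fps_nth f 0 = 1"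
  shows "fps_nth (inverse f) n \<in> \<int>"
proof (induction n rule: less_induct)
  case (less n)
  show ?case
  proof (cases "n = 0")
    case False
    have "f * inverse f = 1"
      using assms(2) by (simp add: inverse_mult_eq_1')
    then have "0 = fps_nth (f * inverse f) n"
      using False by simp
    also have "\<dots> = (\<Sum>i=0..n. fps_nth f i * fps_nth (inverse f) (n - i))"
      by (simp add: fps_mult_nth)
    also have "\<dots> = fps_nth (inverse f) n + (\<Sum>i=1..n. fps_nth f i * fps_nth (inverse f) (n - i))"
      using assms(2) by (simp add: sum.atLeast_Suc_atMost)
    finally have "fps_nth (inverse f) n = - (\<Sum>i=1..n. fps_nth f i * fps_nth (inverse f) (n - i))"
      by linarith
    also have "\<dots> \<in> \<int>"
      using assms(1) less by (intro Ints_minus Ints_sum Ints_mult) auto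
    finally show ?thesis .
  qed (use assms(2) in auto)
qed

lemma q_pochhammer_Ints:
  "fps_nth (q_pochhammer (- (fps_X ^ 2)) (fps_X ^ 2) n :: rat fps) k \<in> \<int>"
proof (induction n arbitrary: k)
  case (Suc n)
  have "fps_nth (1 - (- (fps_X ^ 2)) * (fps_X ^ 2) ^ n :: rat fps) k \<in> \<int>" for k
    by (simp flip: power_mult power_add add: fps_X_power_nth)
  with Suc show ?case
    unfolding q_pochhammer_def prod.lessThan_Suc by (intro fps_mult_Ints) auto
qed (auto simp: q_pochhammer_def)

lemma of_int_V1: "of_int (V1 n) = fps_nth V1_gf n"
proof -
  have "fps_nth (V1_term m) k \<in> \<int>" for m k
    unfolding V1_term_altdef
    by (intro fps_mult_Ints fps_inverse_Ints q_pochhammer_Ints)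
       (auto simp: q_pochhammer_nth_0 fps_X_power_nth)
  then have "fps_nth V1_gf n \<in> \<int>"
    unfolding V1_gf_nth by (intro Ints_sum)
  then show ?thesis
    by (auto simp: V1_def elim: Ints_cases)
qed

end

theory Submission
  imports Defs "HOL-Complex_Analysis.Complex_Analysis" "HOL-Real_Asymp.Real_Asymp" "HOL-Probability.Distributions"
begin

text \<open>
  The coefficients are integrals of the generating function over circles \<open>|q| = exp (- \<eta>)\<close> with
  \<open>\<eta>\<close> of order \<open>1 / sqrt n\<close>, and the neighbourhoods of \<open>q = \<i>\<close> and \<open>q = - \<i>\<close> dominate. For
  \<open>q = \<i> exp (- z)\<close> the summands with index of fixed parity are \<open>(- \<i>)^m\<close> times values at \<open>m + const\<close>
  of an analytic function, the exponential of a dilogarithm divided by \<open>z\<close> up to bounded factors.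
  A kernel with residues \<open>(- \<i>)^m\<close> turns their sum into a contour integral. On the line
  \<open>s = - \<i> y / z\<close> its exponent is \<open>- \<i> clau y / z\<close> with a critical point at \<open>y = \<pi> / 24\<close>, so the
  generating function grows like \<open>exp (- \<i> vol / z)\<close> with \<open>vol = Im (Li2 (exp (\<i> \<pi> / 3))) / 8 > 0\<close>;
  away from \<open>\<plusminus> \<i>\<close> it is exponentially smaller. Laplace's method in the angle then shows
  that \<open>(- 1)^(n div 2) V1 n\<close> is, after rescaling by a positive null sequence, \<open>Re (exp (- \<i> sqrt (2 vol n)) c) + o(1)\<close>
  with \<open>c \<noteq> 0\<close> depending only on the parity of \<open>n\<close>. The phase \<open>sqrt (2 vol n)\<close> varies so slowly that
  the real part is bounded away from 0 on four consecutive indices except on a set of small density.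
\<close>

text \<open>All sizes are exponents of \<open>1 / h\<close>, \<open>h = Re z\<close>. For given
  \<open>h\<close> the real part of \<open>- \<i> vol / z\<close> is largest at
  \<open>z = h (1 - \<i>)\<close>, with value \<open>vol / (2 h)\<close>, and
  \<open>n h = vol / (2 h)\<close> makes this point a saddle of \<open>n z - \<i> vol / z\<close>.
  So whatever is discarded must be at most \<open>exp (c / h)\<close> with
  \<open>c < vol / 2\<close>. Only \<open>1/8 <= vol <= 27/200\<close> is established, so the target
  is \<open>c = 3/50\<close>, just below \<open>1/16\<close>. Many constants serve this narrow gap;
  what is left of it absorbs factors \<open>exp (C / sqrt h)\<close> and powers of
  \<open>1 / h\<close>. Near \<open>q = \<i>\<close> the summands of even index are negligible for
  \<open>Im z >= 0\<close>, those of odd index for \<open>Im z <= 0\<close>. Each half has its own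
  saddle; a conjugation makes the two alike and yields limits \<open>A1\<close> and
  \<open>A2\<close>. Coefficients of even index see \<open>A1 + A2\<close>, those of odd index
  \<open>A1 - A2\<close>. Neither vanishes, because \<open>A1\<close> and \<open>A2\<close> differ
  in norm: the sign of \<open>X\<close> differs at the two saddles, and the regular part of the
  product contributes \<open>exp r\<close> to one and \<open>exp (- r)\<close> to the other, with
  \<open>Re r \<noteq> 0\<close>.\<close>

definition dilog :: "complex \<Rightarrow> complex" where
  "dilog y = (\<Sum>n. y ^ n / of_nat n ^ 2)"

text \<open>The term of index 0 is \<open>1 / 0 = 0\<close>. For the same reason the series of
  \<open>dilog\<close> may start at 0.\<close>

lemma inverse_squares_sums_0: "(\<lambda>n. 1 / real n ^ 2) sums (pi^2 / 6)"
  using inverse_squares_sums sums_Suc_iff[of "\<lambda>n. 1 / real n ^ 2" "pi^2 / 6"] by simp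

lemma summable_inverse_square: "summable (\<lambda>n. 1 / real n ^ 2)"
  using inverse_squares_sums_0 by (rule sums_summable)

lemma norm_dilog_term_le:
  assumes "norm y <= 1"
  shows "norm (y ^ n / of_nat n ^ 2 :: complex) <= 1 / real n ^ 2"
  using assms by (simp add: norm_divide norm_power divide_right_mono power_le_one)

lemma summable_norm_dilog:
  assumes "norm y <= 1"
  shows "summable (\<lambda>n. norm (y ^ n / of_nat n ^ 2 :: complex))"
  by (rule summable_comparison_test'[OF summable_inverse_square])
     (use norm_dilog_term_le[OF assms] in simp)

lemma summable_dilog:
  assumes "norm y <= 1"
  shows "summable (\<lambda>n. y ^ n / of_nat n ^ 2 :: complex)"
  using summable_norm_dilog[OF assms] by (rule summable_norm_cancel)

lemma norm_dilog_le:
  assumes "norm y <= 1"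
  shows "norm (dilog y) <= pi^2 / 6"
proof -
  have "norm (dilog y) <= (\<Sum>n. norm (y ^ n / of_nat n ^ 2 :: complex))"
    unfolding dilog_def by (rule summable_norm[OF summable_norm_dilog[OF assms]])
  also have "... <= (\<Sum>n. 1 / real n ^ 2)"
    by (rule suminf_le[OF norm_dilog_term_le[OF assms] summable_norm_dilog[OF assms] summable_inverse_square])
  also have "... = pi^2 / 6"
    using inverse_squares_sums_0 by (simp add: sums_iff)
  finally show ?thesis .
qed

lemma continuous_on_dilog: "continuous_on (cball 0 1) dilog"
proof -
  have "uniform_limit (cball 0 1) (\<lambda>N y. \<Sum>n<N. y ^ n / of_nat n ^ 2 :: complex)
          (\<lambda>y. \<Sum>n. y ^ n / of_nat n ^ 2) sequentially"
    by (rule Weierstrass_m_test[OF _ summable_inverse_square])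
       (simp add: norm_divide norm_power divide_right_mono power_le_one)
  then show ?thesis
    unfolding dilog_def [abs_def]
  proof (rule uniform_limit_theorem[rotated])
    show "\<forall>\<^sub>F N in sequentially. continuous_on (cball 0 1) (\<lambda>y. \<Sum>n<N. y ^ n / of_nat n ^ 2 :: complex)"
      unfolding divide_inverse by (intro always_eventually allI continuous_intros)
  qed simp
qed

lemma dilog_0 [simp]: "dilog 0 = 0"
proof -
  have "(\<lambda>n. 0 ^ n / of_nat n ^ 2 :: complex) = (\<lambda>n. 0)"
    by (rule ext) (case_tac n, auto)
  then show ?thesis by (simp add: dilog_def)
qed

lemma dilog_1: "dilog 1 = of_real (pi^2 / 6)"
proof -
  have "(\<lambda>n. of_real (1 / real n ^ 2)) sums (of_real (pi^2 / 6) :: complex)"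
    by (rule sums_of_real[OF inverse_squares_sums_0])
  then show ?thesis by (simp add: dilog_def sums_iff)
qed

lemma dilog_cnj: "norm y <= 1 ==> dilog (cnj y) = cnj (dilog y)"
  unfolding dilog_def
  using summable_sums[OF summable_dilog, of y, THEN sums_cnj[THEN iffD2]]
  by (simp add: sums_iff)

text \<open>Odd powers cancel and even powers double; reindexing by \<open>2 * n\<close> recovers
  the series at \<open>y^2\<close>, with a factor \<open>2 / 4\<close>.\<close>

lemma dilog_add_minus:
  assumes "norm y <= 1"
  shows "dilog y + dilog (- y) = dilog (y^2) / 2"
proof -
  define f where "f = (\<lambda>n. y ^ n / of_nat n ^ 2 + (- y) ^ n / of_nat n ^ 2 :: complex)"
  have s: "f sums (dilog y + dilog (- y))"
    unfolding dilog_def f_def using assms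
    by (intro sums_add summable_sums summable_dilog) auto
  have "(\<lambda>n. f (2 * n)) sums (dilog y + dilog (- y))"
    using s by (subst sums_mono_reindex[of "\<lambda>n. 2 * n"])
       (auto simp: strict_mono_def f_def image_iff power_minus_odd dvd_def)
  moreover have "f (2 * n) = ((y^2) ^ n / of_nat n ^ 2) / 2" for n
    by (simp add: f_def power_mult power2_eq_square)
  moreover have "(\<lambda>n. ((y^2) ^ n / of_nat n ^ 2) / 2) sums (dilog (y^2) / 2)"
    unfolding dilog_def using assms
    by (intro sums_divide summable_sums summable_dilog) (auto simp: norm_power power_le_one)
  ultimately show ?thesis
    using sums_unique2 by fastforce
qed

lemma dilog_minus_1: "dilog (- 1) = - of_real (pi^2 / 12)"
  using dilog_add_minus[of 1] by (simp add: dilog_1 algebra_simps add_eq_0_iff2)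

text \<open>Termwise differentiation leaves the series of \<open>y^n / (n + 1)\<close>, which is the
  logarithmic series divided by \<open>y\<close>.\<close>

lemma dilog_has_field_derivative_ball:
  assumes "norm y < 1"
  shows "(dilog has_field_derivative (if y = 0 then 1 else - Ln (1 - y) / y)) (at y)"
proof -
  define c where "c = (\<lambda>n. 1 / of_nat n ^ 2 :: complex)"
  have 1: "(\<lambda>y. \<Sum>n. c n * y ^ n) = dilog"
    by (simp add: dilog_def c_def fun_eq_iff)
  have "((\<lambda>y. \<Sum>n. c n * y ^ n) has_field_derivative (\<Sum>n. diffs c n * y ^ n)) (at y)"
    by (rule termdiffs_strong'[where K = 1])
       (use assms summable_dilog in \<open>auto simp: c_def\<close>)
  moreover have "diffs c n = 1 / of_nat (Suc n)" for n
    unfolding diffs_def c_def by (simp only: power2_eq_square) (simp del: of_nat_Suc)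
  moreover have "(\<Sum>n. 1 / of_nat (Suc n) * y ^ n) = (if y = 0 then 1 else - Ln (1 - y) / y)"
  proof (cases "y = 0")
    case True
    then have "(\<lambda>n. 1 / of_nat (Suc n) * y ^ n) = (\<lambda>n. if n = 0 then 1 else 0)"
      by (auto simp: fun_eq_iff)
    then show ?thesis
      using True sums_If_finite_set[of "{0}" "\<lambda>_. 1::complex"] by (simp add: sums_iff)
  next
    case False
    have "(\<lambda>n. - ((y) ^ n) / of_nat n) sums ln (1 + (- y))"
      using Ln_series'[of "- y"] assms by simp
    then have "(\<lambda>n. - (y ^ Suc n) / of_nat (Suc n)) sums ln (1 - y)"
      by (subst sums_Suc_iff) simp
    then have "(\<lambda>n. (- 1 / y) * (- (y ^ Suc n) / of_nat (Suc n))) sums ((- 1 / y) * ln (1 - y))"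
      by (rule sums_mult)
    moreover have "(- 1 / y) * (- (y ^ Suc n) / of_nat (Suc n)) = 1 / of_nat (Suc n) * y ^ n" for n
      using False by (simp del: of_nat_Suc)
    ultimately show ?thesis using False by (simp add: sums_iff)
  qed
  ultimately show ?thesis using 1 by simp
qed

text \<open>The half plane \<open>Re y < 1\<close> is convex and contains the closed unit disc
  without the point 1, so the known derivative has a primitive there. This makes
  \<open>dilog\<close> differentiable along curves that touch the unit circle, where the power
  series cannot be differentiated term by term.\<close>

lemma dilog_primitive:
  obtains P where
    "\<And>y. Re y < 1 ==> (P has_field_derivative (if y = 0 then 1 else - Ln (1 - y) / y)) (at y)"
    "\<And>y. norm y <= 1 ==> y \<noteq> 1 ==> P y = dilog y"
proof -
  define S where "S = {y. Re y < 1}"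
  define f where "f = (\<lambda>y::complex. if y = 0 then 1 else - Ln (1 - y) / y)"
  have S: "open S" "convex S" "0 \<in> S"
    by (auto simp: S_def open_halfspace_Re_lt convex_halfspace_Re_lt)
  have fd: "f field_differentiable at y" if "y \<in> S - {0}" for y
  proof -
    have "f holomorphic_on (S - {0})"
    proof (rule holomorphic_transform[of "\<lambda>y. - Ln (1 - y) / y"])
      show "(\<lambda>y. - Ln (1 - y) / y) holomorphic_on S - {0}"
        by (auto intro!: holomorphic_intros simp: S_def complex_nonpos_Reals_iff)
    qed (auto simp: f_def)
    then show ?thesis
      using that S by (meson finite.emptyI finite_insert holomorphic_on_imp_differentiable_at open_delete)
  qed
  have "continuous (at y) f" if "y \<in> S" for y
  proof (cases "y = 0")
    case True
    have "((\<lambda>y. Ln (1 - y)) has_field_derivative - 1) (at 0)"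
      by (auto intro!: derivative_eq_intros)
    then have "(\<lambda>h. - ((Ln (1 - h) - 0) / h)) \<midarrow>0\<rightarrow> - (- 1)"
      unfolding DERIV_def by (intro tendsto_minus) simp
    then have "(\<lambda>h. - (Ln (1 - h) / h)) \<midarrow>0\<rightarrow> 1" by simp
    then have "f \<midarrow>0\<rightarrow> 1"
      by (rule Lim_transform_eventually) (auto simp: f_def eventually_at intro!: exI[of _ 1])
    then show ?thesis unfolding True isCont_def by (simp add: f_def)
  next
    case False
    then show ?thesis using fd[of y] that field_differentiable_imp_continuous_at by blast
  qed
  then have "continuous_on S f" by (simp add: continuous_at_imp_continuous_on)
  \<comment> \<open>The primitive theorem tolerates an exceptional point at which the integrand is
    merely continuous; here it is 0.\<close>
  then obtain g where g: "\<And>y. y \<in> S ==> (g has_field_derivative f y) (at y)"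
    using holomorphic_starlike_primitive[of S f "{0}"] S fd convex_imp_starlike by blast
  define P where "P = (\<lambda>y. g y - g 0)"
  have P: "(P has_field_derivative f y) (at y)" if "y \<in> S" for y
    unfolding P_def using g[OF that] by (auto intro!: derivative_eq_intros)
  have 1: "P y = dilog y" if "norm y < 1" for y
  proof -
    have "((\<lambda>y. P y - dilog y) has_field_derivative 0) (at x)" if "x \<in> ball 0 1" for x
    proof -
      have "x \<in> S" using that abs_Re_le_cmod[of x] by (simp add: S_def)
      from DERIV_diff[OF P[OF this] dilog_has_field_derivative_ball[of x]] show ?thesis
        using that by (simp add: f_def split: if_splits)
    qed
    then have "\<exists>c. \<forall>x\<in>ball 0 1. P x - dilog x = c"
      by (intro has_field_derivative_zero_constant) (auto intro: has_field_derivative_at_within)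
    then obtain c where c: "\<forall>x\<in>ball 0 1. P x - dilog x = c" by blast
    from c[rule_format, of 0] c[rule_format, of y] that show ?thesis by (simp add: P_def)
  qed
  have 2: "P y = dilog y" if "norm y <= 1" "y \<noteq> 1" for y
  proof -
    have "y \<in> S"
    proof -
      have "Re y \<noteq> 1"
      proof
        assume "Re y = 1"
        then have "(Im y)^2 <= 0"
          using that(1) by (simp add: cmod_def real_sqrt_le_iff)
        then show False using \<open>Re y = 1\<close> that(2) by (simp add: complex_eq_iff)
      qed
      then show ?thesis using complex_Re_le_cmod[of y] that(1) by (simp add: S_def)
    qed
    \<comment> \<open>Equality passes to the unit circle along the radius, since both functions are
      continuous from inside.\<close>
    have r: "(\<lambda>n. 1 - 1 / real (Suc n)) \<longlonglongrightarrow> 1"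
      using tendsto_diff[OF tendsto_const LIMSEQ_inverse_real_of_nat, of 1] by (simp add: field_simps)
    have yn: "(\<lambda>n. of_real (1 - 1 / real (Suc n)) * y) \<longlonglongrightarrow> y"
      using tendsto_mult[OF tendsto_of_real[OF r] tendsto_const, of y] by simp
    have nn: "norm (of_real (1 - 1 / real (Suc n)) * y) < 1" for n
    proof -
      have "norm (of_real (1 - 1 / real (Suc n)) * y) <= (1 - 1 / real (Suc n)) * 1"
        unfolding norm_mult norm_of_real using that(1) by (intro mult_mono) auto
      then show ?thesis by (auto intro: le_less_trans)
    qed
    have "(\<lambda>n. P (of_real (1 - 1 / real (Suc n)) * y)) \<longlonglongrightarrow> P y"
      using P[OF \<open>y \<in> S\<close>] DERIV_isCont isCont_tendsto_compose yn by blast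
    moreover have "(\<lambda>n. dilog (of_real (1 - 1 / real (Suc n)) * y)) \<longlonglongrightarrow> dilog y"
      by (rule continuous_on_tendsto_compose[OF continuous_on_dilog yn])
         (use that nn in \<open>auto intro!: always_eventually less_imp_le simp del: of_real_diff\<close>)
    ultimately show ?thesis
      using 1[OF nn] LIMSEQ_unique by simp
  qed
  show ?thesis
  proof (rule that[of P])
    show "(P has_field_derivative (if y = 0 then 1 else - Ln (1 - y) / y)) (at y)" if "Re y < 1" for y
      using P[of y] that by (simp add: S_def f_def)
  qed (use 2 in auto)
qed

text \<open>The curve may touch the unit circle, where the saddle points lie.\<close>

lemma dilog_comp_has_vector_derivative:
  assumes "(f has_vector_derivative f') (at x)" "open U" "x \<in> U"
    and "\<And>u. u \<in> U ==> norm (f u) <= 1" "\<And>u. u \<in> U ==> f u \<noteq> 1" "f x \<noteq> 0"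
  shows "((\<lambda>u. dilog (f u)) has_vector_derivative (- (f' * Ln (1 - f x) / f x))) (at x)"
proof -
  obtain P where P: "\<And>y. Re y < 1 ==> (P has_field_derivative (if y = 0 then 1 else - Ln (1 - y) / y)) (at y)"
    "\<And>y. norm y <= 1 ==> y \<noteq> 1 ==> P y = dilog y"
    using dilog_primitive by blast
  have "Re (f x) < 1"
  proof -
    have "Re (f x) \<noteq> 1"
    proof
      assume "Re (f x) = 1"
      then have "(Im (f x))^2 <= 0"
        using assms(4)[OF assms(3)] by (simp add: cmod_def real_sqrt_le_iff)
      then show False using \<open>Re (f x) = 1\<close> assms(3,5) by (simp add: complex_eq_iff)
    qed
    then show ?thesis using complex_Re_le_cmod[of "f x"] assms(3,4) by force
  qed
  from field_vector_diff_chain_at[OF assms(1) P(1)[OF this]]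
  have "((\<lambda>u. P (f u)) has_vector_derivative (- (f' * Ln (1 - f x) / f x))) (at x)"
    using assms(6) by (simp add: o_def)
  then show ?thesis
    by (rule has_vector_derivative_transform_within_open[OF _ assms(2,3)]) (use P(2) assms in auto)
qed

section \<open>Clausen's integral and its maximum \<open>vol\<close>\<close>

lemma Ln_one_minus_cis:
  assumes "0 < t" "t < 2 * pi"
  shows "Ln (1 - cis t) = Complex (ln (2 * sin (t / 2))) ((t - pi) / 2)"
proof (rule Ln_unique)
  have s: "sin (t / 2) > 0" using assms by (intro sin_gt_zero) auto
  have 1: "exp (Complex (ln (2 * sin (t / 2))) ((t - pi) / 2)) =
      of_real (2 * sin (t / 2)) * cis (t / 2 - pi / 2)"
    using s by (simp add: exp_eq_polar diff_divide_distrib)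
  have c: "cos t = 1 - 2 * sin (t / 2) ^ 2" using cos_double_sin[of "t / 2"] by simp
  have d: "sin t = 2 * sin (t / 2) * cos (t / 2)" using sin_double[of "t / 2"] by simp
  have "of_real (2 * sin (t / 2)) * cis (t / 2 - pi / 2) = 1 - cis t"
    unfolding complex_eq_iff by (simp add: c d cos_diff sin_diff power2_eq_square)
  with 1 show "exp (Complex (ln (2 * sin (t / 2))) ((t - pi) / 2)) = 1 - cis t" by simp
qed (use assms in auto)

text \<open>On the arc \<open>[0, \<pi>/8]\<close> the exponent of the saddle point integral is
  \<open>- \<i> clau\<close> (see \<open>saddle_exponent\<close>); \<open>8 clau (y/8)\<close> is Clausen's integral.\<close>

definition clau :: "real \<Rightarrow> real" where
  "clau y = Im (dilog (cis (8 * y))) / 8"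

text \<open>\<open>8 * vol\<close> is Clausen's integral at \<open>pi / 3\<close>, its maximum,
  about 1.015: the volume of the regular ideal tetrahedron in hyperbolic space. Hence
  \<open>vol\<close> is about 0.127.\<close>

definition vol :: real where
  "vol = clau (pi / 24)"

lemma clau_0 [simp]: "clau 0 = 0"
  by (simp add: clau_def dilog_1)

lemma clau_pi_8 [simp]: "clau (pi / 8) = 0"
  by (simp add: clau_def dilog_minus_1)

lemma continuous_on_dilog_cis: "continuous_on A (\<lambda>y. dilog (cis (8 * y)))"
  by (rule continuous_on_compose2[OF continuous_on_dilog]) (auto intro!: continuous_intros simp: cis_conv_exp)

lemma continuous_on_clau: "continuous_on A clau"
  unfolding clau_def[abs_def] by (intro continuous_intros continuous_on_dilog_cis) auto

text \<open>The chain rule gives \<open>- 8 \<i> Ln (1 - cis (8 y))\<close>, and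
  \<open>Ln_one_minus_cis\<close> splits this into real and imaginary part.\<close>

lemma dilog_cis_has_vector_derivative:
  assumes "0 < y" "y < pi / 4"
  shows "((\<lambda>y. dilog (cis (8 * y))) has_vector_derivative
    Complex (8 * (4 * y - pi / 2)) (- 8 * ln (2 * sin (4 * y)))) (at y)"
proof -
  have d: "((\<lambda>y. cis (8 * y)) has_vector_derivative (8 * \<i> * cis (8 * y))) (at y)"
  proof -
    have "((\<lambda>w. exp (8 * \<i> * w)) has_field_derivative (8 * \<i> * exp (8 * \<i> * of_real y))) (at (of_real y))"
      by (auto intro!: derivative_eq_intros)
    from has_vector_derivative_real_field[OF this] show ?thesis
      by (simp add: cis_conv_exp mult_ac)
  qed
  have ne: "cis (8 * u) \<noteq> 1" if "u \<in> {0<..<pi/4}" for u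
    using that cos_one_2pi[of "8*u"]
  proof -
    have "sin (4 * u) > 0" using that by (intro sin_gt_zero) auto
    then have "cos (8 * u) < 1" using cos_double_sin[of "4 * u"] by simp
    then show ?thesis by (auto simp: complex_eq_iff)
  qed
  have "((\<lambda>y. dilog (cis (8 * y))) has_vector_derivative
     (- (8 * \<i> * cis (8 * y) * Ln (1 - cis (8 * y)) / cis (8 * y)))) (at y)"
    by (rule dilog_comp_has_vector_derivative[OF d, of "{0<..<pi/4}"]) (use assms ne in auto)
  also have "- (8 * \<i> * cis (8 * y) * Ln (1 - cis (8 * y)) / cis (8 * y)) = - (8 * \<i>) * Ln (1 - cis (8 * y))"
    by simp
  also have "... = Complex (8 * (4 * y - pi / 2)) (- 8 * ln (2 * sin (4 * y)))"
    using assms by (subst Ln_one_minus_cis) (auto simp: complex_eq_iff)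
  finally show ?thesis .
qed


lemma clau_has_real_derivative:
  assumes "0 < y" "y < pi / 4"
  shows "(clau has_real_derivative - ln (2 * sin (4 * y))) (at y)"
proof -
  have "((\<lambda>y. Im (dilog (cis (8 * y))) / 8) has_vector_derivative
    Im (Complex (8 * (4 * y - pi / 2)) (- 8 * ln (2 * sin (4 * y)))) / 8) (at y)"
    by (intro has_vector_derivative_divide bounded_linear.has_vector_derivative[OF bounded_linear_Im]
        dilog_cis_has_vector_derivative assms)
  then show ?thesis
    unfolding has_real_derivative_iff_has_vector_derivative clau_def[abs_def] by simp
qed

text \<open>At \<open>s = - \<i> y / z\<close> the terms on the left are the numerators over
  \<open>z\<close> contributed by the Gaussian factor, the kernel, the product and
  \<open>norm_factor\<close>. The real part of the dilogarithm on the unit circle is a quadratic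
  polynomial in the angle, so all real parts cancel and only Clausen's integral survives.\<close>

lemma saddle_exponent:
  assumes "0 <= y" "y <= pi / 8"
  shows "2 * of_real y ^ 2 - pi * y / 2 - dilog (cis (8 * y)) / 8 + pi^2 / 48 = - (\<i> * clau y)"
proof -
  define g where "g = (\<lambda>y. 2 * y ^ 2 - pi * y / 2 - Re (dilog (cis (8 * y))) / 8)"
  have d: "(g has_real_derivative 0) (at y)" if "0 < y" "y < pi / 8" for y
  proof -
    have 1: "((\<lambda>y. Re (dilog (cis (8 * y)))) has_real_derivative (8 * (4 * y - pi / 2))) (at y)"
      using bounded_linear.has_vector_derivative[OF bounded_linear_Re dilog_cis_has_vector_derivative[of y]]
        that by (simp add: has_real_derivative_iff_has_vector_derivative)
    have "((\<lambda>y. 2 * y ^ 2 - pi * y / 2) has_real_derivative (4 * y - pi / 2)) (at y)"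
      by (auto intro!: derivative_eq_intros)
    from DERIV_diff[OF this DERIV_cdivide[OF 1, of 8]] show ?thesis
      unfolding g_def by (simp add: field_simps)
  qed
  have "continuous_on {0..pi / 8} g"
    unfolding g_def by (intro continuous_intros continuous_on_dilog_cis) auto
  then have "g y = g 0"
    using DERIV_isconst2[of 0 "pi/8" g y] d assms by simp
  then have "2 * y ^ 2 - pi * y / 2 - Re (dilog (cis (8 * y))) / 8 = - pi\<^sup>2 / 48"
    by (simp add: g_def dilog_1)
  then show ?thesis
    by (simp add: complex_eq_iff clau_def)
qed

lemma two_sin_4: "2 * sin (4 * (pi / 24)) = 1"
  by (simp add: sin_30)

text \<open>With \<open>clau_deriv_right\<close> this says that on both sides of
  \<open>pi / 24\<close> the slope of \<open>clau\<close> is at least as steep as that of the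
  parabola \<open>- (y - pi / 24)^2 / 2\<close>. The mean value theorem is applied to
  \<open>2 sin (4 y)\<close>, which equals 1 at \<open>pi / 24\<close>.\<close>

lemma clau_deriv_left:
  assumes "0 < y" "y <= pi / 24"
  shows "pi / 24 - y <= - ln (2 * sin (4 * y))"
proof -
  have pos: "sin (4 * y) > 0" using assms by (intro sin_gt_zero) auto
  have "2 * sin (4 * y) <= 1 - (pi / 24 - y)"
  proof -
    have "\<exists>c. c > y \<and> c < pi / 24 \<and> 2 * sin (4 * (pi / 24)) - 2 * sin (4 * y) = (pi / 24 - y) * (8 * cos (4 * c))"
      if "y < pi / 24"
      by (rule MVT2[OF that]) (auto intro!: derivative_eq_intros)
    then consider "y = pi / 24" | c where "c > y" "c < pi / 24"
        "2 * sin (4 * (pi / 24)) - 2 * sin (4 * y) = (pi / 24 - y) * (8 * cos (4 * c))"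
      using assms by fastforce
    then show ?thesis
    proof cases
      case 2
      have "cos (4 * c) \<ge> cos (pi / 3)"
        using 2 assms by (intro cos_monotone_0_pi_le) auto
      then have "(pi / 24 - y) * (8 * cos (4 * c)) \<ge> (pi / 24 - y) * 1"
        using assms by (intro mult_left_mono) (auto simp: cos_60)
      then have "(pi / 24 - y) <= 2 * sin (4 * (pi / 24)) - 2 * sin (4 * y)"
        unfolding 2(3) by simp
      then show ?thesis unfolding two_sin_4 by simp
    next
      case 1
      show ?thesis unfolding 1 two_sin_4 by simp
    qed
  qed
  then have "ln (2 * sin (4 * y)) <= - (pi / 24 - y)"
    using ln_le_minus_one[of "2 * sin (4 * y)"] pos by linarith
  then show ?thesis by simp
qed

lemma clau_deriv_right:
  assumes "pi / 24 <= y" "y <= pi / 8"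
  shows "- ln (2 * sin (4 * y)) <= - (y - pi / 24)"
proof -
  define t where "t = y - pi / 24"
  have t: "0 <= t" "t <= pi / 12" using assms by (auto simp: t_def)
  have s: "sin (4 * t) \<ge> 0" using t by (intro sin_ge_zero) auto
  have ct: "cos (4 * t) \<ge> 1 / 2"
    using cos_monotone_0_pi_le[of "4 * t" "pi / 3"] t by (simp add: cos_60)
  have st: "sin (4 * t) \<ge> 2 * t"
  proof -
    have "sin (4 * 0) - 2 * 0 <= sin (4 * t) - 2 * t"
    proof (rule DERIV_nonneg_imp_nondecreasing[OF t(1)], intro exI conjI)
      fix x assume x: "0 <= x" "x <= t"
      show "((\<lambda>t. sin (4 * t) - 2 * t) has_real_derivative 4 * cos (4 * x) - 2) (at x)"
        by (auto intro!: derivative_eq_intros)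
      show "0 <= 4 * cos (4 * x) - 2"
        using cos_monotone_0_pi_le[of "4 * x" "4 * t"] x t ct by simp
    qed
    then show ?thesis by simp
  qed
  have "2 * sin (4 * y) = cos (4 * t) + sqrt 3 * sin (4 * t)"
  proof -
    have "4 * y = 4 * t + pi / 6" by (simp add: t_def)
    then show ?thesis by (simp add: sin_add sin_30 cos_30)
  qed
  \<comment> \<open>The right-hand side is \<open>2 sin (4 y)\<close> expanded around
    \<open>pi / 24\<close>; taking logarithms of the inequality gives the slope bound.\<close>
  moreover have "exp t <= cos (4 * t) + sqrt 3 * sin (4 * t)"
  proof -
    have "t <= 1" using t pi_less_4 by simp
    have 1: "exp t <= 1 + t + t^2"
      using exp_bound[of t] t \<open>t <= 1\<close> by simp
    have "cos (4 * t) = 1 - 2 * sin (2 * t) ^ 2" using cos_double_sin[of "2 * t"] by simp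
    moreover have "sin (4 * t) = 2 * sin (2 * t) * cos (2 * t)" using sin_double[of "2 * t"] by simp
    moreover have "sin (2 * t) <= 2 * t" using sin_x_le_x[of "2 * t"] t by simp
    ultimately have "cos (4 * t) \<ge> 1 - 2 * (2 * t)^2"
      using power_mono[of "sin (2 * t)" "2 * t" 2] t sin_ge_zero[of "2 * t"] by simp
    moreover have "sqrt 3 * sin (4 * t) \<ge> 1.7 * (2 * t)"
      using st t using real_le_rsqrt[of "17/10" 3] by (intro mult_mono) (auto simp: power2_eq_square)
    \<comment> \<open>This closes \<open>1 + t + t^2 <= 1 - 8 t^2 + 3.4 t\<close>; it holds up to
      \<open>t = pi / 12\<close> because \<open>9 pi / 12 < 2.4\<close>.\<close>
    moreover have "9 * t * t <= 2.4 * t"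
      using t pi_approx by (intro mult_right_mono) auto
    ultimately show ?thesis using 1 by (simp add: power2_eq_square)
  qed
  ultimately have "exp t <= 2 * sin (4 * y)" by simp
  then have "t <= ln (2 * sin (4 * y))"
    by (metis exp_gt_zero exp_ln less_le_trans exp_le_cancel_iff)
  then show ?thesis by (simp add: t_def)
qed


lemma clau_mono_left:
  assumes "0 <= x" "x <= y" "y <= pi / 24"
  shows "clau x <= clau y"
proof (rule DERIV_nonneg_imp_increasing_open[OF assms(2) _ continuous_on_clau], intro exI conjI)
  fix t assume t: "x < t" "t < y"
  then show "(clau has_real_derivative - ln (2 * sin (4 * t))) (at t)"
    using assms by (intro clau_has_real_derivative) auto
  show "0 <= - ln (2 * sin (4 * t))"
    using clau_deriv_left[of t] t assms by linarith
qed

text \<open>Adding the parabola leaves a function that increases up to \<open>pi / 24\<close> and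
  decreases afterwards. The bound is global on the arc, so it supplies the Gaussian majorant for
  dominated convergence at the saddle.\<close>

lemma clau_le_vol_quadratic:
  assumes "0 <= y" "y <= pi / 8"
  shows "clau y <= vol - (y - pi / 24)\<^sup>2 / 2"
proof -
  define g where "g = (\<lambda>y. clau y + (y - pi / 24)^2 / 2)"
  have c: "continuous_on A g" for A unfolding g_def by (intro continuous_intros continuous_on_clau) auto
  have d: "(g has_real_derivative - ln (2 * sin (4 * x)) + (x - pi / 24)) (at x)" if "0 < x" "x < pi / 8" for x
    unfolding g_def using that
    by (intro DERIV_add clau_has_real_derivative) (auto intro!: derivative_eq_intros)
  have "g y <= g (pi / 24)"
  proof (cases "y <= pi / 24")
    case True
    show ?thesis
    proof (rule DERIV_nonneg_imp_increasing_open[OF True _ c], intro exI conjI)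
      fix x assume x: "y < x" "x < pi / 24"
      show "(g has_real_derivative - ln (2 * sin (4 * x)) + (x - pi / 24)) (at x)"
        using assms x by (intro d) auto
      show "0 <= - ln (2 * sin (4 * x)) + (x - pi / 24)"
        using clau_deriv_left[of x] x assms by linarith
    qed
  next
    case False
    show ?thesis
    proof (rule DERIV_nonpos_imp_decreasing_open[of "pi / 24" y, OF _ _ c])
      fix x assume x: "pi / 24 < x" "x < y"
      then have "(g has_real_derivative - ln (2 * sin (4 * x)) + (x - pi / 24)) (at x)"
        using assms by (intro d) auto
      moreover have "- ln (2 * sin (4 * x)) + (x - pi / 24) <= 0"
        using clau_deriv_right[of x] x assms by linarith
      ultimately show "\<exists>y. DERIV g x :> y \<and> y <= 0" by blast
    qed (use False in auto)
  qed
  then show ?thesis by (simp add: g_def vol_def)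
qed

lemma clau_le_vol: "0 <= y ==> y <= pi / 8 ==> clau y <= vol"
  using clau_le_vol_quadratic[of y] by (smt (verit) zero_le_power2 divide_nonneg_pos)

lemma clau_nonneg:
  assumes "0 <= y" "y <= pi / 8"
  shows "0 <= clau y"
proof (cases "y <= pi / 24")
  case True
  then show ?thesis using clau_mono_left[of 0 y] assms by simp
next
  case False
  have "clau y \<ge> clau (pi / 8)"
  proof (rule DERIV_nonpos_imp_decreasing_open[OF assms(2) _ continuous_on_clau])
    fix x assume x: "y < x" "x < pi / 8"
    then have "(clau has_real_derivative - ln (2 * sin (4 * x))) (at x)"
      using assms by (intro clau_has_real_derivative) auto
    moreover have "- ln (2 * sin (4 * x)) <= 0"
      using clau_deriv_right[of x] x False by linarith
    ultimately show "\<exists>y. DERIV clau x :> y \<and> y <= 0" by blast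
  qed
  then show ?thesis by simp
qed

text \<open>\<open>y - y ln (8 y)\<close> is the primitive of \<open>- ln (8 y)\<close> that tends
  to 0 at 0, and \<open>sin x <= x\<close> compares the derivatives. As \<open>clau'\<close> blows
  up at 0, the comparison runs on \<open>[e, y]\<close> with \<open>e\<close> tending to 0.\<close>

lemma clau_lower:
  assumes "0 < y" "y < pi / 4"
  shows "y - y * ln (8 * y) <= clau y"
proof -
  define g where "g = (\<lambda>y. clau y - (y - y * ln (8 * y)))"
  have "g e <= g y" if "0 < e" "e < y" for e
  proof (rule DERIV_nonneg_imp_nondecreasing[of e y], use that in simp)
    fix x assume x: "e <= x" "x <= y"
    have "2 * sin (4 * x) <= 8 * x" using sin_x_le_x[of "4 * x"] x that by simp
    moreover have "2 * sin (4 * x) > 0" using x that assms by (intro mult_pos_pos sin_gt_zero) auto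
    ultimately have "ln (2 * sin (4 * x)) <= ln (8 * x)" by (subst ln_le_cancel_iff) auto
    moreover have "(g has_real_derivative - ln (2 * sin (4 * x)) + ln (8 * x)) (at x)"
      unfolding g_def using x that assms
      by (auto intro!: derivative_eq_intros clau_has_real_derivative simp: field_simps)
    ultimately show "\<exists>d. (g has_real_derivative d) (at x) \<and> 0 <= d" by force
  qed
  then have "\<forall>\<^sub>F e in at_right 0. g e <= g y"
    using assms(1) eventually_at_right by blast
  moreover have "(g \<longlongrightarrow> 0) (at_right 0)"
  proof -
    have "((\<lambda>e. e - e * ln (8 * e)) \<longlongrightarrow> 0) (at_right (0::real))" by real_asymp
    moreover have "(clau \<longlongrightarrow> 0) (at_right 0)"
      using continuous_on_clau[of UNIV] clau_0 unfolding continuous_on_def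
      by (metis UNIV_I at_le subset_UNIV tendsto_mono)
    ultimately show ?thesis unfolding g_def using tendsto_diff[of clau 0 _ _ 0] by fastforce
  qed
  ultimately have "0 <= g y" using tendsto_upperbound trivial_limit_at_right_real by blast
  then show ?thesis by (simp add: g_def)
qed

lemma clau_upper:
  assumes "0 < y" "y <= pi / 24"
  shows "clau y <= y - y * ln (8 * y) + y ^ 3"
proof -
  define g where "g = (\<lambda>y. clau y - (y - y * ln (8 * y) + y ^ 3))"
  have "g e \<ge> g y" if "0 < e" "e < y" for e
  proof (rule DERIV_nonpos_imp_nonincreasing[of e y], use that in simp)
    fix x assume x: "e <= x" "x <= y"
    define u where "u = 4 * x"
    have u: "0 < u" "u <= 1" using x that assms pi_less_4 by (auto simp: u_def)
    have "sin 0 - 0 + 0 ^ 3 / 6 <= sin u - u + u ^ 3 / 6"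
    proof (rule DERIV_nonneg_imp_nondecreasing, use u in simp, intro exI conjI)
      fix v :: real assume v: "0 <= v" "v <= u"
      show "((\<lambda>u. sin u - u + u ^ 3 / 6) has_real_derivative cos v - 1 + v^2 / 2) (at v)"
        by (auto intro!: derivative_eq_intros simp: power2_eq_square)
      have "sin (v / 2) ^ 2 <= (v / 2)^2"
        using v u pi_gt3 sin_x_le_x[of "v / 2"] by (intro power_mono sin_ge_zero) auto
      then show "0 <= cos v - 1 + v^2 / 2"
        using cos_double_sin[of "v / 2"] by (simp add: power2_eq_square)
    qed
    then have "u - u ^ 3 / 6 <= sin u" by simp
    \<comment> \<open>The logarithm of the left side is \<open>ln (8 x)\<close> plus the derivative
      of \<open>- x^3\<close>. With \<open>u = 4 x\<close> and \<open>v = 3 x^2\<close> the right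
      side is \<open>8 x (1 - 8/9 v)\<close>.\<close>
    moreover have "8 * x * exp (- 3 * x^2) <= 2 * (u - u ^ 3 / 6)"
    proof -
      define v where "v = 3 * x^2"
      have "x <= 27 / 200" using x assms pi_approx by simp
      then have "x^2 <= (27 / 200)^2" using x that by (intro power_mono) auto
      then have v: "0 <= v" "v <= 1 / 10" by (auto simp: v_def power2_eq_square)
      have "v * v <= v * (1 / 10)" using v by (intro mult_left_mono) auto
      moreover have "v * v * v <= v * v * (1 / 10)" using v by (intro mult_left_mono) auto
      ultimately have "v * v <= v * (1 / 10)" "v * v * v <= v * (1 / 10) * (1 / 10)" by auto
      then have "1 <= (1 - 8 / 9 * v) * (1 + v + v^2 / 2)"
        using v by (simp add: algebra_simps power2_eq_square)
      also have "... <= (1 - 8 / 9 * v) * exp v"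
        using v exp_lower_Taylor_quadratic[of v] by (intro mult_left_mono) auto
      finally have "exp (- v) <= 1 - 8 / 9 * v"
        by (simp add: exp_minus field_simps)
      then have "8 * x * exp (- v) <= 8 * x * (1 - 8 / 9 * v)"
        using x that by (intro mult_left_mono) auto
      then show ?thesis by (simp add: u_def v_def power2_eq_square power3_eq_cube algebra_simps)
    qed
    ultimately have "8 * x * exp (- 3 * x^2) <= 2 * sin (4 * x)" by (simp add: u_def)
    then have "ln (8 * x * exp (- 3 * x^2)) <= ln (2 * sin (4 * x))"
      using x that by (intro ln_mono) auto
    then have "ln (8 * x) - 3 * x^2 <= ln (2 * sin (4 * x))"
      using x that by (simp add: ln_mult)
    moreover have "(g has_real_derivative - ln (2 * sin (4 * x)) + ln (8 * x) - 3 * x^2) (at x)"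
      unfolding g_def using x that assms
      by (auto intro!: derivative_eq_intros clau_has_real_derivative simp: field_simps)
    ultimately show "\<exists>d. (g has_real_derivative d) (at x) \<and> d <= 0" by force
  qed
  then have "\<forall>\<^sub>F e in at_right 0. g e \<ge> g y"
    using assms(1) eventually_at_right by blast
  moreover have "(g \<longlongrightarrow> 0) (at_right 0)"
  proof -
    have "((\<lambda>e. e - e * ln (8 * e) + e ^ 3) \<longlongrightarrow> 0) (at_right (0::real))" by real_asymp
    moreover have "(clau \<longlongrightarrow> 0) (at_right 0)"
      using continuous_on_clau[of UNIV] clau_0 unfolding continuous_on_def
      by (metis UNIV_I at_le subset_UNIV tendsto_mono)
    ultimately show ?thesis unfolding g_def using tendsto_diff[of clau 0 _ _ 0] by fastforce
  qed
  ultimately have "0 \<ge> g y" using tendsto_lowerbound trivial_limit_at_right_real by blast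
  then show ?thesis by (simp add: g_def)
qed

text \<open>At \<open>y = 1/8\<close> the logarithm in \<open>clau_lower\<close> vanishes. This and
  \<open>vol_upper\<close> carry the numerical comparisons of the later parts.\<close>

lemma vol_lower: "1 / 8 <= vol"
proof -
  have "1 / 8 - 1 / 8 * ln (8 * (1 / 8)) <= clau (1 / 8)"
    by (rule clau_lower) (use pi_gt3 in auto)
  moreover have "clau (1 / 8) <= vol" by (rule clau_le_vol) (use pi_gt3 in auto)
  ultimately show ?thesis by simp
qed

lemma vol_upper: "vol <= 27 / 200"
proof -
  have "ln (8 * (pi / 24)) \<ge> 0" using pi_gt3 by simp
  then have "pi / 24 * ln (8 * (pi / 24)) \<ge> 0" by (intro mult_nonneg_nonneg) auto
  then have "vol <= pi / 24 + (pi / 24) ^ 3"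
    unfolding vol_def using clau_upper[of "pi / 24", OF _ order_refl] by simp
  also have "... <= 3.15 / 24 + (3.15 / 24) ^ 3"
    using pi_approx by (intro add_mono power_mono) auto
  finally show ?thesis by (simp add: power3_eq_cube)
qed

text \<open>L'Hopital's rule reduces this to the derivative of \<open>- ln (2 sin (4 y))\<close> at
  \<open>pi / 24\<close>, which is \<open>- 4 cot (pi / 6) = - 4 sqrt 3\<close>.\<close>

lemma clau_second_order:
  "((\<lambda>h. (clau (pi / 24 + h) - vol) / h^2) \<longlongrightarrow> - 2 * sqrt 3) (at 0)"
proof (rule lhopital[where f' = "\<lambda>h. - ln (2 * sin (4 * (pi / 24 + h)))" and g' = "\<lambda>h. 2 * h"])
  have ev: "\<forall>\<^sub>F h in at (0::real). h \<in> {- (pi / 24)<..<pi / 24}"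
    by (rule eventually_at_in_open') auto
  have d: "((\<lambda>h. clau (pi / 24 + h) - vol) has_real_derivative - ln (2 * sin (4 * (pi / 24 + h)))) (at h)"
    if "h \<in> {- (pi / 24)<..<pi / 24}" for h
  proof -
    have "((\<lambda>h. pi / 24 + h) has_real_derivative 1) (at h)"
      by (auto intro!: derivative_eq_intros)
    from DERIV_chain2[OF clau_has_real_derivative this] that
    have "((\<lambda>h. clau (pi / 24 + h)) has_real_derivative - ln (2 * sin (4 * (pi / 24 + h)))) (at h)"
      by simp
    from DERIV_diff[OF this DERIV_const] show ?thesis by simp
  qed
  have "isCont (\<lambda>h. clau (pi / 24 + h) - vol) 0"
    by (rule DERIV_isCont[OF d]) auto
  then show "((\<lambda>h. clau (pi / 24 + h) - vol) \<longlongrightarrow> 0) (at 0)"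
    unfolding isCont_def by (simp add: vol_def)
  show "((\<lambda>h::real. h\<^sup>2) \<longlongrightarrow> 0) (at 0)" by (rule tendsto_eq_intros refl | simp)+
  have "\<forall>\<^sub>F h in at (0::real). h \<noteq> 0" by (simp add: eventually_at_filter)
  then show "\<forall>\<^sub>F h in at (0::real). h\<^sup>2 \<noteq> 0" "\<forall>\<^sub>F h in at (0::real). 2 * h \<noteq> 0"
    by (auto elim: eventually_mono)
  show "\<forall>\<^sub>F h in at 0. ((\<lambda>h. clau (pi / 24 + h) - vol) has_real_derivative - ln (2 * sin (4 * (pi / 24 + h)))) (at h)"
    using ev by eventually_elim (rule d)
  show "\<forall>\<^sub>F h in at (0::real). ((\<lambda>h. h\<^sup>2) has_real_derivative 2 * h) (at h)"
    by (rule always_eventually) (auto intro!: derivative_eq_intros)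
  have s: "sin (4 * (pi / 24)) = 1 / 2" "cos (4 * (pi / 24)) = sqrt 3 / 2"
    by (simp_all add: sin_30 cos_30)
  have "((\<lambda>h. 4 * (pi / 24 + h)) has_real_derivative 4) (at 0)"
    by (auto intro!: derivative_eq_intros)
  from DERIV_cmult[OF DERIV_chain2[OF DERIV_sin this], of 2]
  have "((\<lambda>h. 2 * sin (4 * (pi / 24 + h))) has_real_derivative 4 * sqrt 3) (at 0)" by (simp add: cos_30)
  from DERIV_minus[OF DERIV_chain2[OF DERIV_ln_divide this]]
  have "((\<lambda>h. - ln (2 * sin (4 * (pi / 24 + h)))) has_real_derivative - 4 * sqrt 3) (at 0)"
    by (simp add: sin_30)
  then have "((\<lambda>h. - ln (2 * sin (4 * (pi / 24 + h))) / h) \<longlongrightarrow> - 4 * sqrt 3) (at 0)"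
    unfolding DERIV_def by (simp add: sin_30)
  then have "((\<lambda>h. - ln (2 * sin (4 * (pi / 24 + h))) / h / 2) \<longlongrightarrow> - 4 * sqrt 3 / 2) (at 0)"
    by (intro tendsto_divide tendsto_const) auto
  then show "((\<lambda>h. - ln (2 * sin (4 * (pi / 24 + h))) / (2 * h)) \<longlongrightarrow> - 2 * sqrt 3) (at 0)"
    by (simp add: mult.commute)
qed

section \<open>Monotonicity and extremal values of the dilogarithm on the unit disc\<close>

lemma Im_Ln_nonpos:
  assumes "Im z < 0 \<or> (Im z = 0 \<and> Re z > 0)"
  shows "Im (Ln z) <= 0"
proof (cases "Im z < 0")
  case True
  then have "z \<noteq> 0" by auto
  then show ?thesis
    using Im_Ln_pos_le[of z] Im_Ln_le_pi[of z] True by linarith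
next
  case False
  then have "z = of_real (Re z)" "Re z > 0" using assms by (auto simp: complex_eq_iff)
  then show ?thesis by (metis Im_complex_of_real Ln_of_real order_refl)
qed

lemma has_vector_derivative_radius: "((\<lambda>r. of_real r * c) has_vector_derivative c) (at (r::real))" for c :: complex
  using has_vector_derivative_real_field[of "\<lambda>w. w * c" c r UNIV] by (auto intro!: derivative_eq_intros)

lemma has_vector_derivative_angle:
  "((\<lambda>t. of_real r * cis t) has_vector_derivative (\<i> * (of_real r * cis t))) (at (t::real))"
proof -
  have "((\<lambda>w. of_real r * exp (\<i> * w)) has_field_derivative (\<i> * (of_real r * exp (\<i> * of_real t)))) (at (of_real t))"
    by (auto intro!: derivative_eq_intros)
  from has_vector_derivative_real_field[OF this] show ?thesis by (simp add: cis_conv_exp)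
qed

lemma has_real_derivative_Im:
  "(f has_vector_derivative d) (at x) ==> ((\<lambda>x. Im (f x)) has_real_derivative Im d) (at x)"
  unfolding has_real_derivative_iff_has_vector_derivative
  by (rule bounded_linear.has_vector_derivative[OF bounded_linear_Im])

lemma has_real_derivative_Re:
  "(f has_vector_derivative d) (at x) ==> ((\<lambda>x. Re (f x)) has_real_derivative Re d) (at x)"
  unfolding has_real_derivative_iff_has_vector_derivative
  by (rule bounded_linear.has_vector_derivative[OF bounded_linear_Re])

lemma upper_half_polar:
  assumes "0 <= Im y" "norm y <= 1"
  obtains r t where "0 <= r" "r <= 1" "0 <= t" "t <= pi" "y = of_real r * cis t"
proof (rule that[of "norm y" "Arg y"])
  show "y = of_real (norm y) * cis (Arg y)"
    by (simp add: rcis_def[symmetric] rcis_cmod_Arg)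
  show "0 <= Arg y" using assms Arg_less_0 linorder_not_less by blast
qed (use assms Arg_le_pi in auto)

lemma continuous_on_dilog_comp:
  assumes "continuous_on A f" "\<And>x. x \<in> A ==> norm (f x) <= 1"
  shows "continuous_on A (\<lambda>x. dilog (f x))"
  by (rule continuous_on_compose2[OF continuous_on_dilog assms(1)]) (use assms(2) in auto)

text \<open>Along a radius the derivative is \<open>- Ln (1 - y) / r\<close>. For \<open>y\<close>
  in the upper half disc \<open>1 - y\<close> has nonpositive imaginary part, hence so has its
  logarithm.\<close>

lemma Im_dilog_radial:
  assumes "0 <= t" "t <= pi" "0 <= r" "r <= s" "s <= 1"
  shows "Im (dilog (of_real r * cis t)) <= Im (dilog (of_real s * cis t))"
proof (rule DERIV_nonneg_imp_increasing_open[OF assms(4)])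
  show "continuous_on {r..s} (\<lambda>r. Im (dilog (of_real r * cis t)))"
    by (intro continuous_intros continuous_on_dilog_comp) (use assms in \<open>auto simp: norm_mult\<close>)
  fix x assume x: "r < x" "x < s"
  define y where "y = of_real x * cis t"
  have ny: "norm y < 1" using x assms by (simp add: y_def norm_mult)
  have y0: "y \<noteq> 0" using x assms by (simp add: y_def)
  have "((\<lambda>r. dilog (of_real r * cis t)) has_vector_derivative (- (cis t * Ln (1 - y) / y))) (at x)"
    unfolding y_def
    by (rule dilog_comp_has_vector_derivative[OF has_vector_derivative_radius, of "{0<..<1}"])
       (use x assms y0 ny in \<open>auto simp: norm_mult y_def\<close>, (metis norm_mult norm_cis norm_of_real norm_one mult.right_neutral abs_of_pos less_irrefl))
  then have "((\<lambda>r. Im (dilog (of_real r * cis t))) has_real_derivative Im (- (cis t * Ln (1 - y) / y))) (at x)"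
    by (rule has_real_derivative_Im)
  moreover have "Im (- (cis t * Ln (1 - y) / y)) \<ge> 0"
  proof -
    have "- (cis t * Ln (1 - y) / y) = - (Ln (1 - y)) / of_real x"
      by (simp add: y_def)
    moreover have "Im (Ln (1 - y)) <= 0"
    proof (rule Im_Ln_nonpos)
      have "Im y \<ge> 0" using x assms by (simp add: y_def sin_ge_zero)
      moreover have "Re y < 1" using ny complex_Re_le_cmod[of y] by linarith
      ultimately show "Im (1 - y) < 0 \<or> Im (1 - y) = 0 \<and> 0 < Re (1 - y)" by auto
    qed
    ultimately show ?thesis using x assms by (simp add: divide_nonpos_pos)
  qed
  ultimately show "\<exists>d. ((\<lambda>r. Im (dilog (of_real r * cis t))) has_real_derivative d) (at x) \<and> 0 <= d" by blast
qed

text \<open>Radial monotonicity moves the maximum to the unit circle, where the imaginary part is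
  \<open>8 clau\<close>; the lower half disc follows by conjugation.\<close>

lemma abs_Im_dilog_le:
  assumes "norm y <= 1"
  shows "\<bar>Im (dilog y)\<bar> <= 8 * vol"
proof -
  have *: "\<bar>Im (dilog y)\<bar> <= 8 * vol" if y: "0 <= Im y" "norm y <= 1" for y
  proof -
    obtain r t where rt: "0 <= r" "r <= 1" "0 <= t" "t <= pi" "y = of_real r * cis t"
      using upper_half_polar[OF y] .
    have "Im (dilog (of_real 0 * cis t)) <= Im (dilog y)" "Im (dilog y) <= Im (dilog (of_real 1 * cis t))"
      unfolding rt(5) by (rule Im_dilog_radial; use rt in simp)+
    moreover have "Im (dilog (cis t)) = 8 * clau (t / 8)" by (simp add: clau_def)
    ultimately show ?thesis using clau_le_vol[of "t / 8"] rt by simp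
  qed
  show ?thesis
  proof (cases "0 <= Im y")
    case False
    then show ?thesis using *[of "cnj y"] assms by (simp add: dilog_cnj)
  qed (use * assms in auto)
qed

text \<open>On a circle the real part decreases with the angle up to \<open>pi\<close>, and along
  the negative real axis it decreases with the radius, so the minimum is
  \<open>dilog (- 1)\<close>.\<close>

lemma Re_dilog_ge:
  assumes "norm y <= 1"
  shows "- pi\<^sup>2 / 12 <= Re (dilog y)"
proof -
  have neg: "- pi\<^sup>2 / 12 <= Re (dilog (of_real r * cis pi))" if r: "0 <= r" "r <= 1" for r
  proof -
    have "Re (dilog (of_real 1 * cis pi)) <= Re (dilog (of_real r * cis pi))"
    proof (rule DERIV_nonpos_imp_decreasing_open[OF r(2)])
      show "continuous_on {r..1} (\<lambda>r. Re (dilog (of_real r * cis pi)))"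
        by (intro continuous_intros continuous_on_dilog_comp) (use r in \<open>auto simp: norm_mult\<close>)
      fix x assume x: "r < x" "x < 1"
      have "((\<lambda>r. dilog (of_real r * cis pi)) has_vector_derivative
             (- (cis pi * Ln (1 - of_real x * cis pi) / (of_real x * cis pi)))) (at x)"
        by (rule dilog_comp_has_vector_derivative[OF has_vector_derivative_radius, of "{0<..<1}"])
           (use x r in \<open>auto simp: complex_eq_iff\<close>)
      then have "((\<lambda>r. Re (dilog (of_real r * cis pi))) has_real_derivative
          Re (- (cis pi * Ln (1 - of_real x * cis pi) / (of_real x * cis pi)))) (at x)"
        by (rule has_real_derivative_Re)
      moreover have "Ln (1 + of_real x) = of_real (ln (1 + x))"
        using Ln_of_real[of "1 + x"] x r by simp
      then have "Re (- (cis pi * Ln (1 - of_real x * cis pi) / (of_real x * cis pi))) <= 0"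
        using x r by simp
      ultimately show "\<exists>d. ((\<lambda>r. Re (dilog (of_real r * cis pi))) has_real_derivative d) (at x) \<and> d <= 0"
        by blast
    qed
    then show ?thesis by (simp add: dilog_minus_1)
  qed
  have *: "- pi\<^sup>2 / 12 <= Re (dilog y)" if y: "0 <= Im y" "norm y <= 1" for y
  proof -
    obtain r t where rt: "0 <= r" "r <= 1" "0 <= t" "t <= pi" "y = of_real r * cis t"
      using upper_half_polar[OF y] .
    show ?thesis
    proof (cases "r = 0")
      case True
      then show ?thesis using rt by simp
    next
      case False
      have "Re (dilog (of_real r * cis pi)) <= Re (dilog (of_real r * cis t))"
      proof (rule DERIV_nonpos_imp_decreasing_open[OF rt(4)])
        show "continuous_on {t..pi} (\<lambda>t. Re (dilog (of_real r * cis t)))"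
          by (intro continuous_intros continuous_on_dilog_comp) (use rt in \<open>auto simp: norm_mult cis_conv_exp\<close>)
        fix x assume x: "t < x" "x < pi"
        define y where "y = of_real r * cis x"
        have im: "Im y > 0" using False x rt by (auto simp: y_def intro!: mult_pos_pos sin_gt_zero)
        have "((\<lambda>x. dilog (of_real r * cis x)) has_vector_derivative
             (- (\<i> * y * Ln (1 - y) / y))) (at x)"
          unfolding y_def
        proof (rule dilog_comp_has_vector_derivative[OF has_vector_derivative_angle, of "{0<..<pi}"])
          fix u assume "u \<in> {0<..<pi}"
          then have "Im (of_real r * cis u) > 0" using False rt by (auto intro!: mult_pos_pos sin_gt_zero)
          then show "of_real r * cis u \<noteq> 1" by (metis Im_complex_of_real less_irrefl of_real_1)
        qed (use x rt False in \<open>auto simp: norm_mult\<close>)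
        then have "((\<lambda>x. Re (dilog (of_real r * cis x))) has_real_derivative
            Re (- (\<i> * y * Ln (1 - y) / y))) (at x)"
          by (rule has_real_derivative_Re)
        moreover have "- (\<i> * y * Ln (1 - y) / y) = - (\<i> * Ln (1 - y))" using im by auto
        moreover have "Im (Ln (1 - y)) <= 0" by (rule Im_Ln_nonpos) (use im in auto)
        ultimately show "\<exists>d. ((\<lambda>x. Re (dilog (of_real r * cis x))) has_real_derivative d) (at x) \<and> d <= 0"
          by fastforce
      qed
      then show ?thesis using neg[of r] rt by simp
    qed
  qed
  show ?thesis
  proof (cases "0 <= Im y")
    case False
    then show ?thesis using *[of "cnj y"] assms by (simp add: dilog_cnj)
  qed (use * assms in auto)
qed

subsection \<open>Hyperbolic functions in a sector\<close>

text \<open>A cone around the positive axis, in which all estimates are uniform. The aperture 4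
  serves the major arc; the minor arcs next to \<open>1\<close>, \<open>- 1\<close> and
  \<open>\<i>\<close> need a very large one.\<close>

definition sector :: "real \<Rightarrow> complex set" where
  "sector M = {x. 0 < Re x \<and> \<bar>Im x\<bar> <= M * Re x}"

lemma sector_scale: "x \<in> sector M ==> t > 0 ==> of_real t * x \<in> sector M"
  by (auto simp: sector_def abs_mult mult_left_mono mult.left_commute[of M])

lemma sector_nonzero: "x \<in> sector M ==> x \<noteq> 0"
  by (auto simp: sector_def)

lemma norm_le_sector: "x \<in> sector M ==> norm x <= (1 + M) * Re x"
  using cmod_le[of x] by (auto simp: sector_def algebra_simps)

lemma norm_sinh_sq: "norm (sinh x) ^ 2 = sinh (Re x) ^ 2 + sin (Im x) ^ 2" for x :: complex
proof -
  have "Re (sinh x) = sinh (Re x) * cos (Im x)" "Im (sinh x) = cosh (Re x) * sin (Im x)"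
    by (simp_all add: sinh_def cosh_def Re_exp Im_exp field_simps)
  then have "norm (sinh x) ^ 2 = (sinh (Re x) * cos (Im x))^2 + (cosh (Re x) * sin (Im x))^2"
    by (simp add: cmod_power2)
  also have "... = sinh (Re x) ^ 2 + sin (Im x) ^ 2"
    by (simp add: power_mult_distrib cosh_square_eq cos_squared_eq algebra_simps)
  finally show ?thesis .
qed

lemma norm_cosh_sq: "norm (cosh x) ^ 2 = sinh (Re x) ^ 2 + cos (Im x) ^ 2" for x :: complex
proof -
  have "Re (cosh x) = cosh (Re x) * cos (Im x)" "Im (cosh x) = sinh (Re x) * sin (Im x)"
    by (simp_all add: sinh_def cosh_def Re_exp Im_exp field_simps)
  then have "norm (cosh x) ^ 2 = (cosh (Re x) * cos (Im x))^2 + (sinh (Re x) * sin (Im x))^2"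
    by (simp add: cmod_power2)
  also have "... = sinh (Re x) ^ 2 + cos (Im x) ^ 2"
    by (simp add: power_mult_distrib cosh_square_eq cos_squared_eq algebra_simps)
  finally show ?thesis .
qed

lemma sinh_ge_self: "x <= sinh x" if "0 <= x" for x :: real
proof -
  have "sinh 0 - 0 <= sinh x - x"
  proof (rule DERIV_nonneg_imp_nondecreasing[OF that], intro exI conjI)
    fix t :: real
    show "((\<lambda>x. sinh x - x) has_real_derivative cosh t - 1) (at t)"
      by (auto intro!: derivative_eq_intros)
  qed (simp add: cosh_real_ge_1)
  then show ?thesis by simp
qed

lemma norm_sinh_ge: "sinh (Re x) <= norm (sinh x)"
  by (rule power2_le_imp_le) (auto simp: norm_sinh_sq)

lemma norm_cosh_ge: "sinh (Re x) <= norm (cosh x)"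
  by (rule power2_le_imp_le) (auto simp: norm_cosh_sq)

lemma norm_sinh_ge_sector:
  assumes "x \<in> sector M" "0 <= M"
  shows "norm x / (1 + M) <= norm (sinh x)"
proof -
  have "norm x / (1 + M) <= Re x"
    using norm_le_sector[OF assms(1)] assms(2) by (simp add: field_simps)
  also have "... <= sinh (Re x)" using assms by (intro sinh_ge_self) (auto simp: sector_def)
  finally show ?thesis using norm_sinh_ge[of x] by linarith
qed

text \<open>The cone avoids the zeros of \<open>cosh\<close> on the imaginary axis: either
  \<open>\<bar>Im x\<bar> <= 1\<close> and the cosine is at least 1/2, or
  \<open>Re x >= 1 / M\<close> and \<open>sinh (Re x)\<close> is large enough.\<close>

lemma norm_cosh_ge_sector:
  assumes "x \<in> sector M" "1 <= M"
  shows "norm x / (1 + M) <= norm (cosh x)" "1 / (2 * M) <= norm (cosh x)"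
proof -
  have "norm x / (1 + M) <= Re x"
    using norm_le_sector[OF assms(1)] assms(2) by (simp add: field_simps)
  also have s: "... <= sinh (Re x)" using assms by (intro sinh_ge_self) (auto simp: sector_def)
  finally show "norm x / (1 + M) <= norm (cosh x)" using norm_cosh_ge[of x] by linarith
  show "1 / (2 * M) <= norm (cosh x)"
  proof (cases "\<bar>Im x\<bar> <= 1")
    case True
    have "cos (pi / 3) <= cos \<bar>Im x\<bar>" using True pi_gt3 by (intro cos_monotone_0_pi_le) auto
    then have "1 / 2 <= cos (Im x)" by (simp add: cos_60)
    also have "... <= norm (cosh x)"
      by (rule power2_le_imp_le) (auto simp: norm_cosh_sq)
    finally show ?thesis using assms(2) by (auto simp: field_simps intro: order_trans)
  next
    case False
    then have "1 <= M * Re x" using assms by (auto simp: sector_def)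
    then have "1 / (2 * M) <= Re x" using assms by (simp add: field_simps)
    then show ?thesis using s norm_cosh_ge[of x] by linarith
  qed
qed


definition csch_reg :: "complex \<Rightarrow> complex" where
  "csch_reg x = 1 / (2 * sinh x) - 1 / (2 * x)"

definition half_sech :: "complex \<Rightarrow> complex" where
  "half_sech x = 1 / (2 * cosh x)"

text \<open>Both differences are combinations of the third-order Taylor remainders of
  \<open>exp\<close> at \<open>x\<close> and \<open>- x\<close>.\<close>

lemma norm_sinh_minus_le:
  fixes x :: complex
  assumes "norm x <= 1"
  shows "norm (sinh x - x) <= norm x ^ 3" "norm (cosh x - 1) <= norm x ^ 2"
proof -
  define R where "R = (\<lambda>y::complex. exp y - (1 + y + y^2 / 2 + y ^ 3 / 6))"
  have e: "norm (R y) <= norm y ^ 4 / 2" if "norm y <= 1" for y :: complex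
  proof -
    have "norm (exp y - (\<Sum>k\<le>3. y ^ k / fact k)) <= exp \<bar>Re y\<bar> * norm y ^ Suc 3 / fact 3"
      by (rule Taylor_exp)
    also have "(\<Sum>k\<le>3. y ^ k / fact k) = 1 + y + y^2 / 2 + y ^ 3 / 6"
      by (simp add: numeral_3_eq_3 numeral_2_eq_2)
    also have "exp \<bar>Re y\<bar> * norm y ^ Suc 3 / fact 3 <= 3 * norm y ^ Suc 3 / fact 3"
    proof (intro divide_right_mono mult_right_mono)
      have "exp \<bar>Re y\<bar> <= exp 1" using abs_Re_le_cmod[of y] that by simp
      then show "exp \<bar>Re y\<bar> <= 3" using exp_le by linarith
    qed auto
    also have "... = norm y ^ 4 / 2" by (simp add: fact_numeral)
    finally show ?thesis by (simp add: R_def)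
  qed
  have p: "norm x ^ 4 <= norm x ^ 3" "norm x ^ 4 <= norm x ^ 2"
    using assms by (auto intro!: power_decreasing)
  have eq3: "sinh x - x = x ^ 3 / 6 + (R x - R (- x)) / 2"
    by (simp add: R_def sinh_def scaleR_conv_of_real field_simps)
  have "norm (sinh x - x) <= norm x ^ 3 / 6 + (norm (R x) + norm (R (- x))) / 2"
    unfolding eq3
    by (rule order_trans[OF norm_triangle_ineq add_mono])
       (use norm_triangle_ineq4[of "R x" "R (- x)"] in \<open>auto simp: norm_divide norm_power divide_right_mono\<close>)
  with eq3 show "norm (sinh x - x) <= norm x ^ 3"
  proof -
    assume that: "norm (sinh x - x) <= norm x ^ 3 / 6 + (norm (R x) + norm (R (- x))) / 2"
    have "0 <= norm x ^ 3" by simp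
    moreover have "norm (R x) <= norm x ^ 4 / 2" "norm (R (- x)) <= norm x ^ 4 / 2"
      using e[of x] e[of "- x"] assms by auto
    moreover have "S <= N" if "S <= N / 6 + (a + b) / 2" "a <= P / 2" "b <= P / 2" "P <= N" "0 <= N" for S N a b P :: real
      using that by argo
    ultimately show ?thesis using that p(1) by blast
  qed
  have eq2: "cosh x - 1 = x ^ 2 / 2 + (R x + R (- x)) / 2"
    by (simp add: R_def cosh_def scaleR_conv_of_real field_simps)
  have "norm (cosh x - 1) <= norm x ^ 2 / 2 + (norm (R x) + norm (R (- x))) / 2"
    unfolding eq2
    by (rule order_trans[OF norm_triangle_ineq add_mono])
       (use norm_triangle_ineq[of "R x" "R (- x)"] in \<open>auto simp: norm_divide norm_power divide_right_mono\<close>)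
  with eq2 show "norm (cosh x - 1) <= norm x ^ 2"
  proof -
    assume that: "norm (cosh x - 1) <= norm x ^ 2 / 2 + (norm (R x) + norm (R (- x))) / 2"
    have "norm (R x) <= norm x ^ 4 / 2" "norm (R (- x)) <= norm x ^ 4 / 2"
      using e[of x] e[of "- x"] assms by auto
    moreover have "S <= N" if "S <= N / 2 + (a + b) / 2" "a <= P / 2" "b <= P / 2" "P <= N" for S N a b P :: real
      using that by argo
    ultimately show ?thesis using that p(2) by blast
  qed
qed

text \<open>For large \<open>x\<close> the two terms are separately of order
  \<open>1 / norm x\<close>. For small \<open>x\<close> the common numerator
  \<open>x - sinh x\<close> has order 3 and the denominator order 2.\<close>

lemma csch_reg_bound:
  assumes "x \<in> sector M" "1 <= M"
  shows "norm (csch_reg x) <= (1 + M) * norm x" "norm (csch_reg x) <= (1 + M) / norm x"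
    "norm (csch_reg x) <= 1 + M"
proof -
  have x0: "x \<noteq> 0" "norm x > 0" using sector_nonzero[OF assms(1)] by auto
  have s: "norm x / (1 + M) <= norm (sinh x)" using norm_sinh_ge_sector[of x M] assms by simp
  have "0 < norm x / (1 + M)" using x0 assms(2) by simp
  with s have "norm (sinh x) > 0" by linarith
  then have s0: "norm (sinh x) > 0" "sinh x \<noteq> 0" by auto
  have inv: "1 / norm (sinh x) <= (1 + M) / norm x"
    using s s0 x0 assms(2) by (simp add: field_simps)
  have "norm (csch_reg x) <= 1 / (2 * norm (sinh x)) + 1 / (2 * norm x)"
    unfolding csch_reg_def by (rule order_trans[OF norm_triangle_ineq4]) (simp add: norm_divide norm_mult)
  also have "... = (1 / norm (sinh x) + 1 / norm x) / 2" by (simp add: add_divide_distrib)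
  also have "... <= ((1 + M) / norm x + (1 + M) / norm x) / 2"
    using inv assms(2) by (intro divide_right_mono add_mono) auto
  also have "... = (1 + M) / norm x"   proof -
    have "(a + a) / 2 = a" for a :: real by simp
    then show ?thesis .
  qed
  finally show 2: "norm (csch_reg x) <= (1 + M) / norm x" .
  have 1: "norm (csch_reg x) <= (1 + M) * norm x" if "norm x <= 1"
  proof -
    have "csch_reg x = (x - sinh x) / (2 * x) * (1 / sinh x)"
      using x0 s0 by (simp add: csch_reg_def field_simps)
    then have "norm (csch_reg x) = norm (sinh x - x) / (2 * norm x) * (1 / norm (sinh x))"
      by (simp add: norm_mult norm_divide norm_minus_commute)
    also have "... <= norm x ^ 3 / (2 * norm x) * ((1 + M) / norm x)"
      using norm_sinh_minus_le(1)[OF that] inv by (intro mult_mono divide_right_mono) auto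
    also have "... = (1 + M) * norm x / 2" using x0 by (simp add: power3_eq_cube)
    also have "... <= (1 + M) * norm x" using assms(2) by simp
    finally show ?thesis .
  qed
  show "norm (csch_reg x) <= (1 + M) * norm x"
  proof (cases "norm x <= 1")
    case False
    then have "(1 + M) / norm x <= (1 + M) * norm x"
    proof -
      have "(1 + M) / norm x <= (1 + M) / 1" using False assms(2) by (intro divide_left_mono) auto
      also have "... <= (1 + M) * norm x" using False assms(2) by simp
      finally show ?thesis .
    qed
    with 2 show ?thesis by linarith
  qed (use 1 in auto)
  show "norm (csch_reg x) <= 1 + M"
  proof (cases "norm x <= 1")
    case True
    then have "(1 + M) * norm x <= 1 + M" using assms(2) by (simp add: mult_left_le)
    then show ?thesis using 1[OF True] by linarith
  next
    case False
    then have "(1 + M) / norm x <= (1 + M) / 1" using assms(2) by (intro divide_left_mono) auto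
    then have "(1 + M) / norm x <= 1 + M" by simp
    then show ?thesis using 2 by linarith
  qed
qed

lemma half_sech_bound:
  assumes "x \<in> sector M" "1 <= M"
  shows "norm (half_sech x) <= M" "norm (half_sech x) <= (1 + M) / norm x"
proof -
  have c0: "norm (cosh x) > 0"
    using norm_cosh_ge_sector(2)[OF assms] assms(2) by (auto intro: less_le_trans[rotated])
  show "norm (half_sech x) <= M"
    using norm_cosh_ge_sector(2)[OF assms] assms(2) c0
    by (simp add: half_sech_def norm_divide norm_mult field_simps)
  have "1 / norm (cosh x) <= (1 + M) / norm x"
    using norm_cosh_ge_sector(1)[OF assms] assms(2) c0 sector_nonzero[OF assms(1)] by (simp add: field_simps)
  moreover have "norm (half_sech x) <= 1 / norm (cosh x)"
    using c0 by (simp add: half_sech_def norm_divide norm_mult field_simps)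
  ultimately show "norm (half_sech x) <= (1 + M) / norm x" by (rule order_trans[rotated])
qed

lemma half_sech_deriv:
  assumes "x \<in> sector M" "1 <= M"
  obtains d where "(half_sech has_field_derivative d) (at x)" "norm d <= (1 + M) * (1 + 2 * M) / norm x"
proof -
  have c0: "norm (cosh x) > 0" "cosh x \<noteq> 0"
    using norm_cosh_ge_sector(2)[OF assms] assms(2) by (auto intro: less_le_trans[rotated])
  define d where "d = - (sinh x / cosh x) * half_sech x"
  have "(half_sech has_field_derivative d) (at x)"
    unfolding half_sech_def[abs_def] d_def using c0
    by (auto intro!: derivative_eq_intros simp: field_simps power2_eq_square)
  moreover have "norm (sinh x / cosh x) <= 1 + 2 * M"
  proof -
    have "norm (sinh x) ^ 2 <= 1 + norm (cosh x) ^ 2"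
      unfolding norm_sinh_sq norm_cosh_sq using abs_sin_le_one[of "Im x"] by (simp add: abs_square_le_1 add_increasing2)
    also have "... <= (1 + norm (cosh x))^2" by (simp add: power2_eq_square algebra_simps)
    finally have "norm (sinh x) <= 1 + norm (cosh x)" by (rule power2_le_imp_le) simp
    then have "norm (sinh x / cosh x) <= 1 / norm (cosh x) + 1"
      using c0 by (simp add: norm_divide field_simps)
    also have "1 / norm (cosh x) <= 2 * M"
      using norm_cosh_ge_sector(2)[OF assms] assms(2) c0 by (simp add: field_simps)
    finally show ?thesis by simp
  qed
  then have "norm d <= (1 + 2 * M) * ((1 + M) / norm x)"
    unfolding d_def norm_mult norm_minus_cancel using half_sech_bound(2)[OF assms] assms(2)
    by (intro mult_mono) auto
  ultimately show ?thesis using that by (simp add: mult.commute)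
qed

lemma csch_reg_deriv:
  assumes "x \<in> sector M" "1 <= M"
  obtains d where "(csch_reg has_field_derivative d) (at x)" "norm d <= 8 * (1 + M) ^ 2 / norm x"
proof -
  have x0: "x \<noteq> 0" "norm x > 0" using sector_nonzero[OF assms(1)] by auto
  have s: "norm x / (1 + M) <= norm (sinh x)" using norm_sinh_ge_sector[of x M] assms by simp
  have "0 < norm x / (1 + M)" using x0 assms(2) by simp
  with s have "norm (sinh x) > 0" by linarith
  then have s0: "norm (sinh x) > 0" "sinh x \<noteq> 0" by auto
  have inv: "1 / norm (sinh x) <= (1 + M) / norm x"
    using s s0 x0 assms(2) by (simp add: field_simps)
  define d where "d = - cosh x / (2 * sinh x ^ 2) + 1 / (2 * x ^ 2)"
  have der: "(csch_reg has_field_derivative d) (at x)"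
    unfolding csch_reg_def[abs_def] d_def using x0 s0
    by (auto intro!: derivative_eq_intros simp: field_simps power2_eq_square)
  have "norm d <= 8 * (1 + M) ^ 2 / norm x"
  proof (cases "norm x <= 1")
    case True
    have "d = (sinh x ^ 2 - x ^ 2 * cosh x) / (2 * x ^ 2) * (1 / sinh x) ^ 2"
      using x0 s0 by (simp add: d_def field_simps power2_eq_square)
    \<comment> \<open>Splitting off \<open>x\<close> and \<open>1\<close> exposes the order: both
      summands are of order \<open>norm x ^ 4\<close>, which cancels the four powers in the
      denominator.\<close>
    also have "sinh x ^ 2 - x ^ 2 * cosh x = (sinh x - x) * (sinh x - x + 2 * x) - x ^ 2 * (cosh x - 1)"
      by (simp add: algebra_simps power2_eq_square)
    finally have "norm d = norm ((sinh x - x) * (sinh x - x + 2 * x) - x ^ 2 * (cosh x - 1)) / (2 * norm x ^ 2) * (1 / norm (sinh x)) ^ 2"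
      by (simp only: norm_mult norm_divide norm_power norm_numeral norm_one)
    also have "... <= (4 * norm x ^ 4) / (2 * norm x ^ 2) * ((1 + M) / norm x) ^ 2"
    proof (intro mult_mono divide_right_mono power_mono inv)
      have "norm ((sinh x - x) * (sinh x - x + 2 * x) - x ^ 2 * (cosh x - 1))
         <= norm (sinh x - x) * (norm (sinh x - x) + 2 * norm x) + norm x ^ 2 * norm (cosh x - 1)"
        by (rule order_trans[OF norm_triangle_ineq4], unfold norm_mult norm_power, intro add_mono mult_left_mono)
           (use norm_triangle_ineq[of "sinh x - x" "2 * x"] in \<open>simp_all add: norm_mult\<close>)
      also have "... <= norm x ^ 3 * (norm x + 2 * norm x) + norm x ^ 2 * norm x ^ 2"
      proof -
        have "norm x ^ 3 <= norm x ^ 1" by (rule power_decreasing) (use True in auto)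
        then show ?thesis
          using norm_sinh_minus_le[OF True]
          by (intro add_mono mult_mono mult_left_mono) auto
      qed
      also have "... = 4 * norm x ^ 4" by (simp add: algebra_simps power2_eq_square power3_eq_cube power4_eq_xxxx)
      finally show "norm ((sinh x - x) * (sinh x - x + 2 * x) - x ^ 2 * (cosh x - 1)) <= 4 * norm x ^ 4" .
    qed (use assms in auto)
    also have "... = 2 * (1 + M) ^ 2" using x0 by (simp add: field_simps power2_eq_square power4_eq_xxxx)
    also have "... <= 8 * (1 + M) ^ 2 / norm x"
    proof -
      have "2 * (1 + M)^2 * norm x <= 8 * (1 + M)^2 * 1"
        using True by (intro mult_mono) auto
      then show ?thesis using x0 by (simp add: pos_le_divide_eq)
    qed
    finally show ?thesis .
  next
    case False
    have "norm (cosh x) ^ 2 <= 1 + norm (sinh x) ^ 2"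
      unfolding norm_sinh_sq norm_cosh_sq using abs_cos_le_one[of "Im x"] by (simp add: abs_square_le_1 add_increasing2)
    also have "... <= (1 + norm (sinh x))^2" by (simp add: power2_eq_square algebra_simps)
    finally have c: "norm (cosh x) <= 1 + norm (sinh x)" by (rule power2_le_imp_le) simp
    have i1: "1 / norm (sinh x) <= 1 + M"
    proof -
      have "(1 + M) / norm x <= (1 + M) / 1" using False assms(2) by (intro divide_left_mono) auto
      then show ?thesis using inv by simp
    qed
    have "norm d <= norm (cosh x) / (2 * norm (sinh x) ^ 2) + 1 / (2 * norm x ^ 2)"
      unfolding d_def by (rule order_trans[OF norm_triangle_ineq]) (simp add: norm_mult norm_divide norm_power)
    also have "... <= (1 / norm (sinh x) + 1) * (1 / norm (sinh x)) / 2 + 1 / (2 * norm x ^ 2)"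
    proof -
      have "(1 / norm (sinh x) + 1) * (1 / norm (sinh x)) / 2 = (1 + norm (sinh x)) / (2 * norm (sinh x) ^ 2)"
        using s0 by (simp add: field_simps power2_eq_square)
      then show ?thesis using divide_right_mono[OF c, of "2 * norm (sinh x) ^ 2"] by simp
    qed
    also have "... <= (1 + M + 1) * ((1 + M) / norm x) / 2 + 1 / norm x"
    proof (intro add_mono divide_right_mono mult_mono i1 inv)
      show "1 / (2 * (norm x)^2) <= 1 / norm x"
        using False x0 by (simp add: field_simps power2_eq_square)
    qed (use assms in auto)
    also have "... <= 8 * (1 + M) ^ 2 / norm x"
    proof -
      have "(1 + M + 1) * (1 + M) / 2 + 1 <= 8 * (1 + M) ^ 2"
        using assms(2) by (simp add: power2_eq_square algebra_simps)
      moreover have "(1 + M + 1) * ((1 + M) / norm x) / 2 + 1 / norm x = ((1 + M + 1) * (1 + M) / 2 + 1) / norm x"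
        using x0 by (simp add: field_simps)
      ultimately show ?thesis by (simp only: divide_right_mono norm_ge_zero)
    qed
    finally show ?thesis .
  qed
  with der show ?thesis using that by blast
qed


text \<open>A derivative bounded by \<open>B / norm x\<close> along the ray through \<open>z\<close>
  gives increments that are invariant under scaling of \<open>z\<close>. The bound is therefore
  uniform down to \<open>z = 0\<close>, as the summation by parts requires.\<close>

lemma csch_reg_increment:
  assumes "z \<in> sector M" "1 <= M" "0 < s" "s <= t"
  shows "norm (csch_reg (of_real t * z) - csch_reg (of_real s * z)) <= 8 * (1 + M) ^ 2 * (t - s) / s"
    and "norm (half_sech (of_real t * z) - half_sech (of_real s * z)) <= (1 + M) * (1 + 2 * M) * (t - s) / s"
proof -
  have z: "norm z > 0" using sector_nonzero[OF assms(1)] by simp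
  have gen: "norm (f (of_real t * z) - f (of_real s * z)) <= B * (t - s) / s"
    if f: "\<And>x. x \<in> sector M ==> \<exists>d. (f has_field_derivative d) (at x) \<and> norm d <= B / norm x"
      and B: "0 <= B" for f :: "complex \<Rightarrow> complex" and B
  proof -
    define S where "S = (\<lambda>u. of_real u * z) ` {s..t}"
    obtain f' where f': "\<And>x. x \<in> sector M ==> (f has_field_derivative f' x) (at x) \<and> norm (f' x) <= B / norm x"
      using f by metis
    have cS: "convex S"
      unfolding S_def by (intro convex_linear_image) (auto simp: linear_iff algebra_simps scaleR_conv_of_real)
    have "norm (f (of_real t * z) - f (of_real s * z)) <= (B / (s * norm z)) * norm (of_real t * z - of_real s * z)"
    proof (rule field_differentiable_bound[OF cS, where f' = f'])
      fix x assume "x \<in> S"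
      then obtain u where u: "s <= u" "x = of_real u * z" by (auto simp: S_def)
      then have x: "x \<in> sector M" using sector_scale[OF assms(1), of u] assms(3) by simp
      show "(f has_field_derivative f' x) (at x within S)" using f'[OF x] has_field_derivative_at_within by blast
      have "norm (f' x) <= B / norm x" using f'[OF x] by simp
      also have "... <= B / (s * norm z)"
        using u assms(3) z B by (intro divide_left_mono) (auto simp: norm_mult intro!: mult_right_mono)
      finally show "norm (f' x) <= B / (s * norm z)" .
    qed (use assms in \<open>auto simp: S_def\<close>)
    also have "norm (of_real t * z - of_real s * z) = (t - s) * norm z"
      using assms by (simp flip: left_diff_distrib of_real_diff add: norm_mult)
    also have "(B / (s * norm z)) * ((t - s) * norm z) = B * (t - s) / s"
      using z by simp
    finally show ?thesis .
  qed
  show "norm (csch_reg (of_real t * z) - csch_reg (of_real s * z)) <= 8 * (1 + M) ^ 2 * (t - s) / s"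
  proof (rule gen)
    show "\<exists>d. (csch_reg has_field_derivative d) (at x) \<and> norm d <= 8 * (1 + M) ^ 2 / norm x" if "x \<in> sector M" for x
      using csch_reg_deriv[OF that assms(2)] by metis
  qed simp
  show "norm (half_sech (of_real t * z) - half_sech (of_real s * z)) <= (1 + M) * (1 + 2 * M) * (t - s) / s"
  proof (rule gen)
    show "\<exists>d. (half_sech has_field_derivative d) (at x) \<and> norm d <= (1 + M) * (1 + 2 * M) / norm x" if "x \<in> sector M" for x
      using half_sech_deriv[OF that assms(2)] by metis
  qed (use assms(2) in simp)
qed


subsection \<open>The logarithm of the infinite product\<close>

definition prod_coef :: "complex \<Rightarrow> nat \<Rightarrow> complex" where
  "prod_coef z r = (if even r then 1 / (2 * sinh (of_nat r * z)) else 1 / (2 * cosh (of_nat r * z)))"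

text \<open>With \<open>w = exp (- 2 z)\<close>, \<open>prod_log z X\<close> is the logarithm of
  \<open>\<Prod>j. (1 - X w\<^bsup>2j + 1/2\<^esup>) (1 + X w\<^bsup>2j + 3/2\<^esup>)\<close>; the half-integral shift makes all
  coefficients hyperbolic functions. The terms with index 0 vanish because \<open>x / 0 = 0\<close>.\<close>

definition prod_log :: "complex \<Rightarrow> complex \<Rightarrow> complex" where
  "prod_log z X = - (\<Sum>r. prod_coef z r / of_nat r * X ^ r)"

text \<open>Only the even coefficients have a pole \<open>1 / (2 r z)\<close> at
  \<open>z = 0\<close>. The removed poles add up to \<open>dilog (X^2) / (8 z)\<close>, see
  \<open>prod_log_eq\<close>.\<close>

definition reg_coef :: "complex \<Rightarrow> nat \<Rightarrow> complex" where
  "reg_coef z r = (if even r then csch_reg (of_nat r * z) else half_sech (of_nat r * z))"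

definition prod_log_reg :: "complex \<Rightarrow> complex \<Rightarrow> complex" where
  "prod_log_reg z X = - (\<Sum>r. reg_coef z r / of_nat r * X ^ r)"

lemma norm_prod_coef_le:
  assumes "Re z > 0"
  shows "norm (prod_coef z r / of_nat r) <= exp (- Re z) ^ r / (1 - exp (- (2 * Re z)))"
proof (cases "r = 0")
  case True
  then show ?thesis using assms by simp
next
  case False
  define a where "a = of_nat r * Re z"
  have a: "a \<ge> Re z" "a > 0" using False assms by (auto simp: a_def)
  have e: "exp (- (2 * a)) <= exp (- (2 * Re z))" "exp (- (2 * Re z)) < 1" using a assms by auto
  have "2 * sinh a = exp a * (1 - exp (- (2 * a)))"
    by (simp add: sinh_def field_simps flip: exp_add)
  also have "... \<ge> exp a * (1 - exp (- (2 * Re z)))" using e by (intro mult_left_mono) auto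
  finally have s: "exp a * (1 - exp (- (2 * Re z))) <= 2 * sinh a" .
  have p: "0 < exp a * (1 - exp (- (2 * Re z)))" using e by simp
  have "sinh a <= norm (sinh (of_nat r * z))" "sinh a <= norm (cosh (of_nat r * z))"
    using norm_sinh_ge[of "of_nat r * z"] norm_cosh_ge[of "of_nat r * z"] by (simp_all add: a_def)
  moreover have "sinh a > 0" using a by simp
  ultimately have "norm (prod_coef z r) <= 1 / (2 * sinh a)"
    unfolding prod_coef_def by (auto simp: norm_divide norm_mult intro!: frac_le)
  also have "... <= 1 / (exp a * (1 - exp (- (2 * Re z))))"
    by (rule frac_le[OF _ _ p s]) auto
  also have "... = exp (- Re z) ^ r / (1 - exp (- (2 * Re z)))"
    by (simp add: a_def exp_minus field_simps flip: exp_of_nat_mult)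
  finally have 1: "norm (prod_coef z r) <= exp (- Re z) ^ r / (1 - exp (- (2 * Re z)))" .
  have "norm (prod_coef z r / of_nat r) <= norm (prod_coef z r) / 1"
    unfolding norm_divide using False by (intro divide_left_mono) auto
  with 1 show ?thesis by simp
qed

lemma summable_prod_log:
  assumes "Re z > 0" "norm X < exp (Re z)"
  shows "summable (\<lambda>r. norm (prod_coef z r / of_nat r * X ^ r))"
proof (rule summable_comparison_test')
  have "exp (- Re z) * norm X < exp (- Re z) * exp (Re z)"
    using assms by (intro mult_strict_left_mono) auto
  then have "norm (exp (- Re z) * norm X) < 1" by (simp flip: exp_add)
  then show "summable (\<lambda>r. (exp (- Re z) * norm X) ^ r * (1 / (1 - exp (- (2 * Re z)))))"
    by (intro summable_mult2 summable_geometric)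
  show "norm (norm (prod_coef z r / of_nat r * X ^ r)) <= (exp (- Re z) * norm X) ^ r * (1 / (1 - exp (- (2 * Re z))))" for r
    using mult_right_mono[OF norm_prod_coef_le[OF assms(1), of r], of "norm X ^ r"]
    unfolding real_norm_def abs_norm_cancel norm_mult norm_power power_mult_distrib by (simp add: mult.commute)
qed

text \<open>The coefficients decay like \<open>exp (- r Re z)\<close>. The resulting radius exceeds
  1, which leaves room around the contour side where \<open>norm X = 1\<close>.\<close>

lemma holomorphic_prod_log:
  assumes "Re z > 0"
  shows "prod_log z holomorphic_on ball 0 (exp (Re z))"
proof -
  have "((\<lambda>X. \<Sum>r. prod_coef z r / of_nat r * X ^ r) has_field_derivative
     (\<Sum>n. diffs (\<lambda>r. prod_coef z r / of_nat r) n * X ^ n)) (at X)" if "norm X < exp (Re z)" for X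
    by (rule termdiffs_strong'[OF _ that]) (rule summable_norm_cancel[OF summable_prod_log[OF assms]])
  then have "(\<lambda>X. \<Sum>r. prod_coef z r / of_nat r * X ^ r) holomorphic_on ball 0 (exp (Re z))"
    unfolding holomorphic_on_open[OF open_ball] by (metis mem_ball_0)
  then show ?thesis unfolding prod_log_def[abs_def] by (intro holomorphic_intros)
qed

lemma sums_prod_log:
  assumes "Re z > 0" "norm X <= 1"
  shows "(\<lambda>r. prod_coef z r / of_nat r * X ^ r) sums (- prod_log z X)"
  unfolding prod_log_def minus_minus
  by (rule summable_sums, rule summable_norm_cancel, rule summable_prod_log)
     (use assms in \<open>auto intro: le_less_trans\<close>)

text \<open>Splitting off the first factor of the product at \<open>X\<close> leaves the product at
  \<open>- w X\<close> with \<open>w = exp (- 2 z)\<close>; the rest is the logarithmic series of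
  that factor.\<close>

lemma prod_log_step:
  assumes "Re z > 0" "norm X <= 1"
  shows "prod_log z X = prod_log z (- (exp (- 2 * z) * X)) + Ln (1 - X * exp (- z))"
proof -
  have e: "norm (exp (- z)) < 1" "norm (exp (- 2 * z)) < 1" using assms by auto
  then have n1: "norm (X * exp (- z)) < 1"
    unfolding norm_mult
    using assms(2) mult_left_le_one_le[of "norm (exp (-z))" "norm X", OF norm_ge_zero norm_ge_zero] by linarith
  have n2: "norm (- (exp (- 2 * z) * X)) <= 1"
    using e assms(2) by (simp only: norm_minus_cancel norm_mult mult_le_one norm_ge_zero less_imp_le)
  have "(\<lambda>n. - ((X * exp (- z)) ^ n) / of_nat n) sums Ln (1 - X * exp (- z))"
    using Ln_series'[of "- (X * exp (- z))"] n1 by simp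
  moreover have "(\<lambda>r. prod_coef z r / of_nat r * (- (exp (- 2 * z) * X)) ^ r - prod_coef z r / of_nat r * X ^ r)
      sums (- prod_log z (- (exp (- 2 * z) * X)) - (- prod_log z X))"
    by (intro sums_diff sums_prod_log assms n2)
  moreover have "prod_coef z r / of_nat r * (- (exp (- 2 * z) * X)) ^ r - prod_coef z r / of_nat r * X ^ r
      = - ((X * exp (- z)) ^ r) / of_nat r" for r
  proof (cases "r = 0")
    case False
    define E where "E = exp (of_nat r * z)"
    have E: "E \<noteq> 0" "exp (- (of_nat r * z)) = 1 / E" by (auto simp: E_def exp_minus field_simps)
    have E1: "exp (- z) ^ r = 1 / E" by (simp add: E_def exp_minus field_simps flip: exp_of_nat_mult)
    have E2: "exp (- 2 * z) ^ r = 1 / E ^ 2"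
      unfolding E_def power2_eq_square
      by (simp add: exp_minus field_simps flip: exp_of_nat_mult exp_add)
    have "norm E > 1" using False assms by (simp add: E_def)
    have "E ^ 2 \<noteq> 1" "E ^ 2 \<noteq> - 1"
    proof -
      have "norm (E ^ 2) > 1" using \<open>norm E > 1\<close> by (simp add: norm_power one_less_power)
      then show "E ^ 2 \<noteq> 1" "E ^ 2 \<noteq> - 1" by auto
    qed
    have c: "prod_coef z r * ((- 1) ^ r / E ^ 2 - 1) = - 1 / E"
    proof (cases "even r")
      case True
      have "2 * sinh (of_nat r * z) = E - 1 / E"
        unfolding sinh_def E(2) E_def[symmetric] by (simp add: scaleR_conv_of_real field_simps)
      then have "prod_coef z r = 1 / (E - 1 / E)"
        using True by (simp add: prod_coef_def)
      also have "... = E / (E ^ 2 - 1)" using E \<open>E ^ 2 \<noteq> 1\<close> by (simp add: field_simps power2_eq_square)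
      finally show ?thesis using True E \<open>E ^ 2 \<noteq> 1\<close> by (simp add: field_simps power2_eq_square)
    next
      case False
      have n0: "E ^ 2 + 1 \<noteq> 0" using \<open>E ^ 2 \<noteq> - 1\<close> by (simp add: eq_neg_iff_add_eq_0)
      have "2 * cosh (of_nat r * z) = E + 1 / E"
        unfolding cosh_def E(2) E_def[symmetric] by (simp add: scaleR_conv_of_real algebra_simps)
      then have "prod_coef z r = 1 / (E + 1 / E)"
        using False by (simp add: prod_coef_def)
      also have "... = E / (E ^ 2 + 1)" using E n0 by (simp add: field_simps power2_eq_square)
      finally have "prod_coef z r * ((- 1) ^ r / E ^ 2 - 1) = E / (E ^ 2 + 1) * (- (E ^ 2 + 1) / E ^ 2)"
        using False E by (simp add: field_simps)
      also have "... = - 1 / E"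
      proof -
        have "E / D * (- D / E ^ 2) = - 1 / E" if "D \<noteq> 0" for D
          using that E by (simp add: power2_eq_square)
        then show ?thesis using n0 by blast
      qed
      finally show ?thesis .
    qed
    have "prod_coef z r / of_nat r * (- (exp (- 2 * z) * X)) ^ r - prod_coef z r / of_nat r * X ^ r
       = (prod_coef z r * ((- 1) ^ r / E ^ 2 - 1)) * (X ^ r / of_nat r)"
      unfolding power_minus[of "exp (- 2 * z) * X"] power_mult_distrib E2 by (simp add: algebra_simps diff_divide_distrib)
    also have "... = - ((X * exp (- z)) ^ r) / of_nat r"
      unfolding c power_mult_distrib E1 by simp
    finally show ?thesis .
  qed simp
  ultimately show ?thesis using sums_unique2 by fastforce
qed


lemma norm_reg_coef_le:
  assumes "z \<in> sector M" "1 <= M" "r > 0"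
  shows "norm (reg_coef z r) <= 1 + M" "norm (reg_coef z r) <= (1 + M) / (real r * norm z)"
proof -
  have s: "of_nat r * z \<in> sector M" using sector_scale[OF assms(1), of "real r"] assms(3) by simp
  have n: "norm (of_nat r * z) = real r * norm z" by (simp add: norm_mult)
  have "norm (half_sech (of_nat r * z)) <= 1 + M" using half_sech_bound(1)[OF s assms(2)] by simp
  then show "norm (reg_coef z r) <= 1 + M"
    using csch_reg_bound(3)[OF s assms(2)] by (auto simp: reg_coef_def)
  show "norm (reg_coef z r) <= (1 + M) / (real r * norm z)"
    using csch_reg_bound(2)[OF s assms(2)] half_sech_bound(2)[OF s assms(2)] unfolding n
    by (auto simp: reg_coef_def)
qed

text \<open>With \<open>t = r * norm z\<close>, the bound \<open>(1 + M) / sqrt t\<close> follows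
  from both bounds of \<open>norm_reg_coef_le\<close>. It makes the series absolutely summable at
  the price of \<open>1 / sqrt (norm z)\<close>.\<close>

lemma norm_reg_coef_le_powr:
  assumes "z \<in> sector M" "1 <= M"
  shows "norm (reg_coef z r / of_nat r) <= (1 + M) / sqrt (norm z) * real r powr (- 3 / 2)"
proof (cases "r = 0")
  case False
  define t where "t = real r * norm z"
  have t: "t > 0" using False sector_nonzero[OF assms(1)] by (simp add: t_def)
  have "norm (reg_coef z r) <= (1 + M) / sqrt t"
  proof (cases "t <= 1")
    case True
    have "(1 + M) / 1 <= (1 + M) / sqrt t" using True t assms(2) by (intro divide_left_mono) auto
    then show ?thesis using norm_reg_coef_le(1)[OF assms, of r] False by simp
  next
    case False
    have "sqrt t * 1 <= sqrt t * sqrt t" using False by (intro mult_left_mono) auto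
    then have "sqrt t <= t" using t by simp
    then have "(1 + M) / t <= (1 + M) / sqrt t" using t assms(2) by (intro divide_left_mono) auto
    then show ?thesis using norm_reg_coef_le(2)[OF assms, of r] \<open>r \<noteq> 0\<close> unfolding t_def by simp
  qed
  then have "norm (reg_coef z r / of_nat r) <= (1 + M) / sqrt t / real r"
    by (simp only: norm_divide norm_of_nat divide_right_mono of_nat_0_le_iff)
  also have "... = (1 + M) / sqrt (norm z) * (1 / (sqrt (real r) * real r))"
    by (simp add: t_def real_sqrt_mult)
  also have "1 / (sqrt (real r) * real r) = real r powr (- 3 / 2)"
  proof -
    have "real r powr (3 / 2) = real r powr (1 / 2 + 1)" by simp
    also have "... = sqrt (real r) * real r" using False by (simp only: powr_add) (simp add: powr_half_sqrt)
    finally show ?thesis by (simp add: powr_minus_divide)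
  qed
  finally show ?thesis .
qed simp

lemma summable_powr_three_halves: "summable (\<lambda>r. real r powr (- 3 / 2))"
  by (simp add: summable_real_powr_iff)

lemma summable_prod_log_reg:
  assumes "z \<in> sector M" "1 <= M" "norm X <= 1"
  shows "summable (\<lambda>r. norm (reg_coef z r / of_nat r * X ^ r))"
proof (rule summable_comparison_test'[OF summable_mult[OF summable_powr_three_halves, of "(1 + M) / sqrt (norm z)"]])
  fix r
  have "norm (reg_coef z r / of_nat r) * norm X ^ r <= ((1 + M) / sqrt (norm z) * real r powr (- 3 / 2)) * 1"
    using norm_reg_coef_le_powr[OF assms(1,2), of r] assms(2,3) by (intro mult_mono power_le_one) auto
  then show "norm (norm (reg_coef z r / of_nat r * X ^ r)) <= (1 + M) / sqrt (norm z) * real r powr (- 3 / 2)"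
    by (simp only: mult_1_right real_norm_def abs_norm_cancel abs_mult power_abs norm_mult[of "reg_coef z r / of_nat r"] norm_power)
qed

text \<open>Uniform on the whole closed disc, including the singular points \<open>X = 1\<close> and
  \<open>X = - 1\<close>. The loss \<open>1 / sqrt (Re z)\<close> in the exponent is harmless
  against exponents of order \<open>1 / Re z\<close>.\<close>

lemma norm_prod_log_reg_le:
  assumes "1 <= M"
  obtains C where "0 < C"
    "\<And>z X :: complex. z \<in> sector M ==> norm X <= 1 ==> norm (prod_log_reg z X) <= C / sqrt (Re z)"
proof (rule that)
  let ?S = "\<Sum>r. real r powr (- 3 / 2)"
  have "?S \<ge> 0" by (intro suminf_nonneg summable_powr_three_halves) auto
  then show "0 < (1 + M) * (?S + 1)" using assms by (intro mult_pos_pos) auto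
  fix z X :: complex assume z: "z \<in> sector M" "norm X <= 1"
  have Re: "0 < Re z" "Re z <= norm z" using z complex_Re_le_cmod by (auto simp: sector_def)
  have "norm (prod_log_reg z X) <= (\<Sum>r. norm (reg_coef z r / of_nat r * X ^ r))"
    unfolding prod_log_reg_def norm_minus_cancel by (rule summable_norm[OF summable_prod_log_reg[OF z(1) assms z(2)]])
  also have "... <= (\<Sum>r. (1 + M) / sqrt (norm z) * real r powr (- 3 / 2))"
  proof (rule suminf_le[OF _ summable_prod_log_reg[OF z(1) assms z(2)] summable_mult[OF summable_powr_three_halves]])
    fix r
    have "norm (reg_coef z r / of_nat r) * norm X ^ r <= ((1 + M) / sqrt (norm z) * real r powr (- 3 / 2)) * 1"
      using norm_reg_coef_le_powr[OF z(1) assms, of r] assms z by (intro mult_mono power_le_one) auto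
    then show "norm (reg_coef z r / of_nat r * X ^ r) <= (1 + M) / sqrt (norm z) * real r powr (- 3 / 2)"
      by (simp only: mult_1_right norm_mult[of "reg_coef z r / of_nat r"] norm_power)
  qed
  also have "... = (1 + M) / sqrt (norm z) * ?S"
    by (rule suminf_mult[OF summable_powr_three_halves])
  also have "... <= (1 + M) / sqrt (Re z) * (?S + 1)"
    using Re assms \<open>?S \<ge> 0\<close> by (intro mult_mono frac_le) auto
  finally show "norm (prod_log_reg z X) <= (1 + M) * (?S + 1) / sqrt (Re z)" by simp
qed

lemma prod_log_eq:
  assumes "z \<in> sector M" "1 <= M" "norm X <= 1"
  shows "prod_log z X = prod_log_reg z X - dilog (X^2) / (8 * z)"
proof -
  have z: "0 < Re z" "z \<noteq> 0" using assms by (auto simp: sector_def)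
  define f where "f = (\<lambda>r. prod_coef z r / of_nat r * X ^ r - reg_coef z r / of_nat r * X ^ r)"
  have s: "f sums (- prod_log z X - (- prod_log_reg z X))"
    unfolding f_def prod_log_reg_def minus_minus using z
    by (intro sums_diff sums_prod_log assms summable_sums summable_norm_cancel[OF summable_prod_log_reg[OF assms]])
  have f: "f r = (if even r then X ^ r / (of_nat r * (2 * (of_nat r * z))) else 0)" for r
    by (auto simp: f_def prod_coef_def reg_coef_def csch_reg_def half_sech_def diff_divide_distrib left_diff_distrib)
  have "(\<lambda>n. f (2 * n)) sums (- prod_log z X - (- prod_log_reg z X))"
    using s by (subst sums_mono_reindex[of "\<lambda>n. 2 * n"]) (auto simp: strict_mono_def f image_iff dvd_def)
  moreover have "f (2 * n) = ((X^2) ^ n / of_nat n ^ 2) / (8 * z)" for n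
    by (simp add: f power_mult power2_eq_square)
  moreover have "(\<lambda>n. ((X^2) ^ n / of_nat n ^ 2) / (8 * z)) sums (dilog (X^2) / (8 * z))"
    unfolding dilog_def using assms
    by (intro sums_divide summable_sums summable_dilog) (auto simp: norm_power power_le_one)
  ultimately have "- prod_log z X - (- prod_log_reg z X) = dilog (X^2) / (8 * z)"
    using sums_unique2 by fastforce
  then show ?thesis by (simp add: algebra_simps)
qed


subsection \<open>The regular part away from \<open>X = \<plusminus> 1\<close>\<close>

text \<open>Multiplying by \<open>1 - X\<^sup>2\<close> is a summation by parts: it makes the series converge absolutely,
  uniformly in \<open>z\<close>. Truncated subtraction and \<open>x / 0 = 0\<close> give the right values for \<open>r < 2\<close>.\<close>

definition reg_diff :: "complex \<Rightarrow> nat \<Rightarrow> complex" where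
  "reg_diff z r = reg_coef z r / of_nat r - reg_coef z (r - 2) / of_nat (r - 2)"

lemma sums_shift_two:
  fixes f :: "nat \<Rightarrow> complex"
  assumes "f sums s" "f 0 = 0"
  shows "(\<lambda>r. X\<^sup>2 * f (r - 2)) sums (X^2 * s)"
proof -
  have "(\<lambda>r. f (r + 2 - 2)) sums s" using assms(1) by simp
  then have "(\<lambda>r. f (r - 2)) sums (s + (\<Sum>r<2. f (r - 2)))"
    by (subst (asm) sums_iff_shift) (simp add: algebra_simps)
  then show ?thesis using assms(2) by (intro sums_mult) (simp add: numeral_2_eq_2)
qed

lemma sums_reg_diff:
  assumes "z \<in> sector M" "1 <= M" "norm X <= 1"
  shows "(\<lambda>r. reg_diff z r * X ^ r) sums (- (1 - X\<^sup>2) * prod_log_reg z X)"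
proof -
  define f where "f = (\<lambda>r. reg_coef z r / of_nat r * X ^ r)"
  have f: "f sums (- prod_log_reg z X)"
    unfolding f_def prod_log_reg_def minus_minus
    by (intro summable_sums summable_norm_cancel[OF summable_prod_log_reg[OF assms]])
  have "(\<lambda>r. f r - X\<^sup>2 * f (r - 2)) sums (- prod_log_reg z X - X\<^sup>2 * (- prod_log_reg z X))"
    by (intro sums_diff f sums_shift_two) (simp add: f_def)
  moreover have "f r - X\<^sup>2 * f (r - 2) = reg_diff z r * X ^ r" for r
  proof (cases "r < 2")
    case True
    then show ?thesis by (cases r) (auto simp: f_def reg_diff_def)
  next
    case False
    then have "X ^ r = X^2 * X ^ (r - 2)" by (metis linorder_not_less le_add_diff_inverse power_add)
    then show ?thesis by (simp add: f_def reg_diff_def algebra_simps)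
  qed
  ultimately show ?thesis by (simp add: algebra_simps)
qed

text \<open>For \<open>r >= 3\<close> and \<open>s = r - 2\<close>, the increment of the
  coefficients is of order \<open>1 / s\<close> and is divided by \<open>r\<close>, and
  \<open>1 / s - 1 / r = 2 / (r s)\<close>. The indices up to 2 have no predecessor and are treated
  separately.\<close>

lemma norm_reg_diff_le:
  assumes "1 <= M"
  shows "\<exists>B>0. \<forall>z\<in>sector M. \<forall>r. norm (reg_diff z r) <= B / real r ^ 2"
proof -
  define K where "K = 8 * (1 + M) ^ 2 + (1 + M) * (1 + 2 * M)"
  have K0: "K > 0" unfolding K_def using assms by (intro add_pos_pos mult_pos_pos) auto
  have M0: "(1 + M) <= K" unfolding K_def using assms by (simp add: power2_eq_square algebra_simps)
  define B where "B = 36 * K"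
  have "norm (reg_diff z r) <= B / real r ^ 2" if z: "z \<in> sector M" for z r
  proof -
    consider "r = 0" | "r = 1" | "r = 2" | "r \<ge> 3" by linarith
    then show ?thesis
    proof cases
      case 4
      define s where "s = r - 2"
      have s: "r = s + 2" "s > 0" using 4 by (auto simp: s_def)
      have inc: "norm (reg_coef z r - reg_coef z s) <= 2 * K / real s"
      proof -
        have "8 * (1 + M) ^ 2 * 2 / real s <= 2 * K / real s" "(1 + M) * (1 + 2 * M) * 2 / real s <= 2 * K / real s"
          unfolding K_def using assms by (auto intro!: divide_right_mono)
        then show ?thesis
          using csch_reg_increment[OF z assms, of "real s" "real r"] s
          by (auto simp: reg_coef_def)
      qed
      have "reg_diff z r = (reg_coef z r - reg_coef z s) / of_nat r - reg_coef z s * (2 / (of_nat r * of_nat s))"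
      proof -
        have "2 / (b * a) = 1 / a - 1 / b" if "a \<noteq> 0" "b \<noteq> 0" "b = a + 2" for a b :: complex
          using that(1,2) unfolding that(3) by (simp add: field_simps)
        note that = this
        have "2 / (of_nat r * of_nat s) = 1 / of_nat s - (1 / of_nat r :: complex)"
        proof -
          have "of_nat r \<noteq> (0::complex)" "of_nat s \<noteq> (0::complex)" using 4 s(2) by simp_all
          moreover have "of_nat r = of_nat s + (2::complex)" unfolding s(1) by simp
          ultimately show ?thesis using that by blast
        qed
        note e1 = this
        have "a / of_nat r - b / of_nat s = (a - b) / of_nat r - b * (1 / of_nat s - 1 / of_nat r)" for a b :: complex
          by (simp add: diff_divide_distrib right_diff_distrib)
        then show ?thesis unfolding reg_diff_def s_def[symmetric] e1 .
      qed
      then have "norm (reg_diff z r) <= norm (reg_coef z r - reg_coef z s) / real r + norm (reg_coef z s) * (2 / (real r * real s))"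
        by (simp only:) (rule order_trans[OF norm_triangle_ineq4], simp add: norm_mult norm_divide)
      also have "... <= (2 * K / real s) / real r + K * (2 / (real r * real s))"
        using inc norm_reg_coef_le(1)[OF z assms s(2)] M0
        by (intro add_mono divide_right_mono mult_right_mono) auto
      also have "... = 4 * K / (real s * real r)" using s by (simp add: field_simps)
      also have "... <= 4 * K / (real r / 3 * real r)"
        using s K0 by (intro divide_left_mono mult_right_mono) auto
      also have "... <= B / real r ^ 2" using K0 by (simp add: B_def power2_eq_square divide_right_mono)
      finally show ?thesis .
    next
      case 2
      then show ?thesis using norm_reg_coef_le(1)[OF z assms, of 1] M0 K0 by (simp add: reg_diff_def B_def)
    next
      case 3
      then show ?thesis using norm_reg_coef_le(1)[OF z assms, of 2] M0 K0 by (simp add: reg_diff_def B_def norm_divide)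
    qed (simp add: reg_diff_def)
  qed
  moreover have "B > 0" using K0 by (simp add: B_def)
  ultimately show ?thesis by blast
qed

text \<open>In contrast with \<open>norm_prod_log_reg_le\<close> there is no loss in
  \<open>z\<close>, as long as \<open>X\<close> stays away from \<open>1\<close> and
  \<open>- 1\<close>.\<close>

lemma norm_one_minus_sq_prod_log_reg_le:
  assumes "1 <= M"
  obtains C where "0 < C"
    "\<And>z X :: complex. z \<in> sector M ==> norm X <= 1 ==> norm (1 - X\<^sup>2) * norm (prod_log_reg z X) <= C"
proof -
  obtain B where B: "B > 0" "\<And>z r. z \<in> sector M ==> norm (reg_diff z r) <= B / real r ^ 2"
    using norm_reg_diff_le[OF assms] by blast
  have sB: "summable (\<lambda>r. B * (1 / real r ^ 2))" by (intro summable_mult summable_inverse_square)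
  show ?thesis
  proof (rule that[of "B * (pi^2 / 6)"])
    fix z X :: complex assume z: "z \<in> sector M" "norm X <= 1"
    have le: "norm (reg_diff z r * X ^ r) <= B * (1 / real r ^ 2)" for r
    proof -
      have "norm (reg_diff z r) * norm X ^ r <= B / real r ^ 2 * 1"
        using B z by (intro mult_mono power_le_one) auto
      then show ?thesis by (simp add: norm_mult norm_power)
    qed
    have sn: "summable (\<lambda>r. norm (reg_diff z r * X ^ r))"
      by (rule summable_comparison_test'[OF sB]) (use le in simp)
    have "norm (1 - X\<^sup>2) * norm (prod_log_reg z X) = norm (\<Sum>r. reg_diff z r * X ^ r)"
      using sums_reg_diff[OF z(1) assms z(2)] by (simp add: sums_iff norm_mult norm_minus_commute)
    also have "... <= (\<Sum>r. norm (reg_diff z r * X ^ r))" by (rule summable_norm[OF sn])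
    also have "... <= (\<Sum>r. B * (1 / real r ^ 2))" by (rule suminf_le[OF le sn sB])
    also have "... = B * (pi^2 / 6)"
      using inverse_squares_sums_0 by (subst suminf_mult) (auto simp: sums_iff)
    finally show "norm (1 - X\<^sup>2) * norm (prod_log_reg z X) <= B * (pi^2 / 6)" .
  qed (use B in auto)
qed


lemma reg_coef_tendsto:
  assumes z: "\<And>n. z n \<in> sector M" and M: "1 <= M" and lim: "z \<longlonglongrightarrow> 0"
  shows "(\<lambda>n. reg_coef (z n) r) \<longlonglongrightarrow> (if even r then 0 else 1 / 2)"
proof (cases "even r")
  case True
  have "(\<lambda>n. csch_reg (of_nat r * z n)) \<longlonglongrightarrow> 0"
  proof (cases "r = 0")
    case False
    show ?thesis
    proof (rule Lim_null_comparison)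
      show "\<forall>\<^sub>F n in sequentially. norm (csch_reg (of_nat r * z n)) <= (1 + M) * norm (of_nat r * z n)"
        using csch_reg_bound(1)[OF _ M] sector_scale[OF z, of "real r"] False by simp
      have "(\<lambda>n. (1 + M) * norm (of_nat r * z n)) \<longlonglongrightarrow> (1 + M) * norm (of_nat r * (0::complex))"
        by (intro tendsto_intros lim)
      then show "(\<lambda>n. (1 + M) * norm (of_nat r * z n)) \<longlonglongrightarrow> 0" by simp
    qed
  qed (simp add: csch_reg_def)
  then show ?thesis using True by (simp add: reg_coef_def)
next
  case False
  have "(\<lambda>n. half_sech (of_nat r * z n)) \<longlonglongrightarrow> 1 / (2 * cosh (of_nat r * 0))"
    unfolding half_sech_def by (intro tendsto_intros lim) auto
  then show ?thesis using False by (simp add: reg_coef_def)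
qed

text \<open>As \<open>z\<close> tends to 0 the even coefficients tend to 0 and the odd ones to 1/2,
  so the limit is minus the sum of \<open>X^r / (2 r)\<close> over odd \<open>r\<close>, that is
  \<open>- artanh X / 2\<close>.\<close>

definition reg_limit :: "complex \<Rightarrow> complex" where
  "reg_limit X = - (Ln (1 + X) - Ln (1 - X)) / 4"

text \<open>The limit of \<open>reg_diff z r\<close> as \<open>z\<close> tends to 0. At
  \<open>r = 1\<close> the truncated subtraction gives \<open>1 / 0 = 0\<close>.\<close>

definition lim_diff :: "nat \<Rightarrow> complex" where
  "lim_diff r = (if even r then 0 else 1 / (2 * of_nat r) - 1 / (2 * of_nat (r - 2)))"

lemma norm_lim_diff_le: "norm (lim_diff r) <= 3 / real r ^ 2"
proof -
  consider "even r" | "r = 1" | s where "r = s + 2" "s > 0" "odd s"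
  proof (cases "even r \<or> r = 1")
    case False
    then have "r = (r - 2) + 2" "r - 2 > 0" "odd (r - 2)" by (auto elim!: oddE)
    then show ?thesis using that by blast
  qed (use that in auto)
  then show ?thesis
  proof cases
    case 3
    have "lim_diff r = - (1 / (of_nat r * of_nat s))"
    proof -
      have "1 / (2 * b) - 1 / (2 * a) = - (1 / (b * a))" if "a \<noteq> 0" "b \<noteq> 0" "b = a + 2" for a b :: complex
      proof -
        have "1 / (2 * b) - 1 / (2 * a) = - (1 / a - 1 / b) / 2" by (simp add: diff_divide_distrib mult.commute)
        also have "1 / a - 1 / b = 2 / (b * a)"
          using that(1,2) unfolding that(3) by (simp add: field_simps)
        finally show ?thesis by simp
      qed
      from this[of "of_nat s" "of_nat r"]
      have "1 / (2 * of_nat r) - 1 / (2 * of_nat s) = - (1 / (of_nat r * of_nat s) :: complex)"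
        using 3(1,2) by (metis of_nat_add of_nat_eq_0_iff of_nat_numeral add_is_0 less_irrefl)
      moreover have "odd r" "s = r - 2" using 3 by auto
      ultimately show ?thesis by (simp only: lim_diff_def if_False)
    qed
    then have "norm (lim_diff r) = 1 / (real r * real s)" by (simp only: norm_minus_cancel norm_divide norm_mult norm_of_nat norm_one)
    also have "... <= 1 / (real r * (real r / 3))"
      using 3 by (intro divide_left_mono mult_left_mono) auto
    finally show ?thesis by (simp add: power2_eq_square)
  qed (auto simp: lim_diff_def)
qed

text \<open>Inside the disc this comes from the logarithmic series. After differencing the series
  converges uniformly on the closed disc, so the identity extends along radii to the circle.\<close>

lemma sums_lim_diff:
  assumes "norm X <= 1" "X \<noteq> 1" "X \<noteq> - 1"
  shows "(\<lambda>r. lim_diff r * X ^ r) sums (- (1 - X\<^sup>2) * reg_limit X)"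
proof -
  define F where "F = (\<lambda>X. \<Sum>r. lim_diff r * X ^ r)"
  have M: "norm (lim_diff r * X ^ r) <= 3 * (1 / real r ^ 2)" if "norm X <= 1" for X r
  proof -
    have "norm (lim_diff r) * norm X ^ r <= 3 / real r ^ 2 * 1"
      using norm_lim_diff_le that by (intro mult_mono power_le_one) auto
    then show ?thesis by (simp add: norm_mult norm_power)
  qed
  have sM: "summable (\<lambda>r. 3 * (1 / real r ^ 2))" by (intro summable_mult summable_inverse_square)
  have cont: "continuous_on (cball 0 1) F"
  proof -
    have "uniform_limit (cball 0 1) (\<lambda>N X. \<Sum>r<N. lim_diff r * X ^ r) F sequentially"
      unfolding F_def by (rule Weierstrass_m_test[OF _ sM]) (use M in auto)
    then show ?thesis
    proof (rule uniform_limit_theorem[rotated])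
      show "\<forall>\<^sub>F N in sequentially. continuous_on (cball 0 1) (\<lambda>X. \<Sum>r<N. lim_diff r * X ^ r)"
        by (intro always_eventually allI continuous_intros)
    qed simp
  qed
  have inside: "F X = - (1 - X\<^sup>2) * reg_limit X" if X: "norm X < 1" for X
  proof -
    have "(\<lambda>n. - (X ^ n) / of_nat n) sums Ln (1 - X)"
      using Ln_series'[of "- X"] X by simp
    moreover have "(\<lambda>n. - ((- X) ^ n) / of_nat n) sums Ln (1 + X)"
      using Ln_series'[of X] X by simp
    ultimately have "(\<lambda>n. (- ((- X) ^ n) / of_nat n - - (X ^ n) / of_nat n) / 4) sums ((Ln (1 + X) - Ln (1 - X)) / 4)"
      by (intro sums_divide sums_diff)
    moreover have "(Ln (1 + X) - Ln (1 - X)) / 4 = - reg_limit X" by (simp add: reg_limit_def field_simps)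
    ultimately have "(\<lambda>n. (- ((- X) ^ n) / of_nat n - - (X ^ n) / of_nat n) / 4) sums (- reg_limit X)" by simp
    moreover have "(- ((- X) ^ n) / of_nat n - - (X ^ n) / of_nat n) / 4 = (if even n then 0 else X ^ n / (2 * of_nat n))" for n
      by (simp add: field_simps)
    ultimately have f: "(\<lambda>n. if even n then 0 else X ^ n / (2 * of_nat n)) sums (- reg_limit X)" by simp
    define f where "f = (\<lambda>n. if even n then 0 else X ^ n / (2 * of_nat n))"
    have "(\<lambda>r. f r - X\<^sup>2 * f (r - 2)) sums (- reg_limit X - X\<^sup>2 * (- reg_limit X))"
      using f unfolding f_def[symmetric] by (intro sums_diff sums_shift_two) (auto simp: f_def)
    moreover have "f r - X\<^sup>2 * f (r - 2) = lim_diff r * X ^ r" for r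
    proof (cases "r < 2")
      case True
      then show ?thesis by (cases r) (auto simp: f_def lim_diff_def)
    next
      case False
      then have "X ^ r = X^2 * X ^ (r - 2)" by (metis linorder_not_less le_add_diff_inverse power_add)
      then show ?thesis using False by (simp add: f_def lim_diff_def algebra_simps)
    qed
    ultimately show ?thesis by (simp add: F_def sums_iff algebra_simps)
  qed
  have F: "F X = - (1 - X\<^sup>2) * reg_limit X"
  proof -
    have r: "(\<lambda>n. 1 - 1 / real (Suc n)) \<longlonglongrightarrow> 1"
      using tendsto_diff[OF tendsto_const LIMSEQ_inverse_real_of_nat, of 1] by (simp add: field_simps)
    define Y where "Y = (\<lambda>n. of_real (1 - 1 / real (Suc n)) * X)"
    have yn: "Y \<longlonglongrightarrow> X"
      unfolding Y_def using tendsto_mult[OF tendsto_of_real[OF r] tendsto_const, of X] by simp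
    have nn: "norm (Y n) < 1" for n
    proof -
      have "norm (Y n) <= (1 - 1 / real (Suc n)) * 1"
        unfolding Y_def norm_mult norm_of_real using assms(1) by (intro mult_mono) auto
      then show ?thesis by (auto intro: le_less_trans)
    qed
    have 1: "(\<lambda>n. F (Y n)) \<longlonglongrightarrow> F X"
      by (rule continuous_on_tendsto_compose[OF cont yn])
         (use assms nn in \<open>auto intro!: always_eventually less_imp_le\<close>)
    have nr: "1 + X \<notin> \<real>\<^sub>\<le>\<^sub>0" "1 - X \<notin> \<real>\<^sub>\<le>\<^sub>0"
    proof -
      have *: "\<not> (Im X = 0 \<and> \<bar>Re X\<bar> \<ge> 1)"
      proof
        assume a: "Im X = 0 \<and> \<bar>Re X\<bar> \<ge> 1"
        then have "\<bar>Re X\<bar> = 1" using abs_Re_le_cmod[of X] assms(1) by linarith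
        then show False using a assms(2,3) by (auto simp: complex_eq_iff abs_if split: if_splits)
      qed
      show "1 + X \<notin> \<real>\<^sub>\<le>\<^sub>0" "1 - X \<notin> \<real>\<^sub>\<le>\<^sub>0" using * by (auto simp: complex_nonpos_Reals_iff)
    qed
    have "(\<lambda>n. - (1 - (Y n)\<^sup>2) * reg_limit (Y n)) \<longlonglongrightarrow> - (1 - X\<^sup>2) * reg_limit X"
      unfolding reg_limit_def using nr by (intro tendsto_intros yn) auto
    then have "(\<lambda>n. F (Y n)) \<longlonglongrightarrow> - (1 - X\<^sup>2) * reg_limit X" using inside[OF nn] by simp
    with 1 show ?thesis by (rule LIMSEQ_unique)
  qed
  have "summable (\<lambda>r. lim_diff r * X ^ r)"
    by (rule summable_norm_cancel, rule summable_comparison_test'[OF sM]) (use M[OF assms(1)] in simp)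
  then show ?thesis unfolding F[symmetric] F_def by (rule summable_sums)
qed

text \<open>Dominated convergence for series applies only after differencing. The factor
  \<open>1 - X^2\<close> is then divided out, being eventually nonzero.\<close>

lemma prod_log_reg_tendsto:
  assumes z: "\<And>n. z n \<in> sector M" and M: "1 <= M" and lim: "z \<longlonglongrightarrow> 0"
    and X: "\<And>n. norm (X n) <= 1" "X \<longlonglongrightarrow> Y" "Y \<noteq> 1" "Y \<noteq> - 1"
  shows "(\<lambda>n. prod_log_reg (z n) (X n)) \<longlonglongrightarrow> reg_limit Y"
proof -
  obtain B where B: "B > 0" "\<And>z r. z \<in> sector M ==> norm (reg_diff z r) <= B / real r ^ 2"
    using norm_reg_diff_le[OF M] by blast
  have Y: "norm Y <= 1" using Lim_bounded[OF tendsto_norm[OF X(2)], of 0 1] X(1) by simp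
  have ne: "1 - Y\<^sup>2 \<noteq> 0" using X(3,4) by (simp add: power2_eq_1_iff)
  have "(\<lambda>n. \<Sum>r. reg_diff (z n) r * X n ^ r) \<longlonglongrightarrow> (\<Sum>r. lim_diff r * Y ^ r)"
  proof (rule tannerys_theorem[THEN conjunct2, THEN conjunct2])
    show "(\<lambda>n. reg_diff (z n) r * X n ^ r) \<longlonglongrightarrow> lim_diff r * Y ^ r" for r
    proof -
      have "(\<lambda>n. reg_diff (z n) r) \<longlonglongrightarrow>
          (if even r then 0 else 1 / 2) / of_nat r - (if even (r - 2) then 0 else 1 / 2) / of_nat (r - 2)"
        unfolding reg_diff_def divide_inverse[of _ "of_nat _"]
        by (intro tendsto_diff tendsto_mult[OF _ tendsto_const] reg_coef_tendsto[OF z M lim])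
      also have "(if even r then 0 else 1 / 2) / of_nat r - (if even (r - 2) then 0 else 1 / 2) / of_nat (r - 2) = lim_diff r"
        by (cases "r < 2") (auto simp: lim_diff_def less_2_cases_iff)
      finally show ?thesis by (intro tendsto_mult tendsto_power X)
    qed
    show "\<forall>\<^sub>F (r, n) in sequentially \<times>\<^sub>F sequentially. norm (reg_diff (z n) r * X n ^ r) <= B * (1 / real r ^ 2)"
    proof (rule always_eventually, clarify)
      fix r n
      have "norm (reg_diff (z n) r) * norm (X n) ^ r <= B / real r ^ 2 * 1"
        using B z X by (intro mult_mono power_le_one) auto
      then show "norm (reg_diff (z n) r * X n ^ r) <= B * (1 / real r ^ 2)" by (simp add: norm_mult norm_power)
    qed
    show "summable (\<lambda>r. B * (1 / real r ^ 2))" by (intro summable_mult summable_inverse_square)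
  qed simp
  then have "(\<lambda>n. - (1 - (X n)\<^sup>2) * prod_log_reg (z n) (X n)) \<longlonglongrightarrow> - (1 - Y\<^sup>2) * reg_limit Y"
    using sums_unique[OF sums_reg_diff[OF z M X(1)]] sums_unique[OF sums_lim_diff[OF Y X(3,4)]] by simp
  then have 1: "(\<lambda>n. (- (1 - (X n)\<^sup>2) * prod_log_reg (z n) (X n)) / (- (1 - (X n)\<^sup>2))) \<longlonglongrightarrow>
      (- (1 - Y\<^sup>2) * reg_limit Y) / (- (1 - Y\<^sup>2))"
  proof (rule tendsto_divide)
    show "(\<lambda>n. - (1 - (X n)\<^sup>2)) \<longlonglongrightarrow> - (1 - Y\<^sup>2)" by (intro tendsto_intros X)
  qed (use ne in simp)
  have "(\<lambda>n. 1 - (X n)\<^sup>2) \<longlonglongrightarrow> 1 - Y\<^sup>2" by (intro tendsto_intros X)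
  then have "\<forall>\<^sub>F n in sequentially. 1 - (X n)\<^sup>2 \<noteq> 0" by (rule tendsto_imp_eventually_ne[OF _ ne])
  then have 2: "\<forall>\<^sub>F n in sequentially. (- (1 - (X n)\<^sup>2) * prod_log_reg (z n) (X n)) / (- (1 - (X n)\<^sup>2)) = prod_log_reg (z n) (X n)"
    by (rule eventually_mono) simp
  have 3: "(- (1 - Y\<^sup>2) * reg_limit Y) / (- (1 - Y\<^sup>2)) = reg_limit Y" using ne by simp
  show ?thesis
    using Lim_transform_eventually[OF 1 2] unfolding 3 .
qed

subsection \<open>The summands near \<open>q = \<i>\<close>\<close>

lemma sums_even_indices:
  fixes f :: "nat \<Rightarrow> complex"
  assumes "(\<lambda>k. f (2 * k)) sums T"
  shows "(\<lambda>k. if even k then f k else 0) sums T"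
proof -
  have "(\<lambda>n. (\<lambda>k. if even k then f k else 0) (2 * n)) sums T \<longleftrightarrow> (\<lambda>k. if even k then f k else 0) sums T"
    by (rule sums_mono_reindex) (auto simp: strict_mono_def image_iff dvd_def)
  then show ?thesis using assms by simp
qed

text \<open>In terms of products this is Euler's identity
  \<open>(w; w\<^sup>2)\<^sub>\<infinity> (- w; w)\<^sub>\<infinity> = 1\<close>; it turns the normalising factor of the
  summands into values of \<open>prod_log\<close> at points where it has a simple limit.\<close>

lemma prod_log_normalization:
  assumes "Re z > 0"
  shows "- prod_log z (exp (- z)) = prod_log z \<i> + prod_log z (- \<i>)"
proof -
  \<comment> \<open>With \<open>w = exp (- 2 z)\<close> the sums \<open>F\<close>,
    \<open>2 T\<close> and \<open>4 Q\<close> below are the negated logarithms of the products of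
    \<open>1 - w^r\<close>, \<open>1 - w^(2 r)\<close> and \<open>1 - w^(4 r)\<close>. Both sides of
    the identity are \<open>F - 4 T + 4 Q\<close>.\<close>
  define f where "f = (\<lambda>r. 1 / (exp (2 * (of_nat r * z)) - 1) / of_nat r)"
  define E where "E = (\<lambda>r. exp (of_nat r * z))"
  have nE: "norm (E r) > 1" if "r > 0" for r using that assms by (simp add: E_def)
  have E2: "exp (2 * (of_nat r * z)) = E r ^ 2" "exp (2 * (of_nat (2 * r) * z)) = E r ^ 4" for r
    by (simp_all add: E_def mult_ac flip: exp_of_nat_mult)
  have E0: "E r \<noteq> 0" for r by (simp add: E_def)
  have E3: "E (2 * r) = E r ^ 2" for r by (simp add: E_def mult_ac flip: exp_of_nat_mult)
  have f2: "f r = 1 / (E r ^ 2 - 1) / of_nat r" "f (2 * r) = 1 / (E r ^ 4 - 1) / of_nat r / 2" for r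
    using E2[of r] by (simp_all add: f_def)
  have E24: "E r ^ 2 \<noteq> 1" "E r ^ 2 \<noteq> - 1" "E r ^ 4 \<noteq> 1" if "r > 0" for r
  proof -
    have "norm (E r ^ 2) > 1" "norm (E r ^ 4) > 1" using nE[OF that] by (simp_all add: norm_power one_less_power)
    then show "E r ^ 2 \<noteq> 1" "E r ^ 2 \<noteq> - 1" "E r ^ 4 \<noteq> 1" by auto
  qed
  have sinh_E: "2 * sinh (of_nat r * z) = E r - 1 / E r" "2 * cosh (of_nat r * z) = E r + 1 / E r" for r
    by (simp_all add: sinh_def cosh_def E_def exp_minus scaleR_conv_of_real field_simps)
  have sf: "summable (\<lambda>r. norm (f r))"
  proof (rule summable_comparison_test')
    show "summable (\<lambda>r. exp (- (2 * Re z)) ^ r * (1 / (1 - exp (- (2 * Re z)))))"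
      using assms by (intro summable_mult2 summable_geometric) auto
    fix r :: nat
    show "norm (norm (f r)) <= exp (- (2 * Re z)) ^ r * (1 / (1 - exp (- (2 * Re z))))"
    proof (cases "r = 0")
      case False
      define x where "x = exp (2 * (real r * Re z))"
      have x: "exp (2 * Re z) <= x" "1 < exp (2 * Re z)" using False assms by (auto simp: x_def)
      have x1: "1 < x" using x by linarith
      have "x - 1 <= norm (exp (2 * (of_nat r * z)) - 1)"
        using norm_triangle_ineq2[of "exp (2 * (of_nat r * z))" 1] by (simp add: x_def)
      then have "norm (f r) <= 1 / (x - 1) / real r"
        using x1 False unfolding f_def norm_divide norm_of_nat norm_one
        by (intro divide_right_mono frac_le) auto
      also have "... <= 1 / (x - 1) / 1" using x1 False by (intro divide_left_mono) auto
      also have "... = 1 / x * (1 / (1 - 1 / x))" using x1 by (simp add: field_simps)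
      also have "... <= 1 / x * (1 / (1 - exp (- (2 * Re z))))"
        using x x1 by (intro mult_left_mono frac_le) (auto simp: exp_minus field_simps)
      also have "1 / x = exp (- (2 * Re z)) ^ r"
        by (simp add: x_def exp_minus field_simps flip: exp_of_nat_mult)
      finally show ?thesis by simp
    qed (use assms in \<open>simp add: f_def\<close>)
  qed
  then have sf': "summable f" by (rule summable_norm_cancel)
  have sf2: "summable (\<lambda>k. norm (f (2 * k)))"
    using summable_reindex[OF sf, of "\<lambda>k. 2 * k"] by (simp add: inj_on_def o_def)
  have sf4: "summable (\<lambda>k. norm (f (2 * (2 * k))))"
    using summable_reindex[OF sf2, of "\<lambda>k. 2 * k"] by (simp add: inj_on_def o_def)
  define F T Q where "F = suminf f" and "T = (\<Sum>k. f (2 * k))" and "Q = (\<Sum>k. f (2 * (2 * k)))"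
  have F: "f sums F" using sf' by (simp add: F_def summable_sums)
  have T: "(\<lambda>k. f (2 * k)) sums T" using summable_norm_cancel[OF sf2] by (simp add: T_def summable_sums)
  have Q: "(\<lambda>k. f (2 * (2 * k))) sums Q" using summable_norm_cancel[OF sf4] by (simp add: Q_def summable_sums)
  note Te = sums_even_indices[OF T] and Qe = sums_even_indices[of "\<lambda>k. f (2 * k)", OF Q]
  have L: "(\<lambda>r. f r - 4 * (f (2 * r) - (if even r then f (2 * r) else 0))) sums (F - 4 * (T - Q))"
    by (intro sums_diff sums_mult F T Qe)
  have R: "(\<lambda>k. ((f k - 2 * f (2 * k)) - 2 * (if even k then f k else 0)) + 4 * (if even k then f (2 * k) else 0))
      sums (((F - 2 * T) - 2 * T) + 4 * Q)"
    by (intro sums_diff sums_add sums_mult F T Te Qe)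
  have "(\<lambda>r. prod_coef z r / of_nat r * exp (- z) ^ r) sums (- prod_log z (exp (- z)))"
    using assms by (intro sums_prod_log) auto
  moreover have "prod_coef z r / of_nat r * exp (- z) ^ r = f r - 4 * (f (2 * r) - (if even r then f (2 * r) else 0))" for r
  proof (cases "r = 0")
    case False
    then have ne: "E r ^ 2 \<noteq> 1" "E r ^ 2 \<noteq> - 1" "E r ^ 4 \<noteq> 1" using E24[of r] by auto
    have e1: "exp (- z) ^ r = 1 / E r"
      by (simp add: E_def exp_minus field_simps flip: exp_of_nat_mult)
    have 1: "prod_coef z r * (1 / E r) = 1 / (E r ^ 2 - 1) - (if even r then 0 else 2 / (E r ^ 4 - 1))"
    proof (cases "even r")
      case True
      then have "prod_coef z r * (1 / E r) = 1 / ((E r - 1 / E r) * E r)" by (simp add: prod_coef_def sinh_E)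
      also have "(E r - 1 / E r) * E r = E r ^ 2 - 1" using E0[of r] by (simp add: field_simps power2_eq_square)
      finally show ?thesis using True by simp
    next
      case False
      then have "prod_coef z r * (1 / E r) = 1 / ((E r + 1 / E r) * E r)" by (simp add: prod_coef_def sinh_E)
      also have "(E r + 1 / E r) * E r = E r ^ 2 + 1" using E0[of r] by (simp add: field_simps power2_eq_square)
      also have "1 / (E r ^ 2 + 1) = 1 / (E r ^ 2 - 1) - 2 / (E r ^ 4 - 1)"
      proof -
        have "1 / (y + 1) = 1 / (y - 1) - 2 / (y ^ 2 - 1)" if "y \<noteq> 1" "y \<noteq> - 1" for y :: complex
        proof -
          have "y - 1 \<noteq> 0" "y + 1 \<noteq> 0" using that by (auto simp: eq_neg_iff_add_eq_0)
          moreover have "y ^ 2 - 1 = (y - 1) * (y + 1)" by (simp add: algebra_simps power2_eq_square)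
          moreover have "1 / b = 1 / a - 2 / (a * b)" if "a \<noteq> 0" "b \<noteq> 0" "b = a + 2" for a b :: complex
          proof -
            have "1 / a - 2 / (a * b) = (b - 2) / (a * b)" using that(1,2) by (simp add: diff_divide_distrib)
            then show ?thesis using that(1) by (simp add: that(3))
          qed
          note * = this[of "y - 1" "y + 1"]
          have "y + 1 = y - 1 + 2" by simp
          ultimately show ?thesis using * by metis
        qed
        from this[OF ne(1,2)] show ?thesis by (simp flip: power_mult)
      qed
      finally show ?thesis using False by simp
    qed
    have "prod_coef z r / of_nat r * exp (- z) ^ r = (prod_coef z r * (1 / E r)) / of_nat r" by (simp add: e1)
    also have "... = f r - 4 * (f (2 * r) - (if even r then f (2 * r) else 0))"
      unfolding 1 f2 by (simp add: diff_divide_distrib E3 flip: power_mult)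
    finally show ?thesis .
  qed (simp add: f_def)
  ultimately have 1: "- prod_log z (exp (- z)) = F - 4 * (T - Q)" using L sums_unique2 by fastforce
  \<comment> \<open>Odd powers of \<open>\<i>\<close> and \<open>- \<i>\<close> cancel and the even
    ones add up to \<open>2 (- 1)^k\<close>, so only the hyperbolic sines survive.\<close>
  define g where "g = (\<lambda>r. prod_coef z r / of_nat r * \<i> ^ r + prod_coef z r / of_nat r * (- \<i>) ^ r)"
  have "g sums (- prod_log z \<i> + - prod_log z (- \<i>))"
    unfolding g_def using assms by (intro sums_add sums_prod_log) auto
  then have "(\<lambda>n. g (2 * n)) sums (- prod_log z \<i> + - prod_log z (- \<i>))"
    by (subst sums_mono_reindex[of "\<lambda>n. 2 * n"])
       (auto simp: strict_mono_def g_def image_iff dvd_def power_minus_odd)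
  then have "(\<lambda>n. - g (2 * n)) sums (- (- prod_log z \<i> + - prod_log z (- \<i>)))"
    by (rule sums_minus)
  moreover have "- g (2 * k) = ((f k - 2 * f (2 * k)) - 2 * (if even k then f k else 0)) + 4 * (if even k then f (2 * k) else 0)" for k
  proof (cases "k = 0")
    case False
    then have ne: "E k ^ 2 \<noteq> 1" "E k ^ 4 \<noteq> 1" using E24[of k] by auto
    have e: "E (2 * k) = E k ^ 2" by (simp add: E_def mult_ac flip: exp_of_nat_mult)
    have "prod_coef z (2 * k) = 1 / (E k ^ 2 - 1 / E k ^ 2)"
      unfolding prod_coef_def using sinh_E[of "2 * k"] by (simp add: e)
    also have "... = 1 / (E k ^ 2 - 1) - 1 / (E k ^ 4 - 1)"
    proof -
      have "1 / (y - 1 / y) = 1 / (y - 1) - 1 / (y ^ 2 - 1)" if "y \<noteq> 1" "y ^ 2 \<noteq> 1" "y \<noteq> 0" for y :: complex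
      proof -
        have "y - 1 \<noteq> 0" "y + 1 \<noteq> 0" "y \<noteq> 0" using that by (auto simp: power2_eq_1_iff eq_neg_iff_add_eq_0)
        moreover have y: "y ^ 2 - 1 = (y - 1) * (y + 1)" by (simp add: algebra_simps power2_eq_square)
        moreover have "y - 1 / y = (y - 1) * (y + 1) / y" using \<open>y \<noteq> 0\<close> by (simp add: field_simps)
        moreover have "1 / a - 1 / (a * b) = (b - 1) / (a * b)" if "a \<noteq> 0" "b \<noteq> 0" for a b :: complex
          using that by (simp add: diff_divide_distrib)
        ultimately show ?thesis by (simp only: divide_divide_eq_right mult_1_left) simp
      qed
      from this[of "E k ^ 2"] ne E0[of k] show ?thesis by (simp flip: power_mult)
    qed
    finally have pc0: "prod_coef z (2 * k) = 1 / (E k ^ 2 - 1) - 1 / (E k ^ 4 - 1)" .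
    have dist: "(a - b) / of_nat (2 * k) = (a / of_nat k - 2 * (b / of_nat k / 2)) / 2" for a b :: complex
      by (simp add: diff_divide_distrib mult.commute)
    have pc: "prod_coef z (2 * k) / of_nat (2 * k) = (f k - 2 * f (2 * k)) / 2"
      unfolding pc0 f2(2)[of k] f2(1)[of k] by (rule dist)
    have "g (2 * k) = prod_coef z (2 * k) / of_nat (2 * k) * (2 * (- 1) ^ k)"
    proof -
      have "\<i> ^ (2 * k) = (- 1) ^ k" "(- \<i>) ^ (2 * k) = (- 1) ^ k"
        unfolding power_mult by simp_all
      then show ?thesis unfolding g_def by (simp only: mult_2 distrib_left)
    qed
    then have "g (2 * k) = (f k - 2 * f (2 * k)) * (- 1) ^ k" unfolding pc by simp
    then show ?thesis by (cases "even k") simp_all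
  qed (simp add: f_def g_def)
  ultimately have "- (- prod_log z \<i> + - prod_log z (- \<i>)) = (((F - 2 * T) - 2 * T) + 4 * Q)"
    using R sums_unique2 by fastforce
  then show ?thesis unfolding 1 by (simp add: algebra_simps)
qed

text \<open>What does not depend on \<open>n\<close> when \<open>q = \<i> exp (- z)\<close>: the
  inverse of the product of all \<open>1 + q^(2 j)\<close>, and \<open>exp (z / 8)\<close> from
  completing the square in \<open>n (n + 1) / 2 = (n + 1/2)^2 / 2 - 1/8\<close>.\<close>

definition norm_factor :: "complex \<Rightarrow> complex" where
  "norm_factor z = exp (z / 8 - prod_log z (exp (- z)))"

lemma norm_factor_eq:
  assumes "z \<in> sector M" "1 <= M"
  shows "norm_factor z = exp (of_real (pi^2 / 48) / z) * exp (z / 8 + prod_log_reg z \<i> + prod_log_reg z (- \<i>))"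
proof -
  have z: "Re z > 0" "z \<noteq> 0" using assms by (auto simp: sector_def)
  have "norm_factor z = exp (z / 8 + (prod_log z \<i> + prod_log z (- \<i>)))"
    unfolding norm_factor_def prod_log_normalization[OF z(1), symmetric] by simp
  also have "prod_log z \<i> + prod_log z (- \<i>) = of_real (pi^2 / 48) / z + (prod_log_reg z \<i> + prod_log_reg z (- \<i>))"
  proof -
    have "prod_log z \<i> = prod_log_reg z \<i> + of_real (pi^2 / 96) / z"
      "prod_log z (- \<i>) = prod_log_reg z (- \<i>) + of_real (pi^2 / 96) / z"
      using prod_log_eq[OF assms, of \<i>] prod_log_eq[OF assms, of "- \<i>"] by (simp_all add: dilog_minus_1)
    moreover have "of_real (pi^2 / 48) / z = of_real (pi^2 / 96) / z + of_real (pi^2 / 96) / z"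
      by (simp flip: add_divide_distrib)
    ultimately show ?thesis by (simp add: algebra_simps)
  qed
  finally show ?thesis by (simp add: exp_add mult_ac)
qed

text \<open>\<open>reg_limit\<close> is odd, so its values at \<open>\<i>\<close> and
  \<open>- \<i>\<close> cancel.\<close>

lemma norm_factor_tendsto:
  assumes "\<And>n. z n \<in> sector M" "1 <= M" "z \<longlonglongrightarrow> 0"
  shows "(\<lambda>n. norm_factor (z n) * exp (- (of_real (pi^2 / 48) / z n))) \<longlonglongrightarrow> 1"
proof -
  have "(\<lambda>n. exp (z n / 8 + prod_log_reg (z n) \<i> + prod_log_reg (z n) (- \<i>))) \<longlonglongrightarrow>
      exp (0 / 8 + reg_limit \<i> + reg_limit (- \<i>))"
    by (intro tendsto_intros assms prod_log_reg_tendsto[OF assms]) (auto simp: complex_eq_iff)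
  also have "exp (0 / 8 + reg_limit \<i> + reg_limit (- \<i>)) = 1"
    by (simp add: reg_limit_def field_simps)
  finally show ?thesis
    unfolding norm_factor_eq[OF assms(1,2)] by (simp add: mult_ac exp_minus_inverse flip: exp_add)
qed

lemma norm_norm_factor_le:
  assumes "1 <= M"
  obtains C where "0 < C" "\<And>z. z \<in> sector M ==> Re z <= 1 ==>
    norm (norm_factor z) <= C * exp (Re (of_real (pi^2 / 48) / z))"
proof -
  obtain C where C: "0 < C" "\<And>z X :: complex. z \<in> sector M ==> norm X <= 1 ==> norm (1 - X\<^sup>2) * norm (prod_log_reg z X) <= C"
    using norm_one_minus_sq_prod_log_reg_le[OF assms] by blast
  show ?thesis
  proof (rule that[of "exp (1 + C)"])
    fix z assume z: "z \<in> sector M" "Re z <= 1"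
    have "norm (prod_log_reg z \<i>) <= C / 2" "norm (prod_log_reg z (- \<i>)) <= C / 2"
      using C(2)[OF z(1), of \<i>] C(2)[OF z(1), of "- \<i>"] by auto
    then have "Re (z / 8 + prod_log_reg z \<i> + prod_log_reg z (- \<i>)) <= 1 + C"
      using z complex_Re_le_cmod[of "prod_log_reg z \<i>"] complex_Re_le_cmod[of "prod_log_reg z (-\<i>)"] by simp
    then show "norm (norm_factor z) <= exp (1 + C) * exp (Re (of_real (pi^2 / 48) / z))"
      unfolding norm_factor_eq[OF z(1) assms] norm_mult norm_exp_eq_Re by (simp add: mult.commute)
  qed simp
qed

definition qterm :: "complex \<Rightarrow> nat \<Rightarrow> complex" where
  "qterm q n = q ^ (n * (n + 1) div 2) / (\<Prod>j=1..n. 1 + q ^ (2 * j))"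

lemma qterm_0 [simp]: "qterm q 0 = 1" by (simp add: qterm_def)

lemma triangle_Suc: "Suc n * (Suc n + 1) div 2 = n * (n + 1) div 2 + Suc n"
proof -
  have "Suc n * (Suc n + 1) = n * (n + 1) + Suc n * 2" by (simp add: algebra_simps)
  then show ?thesis by simp
qed

lemma qterm_Suc: "qterm q (Suc n) = qterm q n * (q ^ Suc n / (1 + q ^ (2 * Suc n)))"
  unfolding qterm_def triangle_Suc power_add by simp

lemma norm_sign_exp_le: "Re z > 0 ==> norm ((- 1) ^ n * exp (- (of_nat (2 * n + 1) * z))) <= 1"
  by (simp add: norm_mult norm_power)

text \<open>The inverse of the finite denominator is the tail of the infinite product over the whole
  product. Apart from \<open>(- 1)^n\<close> and the power of \<open>\<i>\<close> the result is
  analytic in \<open>n\<close>, as the contour integral demands.\<close>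

lemma qterm_eq_prod_log:
  assumes "Re z > 0"
  shows "qterm (\<i> * exp (- z)) n = norm_factor z * \<i> ^ (n * (n + 1) div 2) *
     exp (- z * (of_nat n + 1 / 2)^2 / 2 + prod_log z ((- 1) ^ n * exp (- (of_nat (2 * n + 1) * z))))"
proof (induction n)
  case 0
  show ?case by (simp add: norm_factor_def power2_eq_square flip: exp_add)
next
  case (Suc n)
  define X where "X = (\<lambda>n. (- 1) ^ n * exp (- (of_nat (2 * n + 1) * z)))"
  define q where "q = \<i> * exp (- z)"
  have X: "norm (X n) <= 1" unfolding X_def by (rule norm_sign_exp_le[OF assms])
  have XS: "- (exp (- 2 * z) * X n) = X (Suc n)"
    by (simp add: X_def exp_add[symmetric] algebra_simps flip: exp_add)
  have q2: "1 - X n * exp (- z) = 1 + q ^ (2 * Suc n)"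
  proof -
    have "q ^ (2 * Suc n) = (q^2) ^ Suc n" by (rule power_mult)
    also have "q^2 = - exp (- 2 * z)" by (simp add: q_def power_mult_distrib flip: exp_of_nat_mult)
    also have "(- exp (- 2 * z)) ^ Suc n = (- 1) ^ Suc n * exp (- 2 * z) ^ Suc n" by (rule power_minus)
    also have "exp (- 2 * z) ^ Suc n = exp (- (of_nat (2 * n + 1) * z)) * exp (- z)"
      by (simp add: algebra_simps flip: exp_of_nat_mult exp_add)
    finally show ?thesis by (simp add: X_def)
  qed
  have ne: "1 - X n * exp (- z) \<noteq> 0"
  proof
    assume "1 - X n * exp (- z) = 0"
    then have "norm (X n) * norm (exp (- z)) = 1" by (metis eq_iff_diff_eq_0 norm_mult norm_one)
    moreover have "norm (X n) * norm (exp (- z)) < 1"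
    proof -
      have "norm (X n) * norm (exp (- z)) <= norm (exp (- z))"
        using X by (intro mult_left_le_one_le) auto
      also have "... < 1" using assms by simp
      finally show ?thesis .
    qed
    ultimately show False by simp
  qed
  have st: "exp (prod_log z (X n)) = exp (prod_log z (X (Suc n))) * (1 + q ^ (2 * Suc n))"
    unfolding prod_log_step[OF assms X] XS exp_add q2 exp_Ln[OF ne[unfolded q2]] ..
  have "qterm q (Suc n) = qterm q n * (q ^ Suc n / (1 + q ^ (2 * Suc n)))" by (rule qterm_Suc)
  also have "qterm q n = norm_factor z * \<i> ^ (n * (n + 1) div 2) * (exp (- z * (of_nat n + 1 / 2)^2 / 2) * exp (prod_log z (X n)))"
    using Suc unfolding q_def X_def exp_add by simp
  also have "... * (q ^ Suc n / (1 + q ^ (2 * Suc n))) =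
     norm_factor z * (\<i> ^ (n * (n + 1) div 2) * \<i> ^ Suc n) * (exp (- z * (of_nat n + 1 / 2)^2 / 2) * exp (- z) ^ Suc n * exp (prod_log z (X (Suc n))))"
    unfolding st using ne unfolding q2 by (simp add: q_def power_mult_distrib)
  also have "\<i> ^ (n * (n + 1) div 2) * \<i> ^ Suc n = \<i> ^ (Suc n * (Suc n + 1) div 2)"
    unfolding triangle_Suc power_add ..
  also have "exp (- z * (of_nat n + 1 / 2)^2 / 2) * exp (- z) ^ Suc n = exp (- z * (of_nat (Suc n) + 1 / 2)^2 / 2)"
    by (simp add: power2_eq_square field_simps flip: exp_of_nat_mult exp_add)
  finally show ?case unfolding q_def X_def exp_add by simp
qed

text \<open>Here \<open>e\<close> is the sign \<open>(- 1)^n\<close> and \<open>s\<close> is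
  \<open>(n + 1/2) / 2\<close>: for \<open>n = 2 m\<close> this is \<open>m + 1/4\<close>, for
  \<open>n = 2 m + 1\<close> it is \<open>m + 3/4\<close>.\<close>

definition saddle_fun :: "complex \<Rightarrow> complex \<Rightarrow> complex \<Rightarrow> complex" where
  "saddle_fun e z s = exp (- 2 * z * s^2 + prod_log z (e * exp (- 4 * z * s)))"

definition half_sum :: "complex \<Rightarrow> real \<Rightarrow> nat \<Rightarrow> complex \<Rightarrow> complex" where
  "half_sum e a N z = norm_factor z * (\<Sum>m<N. (- \<i>) ^ m * saddle_fun e z (of_nat m + of_real a))"

lemma prod_log_cnj:
  assumes "Re z > 0" "norm X <= 1"
  shows "prod_log (cnj z) (cnj X) = cnj (prod_log z X)"
proof -
  have "cnj (prod_coef z r) = prod_coef (cnj z) r" for r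
    by (simp add: prod_coef_def sinh_def cosh_def scaleR_conv_of_real exp_cnj)
  then have "(\<lambda>r. prod_coef (cnj z) r / of_nat r * cnj X ^ r) sums cnj (- prod_log z X)"
    using sums_cnj[THEN iffD2, OF sums_prod_log[OF assms]] by simp
  moreover have "(\<lambda>r. prod_coef (cnj z) r / of_nat r * cnj X ^ r) sums (- prod_log (cnj z) (cnj X))"
    using assms by (intro sums_prod_log) auto
  ultimately show ?thesis using sums_unique2 by fastforce
qed

lemma norm_factor_cnj: "Re z > 0 ==> norm_factor (cnj z) = cnj (norm_factor z)"
  using prod_log_cnj[of z "exp (- z)"] by (simp add: norm_factor_def exp_cnj)

text \<open>Even indices carry \<open>(- \<i>)^m\<close>, odd ones \<open>\<i> * \<i>^m\<close>.
  Conjugating the odd half restores \<open>(- \<i>)^m\<close>, so that one kernel and one contour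
  serve both halves, at \<open>z\<close> and at \<open>cnj z\<close>.\<close>

lemma sum_qterm_split:
  assumes "Re z > 0"
  shows "(\<Sum>n<2*N. qterm (\<i> * exp (- z)) n) =
    half_sum 1 (1/4) N z + cnj (- \<i> * half_sum (- 1) (3/4) N (cnj z))"
proof -
  have ev: "qterm (\<i> * exp (- z)) (2 * m) = norm_factor z * ((- \<i>) ^ m * saddle_fun 1 z (of_nat m + of_real (1/4)))" for m
  proof -
    have "\<i> ^ (2 * m * (2 * m + 1) div 2) = (- \<i>) ^ m"
    proof -
      have "2 * m * (2 * m + 1) div 2 = 2 * (m * m) + m" by (simp add: algebra_simps)
      then have "\<i> ^ (2 * m * (2 * m + 1) div 2) = (\<i>\<^sup>2) ^ (m * m) * \<i> ^ m" by (simp add: power_add power_mult)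
      also have "(\<i>\<^sup>2) ^ (m * m) = (- 1) ^ m" by (cases "even m") auto
      finally show ?thesis by (simp add: power_minus[of \<i>])
    qed
    moreover have "- z * (of_nat (2 * m) + 1 / 2)^2 / 2 = - 2 * z * (of_nat m + of_real (1/4))^2"
      by (simp add: power2_eq_square field_simps)
    moreover have "(- 1) ^ (2 * m) * exp (- (of_nat (2 * (2 * m) + 1) * z)) = 1 * exp (- 4 * z * (of_nat m + of_real (1/4)))"
      by (simp add: algebra_simps)
    ultimately show ?thesis
      unfolding qterm_eq_prod_log[OF assms] saddle_fun_def by (simp only: mult.assoc)
  qed
  have od: "qterm (\<i> * exp (- z)) (2 * m + 1) =
    cnj (- \<i> * (norm_factor (cnj z) * ((- \<i>) ^ m * saddle_fun (- 1) (cnj z) (of_nat m + of_real (3/4)))))" for m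
  proof -
    have "\<i> ^ ((2 * m + 1) * (2 * m + 1 + 1) div 2) = \<i> * \<i> ^ m"
    proof -
      have "(2 * m + 1) * (2 * m + 1 + 1) div 2 = 2 * (m * m + m) + (m + 1)" by (simp add: algebra_simps)
      then have "\<i> ^ ((2 * m + 1) * (2 * m + 1 + 1) div 2) = (\<i>\<^sup>2) ^ (m * m + m) * \<i> ^ (m + 1)"
        by (simp only: power_add power_mult)
      also have "(\<i>\<^sup>2) ^ (m * m + m) = 1" by simp
      finally show ?thesis by simp
    qed
    moreover have "cnj (saddle_fun (- 1) (cnj z) (of_nat m + of_real (3/4))) = saddle_fun (- 1) z (of_nat m + of_real (3/4))"
      using prod_log_cnj[of "cnj z" "- exp (- 4 * cnj z * (of_nat m + of_real (3/4)))"] assms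
      by (simp add: saddle_fun_def exp_cnj)
    moreover have "- z * (of_nat (2 * m + 1) + 1 / 2)^2 / 2 = - 2 * z * (of_nat m + of_real (3/4))^2"
      by (simp add: power2_eq_square field_simps)
    moreover have "(- 1) ^ (2 * m + 1) * exp (- (of_nat (2 * (2 * m + 1) + 1) * z)) = - 1 * exp (- 4 * z * (of_nat m + of_real (3/4)))"
      by (simp add: algebra_simps)
    ultimately have "qterm (\<i> * exp (- z)) (2 * m + 1) = norm_factor z * (\<i> * \<i> ^ m) * cnj (saddle_fun (- 1) (cnj z) (of_nat m + of_real (3/4)))"
      unfolding qterm_eq_prod_log[OF assms] by (simp only: saddle_fun_def)
    then show ?thesis unfolding norm_factor_cnj[OF assms] by simp
  qed
  have split: "(\<Sum>n<2*N. f n) = (\<Sum>m<N. f (2 * m)) + (\<Sum>m<N. f (2 * m + 1))" for f :: "nat \<Rightarrow> complex"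
    by (induction N) (auto simp: algebra_simps)
  show ?thesis
    unfolding split ev od half_sum_def sum_distrib_left cnj_sum complex_cnj_mult by simp
qed

subsection \<open>Residues of the summation kernel\<close>

text \<open>The kernel has simple poles at \<open>a + m\<close> with residue \<open>(- \<i>)\<^sup>m / (2 \<pi> \<i>)\<close>, and it
  decays in both vertical directions.\<close>

definition kern :: "real \<Rightarrow> complex \<Rightarrow> complex" where
  "kern a s = exp (3 * pi * \<i> / 2 * (s - a)) / (exp (2 * pi * \<i> * (s - a)) - 1)"

lemma kern_zero_iff: "exp (2 * pi * \<i> * (s - of_real a)) = 1 \<longleftrightarrow> (\<exists>m::int. s = of_int m + of_real a)"
proof
  assume "exp (2 * pi * \<i> * (s - a)) = 1"
  then obtain m :: int where m: "Re (2 * pi * \<i> * (s - a)) = 0" "Im (2 * pi * \<i> * (s - a)) = of_int (2 * m) * pi"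
    by (auto simp: exp_eq_1)
  have "2 * pi * (Re s - a - of_int m) = 0" using m(2) by (simp add: algebra_simps)
  then have "Im s = 0" "Re s = of_int m + a" using m(1) by auto
  then show "\<exists>m::int. s = of_int m + of_real a" by (intro exI[of _ m]) (simp add: complex_eq_iff)
next
  assume "\<exists>m::int. s = of_int m + of_real a"
  then show "exp (2 * pi * \<i> * (s - a)) = 1" by (auto simp: exp_eq_1 algebra_simps)
qed

lemma closed_segment_add_real:
  assumes "s \<in> closed_segment a (a + of_nat N)"
  obtains t where "0 <= t" "t <= real N" "s = a + of_real t"
proof -
  obtain u where u: "0 <= u" "u <= 1" "s = (1 - u) *\<^sub>R a + u *\<^sub>R (a + of_nat N)"
    using assms by (auto simp: in_segment)
  show ?thesis
  proof (rule that[of "u * real N"])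
    show "s = a + of_real (u * real N)" using u(3) by (simp add: scaleR_conv_of_real algebra_simps)
  qed (use u in \<open>auto simp: mult_left_le_one_le\<close>)
qed

lemma closed_segment_rotated:
  assumes "s \<in> closed_segment (a - \<i> * of_real Y / z) (a + \<i> * of_real Y / z)" "0 <= Y"
  obtains y where "\<bar>y\<bar> <= Y" "s = a - \<i> * of_real y / z"
proof -
  obtain u where u: "0 <= u" "u <= 1" "s = (1 - u) *\<^sub>R (a - \<i> * of_real Y / z) + u *\<^sub>R (a + \<i> * of_real Y / z)"
    using assms by (auto simp: in_segment)
  show ?thesis
  proof (rule that[of "Y * (1 - 2 * u)"])
    have "\<bar>Y * (1 - 2 * u)\<bar> <= Y * 1" unfolding abs_mult using u assms by (intro mult_mono) auto
    then show "\<bar>Y * (1 - 2 * u)\<bar> <= Y" by simp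
    show "s = a - \<i> * of_real (Y * (1 - 2 * u)) / z"
      using u(3) by (simp add: scaleR_conv_of_real algebra_simps diff_divide_distrib add_divide_distrib)
  qed
qed

text \<open>The residue theorem on a parallelogram with two horizontal sides of length
  \<open>N\<close> and two sides in direction \<open>\<i> / z\<close>. On the left side
  \<open>Re (z * s) = 0\<close>, on the right side it is \<open>N Re z\<close>; the poles
  \<open>u + m\<close> with \<open>m < N\<close> lie between them.\<close>

lemma contour_sum:
  fixes z :: complex and Y d u :: real
  defines "Q \<equiv> \<i> * of_real Y / z" and "P \<equiv> - (\<i> * of_real Y / z)"
  assumes f: "f holomorphic_on {s. Re (z * s) > - d}" and d: "d > 0" and z: "Re z > 0" and Y: "Y > 0"
    and u: "0 < u" "u < 1" and f0: "\<And>s. f s \<noteq> 0"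
  shows "(\<Sum>m<N. (- \<i>) ^ m * f (of_nat m + of_real u)) =
    contour_integral (linepath P (P + of_nat N)) (\<lambda>s. kern u s * f s)
    + (contour_integral (linepath (P + of_nat N) (Q + of_nat N)) (\<lambda>s. kern u s * f s)
    + (contour_integral (linepath (Q + of_nat N) Q) (\<lambda>s. kern u s * f s)
    + contour_integral (linepath Q P) (\<lambda>s. kern u s * f s)))"
proof -
  define x where "x = Re z"
  have x: "x > 0" using z by (simp add: x_def)
  have z0: "z \<noteq> 0" using z by auto
  \<comment> \<open>The margin of the strip \<open>W\<close> beyond the contour is small enough to
    exclude the neighbouring poles \<open>u - 1\<close> and \<open>u + N\<close>.\<close>
  define e where "e = min d (min (x * u) (x * (1 - u)))"
  have e: "e > 0" "e <= d" "e <= x * u" "e <= x * (1 - u)" using d x u by (auto simp: e_def)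
  define W where "W = {s. - e < Re (z * s)} \<inter> {s. Re (z * s) < real N * x + e}"
  have W: "open W" "convex W"
  proof -
    have 1: "Re (z * s) = inner (cnj z) s" for s by (simp add: inner_complex_def)
    have W: "W = {s. inner (cnj z) s > - e} \<inter> {s. inner (cnj z) s < real N * x + e}"
      unfolding W_def 1 ..
    show "open W" unfolding W by (intro open_Int open_halfspace_lt open_halfspace_gt)
    show "convex W" unfolding W by (intro convex_Int convex_halfspace_lt convex_halfspace_gt)
  qed
  have fW: "f holomorphic_on W"
    by (rule holomorphic_on_subset[OF f]) (use e in \<open>auto simp: W_def\<close>)
  define p where "p = (\<lambda>m::nat. of_nat m + complex_of_real u)"
  define h where "h = (\<lambda>s. kern u s * f s)"
  have ImQ: "Im Q > 0" "Im P < 0"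
  proof -
    have "Im Q = Y * x / (norm z)^2"
      by (simp add: Q_def x_def Im_divide cmod_power2)
    also have "... > 0" using Y x z0 by simp
    finally show "Im Q > 0" .
    then show "Im P < 0" by (simp add: Q_def P_def)
  qed
  have zQ: "z * Q = \<i> * of_real Y" "z * P = - (\<i> * of_real Y)" using z0 by (simp_all add: Q_def P_def)
  have corners: "P \<in> W" "Q \<in> W" "P + of_nat N \<in> W" "Q + of_nat N \<in> W"
  proof -
    have "Re (z * P) = 0" "Re (z * Q) = 0" by (simp_all only: zQ) simp_all
    moreover have "Re (z * (P + of_nat N)) = real N * x" "Re (z * (Q + of_nat N)) = real N * x"
      unfolding distrib_left plus_complex.simps using calculation by (simp_all add: x_def)
    moreover have "real N * x + e > 0" "- e < real N * x" using x e by (simp_all add: add_nonneg_pos less_le_trans[of _ 0])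
    ultimately show "P \<in> W" "Q \<in> W" "P + of_nat N \<in> W" "Q + of_nat N \<in> W"
      unfolding W_def using e x by auto
  qed
  define g1 where "g1 = linepath P (P + of_nat N) +++ linepath (P + of_nat N) (Q + of_nat N) +++ linepath (Q + of_nat N) Q"
  define g2 where "g2 = linepath Q P"
  define g where "g = g1 +++ g2"
  have left: "\<exists>y. s = - (\<i> * of_real y / z)" if "s \<in> closed_segment Q P" for s
  proof -
    have "s \<in> closed_segment (0 - \<i> * of_real Y / z) (0 + \<i> * of_real Y / z)"
      using that by (simp add: Q_def P_def closed_segment_commute)
    then obtain y where "s = 0 - \<i> * of_real y / z"
      using closed_segment_rotated[OF _ less_imp_le[OF Y]] by metis
    then show ?thesis by auto
  qed
  have right: "\<exists>y. s = of_nat N - \<i> * of_real y / z" if "s \<in> closed_segment (P + of_nat N) (Q + of_nat N)" for s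
  proof -
    have "s \<in> closed_segment (of_nat N - \<i> * of_real Y / z) (of_nat N + \<i> * of_real Y / z)"
      using that by (simp add: Q_def P_def add.commute)
    then obtain y where "s = of_nat N - \<i> * of_real y / z"
      using closed_segment_rotated[OF _ less_imp_le[OF Y]] by metis
    then show ?thesis by auto
  qed
  have hor: "Im s < 0" if "s \<in> closed_segment P (P + of_nat N)" for s
    using closed_segment_add_real[OF that] ImQ by force
  have hor2: "Im s > 0" if "s \<in> closed_segment (Q + of_nat N) Q" for s
    using closed_segment_add_real[of s Q N] that ImQ closed_segment_commute[of Q] by force
  have ImR: "Im (\<i> * of_real y / z) = y * x / (norm z)^2" for y
    by (simp add: x_def Im_divide cmod_power2)
  have im_left: "s = 0" if s: "s \<in> closed_segment Q P" "Im s = 0" for s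
  proof -
    obtain y where y: "s = - (\<i> * of_real y / z)" using left[OF s(1)] by blast
    then have "y * x / (norm z)^2 = 0" using s(2) ImR[of y] by simp
    then show ?thesis using y x z0 by simp
  qed
  have im_right: "s = of_nat N" if s: "s \<in> closed_segment (P + of_nat N) (Q + of_nat N)" "Im s = 0" for s
  proof -
    obtain y where y: "s = of_nat N - \<i> * of_real y / z" using right[OF s(1)] by blast
    then have "y * x / (norm z)^2 = 0" using s(2) ImR[of y] by simp
    then show ?thesis using y x z0 by simp
  qed
  have pi: "path_image g1 = closed_segment P (P + of_nat N) \<union> closed_segment (P + of_nat N) (Q + of_nat N) \<union> closed_segment (Q + of_nat N) Q"
    "path_image g2 = closed_segment Q P"
    unfolding g1_def g2_def by (auto simp: path_image_join)
  have vp: "valid_path g1" "valid_path g2" "pathfinish g1 = pathstart g2" "pathfinish g2 = pathstart g1"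
    unfolding g1_def g2_def by (auto intro!: valid_path_join)
  have sub: "path_image g1 \<subseteq> W" "path_image g2 \<subseteq> W"
    unfolding pi by (intro Un_least closed_segment_subset corners W(2))+
  have pole_out: "p m \<notin> path_image g1" "p m \<notin> path_image g2" for m
  proof -
    have 0: "Im (p m) = 0" "Re (p m) = real m + u" by (simp_all add: p_def)
    have "p m \<noteq> of_nat N"
    proof
      assume "p m = of_nat N"
      then have "real m + u = real N" using 0(2) by simp
      then show False using u by (cases "m < N") linarith+
    qed
    then show "p m \<notin> path_image g1" using hor[of "p m"] hor2[of "p m"] im_right[of "p m"] 0 by (auto simp: pi)
    have "p m \<noteq> 0" using 0(2) u by auto
    then show "p m \<notin> path_image g2" using im_left[of "p m"] 0 by (auto simp: pi)
  qed
  have wind: "winding_number g (p m) = 1" if m: "m < N" for m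
  proof -
    have 0: "Im (p m) = 0" "Re (p m) = real m + u" by (simp_all add: p_def)
    have "real m + 1 <= real N" using m by linarith
    then have pN: "real m + u < real N" using u by linarith
    \<comment> \<open>Three sides avoid the ray to the left of the pole and the fourth avoids the
      ray to its right. So \<open>Ln (s - p m)\<close> and \<open>Ln (p m - s)\<close> are
      primitives on the two pieces; they differ by \<open>\<plusminus> \<i> pi\<close> at the two
      joints, which adds up to \<open>2 pi \<i>\<close>.\<close>
    define A where "A = {s. s - p m \<notin> \<real>\<^sub>\<le>\<^sub>0}"
    define B where "B = {s. p m - s \<notin> \<real>\<^sub>\<le>\<^sub>0}"
    have gA: "path_image g1 \<subseteq> A"
    proof
      fix s assume s: "s \<in> path_image g1"
      show "s \<in> A"
      proof (cases "Im s = 0")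
        case True
        then have "s = of_nat N" using s hor[of s] hor2[of s] im_right[of s] unfolding pi by auto
        then show ?thesis using pN 0 by (simp add: A_def complex_nonpos_Reals_iff)
      qed (use 0 in \<open>simp add: A_def complex_nonpos_Reals_iff\<close>)
    qed
    have gB: "path_image g2 \<subseteq> B"
    proof
      fix s assume s: "s \<in> path_image g2"
      show "s \<in> B"
      proof (cases "Im s = 0")
        case True
        then have "s = 0" using s im_left[of s] unfolding pi by auto
        then show ?thesis using u 0 by (simp add: B_def complex_nonpos_Reals_iff)
      qed (use 0 in \<open>simp add: B_def complex_nonpos_Reals_iff\<close>)
    qed
    have "((\<lambda>s. 1 / (s - p m)) has_contour_integral (Ln (pathfinish g1 - p m) - Ln (pathstart g1 - p m))) g1"
    proof (rule contour_integral_primitive[OF _ vp(1) gA, of "\<lambda>s. Ln (s - p m)"])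
      fix s assume "s \<in> A"
      then have s: "s - p m \<notin> \<real>\<^sub>\<le>\<^sub>0" by (simp add: A_def)
      have "((\<lambda>s. s - p m) has_field_derivative 1) (at s within A)" by (auto intro!: derivative_eq_intros)
      from DERIV_chain2[OF has_field_derivative_Ln[OF s] this]
      show "((\<lambda>s. Ln (s - p m)) has_field_derivative 1 / (s - p m)) (at s within A)"
        by (simp add: inverse_eq_divide)
    qed
    moreover have "((\<lambda>s. 1 / (s - p m)) has_contour_integral (Ln (p m - pathfinish g2) - Ln (p m - pathstart g2))) g2"
    proof (rule contour_integral_primitive[OF _ vp(2) gB, of "\<lambda>s. Ln (p m - s)"])
      fix s assume "s \<in> B"
      then have s: "p m - s \<notin> \<real>\<^sub>\<le>\<^sub>0" by (simp add: B_def)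
      have "((\<lambda>s. p m - s) has_field_derivative - 1) (at s within B)" by (auto intro!: derivative_eq_intros)
      from DERIV_chain2[OF has_field_derivative_Ln[OF s] this]
      show "((\<lambda>s. Ln (p m - s)) has_field_derivative 1 / (s - p m)) (at s within B)"
      proof -
        have "inverse (p m - s) * - 1 = 1 / (s - p m)"
          unfolding minus_diff_eq[of s "p m", symmetric] inverse_minus_eq by (simp add: divide_inverse)
        then show ?thesis using \<open>((\<lambda>s. Ln (p m - s)) has_field_derivative inverse (p m - s) * - 1) (at s within B)\<close> by simp
      qed
    qed
    ultimately have "((\<lambda>s. 1 / (s - p m)) has_contour_integral
       ((Ln (pathfinish g1 - p m) - Ln (pathstart g1 - p m)) + (Ln (p m - pathfinish g2) - Ln (p m - pathstart g2)))) g"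
      unfolding g_def by (rule has_contour_integral_join[OF _ _ vp(1,2)])
    moreover have "(Ln (pathfinish g1 - p m) - Ln (pathstart g1 - p m)) + (Ln (p m - pathfinish g2) - Ln (p m - pathstart g2)) = 2 * pi * \<i>"
    proof -
      have "Q \<noteq> p m" using ImQ(1) 0(1) by (metis less_irrefl)
      moreover have "P \<noteq> p m" using ImQ(2) 0(1) by (metis less_irrefl)
      ultimately have ne: "Q \<noteq> p m \<and> P \<noteq> p m" by blast
      have "Ln (p m - Q) = Ln (Q - p m) - \<i> * pi" using ne Ln_minus[of "Q - p m"] ImQ 0 by auto
      moreover have "Ln (p m - P) = Ln (P - p m) + \<i> * pi" using ne Ln_minus[of "P - p m"] ImQ 0 by auto
      ultimately show ?thesis by (simp add: g1_def g2_def)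
    qed
    ultimately have "contour_integral g (\<lambda>s. 1 / (s - p m)) = 2 * pi * \<i>" by (simp add: contour_integral_unique)
    moreover have "valid_path g" unfolding g_def using vp by (intro valid_path_join)
    moreover have "p m \<notin> path_image g" unfolding g_def using pole_out vp by (simp add: path_image_join)
    ultimately show ?thesis by (simp add: winding_number_valid_path)
  qed
  have no_pole: "exp (2 * pi * \<i> * (s - u)) - 1 \<noteq> 0" if "s \<in> W - p ` {..<N}" for s :: complex
  proof
    assume "exp (2 * pi * \<i> * (s - u)) - 1 = 0"
    then obtain k :: int where k: "s = of_int k + of_real u" using kern_zero_iff[of s u] by auto
    then have zs: "Re (z * s) = x * (of_int k + u)" by (simp add: x_def)
    have ws: "- e < Re (z * s)" "Re (z * s) < real N * x + e" using that unfolding W_def by blast+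
    have "x * (of_int k + u) > x * (u - 1)"
      using ws(1) zs e(4) unfolding distrib_left right_diff_distrib by linarith
    then have "k > - 1" using x by simp
    have "x * (of_int k + u) < x * (real N + u)"
      using ws(2) zs e(3) unfolding distrib_left mult.commute[of "real N"] by linarith
    then have "k < int N" using x by simp
    with \<open>k > - 1\<close> have "s = p (nat k)" "nat k < N" by (auto simp: k p_def)
    then show False using that by auto
  qed
  have hholo: "h holomorphic_on W - p ` {..<N}"
    unfolding h_def kern_def
    using no_pole by (intro holomorphic_intros holomorphic_on_subset[OF fW]) auto
  have pW: "p m \<in> W" if "m < N" for m
  proof -
    have zp: "Re (z * p m) = x * (real m + u)" by (simp add: p_def x_def)
    have "real m + 1 <= real N" using that by linarith
    then have "real m + u < real N" using u by linarith
    then have "x * (real m + u) < x * real N" using x by simp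
    moreover have "0 < x * (real m + u)" using x u by (intro mult_pos_pos) auto
    ultimately have "- e < x * (real m + u)" "x * (real m + u) < real N * x + e"
      using e(1) unfolding mult.commute[of "real N"] by linarith+
    then show ?thesis unfolding W_def Int_iff mem_Collect_eq zp by blast
  qed
  have res: "residue h (p m) = (- \<i>) ^ m * f (p m) / (2 * pi * \<i>)" if "m < N" for m
  proof -
    have ex: "exp (2 * pi * \<i> * (p m - u)) = 1"
      unfolding kern_zero_iff by (rule exI[of _ "int m"]) (simp add: p_def)
    have der: "((\<lambda>s. exp (2 * pi * \<i> * (s - u)) - 1) has_field_derivative 2 * pi * \<i>) (at (p m))"
      using ex by (auto intro!: derivative_eq_intros)
    have e3: "exp (3 * pi * \<i> / 2 * (p m - u)) = (- \<i>) ^ m"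
    proof -
      have "exp (3 * pi * \<i> / 2 * (p m - u)) = exp (3 * pi * \<i> / 2) ^ m"
        unfolding exp_of_nat_mult[symmetric] by (simp add: p_def mult.commute)
      also have "exp (3 * pi * \<i> / 2) = - \<i>"
      proof -
        have "exp (3 * pi * \<i> / 2) = cis (pi + pi / 2)"
          unfolding cis_conv_exp by (rule arg_cong[of _ _ exp]) (simp add: field_simps)
        also have "... = - \<i>" unfolding cis_mult [symmetric] by simp
        finally show ?thesis .
      qed
      finally show ?thesis .
    qed
    have "residue (\<lambda>s. (exp (3 * pi * \<i> / 2 * (s - u)) * f s) / (exp (2 * pi * \<i> * (s - u)) - 1)) (p m)
         = (exp (3 * pi * \<i> / 2 * (p m - u)) * f (p m)) / (2 * pi * \<i>)"
        by (rule residue_simple_pole_deriv[OF _ _ W(1) convex_connected[OF W(2)] pW[OF that] der])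
           (use ex f0 in \<open>auto intro!: holomorphic_intros fW\<close>)
    then show ?thesis unfolding e3 h_def kern_def by simp
  qed
  have "contour_integral g h = 2 * pi * \<i> * (\<Sum>q\<in>p ` {..<N}. winding_number g q * residue h q)"
  proof (rule Residue_theorem[OF W(1) convex_connected[OF W(2)] _ hholo])
    show "valid_path g" "pathfinish g = pathstart g" unfolding g_def using vp by (auto intro!: valid_path_join)
    show gi: "path_image g \<subseteq> W - p ` {..<N}"
      unfolding g_def using vp(3) sub pole_out by (auto simp: path_image_join)
    show "\<forall>z. z \<notin> W \<longrightarrow> winding_number g z = 0"
    proof clarify
      fix s assume "s \<notin> W"
      then show "winding_number g s = 0"
        using \<open>valid_path g\<close> \<open>pathfinish g = pathstart g\<close> gi
        by (intro winding_number_zero_outside[OF _ W(2)]) (auto simp: valid_path_imp_path)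
    qed
  qed simp
  also have "(\<Sum>q\<in>p ` {..<N}. winding_number g q * residue h q) = (\<Sum>m<N. winding_number g (p m) * residue h (p m))"
    by (subst sum.reindex) (auto simp: inj_on_def p_def o_def)
  also have "... = (\<Sum>m<N. (- \<i>) ^ m * f (p m) / (2 * pi * \<i>))" by (intro sum.cong) (auto simp: wind res)
  also have "2 * pi * \<i> * ... = (\<Sum>m<N. (- \<i>) ^ m * f (p m))"
    unfolding sum_distrib_left by (intro sum.cong) auto
  finally have 1: "contour_integral g h = (\<Sum>m<N. (- \<i>) ^ m * f (p m))" .
  have int: "h contour_integrable_on linepath a b" if "closed_segment a b \<subseteq> W - p ` {..<N}" for a b
    by (rule contour_integrable_continuous_linepath)
       (rule continuous_on_subset[OF holomorphic_on_imp_continuous_on[OF hholo] that])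
  have i4: "h contour_integrable_on linepath P (P + of_nat N)" "h contour_integrable_on linepath (P + of_nat N) (Q + of_nat N)"
     "h contour_integrable_on linepath (Q + of_nat N) Q" "h contour_integrable_on linepath Q P"
    by (rule int; use sub pole_out in \<open>auto simp: pi\<close>)+
  have "contour_integral g h = contour_integral (linepath P (P + of_nat N)) h
    + (contour_integral (linepath (P + of_nat N) (Q + of_nat N)) h
    + contour_integral (linepath (Q + of_nat N) Q) h)
    + contour_integral (linepath Q P) h"
    unfolding g_def g1_def g2_def using i4
    by (simp add: contour_integrable_join valid_path_join)
  then show ?thesis using 1 unfolding h_def p_def by (simp add: add_ac)
qed

subsection \<open>Exponents on the four edges\<close>

lemma Re_of_real_divide: "Re (of_real c / z) = c * Re z / (norm z)^2"
  by (simp add: Re_divide cmod_power2)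

lemma Re_ii_divide: "Re (\<i> * of_real c / z) = c * Im z / (norm z)^2" "Im (\<i> * of_real c / z) = c * Re z / (norm z)^2"
  by (simp_all add: Re_divide Im_divide cmod_power2)

text \<open>Upwards the numerator decays at rate \<open>3 pi / 2\<close>; downwards only
  \<open>2 pi - 3 pi / 2 = pi / 2\<close> remains, see \<open>kern_bound_down\<close>. The slower
  rate is what lets the lower half of the left side dominate.\<close>

lemma kern_bound_up:
  assumes "1 <= Im s"
  shows "norm (kern a s) <= 2 * exp (- (3 * pi / 2 * Im s))"
proof -
  have "norm (exp (2 * pi * \<i> * (s - a))) = exp (- (2 * pi * Im s))" by simp
  also have "... <= 1 / 2"
  proof -
    have "1 * 1 <= 2 * pi * Im s" using assms pi_gt3 by (intro mult_mono) auto
    then have "2 <= exp (2 * pi * Im s)" using exp_ge_add_one_self[of "2 * pi * Im s"] by linarith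
    then show ?thesis by (simp add: exp_minus field_simps)
  qed
  finally have "1 / 2 <= norm (exp (2 * pi * \<i> * (s - a)) - 1)"
    using norm_triangle_ineq2[of 1 "exp (2 * pi * \<i> * (s - a))"] by (simp add: norm_minus_commute)
  then have "norm (kern a s) <= exp (- (3 * pi / 2 * Im s)) / (1 / 2)"
    unfolding kern_def norm_divide by (intro frac_le) auto
  then show ?thesis by simp
qed

lemma kern_bound_down:
  assumes "Im s <= - 1"
  shows "norm (kern a s) <= 2 * exp (pi / 2 * Im s)"
proof -
  define t where "t = - Im s"
  have t: "t \<ge> 1" using assms by (simp add: t_def)
  have "1 * 1 <= 2 * pi * t" using t pi_gt3 by (intro mult_mono) auto
  then have "exp (2 * pi * t) \<ge> 2" using exp_ge_add_one_self[of "2 * pi * t"] by linarith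
  moreover have "norm (exp (2 * pi * \<i> * (s - a))) = exp (2 * pi * t)" by (simp add: t_def)
  ultimately have "exp (2 * pi * t) / 2 <= norm (exp (2 * pi * \<i> * (s - a)) - 1)"
    using norm_triangle_ineq2[of "exp (2 * pi * \<i> * (s - a))" 1] unfolding norm_one by argo
  then have "norm (kern a s) <= exp (3 * pi / 2 * t) / (exp (2 * pi * t) / 2)"
    unfolding kern_def norm_divide by (intro frac_le) (auto simp: t_def)
  also have "... = 2 * exp (3 * pi / 2 * t - 2 * pi * t)" unfolding exp_diff by simp
  also have "3 * pi / 2 * t - 2 * pi * t = pi / 2 * Im s" by (simp add: t_def)
  finally show ?thesis .
qed

lemma kern_periodic: "norm (kern a (s + of_nat N)) = norm (kern a s)"
proof -
  have "exp (2 * pi * \<i> * (s + of_nat N - a)) = exp (2 * pi * \<i> * (s - a)) * exp (2 * pi * \<i>) ^ N"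
    unfolding exp_of_nat_mult[symmetric] exp_add[symmetric] by (rule arg_cong[of _ _ exp]) (simp add: algebra_simps)
  also have "exp (2 * pi * \<i>) = 1" by (simp add: exp_two_pi_i')
  finally have "exp (2 * pi * \<i> * (s + of_nat N - a)) = exp (2 * pi * \<i> * (s - a))" by simp
  then show ?thesis unfolding kern_def norm_divide by simp
qed

text \<open>What is left of \<open>kern a (- \<i> w)\<close> once \<open>exp (- pi w / 2)\<close> is
  taken out. It is bounded in a sector and tends to \<open>cis (pi a / 2)\<close> as
  \<open>Re w\<close> grows.\<close>

definition kern_factor :: "real \<Rightarrow> complex \<Rightarrow> complex" where
  "kern_factor a w = exp (- (3 * pi * \<i> / 2 * a)) / (exp (- (2 * pi * \<i> * a)) - exp (- (of_real (2 * pi) * w)))"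

lemma kern_left_lower:
  fixes w :: complex
  shows "kern a (- (\<i> * w)) = exp (- (pi / 2 * w)) * kern_factor a w"
proof -
  have 1: "exp (3 * pi * \<i> / 2 * (- (\<i> * w) - a)) = exp (- (pi / 2 * w)) * exp (2 * pi * w) * exp (- (3 * pi * \<i> / 2 * a))"
    unfolding exp_add[symmetric] by (rule arg_cong[of _ _ exp]) (simp add: complex_eq_iff field_simps)
  have 2: "exp (2 * pi * \<i> * (- (\<i> * w) - a)) = exp (2 * pi * w) * exp (- (2 * pi * \<i> * a))"
    unfolding exp_add[symmetric] by (rule arg_cong[of _ _ exp]) (simp add: complex_eq_iff algebra_simps)
  have "exp (2 * pi * w) * exp (- (2 * pi * \<i> * a)) - 1 = exp (2 * pi * w) * (exp (- (2 * pi * \<i> * a)) - exp (- (2 * pi * w)))"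
    by (simp add: algebra_simps exp_minus_inverse)
  then show ?thesis unfolding kern_def kern_factor_def 1 2 by simp
qed

lemma norm_kern_left_upper:
  fixes w :: complex
  shows "norm (kern a (\<i> * w)) = exp (- (3 * pi / 2 * Re w)) * norm (1 / (exp (2 * pi * \<i> * a) - exp (- (2 * pi * w))))"
proof -
  have 1: "exp (3 * pi * \<i> / 2 * (\<i> * w - a)) = exp (- (3 * pi / 2 * w)) * exp (- (3 * pi * \<i> / 2 * a))"
    unfolding exp_add[symmetric] by (rule arg_cong[of _ _ exp]) (simp add: complex_eq_iff field_simps)
  have 2: "exp (2 * pi * \<i> * (\<i> * w - a)) = exp (- (2 * pi * w)) * exp (- (2 * pi * \<i> * a))"
    unfolding exp_add[symmetric] by (rule arg_cong[of _ _ exp]) (simp add: complex_eq_iff algebra_simps)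
  have "exp (- (2 * pi * w)) * exp (- (2 * pi * \<i> * a)) - 1 = - (exp (- (2 * pi * \<i> * a)) * (exp (2 * pi * \<i> * a) - exp (- (2 * pi * w))))"
    by (simp add: algebra_simps exp_minus_inverse)
  then have 3: "norm (exp (- (2 * pi * w)) * exp (- (2 * pi * \<i> * a)) - 1) = norm (exp (2 * pi * \<i> * a) - exp (- (2 * pi * w)))"
    by (simp add: norm_mult)
  show ?thesis unfolding kern_def norm_divide 1 2 3 by (simp add: norm_mult)
qed

text \<open>For small \<open>w\<close> the exponential is close to 1, which is not \<open>u\<close>;
  as soon as \<open>Re w\<close> is bounded below, its norm is bounded away from
  \<open>norm u = 1\<close>. In the cone there is no third case.\<close>

lemma dist_root_exp_sector:
  assumes "1 <= M" "norm u = 1" "u \<noteq> 1"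
  obtains c where "0 < c" "\<And>w::complex. 0 <= Re w ==> \<bar>Im w\<bar> <= M * Re w ==> c <= norm (u - exp (- (2 * pi * w)))"
proof -
  define d where "d = norm (u - 1)"
  have d: "d > 0" using assms by (simp add: d_def)
  \<comment> \<open>In the cone, \<open>Re w <= a\<close> forces
    \<open>2 * pi * norm w <= d / 2\<close>.\<close>
  define a where "a = d / (2 * (1 + M) * (2 * pi))"
  have a: "a > 0" using d assms by (simp add: a_def)
  show ?thesis
  proof (rule that[of "min (d / 2) (1 - exp (- (2 * pi * a)))"])
    show "0 < min (d / 2) (1 - exp (- (2 * pi * a)))" using a d by simp
    fix w :: complex assume w: "0 <= Re w" "\<bar>Im w\<bar> <= M * Re w"
    show "min (d / 2) (1 - exp (- (2 * pi * a))) <= norm (u - exp (- (2 * pi * w)))"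
    proof (cases "Re w \<ge> a")
      case True
      have "norm (exp (- (2 * pi * w))) <= exp (- (2 * pi * a))" using True by simp
      then have "1 - exp (- (2 * pi * a)) <= norm (u - exp (- (2 * pi * w)))"
        using norm_triangle_ineq2[of u "exp (- (2 * pi * w))"] assms(2) by linarith
      then show ?thesis by simp
    next
      case False
      have "norm w <= (1 + M) * Re w" using cmod_le[of w] w by (simp add: algebra_simps)
      also have "... <= (1 + M) * a" using False assms by (intro mult_left_mono) auto
      also have "(1 + M) * a = d / 2 / (2 * pi)" using assms by (simp add: a_def divide_simps) (simp add: algebra_simps)?
      finally have nw: "2 * pi * norm w <= d / 2" by (simp add: pos_le_divide_eq mult_ac)
      have "norm (exp (- (2 * pi * w)) - 1) <= norm (- (2 * pi * w))"
      proof -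
        have "norm (exp x - exp 0) <= 1 * norm (x - 0)" if "Re x <= 0" for x :: complex
        proof (rule field_differentiable_bound[of "{x. Re x <= 0}"])
          show "convex {x. Re x <= 0}" by (rule convex_halfspace_Re_le)

          show "(exp has_field_derivative exp y) (at y within {x. Re x <= 0})" for y :: complex
            by (rule has_field_derivative_at_within[OF DERIV_exp])
        qed (use that in auto)
        from this[of "- (2 * pi * w)"] show ?thesis using w by simp
      qed
      also have "... = 2 * pi * norm w" by (simp add: norm_mult)
      finally have "norm (exp (- (2 * pi * w)) - 1) <= d / 2" using nw by simp
      then have "d / 2 <= norm (u - exp (- (2 * pi * w)))"
        using norm_triangle_ineq2[of "u - 1" "exp (- (2 * pi * w)) - 1"] by (simp add: d_def)
      then show ?thesis by simp
    qed
  qed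
qed

text \<open>As \<open>0 < a < 1\<close>, the numbers \<open>exp (\<plusminus> 2 pi \<i> a)\<close>
  differ from 1, so \<open>dist_root_exp_sector\<close> keeps the denominators away from 0 on both
  halves of the slanted side.\<close>

lemma kern_left_bound:
  assumes "1 <= M" "0 < a" "a < 1"
  obtains c where "0 < c"
    "\<And>w::complex. 0 <= Re w ==> \<bar>Im w\<bar> <= M * Re w ==> norm (kern_factor a w) <= c"
    "\<And>w::complex. 0 <= Re w ==> \<bar>Im w\<bar> <= M * Re w ==> norm (kern a (\<i> * w)) <= c * exp (- (3 * pi / 2 * Re w))"
proof -
  have ne: "exp (2 * pi * \<i> * a) \<noteq> 1" "exp (- (2 * pi * \<i> * a)) \<noteq> 1"
  proof -
    show "exp (2 * pi * \<i> * a) \<noteq> 1"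
    proof
      assume "exp (2 * pi * \<i> * a) = 1"
      then obtain n :: int where "2 * pi * a = of_int (2 * n) * pi" by (auto simp: exp_eq_1)
      then have "a = of_int n" by simp
      then have "0 < n" "n < 1" using assms by auto
      then show False by simp
    qed
    then show "exp (- (2 * pi * \<i> * a)) \<noteq> 1" by (simp add: exp_minus)
  qed
  obtain c1 where c1: "0 < c1" "\<And>w::complex. 0 <= Re w ==> \<bar>Im w\<bar> <= M * Re w ==> c1 <= norm (exp (- (2 * pi * \<i> * a)) - exp (- (2 * pi * w)))"
    using dist_root_exp_sector[OF assms(1) _ ne(2)] by (auto simp: norm_exp_eq_Re)
  obtain c2 where c2: "0 < c2" "\<And>w::complex. 0 <= Re w ==> \<bar>Im w\<bar> <= M * Re w ==> c2 <= norm (exp (2 * pi * \<i> * a) - exp (- (2 * pi * w)))"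
    using dist_root_exp_sector[OF assms(1) _ ne(1)] by (auto simp: norm_exp_eq_Re)
  show ?thesis
  proof (rule that[of "max (1 / c1) (1 / c2)"])
    fix w :: complex assume w: "0 <= Re w" "\<bar>Im w\<bar> <= M * Re w"
    have "norm (kern_factor a w) <= 1 / c1"
      unfolding kern_factor_def norm_divide using c1 w by (intro frac_le) auto
    then show "norm (kern_factor a w) <= max (1 / c1) (1 / c2)" by linarith
    have "norm (1 / (exp (2 * pi * \<i> * a) - exp (- (2 * pi * w)))) <= 1 / c2"
      unfolding norm_divide using c2 w by (intro frac_le) auto
    then have "norm (kern a (\<i> * w)) <= exp (- (3 * pi / 2 * Re w)) * (1 / c2)"
      unfolding norm_kern_left_upper by (intro mult_left_mono) auto
    also have "... <= exp (- (3 * pi / 2 * Re w)) * max (1 / c1) (1 / c2)" by (intro mult_left_mono) auto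
    finally show "norm (kern a (\<i> * w)) <= max (1 / c1) (1 / c2) * exp (- (3 * pi / 2 * Re w))" by (subst mult.commute)
  qed (use c1 in \<open>simp add: less_max_iff_disj\<close>)
qed

lemma saddle_fun_eq:
  assumes "z \<in> sector M" "1 <= M" "e^2 = 1" "0 <= Re (z * s)"
  shows "saddle_fun e z s = exp (- 2 * z * s^2 - dilog (exp (- 8 * z * s)) / (8 * z)) * exp (prod_log_reg z (e * exp (- 4 * z * s)))"
proof -
  have "norm e = 1" using assms(3) by (auto simp: power2_eq_1_iff)
  then have n: "norm (e * exp (- 4 * z * s)) <= 1" using assms(4) by (simp add: norm_mult)
  have "(e * exp (- 4 * z * s))^2 = exp (- 8 * z * s)"
    using assms(3) by (simp add: power_mult_distrib mult.assoc flip: exp_double)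
  then show ?thesis
    unfolding saddle_fun_def prod_log_eq[OF assms(1,2) n] exp_add[symmetric]
    by (intro arg_cong[of _ _ exp]) simp
qed

text \<open>The derivative in \<open>t\<close> is \<open>- ln (2 * norm (cosh (4 z t)))\<close> and
  the value at 0 is 0. In the sector, growth is possible only for \<open>1/16 < h t < 1/8\<close>:
  before, the cosine of \<open>4 t Im z\<close> is at least 1/2, afterwards
  \<open>sinh (4 h t)\<close> is large. In between the slope is at most \<open>ln 2\<close>.\<close>

lemma bottom_exponent:
  assumes z: "z \<in> sector 4" and t: "0 <= t"
  shows "Re ((- of_real (pi^2 / 12) - dilog (- exp (- (8 * z * of_real t)))) / (8 * z)) - 2 * Re z * t^2 <= ln 2 / (16 * Re z)"
proof -
  define h where "h = Re z"
  have h: "h > 0" "\<bar>Im z\<bar> <= 4 * h" using z by (auto simp: sector_def h_def)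
  have z0: "z \<noteq> 0" using sector_nonzero[OF z] .
  define g where "g = (\<lambda>t. Re ((- of_real (pi^2 / 12) - dilog (- exp (- (8 * z * of_real t)))) / (8 * z)) - 2 * h * t^2)"
  have cont: "continuous_on {0..u} g" for u
    unfolding g_def
    by (intro continuous_intros continuous_on_dilog_comp) (use h z0 in \<open>auto simp: h_def\<close>)
  have der: "(g has_real_derivative - ln (2 * norm (cosh (4 * z * of_real x)))) (at x)" if x: "x > 0" for x
  proof -
    define w where "w = - exp (- (8 * z * of_real x))"
    have w: "w \<noteq> 0" "norm w < 1" using x h by (auto simp: w_def h_def)
    have small: "norm (- exp (- (8 * z * of_real u))) < 1" if "u > 0" for u using that h by (simp add: h_def)
    have ne1: "- exp (- (8 * z * of_real u)) \<noteq> 1" if "u > 0" for u using small[OF that] by (metis norm_one less_irrefl)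
    have "((\<lambda>x. - exp (- (8 * z * of_real x))) has_vector_derivative (- (8 * z) * w)) (at x)"
    proof -
      have "((\<lambda>u. - exp (- (8 * z * u))) has_field_derivative (- (8 * z) * w)) (at (of_real x))"
        by (auto intro!: derivative_eq_intros simp: w_def)
      from has_vector_derivative_real_field[OF this] show ?thesis by simp
    qed
    then have "((\<lambda>x. dilog (- exp (- (8 * z * of_real x)))) has_vector_derivative (- (- (8 * z) * w * Ln (1 - w) / w))) (at x)"
      unfolding w_def
      by (rule dilog_comp_has_vector_derivative[of _ _ _ "{0<..}"]) (use x less_imp_le[OF small] small ne1 in auto)
    then have d1: "((\<lambda>x. dilog (- exp (- (8 * z * of_real x)))) has_vector_derivative (8 * z * Ln (1 - w))) (at x)"
      using w by (simp add: mult.assoc)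
    have "((\<lambda>x. (- of_real (pi^2 / 12) - dilog (- exp (- (8 * z * of_real x)))) / (8 * z)) has_vector_derivative ((0 - 8 * z * Ln (1 - w)) / (8 * z))) (at x)"
      by (intro has_vector_derivative_divide has_vector_derivative_diff has_vector_derivative_const d1)
    then have "((\<lambda>x. (- of_real (pi^2 / 12) - dilog (- exp (- (8 * z * of_real x)))) / (8 * z)) has_vector_derivative - Ln (1 - w)) (at x)"
      using z0 by simp
    from has_real_derivative_Re[OF this]
    have "(g has_real_derivative Re (- Ln (1 - w)) - 4 * h * x) (at x)"
      unfolding g_def by (rule DERIV_diff) (auto intro!: derivative_eq_intros)
    moreover have "Re (Ln (1 - w)) = ln (norm (1 - w))" using w by (intro Re_Ln) auto
    moreover have "ln (norm (1 - w)) + 4 * h * x = ln (2 * norm (cosh (4 * z * of_real x)))"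
    proof -
      have "2 * cosh (4 * z * of_real x) = exp (4 * z * of_real x) * (1 - w)"
        by (simp add: cosh_def w_def scaleR_conv_of_real algebra_simps flip: exp_add)
      then have "2 * norm (cosh (4 * z * of_real x)) = exp (4 * h * x) * norm (1 - w)"
        by (metis norm_mult norm_numeral norm_exp_eq_Re mult.assoc h_def Re_complex_of_real complex_Re_numeral times_complex.simps(1) complex_Im_numeral Im_complex_of_real diff_zero mult_zero_left mult_zero_right)
      moreover have "1 - w \<noteq> 0" using w by auto
      ultimately show ?thesis by (simp add: ln_mult)
    qed
    ultimately have "Re (- Ln (1 - w)) - 4 * h * x = - ln (2 * norm (cosh (4 * z * of_real x)))" by simp
    with \<open>(g has_real_derivative _) _\<close> show ?thesis by simp
  qed
  have cosh_sq: "norm (cosh (4 * z * of_real x)) ^ 2 = sinh (4 * h * x) ^ 2 + cos (4 * Im z * x) ^ 2" for x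
    using norm_cosh_sq[of "4 * z * of_real x"] by (simp add: h_def mult_ac)
  have big: "1 <= 2 * norm (cosh (4 * z * of_real x))" if "0 < x" "16 * h * x <= 1" for x
  proof -
    have "\<bar>4 * Im z * x\<bar> = \<bar>Im z\<bar> * (4 * x)" using that by (simp add: abs_mult)
    also have "... <= 4 * h * (4 * x)" using that h by (intro mult_right_mono) auto
    finally have "\<bar>4 * Im z * x\<bar> <= 1" using that by linarith
    then have "cos (pi / 3) <= cos \<bar>4 * Im z * x\<bar>" using pi_gt3 by (intro cos_monotone_0_pi_le) auto
    then have "1 / 2 <= cos (4 * Im z * x)" by (simp add: cos_60)
    then have "(1 / 2)^2 <= norm (cosh (4 * z * of_real x)) ^ 2"
      unfolding cosh_sq by (smt (verit) power_mono zero_le_power2 divide_nonneg_pos)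
    then have "1 / 2 <= norm (cosh (4 * z * of_real x))" by (rule power2_le_imp_le) simp
    then show ?thesis by simp
  qed
  have lower: "8 * h * x <= 2 * norm (cosh (4 * z * of_real x))" if "0 < x" for x
  proof -
    have "4 * h * x <= sinh (4 * h * x)" using h that by (intro sinh_ge_self) auto
    also have "... <= norm (cosh (4 * z * of_real x))"
      using norm_cosh_ge[of "4 * z * of_real x"] by (simp add: h_def mult_ac)
    finally show ?thesis by simp
  qed
  define a b where "a = 1 / (16 * h)" and "b = 1 / (8 * h)"
  have ab: "0 < a" "a < b" "b - a = 1 / (16 * h)" using h by (auto simp: a_def b_def field_simps)
  have mono1: "g v <= g u" if "0 <= u" "u <= v" "\<And>x. u < x ==> x < v ==> 1 <= 2 * norm (cosh (4 * z * of_real x))" for u v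
  proof (rule DERIV_nonpos_imp_decreasing_open[OF that(2)])
    fix x assume x: "u < x" "x < v"
    then show "\<exists>d. (g has_real_derivative d) (at x) \<and> d <= 0"
      using der[of x] that by (intro exI[of _ "- ln (2 * norm (cosh (4 * z * of_real x)))"]) auto
  qed (rule continuous_on_subset[OF cont[of v]], use that in auto)
  have g0: "g 0 = 0" by (simp add: g_def dilog_minus_1)
  have g1: "g t <= 0" if "0 <= t" "t <= a" for t
  proof -
    have "g t <= g 0"
    proof (rule mono1)
      fix x assume "0 < x" "x < t"
      then show "1 <= 2 * norm (cosh (4 * z * of_real x))" using that h mult_strict_left_mono[of x a "16 * h"] by (intro big) (auto simp: a_def)
    qed (use that in auto)
    then show ?thesis using g0 by simp
  qed
  have g2: "g t <= ln 2 / (16 * h)" if "a <= t" "t <= b" for t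
  proof -
    have "g t - ln 2 * t <= g a - ln 2 * a"
    proof (rule DERIV_nonpos_imp_decreasing_open[OF that(1)])
      show "continuous_on {a..t} (\<lambda>t. g t - ln 2 * t)"
        using ab by (intro continuous_intros continuous_on_subset[OF cont[of t]]) auto
      fix x assume x: "a < x" "x < t"
      then have x0: "0 < x" using ab by linarith
      have "1 / 2 <= 8 * h * x" using x h by (simp add: a_def field_simps)
      then have "1 / 2 <= 2 * norm (cosh (4 * z * of_real x))" using lower[OF x0] by linarith
      then have "ln (1 / 2) <= ln (2 * norm (cosh (4 * z * of_real x)))" by (intro ln_mono) auto
      then have "- ln (2 * norm (cosh (4 * z * of_real x))) - ln 2 <= 0" by (simp add: ln_div)
      moreover have "((\<lambda>t. g t - ln 2 * t) has_real_derivative (- ln (2 * norm (cosh (4 * z * of_real x))) - ln 2)) (at x)"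
        using der[OF x0] by (auto intro!: derivative_eq_intros)
      ultimately show "\<exists>d. ((\<lambda>t. g t - ln 2 * t) has_real_derivative d) (at x) \<and> d <= 0" by blast
    qed
    then have "g t <= ln 2 * (t - a)" using g1[of a] ab by (simp add: algebra_simps)
    also have "... <= ln 2 * (b - a)" using that by (intro mult_left_mono) auto
    finally show ?thesis using ab by simp
  qed
  have g3: "g t <= ln 2 / (16 * h)" if "b <= t" for t
  proof -
    have "g t <= g b"
    proof (rule mono1)
      fix x assume x: "b < x"
      then have x0: "0 < x" using ab by linarith
      have "1 <= 8 * h * x" using x h by (simp add: b_def field_simps)
      then show "1 <= 2 * norm (cosh (4 * z * of_real x))" using lower[OF x0] by linarith
    qed (use ab that in auto)
    then show ?thesis using g2[of b] ab by linarith
  qed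
  have "0 <= ln 2 / (16 * h)" using h by simp
  then have "g t <= ln 2 / (16 * h)" using g1 g2 g3 t by (meson linear order_trans)
  then show ?thesis by (simp add: g_def h_def)
qed

lemma norm_contour_integral_linepath_le:
  assumes "0 <= B" "c \<noteq> 0" "\<And>s. s \<in> closed_segment a b ==> norm (c * f s) <= B"
  shows "norm (c * contour_integral (linepath a b) f) <= B * norm (b - a)"
proof (cases "f contour_integrable_on linepath a b")
  case True
  have "norm (contour_integral (linepath a b) f) <= B / norm c * norm (b - a)"
  proof (rule has_contour_integral_bound_linepath[OF has_contour_integral_integral[OF True]])
    fix s assume "s \<in> closed_segment a b"
    then show "norm (f s) <= B / norm c" using assms(2,3) by (simp add: norm_mult field_simps)
  qed (use assms in auto)
  then show ?thesis using assms(2) by (simp add: norm_mult field_simps)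
qed (use assms in \<open>simp add: not_integrable_contour_integral\<close>)

lemma norm_factor_nonzero [simp]: "norm_factor z \<noteq> 0"
  by (simp add: norm_factor_def)

lemma saddle_fun_nonzero [simp]: "saddle_fun e z s \<noteq> 0"
  by (simp add: saddle_fun_def)

lemma holomorphic_saddle_fun:
  assumes "Re z > 0" "norm e = 1"
  shows "saddle_fun e z holomorphic_on {s. Re (z * s) > - (Re z / 4)}"
  unfolding saddle_fun_def
proof (intro holomorphic_intros)
  have "(prod_log z \<circ> (\<lambda>s. e * exp (- 4 * z * s))) holomorphic_on {s. Re (z * s) > - (Re z / 4)}"
  proof (rule holomorphic_on_compose_gen[OF _ holomorphic_prod_log[OF assms(1)]])
    show "(\<lambda>s. e * exp (- 4 * z * s)) ` {s. Re (z * s) > - (Re z / 4)} \<subseteq> ball 0 (exp (Re z))"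
      using assms(2) by (auto simp: norm_mult)
  qed (intro holomorphic_intros)
  then show "(\<lambda>s. prod_log z (e * exp (- 4 * z * s))) holomorphic_on {s. Re (z * s) > - (Re z / 4)}"
    by (simp add: o_def)
qed

text \<open>The bound has to hold up to \<open>norm X = 1\<close>, also at
  \<open>X = \<plusminus> 1\<close>; hence the loss \<open>exp (C / sqrt (Re z))\<close>.\<close>

lemma norm_saddle_bound:
  obtains C where "0 < C"
    "\<And>z e s. z \<in> sector 4 ==> Re z <= 1 ==> e^2 = 1 ==> 0 <= Re (z * s) ==>
      norm (norm_factor z * saddle_fun e z s) <=
        C * exp (C / sqrt (Re z)) * exp (Re (of_real (pi^2 / 48) / z - 2 * z * s^2 - dilog (exp (- 8 * z * s)) / (8 * z)))"
proof -
  obtain Cn where Cn: "\<And>z. z \<in> sector 4 ==> Re z <= 1 ==> norm (norm_factor z) <= Cn * exp (Re (of_real (pi^2 / 48) / z))"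
    using norm_norm_factor_le[of 4] by auto
  obtain Cp where Cp: "\<And>z X. z \<in> sector 4 ==> norm X <= 1 ==> norm (prod_log_reg z X) <= Cp / sqrt (Re z)"
    using norm_prod_log_reg_le[of 4] by (metis one_le_numeral)
  define C where "C = max 1 (max Cn Cp)"
  have C: "C \<ge> 1" "Cn <= C" "Cp <= C" by (auto simp: C_def)
  show ?thesis
  proof (rule that)
    show "0 < C" using C by simp
    fix z e s :: complex assume z: "z \<in> sector 4" "Re z <= 1" and e: "e^2 = 1" and s: "0 <= Re (z * s)"
    have x: "Re z > 0" using z by (simp add: sector_def)
    have "norm e = 1" using e by (auto simp: power2_eq_1_iff)
    then have n: "norm (e * exp (- 4 * z * s)) <= 1" using s by (simp add: norm_mult)
    have "norm (prod_log_reg z (e * exp (- 4 * z * s))) <= Cp / sqrt (Re z)" using Cp[OF z(1) n] .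
    also have "... <= C / sqrt (Re z)" using C x by (intro divide_right_mono) auto
    finally have 1: "Re (prod_log_reg z (e * exp (- 4 * z * s))) <= C / sqrt (Re z)"
      using complex_Re_le_cmod order_trans by blast
    define a where "a = - 2 * z * s^2 - dilog (exp (- 8 * z * s)) / (8 * z)"
    have "norm (norm_factor z * saddle_fun e z s) = norm (norm_factor z) * (exp (Re a) * exp (Re (prod_log_reg z (e * exp (- 4 * z * s)))))"
      unfolding saddle_fun_eq[OF z(1) _ e s, simplified] a_def by (simp add: norm_mult)
    also have "... <= (Cn * exp (Re (of_real (pi^2 / 48) / z))) * (exp (Re a) * exp (C / sqrt (Re z)))"
      using Cn[OF z] 1 by (intro mult_mono) (auto intro: order_trans[OF norm_ge_zero])
    also have "... <= (C * exp (Re (of_real (pi^2 / 48) / z))) * (exp (Re a) * exp (C / sqrt (Re z)))"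
      using C by (intro mult_right_mono) auto
    also have "... = C * exp (C / sqrt (Re z)) * (exp (Re (of_real (pi^2 / 48) / z)) * exp (Re a))" by (simp only: mult_ac)
    also have "exp (Re (of_real (pi^2 / 48) / z)) * exp (Re a) = exp (Re (of_real (pi^2 / 48) / z + a))"
      by (simp add: exp_add)
    finally show "norm (norm_factor z * saddle_fun e z s) <=
        C * exp (C / sqrt (Re z)) * exp (Re (of_real (pi^2 / 48) / z - 2 * z * s^2 - dilog (exp (- 8 * z * s)) / (8 * z)))"
      by (simp add: a_def algebra_simps)
  qed
qed

text \<open>At height \<open>\<plusminus> pi / 8\<close> the factor
  \<open>exp (\<plusminus> 8 \<i> pi / 8)\<close> is \<open>- 1\<close>, so the dilogarithm is taken
  at \<open>- exp (- 8 z t)\<close>, and \<open>1/48 + 1/32 - 1/16 = - 1/96\<close> produces the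
  constant of \<open>bottom_exponent\<close>. The downward kernel rate \<open>pi / 2\<close> is
  enough on the upper side as well.\<close>

lemma horizontal_exponent:
  assumes z: "z \<in> sector 4" and t: "0 <= t" and d: "d = 1 \<or> d = - 1"
  defines "s \<equiv> of_real d * (\<i> * of_real (pi / 8) / z) + of_real t"
  shows "Re (of_real (pi^2 / 48) / z - 2 * z * s^2 - dilog (exp (- 8 * z * s)) / (8 * z)) - pi / 2 * (pi / 8 * Re z / (norm z)^2)
    <= ln 2 / (16 * Re z)"
proof -
  have z0: "z \<noteq> 0" using sector_nonzero[OF z] .
  define c where "c = of_real d * (\<i> * of_real (pi / 8))"
  have zs: "z * s = c + z * of_real t" using z0 by (simp add: s_def c_def algebra_simps)
  have "exp (- 8 * z * s) = exp (- 8 * c) * exp (- (8 * z * of_real t))"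
  proof -
    have "- 8 * z * s = - 8 * c + - (8 * z * of_real t)" using zs by (simp add: mult.assoc distrib_left)
    then show ?thesis by (metis exp_add)
  qed
  also have "exp (- 8 * c) = - 1"
    using d by (auto simp: c_def exp_minus)
  finally have e: "exp (- 8 * z * s) = - exp (- (8 * z * of_real t))" by simp
  have cc: "c^2 = - of_real (pi^2 / 64)" using d by (auto simp: c_def power_mult_distrib power_divide)
  have "2 * z * s^2 = 2 * (z * s)^2 / z" using z0 by (simp add: power2_eq_square)
  also have "... = 2 * c^2 / z + 4 * c * of_real t + 2 * z * (of_real t)^2"
    unfolding zs using z0 by (simp add: power2_eq_square field_simps)
  finally have sq: "2 * z * s^2 = - (of_real (pi^2 / 32) / z) + 4 * c * of_real t + 2 * z * (of_real t)^2"
    unfolding cc by simp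
  have "Re (of_real (pi^2 / 48) / z - 2 * z * s^2 - dilog (exp (- 8 * z * s)) / (8 * z)) - pi / 2 * (pi / 8 * Re z / (norm z)^2)
    = Re (of_real (pi^2 / 48) / z) + Re (of_real (pi^2 / 32) / z) - Re (of_real (pi^2 / 16) / z)
       - Re (dilog (- exp (- (8 * z * of_real t))) / (8 * z)) - 2 * Re z * t^2"
    unfolding sq e by (simp add: c_def power2_eq_square Re_of_real_divide del: of_real_divide of_real_power of_real_mult)
  also have "Re (of_real (pi^2 / 48) / z) + Re (of_real (pi^2 / 32) / z) - Re (of_real (pi^2 / 16) / z)
      = Re (- of_real (pi^2 / 12) / (8 * z))"
  proof -
    have "Re (- of_real (pi^2 / 12) / (8 * z)) = Re (of_real (- (pi^2 / 96)) / z)" by (simp add: field_simps)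
    then show ?thesis unfolding Re_of_real_divide by (simp add: field_simps)
  qed
  also have "Re (- of_real (pi^2 / 12) / (8 * z)) - Re (dilog (- exp (- (8 * z * of_real t))) / (8 * z))
     = Re ((- of_real (pi^2 / 12) - dilog (- exp (- (8 * z * of_real t)))) / (8 * z))"
    by (simp add: diff_divide_distrib del: of_real_divide of_real_power)
  finally show ?thesis using bottom_exponent[OF z t] by linarith
qed

text \<open>Since \<open>N Re z >= 1\<close>, the Gaussian term contributes at most
  \<open>- 2 / Re z\<close>, while all other terms together are at most
  \<open>(7 pi^2 / 96) / Re z\<close>.\<close>

lemma right_exponent:
  assumes z: "z \<in> sector 4" and y: "\<bar>y\<bar> <= pi / 8" and N: "1 <= Re z * real N"
  defines "s \<equiv> \<i> * of_real y / z + of_nat N"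
  shows "Re (of_real (pi^2 / 48) / z - 2 * z * s^2 - dilog (exp (- 8 * z * s)) / (8 * z)) <= 0"
proof -
  have z0: "z \<noteq> 0" using sector_nonzero[OF z] .
  have x: "Re z > 0" using z by (simp add: sector_def)
  have xz: "Re z <= norm z" by (rule complex_Re_le_cmod)
  have zs: "z * s = \<i> * of_real y + z * of_nat N" using z0 by (simp add: s_def algebra_simps)
  have "2 * z * s^2 = 2 * (z * s)^2 / z" using z0 by (simp add: power2_eq_square)
  also have "... = 2 * (\<i> * of_real y)^2 / z + 4 * (\<i> * of_real y) * of_nat N + 2 * z * (of_nat N)^2"
    unfolding zs using z0 by (simp add: power2_eq_square field_simps)
  finally have "Re (2 * z * s^2) = - Re (of_real (2 * y^2) / z) + 2 * Re z * (real N)^2"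
    by (simp add: power_mult_distrib Re_power2 del: Re_divide_of_real)
  moreover have "norm (dilog (exp (- 8 * z * s)) / (8 * z)) <= (pi^2 / 6) / (8 * Re z)"
    unfolding norm_divide using x xz by (intro frac_le norm_dilog_le) (auto simp: norm_mult mult.assoc zs)
  then have "- Re (dilog (exp (- 8 * z * s)) / (8 * z)) <= (pi^2 / 6) / (8 * Re z)"
    using abs_Re_le_cmod[of "dilog (exp (- 8 * z * s)) / (8 * z)"] by linarith
  moreover have up: "Re (of_real c / z) <= c / Re z" if "c \<ge> 0" for c
  proof -
    have "Re (of_real c / z) <= norm (of_real c / z)" by (rule complex_Re_le_cmod)
    also have "... = c / norm z" using that by (simp add: norm_divide)
    also have "... <= c / Re z" using that x xz by (intro divide_left_mono mult_pos_pos) auto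
    finally show ?thesis .
  qed
  have "y^2 <= (pi / 8)^2" using y by (metis abs_ge_zero power2_abs power_mono)
  then have "Re (of_real (2 * y^2) / z) <= 2 * (pi / 8)^2 / Re z"
    using up[of "2 * y^2"] x by (smt (verit) divide_right_mono zero_le_power2)
  moreover have "Re (of_real (pi^2 / 48) / z) <= (pi^2 / 48) / Re z" by (rule up) simp
  moreover have "2 / Re z <= 2 * Re z * (real N)^2"
  proof -
    have "1^2 <= (Re z * real N)^2" by (rule power_mono[OF N]) simp
    then show ?thesis using x by (simp add: field_simps power2_eq_square)
  qed
  ultimately have "Re (of_real (pi^2 / 48) / z - 2 * z * s^2 - dilog (exp (- 8 * z * s)) / (8 * z))
     <= (pi^2 / 48) / Re z + 2 * (pi / 8)^2 / Re z + (pi^2 / 6) / (8 * Re z) - 2 / Re z"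
    by simp
  also have "... = (7 * pi^2 / 96 - 2) / Re z" using x by (simp add: field_simps power2_eq_square)
  also have "... <= 0"
  proof (intro divide_nonpos_pos x)
    have "pi^2 <= 4^2" using pi_less_4 pi_gt3 by (intro power_mono) auto
    then show "7 * pi^2 / 96 - 2 <= 0" by simp
  qed
  finally show ?thesis .
qed

lemma dilog_cis_minus: "dilog (cis (- y)) = cnj (dilog (cis y))"
  by (simp add: cis_cnj flip: dilog_cnj)

text \<open>By the conjugate of \<open>saddle_exponent\<close> the exponent is
  \<open>(\<i> clau t + pi t / 2) / z\<close>, and the faster upward decay of the kernel turns
  \<open>pi t / 2\<close> into \<open>- pi t\<close>. Only \<open>Im z > 0\<close> is dangerous;
  there \<open>2 Re z Im z <= (norm z)^2 <= 17 (Re z)^2\<close>.\<close>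

lemma left_upper_exponent:
  assumes z: "z \<in> sector 4" and t: "0 <= t" "t <= pi / 8"
  defines "s \<equiv> \<i> * of_real t / z"
  shows "Re (of_real (pi^2 / 48) / z - 2 * z * s^2 - dilog (exp (- 8 * z * s)) / (8 * z)) - 3 * pi / 2 * Re (of_real t / z)
    <= 3 / (50 * Re z)"
proof -
  have z0: "z \<noteq> 0" using sector_nonzero[OF z] .
  have x: "Re z > 0" "\<bar>Im z\<bar> <= 4 * Re z" using z by (auto simp: sector_def)
  have e: "exp (- 8 * z * s) = cis (- (8 * t))" using z0 by (simp add: s_def cis_conv_exp mult_ac)
  have sq: "2 * z * s^2 = - (2 * of_real t ^ 2 / z)"
  proof -
    have "2 * z * s^2 = 2 * (\<i> * of_real t)^2 / z" using z0 by (simp add: s_def power2_eq_square)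
    then show ?thesis by (simp add: power_mult_distrib)
  qed
  have "cnj (2 * of_real t^2 - pi * t / 2 - dilog (cis (8 * t)) / 8 + pi^2 / 48) = cnj (- (\<i> * clau t))"
    using saddle_exponent[OF t] by simp
  then have "2 * of_real t ^ 2 - dilog (cis (- (8 * t))) / 8 + of_real (pi^2 / 48) = \<i> * clau t + of_real (pi * t / 2)"
    by (simp add: dilog_cis_minus algebra_simps)
  then have "(2 * of_real t ^ 2 - dilog (cis (- (8 * t))) / 8 + of_real (pi^2 / 48)) / z = (\<i> * clau t + of_real (pi * t / 2)) / z"
    by (rule arg_cong)
  then have "of_real (pi^2 / 48) / z - 2 * z * s^2 - dilog (exp (- 8 * z * s)) / (8 * z)
     = \<i> * clau t / z + of_real (pi * t / 2) / z"
    unfolding e sq by (simp add: add_divide_distrib diff_divide_distrib algebra_simps)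
  then have "Re (of_real (pi^2 / 48) / z - 2 * z * s^2 - dilog (exp (- 8 * z * s)) / (8 * z)) - 3 * pi / 2 * Re (of_real t / z)
     = (clau t * Im z - pi * t * Re z) / (norm z)^2"
    by (simp only: plus_complex.simps Re_of_real_divide Re_ii_divide) (simp add: diff_divide_distrib algebra_simps)
  also have "... <= 3 / (50 * Re z)"
  proof (cases "Im z <= 0")
    case True
    have "clau t * Im z <= 0" using True clau_nonneg[of t] t by (simp add: mult_nonneg_nonpos)
    moreover have "0 <= pi * t * Re z" using t x by simp
    ultimately have "(clau t * Im z - pi * t * Re z) / (norm z)^2 <= 0" by (intro divide_nonpos_nonneg) auto
    also have "0 <= 3 / (50 * Re z)" using x by simp
    finally show ?thesis .
  next
    case False
    have nz: "(norm z)^2 = (Re z)^2 + (Im z)^2" by (rule cmod_power2)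
    have "(Im z)^2 <= (4 * Re z)^2" using x by (metis abs_ge_zero power2_abs power_mono)
    then have n17: "(norm z)^2 <= 17 * (Re z)^2" unfolding nz by (simp add: power_mult_distrib)
    have am: "2 * Re z * Im z <= (norm z)^2" unfolding nz by (rule sum_squares_bound)
    have n0: "(norm z)^2 > 0" using z0 by simp
    have "50 * Re z * (clau t * Im z - pi * t * Re z) <= 25 * clau t * (norm z)^2 - 50 * (pi * t) * ((norm z)^2 / 17)"
    proof -
      have "25 * clau t * (2 * Re z * Im z) <= 25 * clau t * (norm z)^2"
        using am clau_nonneg[of t] t by (intro mult_left_mono) auto
      moreover have "50 * (pi * t) * ((norm z)^2 / 17) <= 50 * (pi * t) * (Re z)^2"
        using n17 t by (intro mult_left_mono) auto
      moreover have "50 * Re z * (clau t * Im z - pi * t * Re z) = 25 * clau t * (2 * Re z * Im z) - 50 * (pi * t) * (Re z)^2"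
        by (simp add: power2_eq_square algebra_simps)
      ultimately show ?thesis by linarith
    qed
    also have "... = (25 * clau t - 50 * (pi * t) / 17) * (norm z)^2" by (simp add: algebra_simps)
    also have "... <= 3 * (norm z)^2"
    proof (rule mult_right_mono)
      show "25 * clau t - 50 * (pi * t) / 17 <= 3"
      \<comment> \<open>From 1/20 on the linear term compensates \<open>clau t <= vol\<close>; below
        1/20 monotonicity keeps \<open>clau t\<close> close to at most 1/10.\<close>
      proof (cases "t \<ge> 1 / 20")
        case True
        have "clau t <= 27 / 200" using clau_le_vol[of t] vol_upper t by linarith
        moreover have "3 * (1 / 20) <= pi * t" using True pi_gt3 by (intro mult_mono) auto
        ultimately show ?thesis by linarith
      next
        case False
        have "clau t <= clau (1 / 20)" using False t pi_gt3 by (intro clau_mono_left) auto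
        also have "... <= 1 / 20 - 1 / 20 * ln (8 * (1 / 20)) + (1 / 20) ^ 3"
          using pi_gt3 by (intro clau_upper) auto
        also have "- ln (8 * (1 / 20)) <= (1::real)"
        proof -
          have "1 + 1 + 1 ^ 2 / 2 <= exp (1::real)" by (rule exp_lower_Taylor_quadratic) simp
          then have "5 / 2 <= exp (1::real)" by simp
          then have "ln (5 / 2) <= ln (exp (1::real))" by (intro ln_mono) auto
          then have "ln (5 / 2) <= (1::real)" by simp
          moreover have "ln (8 * (1 / 20)) = - ln (5 / 2 :: real)" by (subst ln_inverse[symmetric]) auto
          ultimately show ?thesis by simp
        qed
        then have "1 / 20 - 1 / 20 * ln (8 * (1 / 20)) + (1 / 20) ^ 3 <= 1 / 10 + (1 / 20 :: real) ^ 3" by simp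
        finally have "clau t <= 1 / 10 + (1 / 20 :: real) ^ 3" .
        moreover have "0 <= pi * t" using t by simp
        ultimately show ?thesis by (simp add: power3_eq_cube)
      qed
    qed simp
    finally show ?thesis using x n0 by (simp add: field_simps)
  qed
  finally show ?thesis .
qed

section \<open>The dominant edge: the integral along the lower half of the left side\<close>

definition low_integrand :: "complex \<Rightarrow> real \<Rightarrow> complex \<Rightarrow> real \<Rightarrow> complex" where
  "low_integrand e a z y = exp (- (\<i> * of_real (clau y) / z)) * (norm_factor z * exp (- (of_real (pi^2 / 48) / z))) *
     exp (prod_log_reg z (e * cis (4 * y))) * kern_factor a (of_real y / z)"

text \<open>\<open>saddle_exponent\<close> merges the four exponentials of order
  \<open>1 / z\<close> into the first factor of \<open>low_integrand\<close>. The remaining factors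
  are subexponential and converge at the saddle.\<close>

lemma low_integrand_eq:
  assumes z: "z \<in> sector 4" and y: "0 <= y" "y <= pi / 8" and e: "e^2 = 1"
  defines "s \<equiv> - (\<i> * (of_real y / z))"
  shows "norm_factor z * (kern a s * saddle_fun e z s) = low_integrand e a z y"
proof -
  have z0: "z \<noteq> 0" using sector_nonzero[OF z] .
  have zs: "z * s = - (\<i> * of_real y)" using z0 by (simp add: s_def)
  have "- 8 * z * s = \<i> * of_real (8 * y)" "- 4 * z * s = \<i> * of_real (4 * y)"
    using zs by (simp_all add: mult.assoc)
  then have e8: "exp (- 8 * z * s) = cis (8 * y)" and e4: "exp (- 4 * z * s) = cis (4 * y)"
    unfolding cis_conv_exp by (simp_all only:)
  have sq: "- 2 * z * s^2 = 2 * of_real y ^ 2 / z"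
  proof -
    have "- 2 * z * s^2 = - 2 * (z * s)^2 / z" using z0 by (simp add: power2_eq_square)
    then show ?thesis by (simp add: zs power_mult_distrib)
  qed
  have "(2 * of_real y^2 - pi * y / 2 - dilog (cis (8 * y)) / 8 + pi^2 / 48) / z = (- (\<i> * clau y)) / z"
    using saddle_exponent[OF y] by simp
  then have ex: "- (pi / 2 * (of_real y / z)) + (2 * of_real y ^ 2 / z - dilog (cis (8 * y)) / (8 * z)) =
     - (\<i> * of_real (clau y) / z) + - (of_real (pi^2 / 48) / z)"
    by (simp add: add_divide_distrib diff_divide_distrib algebra_simps)
  have "kern a s * saddle_fun e z s = exp (- (pi / 2 * (of_real y / z)) + (2 * of_real y ^ 2 / z - dilog (cis (8 * y)) / (8 * z)))
      * exp (prod_log_reg z (e * cis (4 * y))) * kern_factor a (of_real y / z)"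
  proof -
    have "saddle_fun e z s = exp (2 * of_real y ^ 2 / z - dilog (cis (8 * y)) / (8 * z)) * exp (prod_log_reg z (e * cis (4 * y)))"
      using saddle_fun_eq[OF z _ e, of s] unfolding e8 e4 sq by (simp add: zs)
    moreover have "kern a s = exp (- (pi / 2 * (of_real y / z))) * kern_factor a (of_real y / z)"
      unfolding s_def by (rule kern_left_lower)
    ultimately show ?thesis unfolding exp_add by (simp only: mult_ac)
  qed
  then show ?thesis unfolding ex low_integrand_def exp_add by (simp only: mult_ac)
qed

lemma continuous_on_low_integrand:
  assumes z: "z \<in> sector 4" and e: "e^2 = 1" and a: "0 < a" "a < 1"
  shows "continuous_on {0..pi / 8} (low_integrand e a z)"
proof -
  have x: "Re z > 0" using z by (simp add: sector_def)
  have z0: "z \<noteq> 0" using sector_nonzero[OF z] .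
  have e1: "norm e = 1" using e by (auto simp: power2_eq_1_iff)
  define s where "s = (\<lambda>y::real. - (\<i> * (of_real y / z)))"
  have s: "continuous_on A s" for A unfolding s_def using z0 by (intro continuous_intros) auto
  have zs: "Re (z * s y) = 0" for y using z0 by (simp add: s_def)
  have "continuous_on {0..pi / 8} (\<lambda>y. saddle_fun e z (s y))"
    by (rule continuous_on_compose2[OF holomorphic_on_imp_continuous_on[OF holomorphic_saddle_fun[OF x e1]] s])
       (use x zs in auto)
  moreover have "continuous_on {0..pi / 8} (\<lambda>y. kern a (s y))"
    unfolding kern_def
  proof (intro continuous_intros s)
    show "\<forall>y\<in>{0..pi / 8}. exp (2 * pi * \<i> * (s y - a)) - 1 \<noteq> 0"
    proof
      fix y assume y: "y \<in> {0..pi / 8}"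
      have "\<nexists>m::int. s y = of_int m + of_real a"
      proof
        assume "\<exists>m::int. s y = of_int m + of_real a"
        then obtain m :: int where m: "s y = of_int m + of_real a" ..
        have "Re (z * (of_int m + of_real a)) = 0" using zs[of y] m by simp
        then have "of_int m + a = 0" using x by (simp flip: distrib_left)
        then have "real_of_int (- 1) < of_int m" "real_of_int m < of_int 0" using a by auto
        then show False unfolding of_int_less_iff by simp
      qed
      then show "exp (2 * pi * \<i> * (s y - a)) - 1 \<noteq> 0" using kern_zero_iff[of "s y" a] by auto
    qed
  qed
  ultimately have "continuous_on {0..pi / 8} (\<lambda>y. norm_factor z * (kern a (s y) * saddle_fun e z (s y)))"
    by (intro continuous_intros)
  then show ?thesis
    by (rule continuous_on_eq) (use low_integrand_eq[OF z _ _ e] in \<open>simp add: s_def\<close>)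
qed

lemma lower_edge_integral:
  assumes z: "z \<in> sector 4" and e: "e^2 = 1" and a: "0 < a" "a < 1"
  shows "norm_factor z * contour_integral (linepath 0 (- (\<i> * of_real (pi / 8) / z))) (\<lambda>s. kern a s * saddle_fun e z s)
    = - (\<i> / z) * (LINT y|lborel. indicator {0..pi / 8} y *\<^sub>R low_integrand e a z y)"
proof -
  let ?I = "LINT u|lborel. indicator {0..pi / 8} (pi / 8 * u) *\<^sub>R low_integrand e a z (pi / 8 * u)"
  let ?J = "LINT y|lborel. indicator {0..pi / 8} y *\<^sub>R low_integrand e a z y"
  define P where "P = - (\<i> * of_real (pi / 8) / z)"
  have z0: "z \<noteq> 0" using sector_nonzero[OF z] .
  have lp: "linepath 0 P u = - (\<i> * (of_real (pi / 8 * u) / z))" for u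
    by (simp add: linepath_def P_def scaleR_conv_of_real)
  have "norm_factor z * contour_integral (linepath 0 P) (\<lambda>s. kern a s * saddle_fun e z s)
    = norm_factor z * (P * integral {0..1} (\<lambda>u. kern a (linepath 0 P u) * saddle_fun e z (linepath 0 P u)))"
    unfolding contour_integral_integral vector_derivative_linepath_at by (simp add: mult.commute)
  also have "... = P * integral {0..1} (\<lambda>u. norm_factor z * (kern a (linepath 0 P u) * saddle_fun e z (linepath 0 P u)))"
    by (simp add: mult_ac)
  also have "integral {0..1} (\<lambda>u. norm_factor z * (kern a (linepath 0 P u) * saddle_fun e z (linepath 0 P u)))
     = integral {0..1} (\<lambda>u. low_integrand e a z (pi / 8 * u))"
    unfolding lp by (intro integral_cong low_integrand_eq z e) auto
  also have "... = (LINT u:{0..1}|lborel. low_integrand e a z (pi / 8 * u))"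
  proof (rule set_borel_integral_eq_integral(2)[symmetric])
    have "continuous_on {0..1} (\<lambda>u. low_integrand e a z (pi / 8 * u))"
      by (rule continuous_on_compose2[OF continuous_on_low_integrand[OF z e a]]) (auto intro!: continuous_intros)
    then show "set_integrable lborel {0..1} (\<lambda>u. low_integrand e a z (pi / 8 * u))"
      by (rule borel_integrable_atLeastAtMost')
  qed
  also have "... = (LINT u|lborel. indicator {0..pi / 8} (pi / 8 * u) *\<^sub>R low_integrand e a z (pi / 8 * u))"
    unfolding set_lebesgue_integral_def
  proof (rule Bochner_Integration.integral_cong)
    fix u :: real
    have "0 <= pi / 8 * u \<longleftrightarrow> 0 <= u" "pi / 8 * u <= pi / 8 \<longleftrightarrow> u <= 1"
      using pi_gt_zero by (auto simp: zero_le_mult_iff simp del: pi_gt_zero)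
    then have "indicator {0..1} u = (indicator {0..pi / 8} (pi / 8 * u) :: real)" by (simp add: indicator_def)
    then show "indicator {0..1} u *\<^sub>R low_integrand e a z (pi / 8 * u) = indicator {0..pi / 8} (pi / 8 * u) *\<^sub>R low_integrand e a z (pi / 8 * u)"
      by simp
  qed simp
  finally have fin: "norm_factor z * contour_integral (linepath 0 P) (\<lambda>s. kern a s * saddle_fun e z s) = P * ?I" .
  have "(pi / 8) *\<^sub>R ?I = ?J"
    using lborel_integral_real_affine[of "pi / 8" "\<lambda>y. indicator {0..pi / 8} y *\<^sub>R low_integrand e a z y" 0] by simp
  moreover have "P * ?I = - (\<i> / z) * ((pi / 8) *\<^sub>R ?I)" unfolding P_def scaleR_conv_of_real by (simp add: mult.commute)
  ultimately show ?thesis using fin unfolding P_def by simp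
qed

text \<open>Both horizontal sides, the right side and the upper half of the left side are at most
  \<open>exp (3 / (50 Re z))\<close> up to subexponential factors. That is smaller than the saddle
  value \<open>exp (vol / (2 Re z))\<close>, because \<open>vol / 2 >= 1/16\<close>.\<close>

lemma half_sum_lower_edge:
  assumes a: "0 < a" "a < 1"
  obtains C where "0 < C"
    "\<And>z p N. z \<in> sector 4 ==> Re z <= 1 / 50 ==> p^2 = 1 ==> 1 <= Re z * real N ==>
      norm (half_sum p a N z + \<i> / z * (LINT y|lborel. indicator {0..pi / 8} y *\<^sub>R low_integrand p a z y))
      <= exp (3 / (50 * Re z) + C / sqrt (Re z)) * (2 * real N + 2 / Re z)"
proof -
  obtain C1 where C1: "0 < C1" "\<And>z p s. z \<in> sector 4 ==> Re z <= 1 ==> p^2 = 1 ==> 0 <= Re (z * s) ==>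
      norm (norm_factor z * saddle_fun p z s) <=
        C1 * exp (C1 / sqrt (Re z)) * exp (Re (of_real (pi^2 / 48) / z - 2 * z * s^2 - dilog (exp (- 8 * z * s)) / (8 * z)))"
    using norm_saddle_bound by blast
  obtain c where c: "0 < c" "\<And>w::complex. 0 <= Re w ==> \<bar>Im w\<bar> <= 4 * Re w ==> norm (kern_factor a w) <= c"
    "\<And>w::complex. 0 <= Re w ==> \<bar>Im w\<bar> <= 4 * Re w ==> norm (kern a (\<i> * w)) <= c * exp (- (3 * pi / 2 * Re w))"
    using kern_left_bound[of 4 a] a by auto
  define K where "K = C1 * (2 + c)"
  show ?thesis
  proof (rule that)
    show "0 < C1 + K" using C1(1) c(1) unfolding K_def by (intro add_pos_pos mult_pos_pos) auto
    fix z p :: complex and N :: nat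
    assume z: "z \<in> sector 4" "Re z <= 1 / 50" and p: "p^2 = 1" and N: "1 <= Re z * real N"
    define h where "h = Re z"
    have h: "0 < h" "\<bar>Im z\<bar> <= 4 * h" "h <= 1 / 50" using z by (auto simp: sector_def h_def)
    have z0: "z \<noteq> 0" using sector_nonzero[OF z(1)] .
    have p1: "norm p = 1" using p by (auto simp: power2_eq_1_iff)
    have nz: "(norm z)^2 = h^2 + (Im z)^2" unfolding h_def by (rule cmod_power2)
    have "(Im z)^2 <= (4 * h)^2" using h by (metis abs_ge_zero power2_abs power_mono)
    then have n17: "(norm z)^2 <= 17 * h^2" unfolding nz by (simp add: power_mult_distrib)
    have n0: "(norm z)^2 > 0" using z0 by simp
    define Q where "Q = \<i> * of_real (pi / 8) / z"
    define B where "B = K * exp (C1 / sqrt h) * exp (3 / (50 * h))"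
    define f where "f = (\<lambda>s. kern a s * saddle_fun p z s)"
    have K: "2 * C1 <= K" "c * C1 <= K" "0 < K" using C1(1) c(1) by (auto simp: K_def algebra_simps add_pos_pos)
    have B: "0 <= B" using K by (simp add: B_def)
    have bound: "norm (norm_factor z * f s) <= B"
      if k: "norm (kern a s) <= k * exp e" "k * C1 <= K" "0 <= k" and s: "0 <= Re (z * s)"
        and e: "e + Re (of_real (pi^2 / 48) / z - 2 * z * s^2 - dilog (exp (- 8 * z * s)) / (8 * z)) <= 3 / (50 * h)"
      for s k e
    proof -
      define E where "E = Re (of_real (pi^2 / 48) / z - 2 * z * s^2 - dilog (exp (- 8 * z * s)) / (8 * z))"
      have "norm (norm_factor z * f s) = norm (kern a s) * norm (norm_factor z * saddle_fun p z s)"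
        by (simp add: f_def norm_mult)
      also have "... <= (k * exp e) * (C1 * exp (C1 / sqrt h) * exp E)"
        unfolding E_def h_def using C1(2)[OF z(1) _ p s] z(2) k by (intro mult_mono) auto
      also have "... = (k * C1) * exp (C1 / sqrt h) * exp (e + E)" by (simp add: exp_add)
      also have "... <= K * exp (C1 / sqrt h) * exp (3 / (50 * h))"
        using k e K by (intro mult_mono) (auto simp: E_def)
      finally show ?thesis unfolding B_def .
    qed
    have ImQ: "Im Q = pi / 8 * h / (norm z)^2" unfolding Q_def Re_ii_divide h_def by simp
    \<comment> \<open>The kernel bounds need \<open>\<bar>Im s\<bar> >= 1\<close>; this is where
      \<open>Re z <= 1 / 50\<close> enters, through \<open>17 / 50 <= pi / 8\<close>.\<close>
    have ImQ1: "1 <= Im Q"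
    proof -
      have "17 * h^2 <= pi / 8 * h" using h pi_gt3 by (simp add: power2_eq_square)
      then have "(norm z)^2 <= pi / 8 * h" using n17 by linarith
      then show ?thesis unfolding ImQ using n0 by (simp add: field_simps)
    qed
    have zQ: "z * Q = \<i> * of_real (pi / 8)" using z0 by (simp add: Q_def)
    \<comment> \<open>\<open>25 / 36 / 16\<close> is about 0.043, below 0.06.\<close>
    have ln2: "ln 2 / (16 * h) <= 3 / (50 * h)"
      using ln2_le_25_over_36 h by (simp add: field_simps)
    have horiz: "norm (norm_factor z * f s) <= B"
      if s: "s = of_real d * Q + of_real t" and t: "0 <= t" and d: "d = 1 \<or> d = - 1" for s d t
    proof (rule bound[of _ 2 "- (pi / 2 * Im Q)"])
      show "norm (kern a s) <= 2 * exp (- (pi / 2 * Im Q))"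
        using d
      proof
        assume "d = 1"
        then have "Im s = Im Q" using s by simp
        then have "norm (kern a s) <= 2 * exp (- (3 * pi / 2 * Im Q))" using kern_bound_up[of s a] ImQ1 by simp
        also have "... <= 2 * exp (- (pi / 2 * Im Q))" using ImQ1 by simp
        finally show ?thesis .
      next
        assume "d = - 1"
        then have "Im s = - Im Q" using s by simp
        then show ?thesis using kern_bound_down[of s a] ImQ1 by simp
      qed
      show "0 <= Re (z * s)" using s t h by (simp add: distrib_left mult.left_commute[of z] zQ h_def)
      show "- (pi / 2 * Im Q) + Re (of_real (pi^2 / 48) / z - 2 * z * s^2 - dilog (exp (- 8 * z * s)) / (8 * z)) <= 3 / (50 * h)"
        using horizontal_exponent[OF z(1) t d] ln2 unfolding s ImQ unfolding Q_def h_def by linarith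
    qed (use K in auto)
    have sect: "0 <= Re (of_real y / z)" "\<bar>Im (of_real y / z)\<bar> <= 4 * Re (of_real y / z)" if "0 <= y" for y
    proof -
      show "0 <= Re (of_real y / z)" unfolding Re_of_real_divide using that h by (simp add: h_def)
      have "\<bar>Im (of_real y / z)\<bar> = y * \<bar>Im z\<bar> / (norm z)^2"
        using that by (simp add: Im_divide cmod_power2 abs_mult)
      also have "... <= y * (4 * h) / (norm z)^2" using that h by (intro divide_right_mono mult_left_mono) auto
      also have "... = 4 * Re (of_real y / z)" unfolding Re_of_real_divide h_def by simp
      finally show "\<bar>Im (of_real y / z)\<bar> <= 4 * Re (of_real y / z)" .
    qed
    have right: "norm (norm_factor z * f s) <= B"
      if s: "s = \<i> * of_real y / z + of_nat N" and y: "\<bar>y\<bar> <= pi / 8" for s y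
    proof (rule bound[of _ c 0])
      have "norm (kern a s) = norm (kern a (\<i> * (of_real y / z)))" unfolding s kern_periodic by simp
      also have "... <= c"
      proof (cases "y \<ge> 0")
        case True
        have "norm (kern a (\<i> * (of_real y / z))) <= c * exp (- (3 * pi / 2 * Re (of_real y / z)))" by (intro c sect True)
        also have "... <= c * 1" using sect(1)[OF True] c by (intro mult_left_mono) auto
        finally show ?thesis by simp
      next
        case False
        have "norm (kern a (\<i> * (of_real y / z))) = norm (kern a (- (\<i> * (of_real (- y) / z))))" by simp
        also have "... = exp (- (pi / 2 * Re (of_real (- y) / z))) * norm (kern_factor a (of_real (- y) / z))"

          unfolding kern_left_lower norm_mult norm_exp_eq_Re uminus_complex.simps times_complex.simps by simp
        also have "... <= 1 * c"
        proof (rule mult_mono)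
          have y': "0 <= - y" using False by simp
          show "norm (kern_factor a (of_real (- y) / z)) <= c" by (rule c(2)[OF sect[OF y']])
          have "0 <= pi / 2 * Re (of_real (- y) / z)" using sect(1)[OF y'] by (intro mult_nonneg_nonneg) auto
          then show "exp (- (pi / 2 * Re (of_real (- y) / z))) <= 1" unfolding exp_le_one_iff by linarith
        qed auto
        finally show ?thesis by simp
      qed
      finally show "norm (kern a s) <= c * exp 0" by simp
      show "0 <= Re (z * s)" using s z0 h by (simp add: distrib_left h_def)
      have "0 <= 3 / (50 * h)" using h by simp
      then show "0 + Re (of_real (pi^2 / 48) / z - 2 * z * s^2 - dilog (exp (- 8 * z * s)) / (8 * z)) <= 3 / (50 * h)"
        using right_exponent[OF z(1) y N] unfolding s by linarith
    qed (use K c in auto)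
    have left: "norm (norm_factor z * f s) <= B" if s: "s = \<i> * of_real y / z" and y: "0 <= y" "y <= pi / 8" for s y
    proof (rule bound[of _ c "- (3 * pi / 2 * Re (of_real y / z))"])
      show "norm (kern a s) <= c * exp (- (3 * pi / 2 * Re (of_real y / z)))"
        using c(3)[OF sect[OF y(1)]] unfolding s by simp
      show "0 <= Re (z * s)" using s z0 by simp
      show "- (3 * pi / 2 * Re (of_real y / z)) + Re (of_real (pi^2 / 48) / z - 2 * z * s^2 - dilog (exp (- 8 * z * s)) / (8 * z)) <= 3 / (50 * h)"
        using left_upper_exponent[OF z(1) y] unfolding s h_def by linarith
    qed (use K c in auto)
    have Q': "- Q = of_real (- 1) * Q" "Q = of_real 1 * Q" by simp_all
    define P where "P = - Q"
    have nQ: "norm Q <= 1 / (2 * h)"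
    proof -
      have "norm Q = pi / 8 / norm z" by (simp add: Q_def norm_divide norm_mult)
      also have "... <= (1 / 2) / h" by (rule frac_le) (use pi_less_4 h complex_Re_le_cmod[of z] in \<open>auto simp: h_def\<close>)
      finally show ?thesis by simp
    qed
    have i1: "norm (norm_factor z * contour_integral (linepath P (P + of_nat N)) f) <= B * N"
    proof -
      have "norm (norm_factor z * f s) <= B" if s: "s \<in> closed_segment P (P + of_nat N)" for s
      proof -
        obtain t where "0 <= t" "s = P + of_real t" using closed_segment_add_real[OF s] by metis
        then show ?thesis by (intro horiz[of s "- 1" t]) (auto simp: P_def)
      qed
      then show ?thesis using norm_contour_integral_linepath_le[OF B norm_factor_nonzero[of z], where f = f] by fastforce
    qed
    have i3: "norm (norm_factor z * contour_integral (linepath (Q + of_nat N) Q) f) <= B * N"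
    proof -
      have "norm (norm_factor z * f s) <= B" if s: "s \<in> closed_segment (Q + of_nat N) Q" for s
      proof -
        obtain t where "0 <= t" "s = Q + of_real t"
          using closed_segment_add_real[of s Q N] s by (metis closed_segment_commute)
        then show ?thesis by (intro horiz[of s 1 t]) auto
      qed
      then show ?thesis using norm_contour_integral_linepath_le[OF B norm_factor_nonzero[of z], where f = f] by fastforce
    qed
    have i2: "norm (norm_factor z * contour_integral (linepath (P + of_nat N) (Q + of_nat N)) f) <= B * norm (Q + of_nat N - (P + of_nat N))"
    proof (rule norm_contour_integral_linepath_le[OF B norm_factor_nonzero])
      fix s assume "s \<in> closed_segment (P + of_nat N) (Q + of_nat N)"
      then obtain u where u: "0 <= u" "u <= 1" "s = (1 - u) *\<^sub>R (P + of_nat N) + u *\<^sub>R (Q + of_nat N)"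
        by (auto simp: in_segment)
      show "norm (norm_factor z * f s) <= B"
      proof (rule right[of _ "(2 * u - 1) * (pi / 8)"])
        show "s = \<i> * of_real ((2 * u - 1) * (pi / 8)) / z + of_nat N"
          unfolding u P_def Q_def by (simp add: scaleR_conv_of_real add_divide_distrib diff_divide_distrib algebra_simps)
        have "\<bar>2 * u - 1\<bar> * (pi / 8) <= 1 * (pi / 8)" using u by (intro mult_right_mono) auto
        then show "\<bar>(2 * u - 1) * (pi / 8)\<bar> <= pi / 8" by (simp add: abs_mult)
      qed
    qed
    have i4: "norm (norm_factor z * contour_integral (linepath Q 0) f) <= B * norm (0 - Q)"
    proof (rule norm_contour_integral_linepath_le[OF B norm_factor_nonzero])
      fix s assume "s \<in> closed_segment Q 0"
      then obtain u where u: "0 <= u" "u <= 1" "s = (1 - u) *\<^sub>R Q + u *\<^sub>R 0"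
        by (auto simp: in_segment)
      show "norm (norm_factor z * f s) <= B"
        by (rule left[of _ "(1 - u) * (pi / 8)"]) (use u in \<open>auto simp: Q_def scaleR_conv_of_real mult_ac mult_left_le_one_le\<close>)
    qed
    have hol: "saddle_fun p z holomorphic_on {s. Re (z * s) > - (h / 4)}"
      unfolding h_def by (rule holomorphic_saddle_fun) (use h p1 in \<open>auto simp: h_def\<close>)
    have contl: "continuous_on (closed_segment Q P) f"
    proof -
      have seg: "Re (z * s) = 0" if "s \<in> closed_segment Q P" for s
      proof -
        from that obtain u where u: "s = (1 - u) *\<^sub>R Q + u *\<^sub>R P" by (auto simp: in_segment)
        have "z * s = (1 - u) *\<^sub>R (z * Q) - u *\<^sub>R (z * Q)" unfolding u P_def by (simp add: scaleR_conv_of_real algebra_simps)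
        then show ?thesis unfolding zQ by simp
      qed
      have "continuous_on (closed_segment Q P) (saddle_fun p z)"
        by (rule continuous_on_subset[OF holomorphic_on_imp_continuous_on[OF hol]]) (use h seg in auto)
      moreover have "exp (2 * pi * \<i> * (s - a)) - 1 \<noteq> 0" if "s \<in> closed_segment Q P" for s :: complex
      proof -
        have "\<nexists>m::int. s = of_int m + of_real a"
        proof
          assume "\<exists>m::int. s = of_int m + of_real a"
          then obtain m :: int where m: "s = of_int m + of_real a" ..
          have "Re (z * (of_int m + of_real a)) = 0" using seg[OF that] m by simp
          then have "of_int m + a = 0" using h by (simp add: h_def flip: distrib_left)
          then have "real_of_int (- 1) < of_int m" "real_of_int m < of_int 0" using a by auto
          then show False unfolding of_int_less_iff by simp
        qed
        then show ?thesis using kern_zero_iff[of s a] by auto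
      qed
      ultimately show ?thesis unfolding f_def kern_def by (intro continuous_intros) auto
    qed
    \<comment> \<open>The left side is cut at 0: its upper half joins the error, its lower half is
      the main term.\<close>
    have "contour_integral (linepath Q P) f = contour_integral (linepath Q 0) f + contour_integral (linepath 0 P) f"
    proof (rule contour_integral_split_linepath[OF contl])
      have "0 = (1 - 1 / 2) *\<^sub>R Q + (1 / 2) *\<^sub>R P" by (simp add: P_def)
      then show "0 \<in> closed_segment Q P" unfolding in_segment by (intro exI[of _ "1 / 2"]) simp
    qed
    then have "(\<Sum>m<N. (- \<i>) ^ m * saddle_fun p z (of_nat m + of_real a)) =
      contour_integral (linepath P (P + of_nat N)) f + (contour_integral (linepath (P + of_nat N) (Q + of_nat N)) f
      + (contour_integral (linepath (Q + of_nat N) Q) f + (contour_integral (linepath Q 0) f + contour_integral (linepath 0 P) f)))"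
      using contour_sum[OF hol, of "pi / 8" a N] h a unfolding f_def P_def Q_def by (simp add: h_def)
    then have hs: "half_sum p a N z - norm_factor z * contour_integral (linepath 0 P) f =
      norm_factor z * contour_integral (linepath P (P + of_nat N)) f + norm_factor z * contour_integral (linepath (P + of_nat N) (Q + of_nat N)) f
      + norm_factor z * contour_integral (linepath (Q + of_nat N) Q) f + norm_factor z * contour_integral (linepath Q 0) f"
      unfolding half_sum_def by (simp add: algebra_simps)
    have "norm (half_sum p a N z - norm_factor z * contour_integral (linepath 0 P) f)
       <= B * N + B * norm (Q + of_nat N - (P + of_nat N)) + B * N + B * norm (0 - Q)"
      unfolding hs by (intro norm_triangle_le add_mono i1 i2 i3 i4)
    also have "... = B * (2 * real N + 3 * norm Q)"
    proof -
      have "Q + of_nat N - (P + of_nat N) = 2 * Q" by (simp add: P_def)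
      then have "norm (Q + of_nat N - (P + of_nat N)) = 2 * norm Q" by (simp only: norm_mult norm_numeral)
      then show ?thesis by (simp add: algebra_simps)
    qed
    also have "... <= B * (2 * real N + 2 / h)"
    proof (rule mult_left_mono[OF _ B])
      have "3 * norm Q <= 3 * (1 / (2 * h))" using nQ by simp
      also have "... <= 2 / h" using h by (simp add: field_simps)
      finally show "2 * real N + 3 * norm Q <= 2 * real N + 2 / h" by simp
    qed
    also have "... <= exp (3 / (50 * h) + (C1 + K) / sqrt h) * (2 * real N + 2 / h)"
    proof (rule mult_right_mono)
      \<comment> \<open>The constant \<open>K\<close> is moved into the exponent as
        \<open>K / sqrt h\<close>, so that a single constant describes the bound.\<close>
      have "K <= K / sqrt h"
      proof -
        have "sqrt h <= 1" using h by simp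
        then show ?thesis using K h by (simp add: field_simps)
      qed
      then have "K <= exp (K / sqrt h)" using exp_ge_add_one_self[of "K / sqrt h"] by linarith
      then have "B <= exp (K / sqrt h) * exp (C1 / sqrt h) * exp (3 / (50 * h))"
        unfolding B_def by (intro mult_right_mono) auto
      also have "... = exp (3 / (50 * h) + (C1 + K) / sqrt h)" by (simp add: add_divide_distrib flip: exp_add)
      finally show "B <= exp (3 / (50 * h) + (C1 + K) / sqrt h)" .
    qed (use h in simp)
    also have "norm_factor z * contour_integral (linepath 0 P) f
      = - (\<i> / z) * (LINT y|lborel. indicator {0..pi / 8} y *\<^sub>R low_integrand p a z y)"
      unfolding P_def Q_def f_def by (rule lower_edge_integral[OF z(1) p a])
    finally show "norm (half_sum p a N z + \<i> / z * (LINT y|lborel. indicator {0..pi / 8} y *\<^sub>R low_integrand p a z y))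
      <= exp (3 / (50 * Re z) + (C1 + K) / sqrt (Re z)) * (2 * real N + 2 / Re z)"
      by (simp add: h_def)
  qed
qed

subsection \<open>Gaussian integrals with complex parameter\<close>

lemma integrable_exp_square:
  fixes c :: real
  assumes "c > 0"
  shows "integrable lborel (\<lambda>x. exp (- (c * x^2)))"
proof -
  have "integrable lborel (normal_density 0 (sqrt (1 / (2 * c))))"
    using assms by (intro integrable_normal_density) auto
  then have "integrable lborel (\<lambda>x. sqrt (2 * pi * (1 / (2 * c))) * normal_density 0 (sqrt (1 / (2 * c))) x)"
    by (rule integrable_mult_right)
  also have "(\<lambda>x. sqrt (2 * pi * (1 / (2 * c))) * normal_density 0 (sqrt (1 / (2 * c))) x) = (\<lambda>x. exp (- (c * x^2)))"
    using assms by (auto simp: normal_density_def fun_eq_iff field_simps)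
  finally show ?thesis .
qed

lemma integrable_complex_exp_square:
  assumes "Re a > 0"
  shows "integrable lborel (\<lambda>x::real. exp (- (a * of_real (x^2))))"
  by (rule Bochner_Integration.integrable_bound[OF integrable_exp_square[OF assms]])
     (auto intro!: borel_measurable_continuous_onI continuous_intros)

lemma gaussian_interval_tendsto:
  assumes "Re a > 0"
  shows "(\<lambda>k. integral {- real k..real k} (\<lambda>x. exp (- (a * of_real (x^2))))) \<longlonglongrightarrow> (LINT x|lborel. exp (- (a * of_real (x^2))))"
proof -
  have "(\<lambda>k. LINT x|lborel. indicator {- real k..real k} x *\<^sub>R exp (- (a * of_real (x^2)))) \<longlonglongrightarrow> (LINT x|lborel. exp (- (a * of_real (x^2))))"
  proof (rule integral_dominated_convergence[where w = "\<lambda>x. norm (exp (- (a * of_real (x^2))))"])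
    show "integrable lborel (\<lambda>x. norm (exp (- (a * of_real (x^2)))))"
      by (rule integrable_norm[OF integrable_complex_exp_square[OF assms]])
    show "AE x in lborel. (\<lambda>k. indicator {- real k..real k} x *\<^sub>R exp (- (a * of_real (x^2)))) \<longlonglongrightarrow> exp (- (a * of_real (x^2)))"
    proof (rule AE_I2)
      fix x :: real
      obtain K :: nat where K: "\<bar>x\<bar> <= real K" using real_arch_simple by blast
      show "(\<lambda>k. indicator {- real k..real k} x *\<^sub>R exp (- (a * of_real (x^2)))) \<longlonglongrightarrow> exp (- (a * of_real (x^2)))"
        by (rule tendsto_eventually, rule eventually_sequentiallyI[of K]) (use K in \<open>auto simp: indicator_def\<close>)
    qed
  qed (auto intro!: borel_measurable_continuous_onI continuous_intros borel_measurable_scaleR simp: indicator_def)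
  moreover have "(LINT x|lborel. indicator {- real k..real k} x *\<^sub>R exp (- (a * of_real (x^2)))) = integral {- real k..real k} (\<lambda>x. exp (- (a * of_real (x^2))))" for k
    unfolding set_lebesgue_integral_def[symmetric]
    by (rule set_borel_integral_eq_integral(2), rule borel_integrable_atLeastAtMost') (auto intro!: continuous_intros)
  ultimately show ?thesis by simp
qed

text \<open>Rotating the line of integration onto the real axis.\<close>

lemma gaussian_integral_nonzero:
  fixes a :: complex
  assumes a: "Re a > 0"
  shows "(LINT x|lborel. exp (- (a * of_real (x^2)))) \<noteq> 0"
proof -
  \<comment> \<open>Substituting \<open>s x\<close> for \<open>x\<close> compares with the case
    \<open>a = 1\<close>. As \<open>\<bar>Im s\<bar> < Re s\<close>, the whole segment from 1 to
    \<open>s\<close> lies where \<open>Re (p^2) > 0\<close>, so the error primitive \<open>E\<close>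
    changes by a vanishing amount between \<open>R\<close> and \<open>R s\<close>.\<close>
  define s where "s = csqrt a"
  have sa: "s^2 = a" by (simp add: s_def)
  have sq: "Re (w^2) = (Re w - \<bar>Im w\<bar>) * (Re w + \<bar>Im w\<bar>)" for w by (simp add: Re_power2 algebra_simps power2_eq_square)
  have "0 <= Re s" using csqrt_principal[of a] by (auto simp: s_def)
  moreover have "0 < (Re s - \<bar>Im s\<bar>) * (Re s + \<bar>Im s\<bar>)" using sq[of s] a sa by simp
  ultimately have s: "\<bar>Im s\<bar> < Re s" by (auto simp: zero_less_mult_iff)
  obtain E :: "complex \<Rightarrow> complex" where E: "\<And>w. (E has_field_derivative exp (- w\<^sup>2)) (at w)"
  proof -
    have "(\<lambda>w::complex. exp (- w\<^sup>2)) holomorphic_on UNIV" by (intro holomorphic_intros)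
    from holomorphic_convex_primitive'[OF convex_UNIV open_UNIV this] obtain g :: "complex \<Rightarrow> complex" where "\<And>w. w \<in> UNIV ==> (g has_field_derivative exp (- w\<^sup>2)) (at w)" by blast
    then show ?thesis by (intro that[of g]) simp
  qed
  have int: "p * integral {- R..R} (\<lambda>x. exp (- (p^2 * of_real (x^2)))) = E (p * of_real R) - E (- (p * of_real R))" if "R \<ge> 0" for p :: complex and R :: real
  proof -
    have d: "((\<lambda>x. E (p * of_real x)) has_vector_derivative p * exp (- (p^2 * of_real (x^2)))) (at x within A)" for x A
    proof -
      have "((\<lambda>w. E (p * w)) has_field_derivative exp (- (p * of_real x)\<^sup>2) * p) (at (of_real x))"
        by (rule DERIV_chain2[OF E]) (auto intro!: derivative_eq_intros)
      from has_vector_derivative_real_field[OF this] show ?thesis by (simp add: power_mult_distrib mult_ac)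
    qed
    have "((\<lambda>x. p * exp (- (p^2 * of_real (x^2)))) has_integral (E (p * of_real R) - E (p * of_real (- R)))) {- R..R}"
      by (rule fundamental_theorem_of_calculus) (use that d in auto)
    from integral_unique[OF this]
    have "integral {- R..R} (\<lambda>x. p * exp (- (p^2 * of_real (x^2)))) = E (p * of_real R) - E (- (p * of_real R))"
      unfolding of_real_minus mult_minus_right .
    then show ?thesis unfolding integral_mult_right .
  qed
  have segpos: "0 < Re (p^2)" if p: "p \<in> closed_segment 1 s" for p
  proof -
    obtain u where u: "0 <= u" "u <= 1" "p = (1 - u) *\<^sub>R 1 + u *\<^sub>R s" using p by (auto simp: in_segment)
    have "u * \<bar>Im s\<bar> < (1 - u) + u * Re s"
    proof (cases "u = 0")
      case False
      then have "u * \<bar>Im s\<bar> < u * Re s" using u s by (intro mult_strict_left_mono) auto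
      then show ?thesis using u by linarith
    qed simp
    moreover have "\<bar>Im p\<bar> = u * \<bar>Im s\<bar>" using u by (simp add: abs_mult)
    moreover have "Re p = (1 - u) + u * Re s" using u by simp
    ultimately have "\<bar>Im p\<bar> < Re p" by simp
    then show ?thesis unfolding sq by (intro mult_pos_pos) auto
  qed
  obtain p0 where p0: "p0 \<in> closed_segment 1 s" "\<And>p. p \<in> closed_segment 1 s ==> Re (p0^2) <= Re (p^2)"
  proof -
    have "continuous_on (closed_segment 1 s) (\<lambda>p. Re (p^2))" by (intro continuous_intros)
    then have "\<exists>x\<in>closed_segment 1 s. \<forall>y\<in>closed_segment 1 s. Re (x^2) <= Re (y^2)"
      by (intro continuous_attains_inf) auto
    then show ?thesis using that by blast
  qed
  define c where "c = Re (p0^2)"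
  have c: "c > 0" using segpos[OF p0(1)] by (simp add: c_def)
  have diff: "norm (E (of_real R * s) - E (of_real R * 1)) <= exp (- (c * R^2)) * (\<bar>R\<bar> * norm (s - 1))" for R :: real
  proof -
    have "norm (E (of_real R * s) - E (of_real R * 1)) <= (\<bar>R\<bar> * exp (- (c * R^2))) * norm (s - 1)"
    proof (rule field_differentiable_bound[of "closed_segment 1 s" "\<lambda>p. E (of_real R * p)" "\<lambda>p. exp (- (of_real R * p)\<^sup>2) * of_real R"])
      fix p assume p: "p \<in> closed_segment 1 s"
      show "((\<lambda>p. E (of_real R * p)) has_field_derivative exp (- (of_real R * p)\<^sup>2) * of_real R) (at p within closed_segment 1 s)"
        by (rule has_field_derivative_at_within, rule DERIV_chain2[OF E]) (auto intro!: derivative_eq_intros)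
      have "norm (exp (- (of_real R * p)\<^sup>2) * of_real R) = exp (- (R^2 * Re (p^2))) * \<bar>R\<bar>"
        by (simp add: norm_mult power_mult_distrib flip: of_real_power)
      also have "... <= exp (- (R^2 * c)) * \<bar>R\<bar>"
        using p0(2)[OF p] by (intro mult_right_mono) (auto intro!: mult_left_mono simp: c_def)
      finally show "norm (exp (- (of_real R * p)\<^sup>2) * of_real R) <= \<bar>R\<bar> * exp (- (c * R^2))" by (simp add: mult_ac)
    qed auto
    then show ?thesis by (simp add: mult_ac)
  qed
  have lim0: "(\<lambda>k. exp (- (c * (real k)^2)) * (\<bar>real k\<bar> * norm (s - 1))) \<longlonglongrightarrow> 0"
  proof -
    have "(\<lambda>k. exp (- (c * (real k)^2)) * real k) \<longlonglongrightarrow> 0" using c by real_asymp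
    from tendsto_mult_left_zero[OF this, of "norm (s - 1)"] show ?thesis by (simp add: mult_ac)
  qed
  have l1: "(\<lambda>k. E (of_real (real k) * s) - E (of_real (real k) * 1)) \<longlonglongrightarrow> 0"
    by (rule Lim_null_comparison[OF _ lim0]) (intro always_eventually allI diff)
  have l2: "(\<lambda>k. E (of_real (- real k) * s) - E (of_real (- real k) * 1)) \<longlonglongrightarrow> 0"
  proof (rule Lim_null_comparison[OF _ lim0], intro always_eventually allI)
    fix k show "norm (E (of_real (- real k) * s) - E (of_real (- real k) * 1)) <= exp (- (c * (real k)^2)) * (\<bar>real k\<bar> * norm (s - 1))"
      using diff[of "- real k"] by simp
  qed
  have L1: "(\<lambda>k. integral {- real k..real k} (\<lambda>x. exp (- ((1::complex) * of_real (x^2))))) \<longlonglongrightarrow> (LINT x|lborel. exp (- ((1::complex) * of_real (x^2))))"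
    by (rule gaussian_interval_tendsto) simp
  have La: "(\<lambda>k. s * integral {- real k..real k} (\<lambda>x. exp (- (a * of_real (x^2))))) \<longlonglongrightarrow> s * (LINT x|lborel. exp (- (a * of_real (x^2))))"
    by (intro tendsto_intros gaussian_interval_tendsto a)
  have eq: "s * integral {- real k..real k} (\<lambda>x. exp (- (a * of_real (x^2)))) - integral {- real k..real k} (\<lambda>x. exp (- ((1::complex) * of_real (x^2))))
     = (E (of_real (real k) * s) - E (of_real (real k) * 1)) - (E (of_real (- real k) * s) - E (of_real (- real k) * 1))" for k
    using int[of "real k" s] int[of "real k" 1] unfolding sa by (simp add: mult.commute)
  have "(\<lambda>k. s * integral {- real k..real k} (\<lambda>x. exp (- (a * of_real (x^2)))) - integral {- real k..real k} (\<lambda>x. exp (- ((1::complex) * of_real (x^2))))) \<longlonglongrightarrow> 0 - 0"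
    unfolding eq by (intro tendsto_diff l1 l2)
  from LIMSEQ_unique[OF this tendsto_diff[OF La L1]]
  have "s * (LINT x|lborel. exp (- (a * of_real (x^2)))) = (LINT x|lborel. exp (- ((1::complex) * of_real (x^2))))" by simp
  also have "... = (LINT x|lborel. complex_of_real (exp (- x\<^sup>2)))"
    by (simp add: exp_of_real[symmetric])
  also have "... = of_real (LINT x|lborel. exp (- x\<^sup>2))" by simp
  also have "... \<noteq> 0"
  proof -
    have "(LINT x|lborel. normal_density 0 (sqrt (1 / 2)) x) = 1" by (rule integral_normal_density) simp
    moreover have "normal_density 0 (sqrt (1 / 2)) x = exp (- x\<^sup>2) / sqrt pi" for x by (simp add: normal_density_def)
    ultimately have "(LINT x|lborel. exp (- x\<^sup>2) / sqrt pi) = 1" by (simp only:)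
    then have "(LINT x|lborel. exp (- x\<^sup>2)) / sqrt pi = 1" by (simp only: integral_divide_zero)
    then have "(LINT x::real|lborel. exp (- x\<^sup>2)) \<noteq> 0" by force
    then show ?thesis by (simp only: of_real_eq_0_iff not_False_eq_True)
  qed
  finally show ?thesis by auto
qed

subsection \<open>Laplace's method on the lower edge\<close>

definition lower_integral :: "complex \<Rightarrow> real \<Rightarrow> complex \<Rightarrow> complex" where
  "lower_integral e a z = (LINT y|lborel. indicator {0..pi / 8} y *\<^sub>R low_integrand e a z y)"

lemma norm_low_integrand:
  "norm (low_integrand e a z y) = exp (- (clau y * (Im z / (norm z)^2))) * norm (norm_factor z * exp (- (of_real (pi^2 / 48) / z)))
     * exp (Re (prod_log_reg z (e * cis (4 * y)))) * norm (kern_factor a (of_real y / z))"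
proof -
  have "Re (- (\<i> * of_real (clau y) / z)) = - (clau y * (Im z / (norm z)^2))"
    unfolding uminus_complex.simps Re_ii_divide by simp
  then show ?thesis unfolding low_integrand_def norm_mult norm_exp_eq_Re by simp
qed

lemma low_integrand_prefactor_bound:
  assumes a: "0 < a" "a < 1"
  obtains C where "0 < C" "\<And>z y e. z \<in> sector 4 ==> Re z <= 1 ==> 0 <= y ==>
      norm (norm_factor z * exp (- (of_real (pi^2 / 48) / z))) * norm (kern_factor a (of_real y / z)) <= C"
proof -
  obtain c where c: "0 < c" "\<And>w::complex. 0 <= Re w ==> \<bar>Im w\<bar> <= 4 * Re w ==> norm (kern_factor a w) <= c"
    using kern_left_bound[of 4 a] a by (metis one_le_numeral)
  obtain Cn where Cn: "0 < Cn" "\<And>z. z \<in> sector 4 ==> Re z <= 1 ==> norm (norm_factor z) <= Cn * exp (Re (of_real (pi^2 / 48) / z))"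
    using norm_norm_factor_le[of 4] by auto
  show ?thesis
  proof (rule that)
    show "0 < Cn * c" using Cn c by simp
    fix z :: complex and y :: real and e :: complex
    assume z: "z \<in> sector 4" "Re z <= 1" and y: "0 <= y"
    have h: "0 < Re z" "\<bar>Im z\<bar> <= 4 * Re z" using z by (auto simp: sector_def)
    have 1: "0 <= Re (of_real y / z)" unfolding Re_of_real_divide using y h by simp
    have "\<bar>Im (of_real y / z)\<bar> = y * \<bar>Im z\<bar> / (norm z)^2"
      using y by (simp add: Im_divide cmod_power2 abs_mult)
    also have "... <= y * (4 * Re z) / (norm z)^2" using y h by (intro divide_right_mono mult_left_mono) auto
    also have "... = 4 * Re (of_real y / z)" unfolding Re_of_real_divide by simp
    finally have k: "norm (kern_factor a (of_real y / z)) <= c" using c(2)[OF 1] by simp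
    have "norm (norm_factor z * exp (- (of_real (pi^2 / 48) / z))) <= (Cn * exp (Re (of_real (pi^2 / 48) / z))) * exp (- Re (of_real (pi^2 / 48) / z))"
      unfolding norm_mult norm_exp_eq_Re uminus_complex.simps using Cn(2)[OF z] by (intro mult_right_mono) auto
    also have "... = Cn" by (simp add: exp_minus_inverse mult.assoc)
    finally show "norm (norm_factor z * exp (- (of_real (pi^2 / 48) / z))) * norm (kern_factor a (of_real y / z)) <= Cn * c"
      using k Cn c by (intro mult_mono) auto
  qed
qed

text \<open>For \<open>- 2 <= Im z / Re z <= - 1/2\<close> one has
  \<open>- Im z / (norm z)^2 >= 2 / (5 Re z)\<close>, so the parabola bound on \<open>clau\<close>
  yields \<open>exp (- x^2 / 5)\<close> with \<open>x = (y - pi / 24) / sqrt (Re z)\<close>. The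
  regular part may consume half of it: it is bounded near the saddle, and farther away
  \<open>1 / sqrt (Re z)\<close> is at most a multiple of \<open>\<bar>x\<bar>\<close>.\<close>

lemma low_integrand_saddle_bound:
  assumes a: "0 < a" "a < 1"
  obtains C where "0 < C"
    "\<And>z y p. z \<in> sector 4 ==> Re z <= 1 ==> - 2 * Re z <= Im z ==> Im z <= - Re z / 2 ==> p^2 = 1 ==>
      0 <= y ==> y <= pi / 8 ==>
      norm (low_integrand p a z y * exp (\<i> * of_real vol / z)) <= C * exp (- ((y - pi / 24)^2 / (10 * Re z)))"
proof -
  obtain C1 where C1: "0 < C1" "\<And>z y p. z \<in> sector 4 ==> Re z <= 1 ==> 0 <= y ==>
      norm (norm_factor z * exp (- (of_real (pi^2 / 48) / z))) * norm (kern_factor a (of_real y / z)) <= C1"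
    using low_integrand_prefactor_bound[OF a] by blast
  obtain Cp where Cp: "0 < Cp" "\<And>z X. z \<in> sector 4 ==> norm X <= 1 ==> norm (prod_log_reg z X) <= Cp / sqrt (Re z)"
    using norm_prod_log_reg_le[of 4] by (metis one_le_numeral)
  obtain Cq where Cq: "0 < Cq" "\<And>z X. z \<in> sector 4 ==> norm X <= 1 ==> norm (1 - X\<^sup>2) * norm (prod_log_reg z X) <= Cq"
    using norm_one_minus_sq_prod_log_reg_le[of 4] by (metis one_le_numeral)
  \<comment> \<open>The first entry serves \<open>d <= pi / 48\<close>, where \<open>1 - X^2\<close>
    has norm at least 1/2; the second comes from completing the square in
    \<open>16 Cp x <= x^2 / 10 + D\<close>.\<close>
  define D where "D = max (2 * Cq) (10 / 4 * (16 * Cp)^2)"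
  show ?thesis
  proof (rule that)
    show "0 < C1 * exp D" using C1 by simp
    fix z :: complex and y :: real and p :: complex
    assume z: "z \<in> sector 4" "Re z <= 1" "- 2 * Re z <= Im z" "Im z <= - Re z / 2" and p: "p^2 = 1" and y: "0 <= y" "y <= pi / 8"
    define h where "h = Re z"
    define d where "d = \<bar>y - pi / 24\<bar>"
    define x where "x = d / sqrt h"
    have h: "0 < h" using z by (auto simp: sector_def h_def)
    have z0: "z \<noteq> 0" using sector_nonzero[OF z(1)] .
    have p1: "norm p = 1" using p by (auto simp: power2_eq_1_iff)
    have x2: "x^2 = (y - pi / 24)^2 / h" using h by (simp add: x_def d_def power_divide)
    have e1: "- (clau y * (Im z / (norm z)^2)) + vol * Im z / (norm z)^2 <= - (x^2 / 5)"
    proof -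
      have "0 <= (- 2 * Im z - h) * (2 * h + Im z)" using z by (intro mult_nonneg_nonneg) (auto simp: h_def)
      then have "2 * (norm z)^2 <= 5 * h * (- Im z)" unfolding cmod_power2 h_def by (simp add: algebra_simps power2_eq_square)
      moreover have "(norm z)^2 > 0" using z0 by simp
      ultimately have im: "2 / (5 * h) <= - Im z / (norm z)^2" using h by (simp add: field_simps)
      have "(y - pi / 24)^2 / 2 * (2 / (5 * h)) <= (vol - clau y) * (- Im z / (norm z)^2)"
      proof (rule mult_mono[OF _ im])
        show "(y - pi / 24)^2 / 2 <= vol - clau y" using clau_le_vol_quadratic[of y] y by simp
        have "0 <= (y - pi / 24)^2 / 2" by simp
        then show "0 <= vol - clau y" using \<open>(y - pi / 24)\<^sup>2 / 2 <= vol - clau y\<close> by linarith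
      qed (use h in auto)
      also have "(y - pi / 24)^2 / 2 * (2 / (5 * h)) = x^2 / 5" by (simp add: x2)
      finally have "x^2 / 5 <= (vol - clau y) * (- Im z / (norm z)^2)" .
      moreover have "(vol - clau y) * (- Im z / (norm z)^2) = clau y * (Im z / (norm z)^2) - vol * Im z / (norm z)^2"
        by (simp add: left_diff_distrib diff_divide_distrib)
      ultimately show ?thesis by linarith
    qed
    have n: "norm (p * cis (4 * y)) <= 1" using p1 by (simp add: norm_mult)
    have e2: "norm (prod_log_reg z (p * cis (4 * y))) <= x^2 / 10 + D"
    proof (cases "d <= pi / 48")
      case True
      have "y - pi / 24 <= pi / 48" using True unfolding d_def by (rule abs_le_D1)
      moreover have "- (y - pi / 24) <= pi / 48" using True unfolding d_def by (rule abs_le_D2)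
      ultimately have yy: "pi / 6 <= 8 * y" "8 * y <= pi / 2" by (simp_all add: field_simps)
      have "1 / 2 = sin (pi / 6)" by (simp add: sin_30)
      also have "... <= sin (8 * y)" using yy by (intro sin_monotone_2pi_le) auto
      also have "... = - Im (1 - (p * cis (4 * y))\<^sup>2)"
      proof -
        have "(cis (4 * y))^2 = cis (8 * y)" by (simp add: power2_eq_square cis_mult)
        then show ?thesis using p by (simp add: power_mult_distrib)
      qed
      also have "... <= norm (1 - (p * cis (4 * y))\<^sup>2)" using abs_Im_le_cmod[of "1 - (p * cis (4 * y))\<^sup>2"] by linarith
      finally have "1 / 2 * norm (prod_log_reg z (p * cis (4 * y))) <= norm (1 - (p * cis (4 * y))\<^sup>2) * norm (prod_log_reg z (p * cis (4 * y)))"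
        by (intro mult_right_mono) auto
      also have "... <= Cq" by (rule Cq(2)[OF z(1) n])
      finally have "norm (prod_log_reg z (p * cis (4 * y))) <= 2 * Cq" by simp
      also have "... <= D" by (simp add: D_def)
      also have "... <= x^2 / 10 + D" by simp
      finally show ?thesis .
    next
      case False
      then have "1 <= 16 * d" using pi_gt3 by simp
      then have "1 / sqrt h <= 16 * x" using h unfolding x_def by (simp add: divide_right_mono)
      then have "Cp * (1 / sqrt h) <= Cp * (16 * x)" using Cp(1) by (intro mult_left_mono) auto
      moreover have "norm (prod_log_reg z (p * cis (4 * y))) <= Cp * (1 / sqrt h)" using Cp(2)[OF z(1) n] by (simp add: h_def)
      ultimately have "norm (prod_log_reg z (p * cis (4 * y))) <= (16 * Cp) * x" by simp
      also have "... <= x^2 / 10 + 10 / 4 * (16 * Cp)^2"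
        using sum_squares_bound[of x "5 * (16 * Cp)"] by (simp add: power2_eq_square algebra_simps)
      also have "... <= x^2 / 10 + D" unfolding D_def by simp
      finally show ?thesis .
    qed
    then have e2': "Re (prod_log_reg z (p * cis (4 * y))) <= x^2 / 10 + D" using complex_Re_le_cmod order_trans by blast
    have "norm (low_integrand p a z y * exp (\<i> * of_real vol / z)) =
       exp (- (clau y * (Im z / (norm z)^2)) + vol * Im z / (norm z)^2 + Re (prod_log_reg z (p * cis (4 * y))))
       * (norm (norm_factor z * exp (- (of_real (pi^2 / 48) / z))) * norm (kern_factor a (of_real y / z)))"
      unfolding norm_mult[of "low_integrand p a z y"] norm_low_integrand norm_exp_eq_Re Re_ii_divide exp_add by (simp only: mult_ac)
    also have "... <= exp (- (x^2 / 5) + (x^2 / 10 + D)) * C1"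
      using e1 e2' C1(2)[OF z(1,2) y(1)] by (intro mult_mono) auto
    also have "... = C1 * exp D * exp (- (x^2 / 10))" by (simp flip: exp_add)
    also have "x^2 / 10 = (y - pi / 24)^2 / (10 * Re z)" unfolding x2 h_def by simp
    finally show "norm (low_integrand p a z y * exp (\<i> * of_real vol / z)) <= C1 * exp D * exp (- ((y - pi / 24)^2 / (10 * Re z)))" .
  qed
qed

text \<open>Outside the window of directions, \<open>- Im z / (norm z)^2 <= 2 / (5 Re z)\<close>;
  even the full height \<open>vol\<close> then gives only \<open>2/5 vol\<close>, less than
  \<open>vol / 2\<close>.\<close>

lemma low_integrand_far_bound:
  assumes a: "0 < a" "a < 1"
  obtains C where "0 < C"
    "\<And>z y p. z \<in> sector 4 ==> Re z <= 1 ==> Im z < - 2 * Re z \<or> - Re z / 2 < Im z ==> p^2 = 1 ==>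
      0 <= y ==> y <= pi / 8 ==>
      norm (low_integrand p a z y) <= C * exp (2 * vol / (5 * Re z) + C / sqrt (Re z))"
proof -
  obtain C1 where C1: "0 < C1" "\<And>z y p. z \<in> sector 4 ==> Re z <= 1 ==> 0 <= y ==>
      norm (norm_factor z * exp (- (of_real (pi^2 / 48) / z))) * norm (kern_factor a (of_real y / z)) <= C1"
    using low_integrand_prefactor_bound[OF a] by blast
  obtain Cp where Cp: "0 < Cp" "\<And>z X. z \<in> sector 4 ==> norm X <= 1 ==> norm (prod_log_reg z X) <= Cp / sqrt (Re z)"
    using norm_prod_log_reg_le[of 4] by (metis one_le_numeral)
  show ?thesis
  proof (rule that)
    show "0 < max C1 Cp" using C1 by (simp add: less_max_iff_disj)
    fix z :: complex and y :: real and p :: complex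
    assume z: "z \<in> sector 4" "Re z <= 1" "Im z < - 2 * Re z \<or> - Re z / 2 < Im z" and p: "p^2 = 1" and y: "0 <= y" "y <= pi / 8"
    define h where "h = Re z"
    have h: "0 < h" using z by (auto simp: sector_def h_def)
    have z0: "z \<noteq> 0" using sector_nonzero[OF z(1)] .
    have p1: "norm p = 1" using p by (auto simp: power2_eq_1_iff)
    have n: "norm (p * cis (4 * y)) <= 1" using p1 by (simp add: norm_mult)
    have n0: "(norm z)^2 > 0" using z0 by simp
    have im: "- Im z / (norm z)^2 <= 2 / (5 * h)"
    proof -
      have "0 <= (2 * Im z + h) * (2 * h + Im z)"
        using z(3)
      proof
        assume "Im z < - 2 * Re z"
        then show ?thesis using h by (intro mult_nonpos_nonpos) (auto simp: h_def)
      next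
        assume "- Re z / 2 < Im z"
        then show ?thesis using h by (intro mult_nonneg_nonneg) (auto simp: h_def)
      qed
      then have "5 * h * (- Im z) <= 2 * (norm z)^2" unfolding cmod_power2 h_def by (simp add: algebra_simps power2_eq_square)
      then show ?thesis using h n0 by (simp add: field_simps)
    qed
    have "clau y * (- Im z / (norm z)^2) <= clau y * (2 / (5 * h))" using im clau_nonneg[of y] y by (intro mult_left_mono) auto
    also have "... <= vol * (2 / (5 * h))" using clau_le_vol[of y] y h by (intro mult_right_mono) auto
    finally have e1: "- (clau y * (Im z / (norm z)^2)) <= 2 * vol / (5 * h)" by (simp add: mult_ac)
    have "norm (prod_log_reg z (p * cis (4 * y))) <= Cp / sqrt h" unfolding h_def by (rule Cp(2)[OF z(1) n])
    also have "... <= max C1 Cp / sqrt h" using h by (intro divide_right_mono) auto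
    finally have e2: "Re (prod_log_reg z (p * cis (4 * y))) <= max C1 Cp / sqrt h" using complex_Re_le_cmod order_trans by blast
    have "norm (low_integrand p a z y) =
       exp (- (clau y * (Im z / (norm z)^2)) + Re (prod_log_reg z (p * cis (4 * y))))
       * (norm (norm_factor z * exp (- (of_real (pi^2 / 48) / z))) * norm (kern_factor a (of_real y / z)))"
      unfolding norm_low_integrand exp_add by (simp only: mult_ac)
    also have "... <= exp (2 * vol / (5 * h) + max C1 Cp / sqrt h) * max C1 Cp"
      using e1 e2 C1(2)[OF z(1,2) y(1)] C1(1) by (intro mult_mono) (auto intro: order_trans)
    finally show "norm (low_integrand p a z y) <= max C1 Cp * exp (2 * vol / (5 * Re z) + max C1 Cp / sqrt (Re z))"
      by (simp add: h_def mult.commute)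
  qed
qed

lemma borel_measurable_low_integrand:
  assumes z: "z \<in> sector 4" and e: "e^2 = 1" and a: "0 < a" "a < 1"
  shows "(\<lambda>y. indicator {0..pi / 8} y *\<^sub>R low_integrand e a z y) \<in> borel_measurable borel"
  by (rule borel_measurable_continuous_on_indicator[OF _ continuous_on_low_integrand[OF assms]]) simp

lemma lower_integral_affine:
  assumes "0 < h"
  shows "lower_integral e a z = sqrt h *\<^sub>R
    (LINT u|lborel. indicator {0..pi / 8} (pi / 24 + sqrt h * u) *\<^sub>R low_integrand e a z (pi / 24 + sqrt h * u))"
  unfolding lower_integral_def
  using lborel_integral_real_affine[of "sqrt h" "\<lambda>y. indicator {0..pi / 8} y *\<^sub>R low_integrand e a z y" "pi / 24"] assms by simp

text \<open>The substitution \<open>y = pi / 24 + sqrt h * u\<close> makes the majorant an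
  integrable Gaussian independent of \<open>z\<close>; the factor \<open>sqrt (Re z)\<close> is its
  Jacobian.\<close>

lemma lower_integral_saddle_bound:
  assumes a: "0 < a" "a < 1"
  obtains C where "0 < C"
    "\<And>z e. z \<in> sector 4 ==> Re z <= 1 ==> - 2 * Re z <= Im z ==> Im z <= - Re z / 2 ==> e^2 = 1 ==>
      norm (lower_integral e a z * exp (\<i> * of_real vol / z)) <= C * sqrt (Re z)"
proof -
  obtain C where C: "0 < C"
    "\<And>z y e. z \<in> sector 4 ==> Re z <= 1 ==> - 2 * Re z <= Im z ==> Im z <= - Re z / 2 ==> e^2 = 1 ==>
      0 <= y ==> y <= pi / 8 ==>
      norm (low_integrand e a z y * exp (\<i> * of_real vol / z)) <= C * exp (- ((y - pi / 24)^2 / (10 * Re z)))"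
    using low_integrand_saddle_bound[OF a] by blast
  define G where "G = (LINT u|lborel. exp (- (1 / 10 * u^2)) :: real)"
  have intG: "integrable lborel (\<lambda>u::real. exp (- (1 / 10 * u^2)))" by (rule integrable_exp_square) simp
  have G: "0 <= G" unfolding G_def by (intro integral_nonneg_AE) auto
  show ?thesis
  proof (rule that)
    show "0 < C * G + 1" using C(1) G by (simp add: add_nonneg_pos)
    fix z e :: complex
    assume z: "z \<in> sector 4" "Re z <= 1" "- 2 * Re z <= Im z" "Im z <= - Re z / 2" and e: "e^2 = 1"
    define h where "h = Re z"
    have h: "0 < h" using z by (auto simp: sector_def h_def)
    let ?g = "\<lambda>u. indicator {0..pi / 8} (pi / 24 + sqrt h * u) *\<^sub>R (low_integrand e a z (pi / 24 + sqrt h * u) * exp (\<i> * of_real vol / z))"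
    have b: "norm (?g u) <= C * exp (- (1 / 10 * u^2))" for u
    proof (cases "pi / 24 + sqrt h * u \<in> {0..pi / 8}")
      case True
      have "norm (?g u) <= C * exp (- ((pi / 24 + sqrt h * u - pi / 24)^2 / (10 * Re z)))"
        using C(2)[OF z e, of "pi / 24 + sqrt h * u"] True by (simp only: indicator_simps scaleR_one atLeastAtMost_iff)
      also have "(pi / 24 + sqrt h * u - pi / 24)^2 / (10 * Re z) = 1 / 10 * u^2"
        using h by (simp add: power_mult_distrib h_def)
      finally show ?thesis .
    qed (use C(1) in simp)
    have "norm (LINT u|lborel. ?g u) <= (LINT u|lborel. C * exp (- (1 / 10 * u^2)))"
      by (rule order_trans[OF integral_norm_bound integral_mono'])
        (use b C(1) integrable_mult_right[OF intG, of C] in \<open>auto\<close>)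
    also have "... = C * G" by (simp add: G_def)
    finally have le: "norm (LINT u|lborel. ?g u) <= C * G" .
    have "lower_integral e a z * exp (\<i> * of_real vol / z) = sqrt h *\<^sub>R (LINT u|lborel. ?g u)"
      unfolding lower_integral_affine[OF h] by (simp add: scaleR_conv_of_real flip: mult.assoc)
    then have "norm (lower_integral e a z * exp (\<i> * of_real vol / z)) <= sqrt h * (C * G)"
      using le h by (simp add: mult_left_mono)
    also have "... <= (C * G + 1) * sqrt h" using h by (simp add: algebra_simps)
    finally show "norm (lower_integral e a z * exp (\<i> * of_real vol / z)) <= (C * G + 1) * sqrt (Re z)" by (simp add: h_def)
  qed
qed

lemma lower_integral_far_bound:
  assumes a: "0 < a" "a < 1"
  obtains C where "0 < C"
    "\<And>z e. z \<in> sector 4 ==> Re z <= 1 ==> Im z < - 2 * Re z \<or> - Re z / 2 < Im z ==> e^2 = 1 ==>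
      norm (lower_integral e a z) <= C * exp (2 * vol / (5 * Re z) + C / sqrt (Re z))"
proof -
  obtain C where C: "0 < C"
    "\<And>z y e. z \<in> sector 4 ==> Re z <= 1 ==> Im z < - 2 * Re z \<or> - Re z / 2 < Im z ==> e^2 = 1 ==>
      0 <= y ==> y <= pi / 8 ==>
      norm (low_integrand e a z y) <= C * exp (2 * vol / (5 * Re z) + C / sqrt (Re z))"
    using low_integrand_far_bound[OF a] by blast
  show ?thesis
  proof (rule that[OF C(1)])
    fix z e :: complex
    assume z: "z \<in> sector 4" "Re z <= 1" "Im z < - 2 * Re z \<or> - Re z / 2 < Im z" and e: "e^2 = 1"
    define B where "B = C * exp (2 * vol / (5 * Re z) + C / sqrt (Re z))"
    have B: "0 <= B" using C(1) by (simp add: B_def)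
    have cont: "continuous_on {0..pi / 8} (low_integrand e a z)" by (rule continuous_on_low_integrand[OF z(1) e a])
    have "lower_integral e a z = integral {0..pi / 8} (low_integrand e a z)"
      unfolding lower_integral_def set_lebesgue_integral_def[symmetric]
      by (rule set_borel_integral_eq_integral(2)[OF borel_integrable_atLeastAtMost'[OF cont]])
    also have "norm ... <= B * (pi / 8 - 0)"
      by (rule integral_bound[OF _ cont]) (use C(2)[OF z e] in \<open>auto simp: B_def\<close>)
    also have "... <= B * 1" using B pi_less_4 by (intro mult_left_mono) auto
    finally show "norm (lower_integral e a z) <= C * exp (2 * vol / (5 * Re z) + C / sqrt (Re z))" by (simp add: B_def)
  qed
qed

text \<open>On the scale \<open>sqrt (h k)\<close>, \<open>clau_second_order\<close> gives
  \<open>(vol - clau) / h\<close> the limit \<open>2 sqrt 3 u^2\<close>; multiplied by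
  \<open>\<i> h / z\<close>, with limit \<open>\<i> / (1 - \<i>)\<close>, this is
  \<open>- sqrt 3 (1 - \<i>) u^2\<close>. The direction \<open>t k\<close> varies with
  \<open>k\<close> because the outer Laplace integral approaches \<open>t = - 1\<close> on its own
  scale.\<close>

lemma lower_integral_tendsto:
  fixes h t :: "nat \<Rightarrow> real"
  assumes a: "0 < a" "a < 1" and p: "p = 1 \<or> p = - 1"
    and h: "\<And>k. 0 < h k" "\<And>k. h k <= 1" "h \<longlonglongrightarrow> 0"
    and t: "\<And>k. - 2 <= t k" "\<And>k. t k <= - 1 / 2" "t \<longlonglongrightarrow> - 1"
  defines "z \<equiv> \<lambda>k. of_real (h k) * (1 + \<i> * of_real (t k))"
  shows "(\<lambda>k. lower_integral p a (z k) * exp (\<i> * of_real vol / z k) / of_real (sqrt (h k))) \<longlonglongrightarrow>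
    cis (pi * a / 2) * exp (reg_limit (p * cis (pi / 6))) * (LINT u|lborel. exp (- (of_real (sqrt 3) * (1 - \<i>) * of_real (u^2))))"
proof -
  have p2: "p^2 = 1" "norm p = 1" using p by auto
  have zR: "Re (z k) = h k" "Im (z k) = h k * t k" for k by (simp_all add: z_def)
  have zs: "z k \<in> sector 4" for k
  proof -
    have "\<bar>t k\<bar> <= 4" using t(1,2)[of k] by linarith
    then have "h k * \<bar>t k\<bar> <= h k * 4" using h(1)[of k] by (intro mult_left_mono) auto
    then show ?thesis unfolding sector_def using h(1)[of k] by (simp add: zR abs_mult)
  qed
  have z0: "z k \<noteq> 0" for k using sector_nonzero[OF zs] .
  have zc: "Re (z k) <= 1" "- 2 * Re (z k) <= Im (z k)" "Im (z k) <= - Re (z k) / 2" for k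
  proof -
    have "0 <= h k" using h(1)[of k] by simp
    from mult_left_mono[OF t(1)[of k] this] mult_left_mono[OF t(2)[of k] this]
    have "h k * (- 2) <= h k * t k" "h k * t k <= h k * (- 1 / 2)" .
    then show "Re (z k) <= 1" "- 2 * Re (z k) <= Im (z k)" "Im (z k) <= - Re (z k) / 2"
      using h(2)[of k] by (auto simp: zR)
  qed
  have zlim: "z \<longlonglongrightarrow> 0"
  proof -
    have "z \<longlonglongrightarrow> of_real 0 * (1 + \<i> * of_real (- 1))" unfolding z_def by (intro tendsto_intros h t)
    then show ?thesis by simp
  qed
  have ratio: "(\<lambda>k. of_real (h k) / z k) \<longlonglongrightarrow> 1 / (1 - \<i>)"
  proof -
    have "(\<lambda>k. 1 / (1 + \<i> * of_real (t k))) \<longlonglongrightarrow> 1 / (1 + \<i> * of_real (- 1))"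
      by (intro tendsto_intros t) (simp add: complex_eq_iff)
    moreover have "of_real (h k) / z k = 1 / (1 + \<i> * of_real (t k))" for k using h(1)[of k] by (simp add: z_def)
    ultimately show ?thesis by simp
  qed
  have slim: "(\<lambda>k. sqrt (h k)) \<longlonglongrightarrow> 0" using tendsto_real_sqrt[OF h(3)] by simp
  obtain C where C: "0 < C"
    "\<And>z y p. z \<in> sector 4 ==> Re z <= 1 ==> - 2 * Re z <= Im z ==> Im z <= - Re z / 2 ==> p^2 = 1 ==>
      0 <= y ==> y <= pi / 8 ==>
      norm (low_integrand p a z y * exp (\<i> * of_real vol / z)) <= C * exp (- ((y - pi / 24)^2 / (10 * Re z)))"
    using low_integrand_saddle_bound[OF a] by blast
  define y where "y = (\<lambda>k u. pi / 24 + sqrt (h k) * u)"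
  define g where "g = (\<lambda>k u. indicator {0..pi / 8} (y k u) *\<^sub>R low_integrand p a (z k) (y k u) * exp (\<i> * of_real vol / z k))"
  define L where "L = cis (pi * a / 2) * exp (reg_limit (p * cis (pi / 6)))"
  have ylim: "(\<lambda>k. y k u) \<longlonglongrightarrow> pi / 24" for u
  proof -
    have "(\<lambda>k. y k u) \<longlonglongrightarrow> pi / 24 + 0 * u" unfolding y_def by (intro tendsto_intros slim)
    then show ?thesis by simp
  qed
  have "(\<lambda>k. LINT u|lborel. g k u) \<longlonglongrightarrow> (LINT u|lborel. L * exp (- (of_real (sqrt 3) * (1 - \<i>) * of_real (u^2))))"
  proof (rule integral_dominated_convergence[where w = "\<lambda>u. C * exp (- (1 / 10 * u^2))"])
    show "integrable lborel (\<lambda>u. C * exp (- (1 / 10 * u^2)))"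
      by (intro integrable_mult_right integrable_exp_square) simp
    show "(\<lambda>u. L * exp (- (of_real (sqrt 3) * (1 - \<i>) * of_real (u^2)))) \<in> borel_measurable lborel"
      by (auto intro!: borel_measurable_continuous_onI continuous_intros)
    show "g k \<in> borel_measurable lborel" for k
    proof -
      have "(\<lambda>u. indicator {0..pi / 8} (y k u) *\<^sub>R low_integrand p a (z k) (y k u)) \<in> borel_measurable borel"
        by (rule measurable_compose[OF _ borel_measurable_low_integrand[OF zs p2(1) a]]) (simp add: y_def)
      from borel_measurable_times[OF this borel_measurable_const[of "exp (\<i> * of_real vol / z k)"]]
      show ?thesis unfolding g_def measurable_lborel2 .
    qed
    show "AE u in lborel. norm (g k u) <= C * exp (- (1 / 10 * u^2))" for k
    proof (rule AE_I2)
      fix u :: real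
      show "norm (g k u) <= C * exp (- (1 / 10 * u^2))"
      proof (cases "y k u \<in> {0..pi / 8}")
        case True
        then have "norm (g k u) <= C * exp (- ((y k u - pi / 24)^2 / (10 * Re (z k))))"
          using C(2)[OF zs zc p2(1)] by (simp add: g_def)
        also have "(y k u - pi / 24)^2 / (10 * Re (z k)) = 1 / 10 * u^2"
          using h(1)[of k] by (simp add: power_mult_distrib y_def zR)
        finally show ?thesis .
      qed (use C(1) in \<open>simp add: g_def\<close>)
    qed
    show "AE u in lborel. (\<lambda>k. g k u) \<longlonglongrightarrow> L * exp (- (of_real (sqrt 3) * (1 - \<i>) * of_real (u^2)))"
    proof (rule AE_I2)
      fix u :: real
      have ev: "\<forall>\<^sub>F k in sequentially. y k u \<in> {0<..<pi / 8}"
        by (rule topological_tendstoD[OF ylim]) auto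
      have d: "(\<lambda>k. (vol - clau (y k u)) / h k) \<longlonglongrightarrow> 2 * sqrt 3 * u^2"
      proof (cases "u = 0")
        case True
        then show ?thesis by (simp add: y_def vol_def)
      next
        case False
        have "filterlim (\<lambda>k. sqrt (h k) * u) (at 0) sequentially"
        proof (rule filterlim_atI)
          show "(\<lambda>k. sqrt (h k) * u) \<longlonglongrightarrow> 0" using tendsto_mult_left_zero[OF slim] .
          show "\<forall>\<^sub>F k in sequentially. sqrt (h k) * u \<noteq> 0" using False h(1) by (intro always_eventually allI) (simp add: less_le)
        qed
        from filterlim_compose[OF clau_second_order this]
        have "(\<lambda>k. - ((clau (pi / 24 + sqrt (h k) * u) - vol) / (sqrt (h k) * u)^2) * u^2) \<longlonglongrightarrow> - (- 2 * sqrt 3) * u^2"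
          by (intro tendsto_intros)
        moreover have "- ((clau (pi / 24 + sqrt (h k) * u) - vol) / (sqrt (h k) * u)^2) * u^2 = (vol - clau (y k u)) / h k" for k
          using False h(1)[of k] by (simp add: y_def power_mult_distrib field_simps)
        ultimately show ?thesis by simp
      qed
      have e1: "(\<lambda>k. exp (\<i> * of_real ((vol - clau (y k u)) / h k) * (of_real (h k) / z k))) \<longlonglongrightarrow>
          exp (\<i> * of_real (2 * sqrt 3 * u^2) * (1 / (1 - \<i>)))"
        by (intro tendsto_intros d ratio)
      have e1': "\<i> * of_real (2 * sqrt 3 * u^2) * (1 / (1 - \<i>)) = - (of_real (sqrt 3) * (1 - \<i>) * of_real (u^2))"
        by (simp add: complex_eq_iff Re_divide Im_divide)
      have e2: "(\<lambda>k. norm_factor (z k) * exp (- (of_real (pi^2 / 48) / z k))) \<longlonglongrightarrow> 1"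
        by (rule norm_factor_tendsto[OF zs _ zlim]) simp
      have e3: "(\<lambda>k. prod_log_reg (z k) (p * cis (4 * y k u))) \<longlonglongrightarrow> reg_limit (p * cis (pi / 6))"
      proof (rule prod_log_reg_tendsto[OF zs _ zlim])
        have "(\<lambda>k. cis (4 * y k u)) \<longlonglongrightarrow> cis (4 * (pi / 24))"
          unfolding cis_conv_exp by (intro tendsto_intros ylim)
        from tendsto_mult[OF tendsto_const this, of p]
        show "(\<lambda>k. p * cis (4 * y k u)) \<longlonglongrightarrow> p * cis (pi / 6)" by simp
        have "Im (cis (pi / 6)) \<noteq> 0" by (simp add: sin_30)
        then show "p * cis (pi / 6) \<noteq> 1" "p * cis (pi / 6) \<noteq> - 1" using p by (auto simp: complex_eq_iff)
      qed (use p2 in \<open>auto simp: norm_mult\<close>)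
      \<comment> \<open>\<open>Re (y / z)\<close> grows like a positive constant over
        \<open>h k\<close>, so only the first term of the denominator of \<open>kern_factor\<close>
        survives.\<close>
      have e4: "(\<lambda>k. kern_factor a (of_real (y k u) / z k)) \<longlonglongrightarrow> cis (pi * a / 2)"
      proof -
        have "(\<lambda>k. 2 * pi * (y k u * Re (1 / (1 + \<i> * of_real (t k))))) \<longlonglongrightarrow> 2 * pi * (pi / 24 * Re (1 / (1 + \<i> * of_real (- 1))))"
          by (intro tendsto_intros ylim t) (simp add: complex_eq_iff)
        also have "2 * pi * (pi / 24 * Re (1 / (1 + \<i> * of_real (- 1)))) = pi^2 / 24"
          by (simp add: Re_divide power2_eq_square)
        finally have lim: "(\<lambda>k. 2 * pi * (y k u * Re (1 / (1 + \<i> * of_real (t k))))) \<longlonglongrightarrow> pi\<^sup>2 / 24" .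
        have "filterlim (\<lambda>k. inverse (h k)) at_top sequentially"
          by (rule filterlim_inverse_at_top[OF h(3)]) (use h(1) in simp)
        from filterlim_tendsto_pos_mult_at_top[OF lim _ this]
        have "filterlim (\<lambda>k. 2 * pi * (y k u * Re (1 / (1 + \<i> * of_real (t k)))) / h k) at_top sequentially"
          by (simp only: divide_inverse) simp
        then have "(\<lambda>k. exp (- (2 * pi * (y k u * Re (1 / (1 + \<i> * of_real (t k)))) / h k))) \<longlonglongrightarrow> 0"
          by (intro filterlim_compose[OF exp_at_bot]) (simp add: filterlim_uminus_at_bot)
        moreover have "norm (exp (- (2 * pi * (of_real (y k u) / z k)))) = exp (- (2 * pi * (y k u * Re (1 / (1 + \<i> * of_real (t k)))) / h k))" for k
        proof -
          have "of_real (y k u) / z k = of_real (y k u / h k) * (1 / (1 + \<i> * of_real (t k)))" using h(1)[of k] by (simp add: z_def)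
          then show ?thesis unfolding norm_exp_eq_Re by (simp only: uminus_complex.simps times_complex.simps Re_complex_of_real Im_complex_of_real) simp
        qed
        ultimately have "(\<lambda>k. exp (- (2 * pi * (of_real (y k u) / z k)))) \<longlonglongrightarrow> 0"
          by (subst tendsto_norm_zero_iff[symmetric]) simp
        then have "(\<lambda>k. kern_factor a (of_real (y k u) / z k)) \<longlonglongrightarrow> exp (- (3 * pi * \<i> / 2 * a)) / (exp (- (2 * pi * \<i> * a)) - 0)"
          unfolding kern_factor_def by (intro tendsto_intros) auto
        also have "exp (- (3 * pi * \<i> / 2 * a)) / (exp (- (2 * pi * \<i> * a)) - 0) = cis (pi * a / 2)"
          by (simp add: cis_conv_exp field_simps flip: exp_diff)
        finally show ?thesis .
      qed
      have "(\<lambda>k. exp (\<i> * of_real ((vol - clau (y k u)) / h k) * (of_real (h k) / z k)) * (norm_factor (z k) * exp (- (of_real (pi^2 / 48) / z k)))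
         * exp (prod_log_reg (z k) (p * cis (4 * y k u))) * kern_factor a (of_real (y k u) / z k))
        \<longlonglongrightarrow> exp (\<i> * of_real (2 * sqrt 3 * u^2) * (1 / (1 - \<i>))) * 1 * exp (reg_limit (p * cis (pi / 6))) * cis (pi * a / 2)"
        by (intro tendsto_mult e1 e2 e4 tendsto_exp e3)
      moreover have "\<forall>\<^sub>F k in sequentially. exp (\<i> * of_real ((vol - clau (y k u)) / h k) * (of_real (h k) / z k)) * (norm_factor (z k) * exp (- (of_real (pi^2 / 48) / z k)))
         * exp (prod_log_reg (z k) (p * cis (4 * y k u))) * kern_factor a (of_real (y k u) / z k) = g k u"
        using ev
      proof eventually_elim
        case (elim k)
        have "\<i> * of_real ((vol - clau (y k u)) / h k) * (of_real (h k) / z k) = - (\<i> * of_real (clau (y k u)) / z k) + \<i> * of_real vol / z k"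
          using h(1)[of k] z0[of k] by (simp add: field_simps)
        then have "exp (\<i> * of_real ((vol - clau (y k u)) / h k) * (of_real (h k) / z k)) =
            exp (- (\<i> * of_real (clau (y k u)) / z k)) * exp (\<i> * of_real vol / z k)"
          by (simp only: exp_add)
        moreover have "y k u \<in> {0..pi / 8}" using elim by auto
        ultimately show ?case unfolding g_def low_integrand_def by (simp only: indicator_simps scaleR_one mult_ac)
      qed
      ultimately have "(\<lambda>k. g k u) \<longlonglongrightarrow> exp (\<i> * of_real (2 * sqrt 3 * u^2) * (1 / (1 - \<i>))) * 1 * exp (reg_limit (p * cis (pi / 6))) * cis (pi * a / 2)"
        by (rule Lim_transform_eventually)
      then show "(\<lambda>k. g k u) \<longlonglongrightarrow> L * exp (- (of_real (sqrt 3) * (1 - \<i>) * of_real (u^2)))"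
        unfolding e1' L_def by (simp add: mult_ac)
    qed
  qed
  moreover have "(LINT u|lborel. g k u) = lower_integral p a (z k) * exp (\<i> * of_real vol / z k) / of_real (sqrt (h k))" for k
    unfolding lower_integral_affine[OF h(1)[of k]] g_def y_def using h(1)[of k]
    by (simp add: scaleR_conv_of_real)
  ultimately show ?thesis unfolding L_def by simp
qed

subsection \<open>Minor arcs\<close>

text \<open>The logarithm of the denominator is a sum of logarithmic series; summing over
  \<open>j\<close> first leaves power sums of \<open>q^(2 r)\<close>, whose size depends on how
  close \<open>q^(2 r)\<close> is to 1. A bound on all partial sums avoids any question of
  convergence.\<close>

lemma norm_qterm_le_series:
  assumes q: "norm q < 1"
    and B: "\<And>K. (\<Sum>r=1..K. norm (\<Sum>j=1..n. q ^ (2 * j * r)) / real r) <= B"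
  shows "norm (qterm q n) <= norm q ^ (n * (n + 1) div 2) * exp B"
proof -
  have lt: "norm (q ^ (2 * j)) < 1" if "j \<in> {1..n}" for j
    using q that by (simp add: norm_power power_less_one_iff)
  define S where "S = (\<Sum>j=1..n. Ln (1 + q ^ (2 * j)))"
  have "(\<lambda>r. \<Sum>j=1..n. (- 1) ^ Suc r / of_nat r * (q ^ (2 * j)) ^ r) sums S"
    unfolding S_def by (intro sums_sum Ln_series lt)
  then have lim: "(\<lambda>K. \<Sum>r<K. \<Sum>j=1..n. (- 1) ^ Suc r / of_nat r * (q ^ (2 * j)) ^ r) \<longlonglongrightarrow> S"
    by (simp add: sums_def)
  have le: "norm (\<Sum>r<K. \<Sum>j=1..n. (- 1) ^ Suc r / of_nat r * (q ^ (2 * j)) ^ r) <= B" for K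
  proof -
    have "norm (\<Sum>r<K. \<Sum>j=1..n. (- 1) ^ Suc r / of_nat r * (q ^ (2 * j)) ^ r)
       <= (\<Sum>r<K. norm (\<Sum>j=1..n. q ^ (2 * j * r)) / real r)"
    proof (rule order_trans[OF norm_sum sum_mono])
      fix r
      have "(\<Sum>j=1..n. (- 1) ^ Suc r / of_nat r * (q ^ (2 * j)) ^ r) = (- 1) ^ Suc r / of_nat r * (\<Sum>j=1..n. q ^ (2 * j * r))"
        by (simp add: sum_distrib_left power_mult)
      then show "norm (\<Sum>j=1..n. (- 1) ^ Suc r / of_nat r * (q ^ (2 * j)) ^ r) <= norm (\<Sum>j=1..n. q ^ (2 * j * r)) / real r"
        by (simp add: norm_mult norm_divide norm_power)
    qed
    also have "... <= (\<Sum>r\<in>insert 0 {1..K}. norm (\<Sum>j=1..n. q ^ (2 * j * r)) / real r)"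
      by (rule sum_mono2) auto
    also have "... = (\<Sum>r=1..K. norm (\<Sum>j=1..n. q ^ (2 * j * r)) / real r)" by simp
    also have "... <= B" by (rule B)
    finally show ?thesis .
  qed
  have "norm S <= B" by (rule Lim_bounded[OF tendsto_norm[OF lim], of 0]) (use le in auto)
  have ne: "1 + q ^ (2 * j) \<noteq> 0" if "j \<in> {1..n}" for j
  proof
    assume "1 + q ^ (2 * j) = 0"
    then have "q ^ (2 * j) = - 1" by (simp add: add_eq_0_iff)
    then show False using lt[OF that] by simp
  qed
  have "(\<Prod>j=1..n. 1 + q ^ (2 * j)) = exp S"
    unfolding S_def by (subst exp_sum) (auto intro!: prod.cong simp: ne)
  then have "norm (qterm q n) = norm q ^ (n * (n + 1) div 2) * exp (- Re S)"
    by (simp add: qterm_def norm_divide norm_power exp_minus field_simps)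
  also have "... <= norm q ^ (n * (n + 1) div 2) * exp B"
    using \<open>norm S <= B\<close> abs_Re_le_cmod[of S] by (intro mult_left_mono) auto
  finally show ?thesis .
qed

lemma sum_exp_le:
  fixes x :: real
  assumes "0 < x"
  shows "(\<Sum>j=1..n. exp (- (x * real j))) <= (1 - exp (- (x * real n))) / x"
proof (induction n)
  case (Suc n)
  define E where "E = exp (- (x * real (Suc n)))"
  have "E * x <= E * (exp x - 1)"
  proof (rule mult_left_mono)
    show "x <= exp x - 1" using exp_ge_add_one_self[of x] by linarith
  qed (simp add: E_def)
  also have "... = exp (- (x * real n)) - E" by (simp add: E_def algebra_simps flip: exp_add)
  finally have "E <= (exp (- (x * real n)) - E) / x" using assms by (simp add: field_simps)
  then have "(\<Sum>j=1..Suc n. exp (- (x * real j))) <= (1 - exp (- (x * real n))) / x + (exp (- (x * real n)) - E) / x"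
    using Suc by (simp add: E_def)
  also have "... = (1 - E) / x" by (simp add: diff_divide_distrib)
  finally show ?case by (simp add: E_def)
qed simp

lemma power_sum_le_decay:
  fixes q :: complex
  assumes "norm q = exp (- h)" "0 < h" "1 <= r"
  shows "norm (\<Sum>j=1..n. q ^ (2 * j * r)) <= (1 - exp (- (2 * real r * h * real n))) / (2 * real r * h)"
proof -
  have "norm (\<Sum>j=1..n. q ^ (2 * j * r)) <= (\<Sum>j=1..n. exp (- ((2 * real r * h) * real j)))"
  proof (rule order_trans[OF norm_sum sum_mono])
    fix j
    have "norm (q ^ (2 * j * r)) = exp (- h) ^ (2 * j * r)" by (simp add: norm_power assms(1))
    also have "... = exp (- ((2 * real r * h) * real j))" by (simp add: mult_ac flip: exp_of_nat_mult)
    finally show "norm (q ^ (2 * j * r)) <= exp (- ((2 * real r * h) * real j))" by simp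
  qed
  also have "... <= (1 - exp (- ((2 * real r * h) * real n))) / (2 * real r * h)"
    by (rule sum_exp_le) (use assms in auto)
  finally show ?thesis .
qed

lemma power_sum_le_nonresonant:
  fixes q :: complex
  assumes "norm q <= 1" "0 < c" "c <= norm (1 - q ^ (2 * r))"
  shows "norm (\<Sum>j=1..n. q ^ (2 * j * r)) <= 2 / c"
proof -
  define u where "u = q ^ (2 * r)"
  have u: "norm u <= 1" using assms by (simp add: u_def norm_power power_le_one)
  have "(1 - u) * (\<Sum>j=1..n. u ^ j) = u - u ^ Suc n"
  proof (induction n)
    case (Suc n)
    have "(1 - u) * (\<Sum>j=1..Suc n. u ^ j) = (1 - u) * (\<Sum>j=1..n. u ^ j) + (1 - u) * u ^ Suc n" by (simp add: distrib_left)
    also have "... = u - u ^ Suc (Suc n)" unfolding Suc.IH by (simp add: algebra_simps)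
    finally show ?case .
  qed simp
  moreover have "(\<Sum>j=1..n. q ^ (2 * j * r)) = (\<Sum>j=1..n. u ^ j)"
    by (simp add: u_def mult_ac flip: power_mult)
  moreover have "norm (u - u ^ Suc n) <= 1 + 1"
    using u by (intro order_trans[OF norm_triangle_ineq4] add_mono) (auto simp: norm_power norm_mult power_le_one mult_le_one)
  ultimately have "norm (1 - u) * norm (\<Sum>j=1..n. q ^ (2 * j * r)) <= 2"
    by (metis norm_mult one_add_one)
  moreover have "c * norm (\<Sum>j=1..n. q ^ (2 * j * r)) <= norm (1 - u) * norm (\<Sum>j=1..n. q ^ (2 * j * r))"
    using assms by (intro mult_right_mono) (auto simp: u_def)
  ultimately show ?thesis using assms by (simp add: field_simps)
qed

lemma sin_ge_half:
  fixes x :: real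
  assumes "0 <= x" "x <= pi / 2"
  shows "x / 2 <= sin x"
proof (cases "x <= pi / 3")
  case True
  have "sin 0 - 0 / 2 <= sin x - x / 2"
  proof (rule DERIV_nonneg_imp_nondecreasing[OF assms(1)])
    fix u assume u: "0 <= u" "u <= x"
    have "cos (pi / 3) <= cos u" using u True pi_gt3 by (subst cos_mono_le_eq) auto
    then have "0 <= cos u - 1 / 2" by (simp add: cos_60)
    moreover have "((\<lambda>x. sin x - x / 2) has_real_derivative cos u - 1 / 2) (at u)"
      by (auto intro!: derivative_eq_intros)
    ultimately show "\<exists>d. ((\<lambda>x. sin x - x / 2) has_real_derivative d) (at u) \<and> 0 <= d" by blast
  qed
  then show ?thesis by simp
next
  case False
  have "17 / 10 <= sqrt 3" by (rule real_le_rsqrt) (simp add: power2_eq_square)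
  moreover have "pi / 2 <= 17 / 10" using pi_approx by simp
  ultimately have "x / 2 <= sqrt 3 / 2" using assms by linarith
  also have "... = sin (pi / 3)" by (simp add: sin_60)
  also have "... <= sin x" using False assms pi_gt3 by (intro sin_monotone_2pi_le) auto
  finally show ?thesis .
qed

text \<open>Reduce \<open>x\<close> to its signed distance \<open>y\<close> from the nearest
  integer; the chord is then \<open>2 \<bar>sin (pi y)\<bar>\<close>.\<close>

lemma norm_one_minus_cis_ge:
  assumes "\<And>b::int. u <= \<bar>x - of_int b\<bar>"
  shows "2 * u <= norm (1 - cis (2 * pi * x))"
proof -
  define y where "y = x - of_int (round x)"
  have y: "u <= \<bar>y\<bar>" "\<bar>y\<bar> <= 1 / 2"
    using assms[of "round x"] of_int_round_abs_le[of x] by (auto simp: y_def abs_minus_commute)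
  have "cis (2 * pi * x) = cis (2 * pi * y) * cis (2 * pi * of_int (round x))"
    by (simp add: y_def cis_mult algebra_simps)
  also have "cis (2 * pi * of_int (round x)) = 1" by (simp add: cis_multiple_2pi)
  finally have c: "cis (2 * pi * x) = cis (2 * pi * y)" by simp
  have "(norm (1 - cis (2 * pi * y)))^2 = (1 - cos (2 * (pi * y)))^2 + (sin (2 * (pi * y)))^2"
    by (simp add: cmod_power2 mult.assoc)
  also have "... = (2 * \<bar>sin (pi * y)\<bar>)^2"
  proof -
    have "(1 - cos (2 * (pi * y)))^2 + (sin (2 * (pi * y)))^2 = 2 - 2 * cos (2 * (pi * y))"
      using sin_cos_squared_add[of "2 * (pi * y)"] by (simp add: power2_eq_square algebra_simps)
    then show ?thesis unfolding cos_double_sin by (simp add: power_mult_distrib)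
  qed
  finally have "norm (1 - cis (2 * pi * y)) = 2 * \<bar>sin (pi * y)\<bar>"
    by (rule power2_eq_imp_eq) auto
  moreover have "\<bar>sin (pi * y)\<bar> = sin (pi * \<bar>y\<bar>)"
  proof -
    have "pi * \<bar>y\<bar> <= pi * (1 / 2)" using y by (intro mult_left_mono) auto
    then have "0 <= sin (pi * \<bar>y\<bar>)" by (intro sin_ge_zero) auto
    then show ?thesis by (cases "y \<ge> 0") auto
  qed
  moreover have "pi * \<bar>y\<bar> / 2 <= sin (pi * \<bar>y\<bar>)" using y by (intro sin_ge_half) auto
  moreover have "2 * \<bar>y\<bar> <= pi * \<bar>y\<bar>" using pi_gt3 by (intro mult_right_mono) auto
  ultimately show ?thesis unfolding c using y by linarith
qed

lemma sum_inverse_squares_tail: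
  assumes "1 <= R"
  shows "(\<Sum>r=R+1..K. 1 / (real r)^2) <= 1 / real R"
proof -
  have "(\<Sum>r=R+1..R+k. 1 / (real r)^2) <= 1 / real R - 1 / real (R + k)" for k
  proof (induction k)
    case (Suc k)
    define x where "x = real (R + k)"
    have x: "x \<ge> 1" using assms by (simp add: x_def)
    have "1 / (x + 1)^2 <= 1 / (x * (x + 1))" using x by (intro divide_left_mono) (auto simp: power2_eq_square)
    also have "... = 1 / x - 1 / (x + 1)" using x by (simp add: field_simps)
    finally have "1 / (real (R + Suc k))^2 <= 1 / x - 1 / real (R + Suc k)" by (simp add: x_def add_ac)
    then show ?case using Suc by (simp add: x_def)
  qed simp
  from this[of "K - R"] show ?thesis
  proof (cases "K <= R")
    case False
    have "0 <= 1 / real (R + (K - R))" by simp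
    moreover have "R + (K - R) = K" using False by simp
    ultimately show ?thesis using \<open>(\<Sum>r=R+1..R+(K-R). 1 / (real r)^2) <= _\<close>
      by (metis (no_types, lifting) diff_ge_0_iff_ge diff_left_mono order_trans diff_zero)
  qed simp
qed

text \<open>The sum minus \<open>R^2 / 4 + R - R ln R\<close> is nonincreasing in \<open>R\<close>
  and vanishes in the limit at 0: its derivative is controlled by the logarithmic series and
  \<open>- ln (1 - exp (- x)) <= x / 2 - ln x\<close>, which is \<open>sinh x >= x\<close>. Finally
  \<open>R - R ln R <= 1\<close>.\<close>

lemma truncated_dilog_bound:
  assumes "0 <= R"
  shows "(\<Sum>m=1..K. (1 - exp (- (real m * R))) / (real m)^2) <= 1 + R^2 / 4"
proof (cases "R = 0")
  case False
  define f where "f = (\<lambda>R. \<Sum>m=1..K. (1 - exp (- (real m * R))) / (real m)^2)"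
  define G where "G = (\<lambda>R. f R - R\<^sup>2 / 4 - R + R * ln R)"
  have dG: "(G has_real_derivative (\<Sum>m=1..K. exp (- (real m * x)) / real m) - x / 2 + ln x) (at x)" if "x > 0" for x
  proof -
    have "(f has_real_derivative (\<Sum>m=1..K. exp (- (real m * x)) / real m)) (at x)"
      unfolding f_def
    proof (rule DERIV_sum)
      fix m assume m: "m \<in> {1..K}"
      have "((\<lambda>R. (1 - exp (- (real m * R))) / (real m)^2) has_real_derivative (0 - exp (- (real m * x)) * (- real m)) / (real m)^2) (at x)"
      proof (rule DERIV_cdivide, rule DERIV_diff[OF DERIV_const])
        show "((\<lambda>R. exp (- (real m * R))) has_real_derivative exp (- (real m * x)) * (- real m)) (at x)"
          by (auto intro!: derivative_eq_intros)
      qed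
      then show "((\<lambda>R. (1 - exp (- (real m * R))) / (real m)^2) has_real_derivative exp (- (real m * x)) / real m) (at x)"
        using m by (simp add: power2_eq_square)
    qed
    moreover have "((\<lambda>R. R * ln R) has_real_derivative (1 * ln x + 1 / x * x)) (at x)"
      by (rule DERIV_mult[OF DERIV_ident DERIV_ln_divide[OF that]])
    moreover have "((\<lambda>R::real. R\<^sup>2 / 4) has_real_derivative x / 2) (at x)"
      by (auto intro!: derivative_eq_intros)
    ultimately have "(G has_real_derivative (\<Sum>m=1..K. exp (- (real m * x)) / real m) - x / 2 - 1 + (1 * ln x + 1 / x * x)) (at x)"
      unfolding G_def by (intro DERIV_add DERIV_diff DERIV_ident)
    moreover have "(\<Sum>m=1..K. exp (- (real m * x)) / real m) - x / 2 - 1 + (1 * ln x + 1 / x * x)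
        = (\<Sum>m=1..K. exp (- (real m * x)) / real m) - x / 2 + ln x" using that by simp
    ultimately show ?thesis by (simp only:)
  qed
  have neg: "(\<Sum>m=1..K. exp (- (real m * x)) / real m) - x / 2 + ln x <= 0" if "x > 0" for x
  proof -
    have s: "(\<lambda>n. - ((- (- exp (- x))) ^ n) / of_nat n) sums ln (1 + (- exp (- x)))"
      by (rule ln_series') (use that in auto)
    have t: "- ((- (- exp (- x))) ^ n) / of_nat n = - (exp (- (real n * x)) / real n)" for n
      by (simp flip: exp_of_nat_mult)
    have "(\<lambda>n. exp (- (real n * x)) / real n) sums - ln (1 - exp (- x))"
      using sums_minus[OF s] unfolding t by simp
    then have "(\<Sum>m\<in>{1..K}. exp (- (real m * x)) / real m) <= - ln (1 - exp (- x))"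
      by (metis (no_types, lifting) sum_le_suminf sums_summable sums_unique finite_atLeastAtMost divide_nonneg_nonneg exp_ge_zero of_nat_0_le_iff)
    moreover have "- ln (1 - exp (- x)) - x / 2 + ln x <= 0"
    proof -
      have "x / 2 <= sinh (x / 2)" using that by (intro sinh_ge_self) auto
      then have "x <= exp (x / 2) - exp (- (x / 2))" by (simp add: sinh_def)
      also have "... = exp (x / 2) * (1 - exp (- x))" by (simp add: right_diff_distrib flip: exp_add)
      finally have "ln x <= ln (exp (x / 2) * (1 - exp (- x)))" using that by (intro ln_mono) auto
      also have "... = x / 2 + ln (1 - exp (- x))" using that by (subst ln_mult) auto
      finally show ?thesis by simp
    qed
    ultimately show ?thesis by linarith
  qed
  have "G R <= 0 + e" if e: "e > 0" for e
  proof -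
    \<comment> \<open>Small enough for \<open>f s <= (K + 1) s <= e\<close>; this replaces a limit
      at 0.\<close>
    define s where "s = min (min R 1) (e / (real K + 1))"
    have s: "0 < s" "s <= R" "s <= 1" "s <= e / (real K + 1)" using False assms e by (auto simp: s_def)
    have "G R <= G s"
    proof (rule DERIV_nonpos_imp_nonincreasing[OF s(2)])
      fix x assume "s <= x" "x <= R"
      then have "x > 0" using s(1) by linarith
      then show "\<exists>y. (G has_real_derivative y) (at x) \<and> y <= 0" using dG neg by blast
    qed
    also have "G s <= f s"
    proof -
      have "s * ln s <= 0" using s by (intro mult_nonneg_nonpos) auto
      moreover have "0 <= s^2 / 4" by simp
      ultimately show ?thesis using s unfolding G_def by linarith
    qed
    also have "f s <= (\<Sum>m=1..K. s)"
      unfolding f_def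
    proof (rule sum_mono)
      fix m assume "m \<in> {1..K}"
      then have m: "1 <= real m" by simp
      have "(1 - exp (- (real m * s))) / (real m)^2 <= real m * s / (real m)^2"
        using exp_ge_add_one_self[of "- (real m * s)"] by (intro divide_right_mono) auto
      also have "... = s / real m" using m by (simp add: power2_eq_square)
      also have "... <= s / 1" using m s by (intro divide_left_mono) auto
      finally show "(1 - exp (- (real m * s))) / (real m)^2 <= s" by simp
    qed
    also have "... <= (real K + 1) * s" using s by simp
    also have "... <= e" using s(4) by (simp add: pos_le_divide_eq mult.commute)
    finally show ?thesis by simp
  qed
  then have "G R <= 0" by (rule field_le_epsilon)
  moreover have "R - R * ln R <= 1"
  proof -
    have "ln (1 / R) <= 1 / R - 1" using False assms by (intro ln_le_minus_one) auto
    then have "R * (- ln R) <= R * (1 / R - 1)" using False assms by (intro mult_left_mono) (auto simp: ln_div)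
    then show ?thesis using False by (simp add: algebra_simps)
  qed
  ultimately show ?thesis unfolding G_def f_def by linarith
qed simp

text \<open>Only multiples of \<open>d\<close> can be resonant, and their decay bounds add up to a
  dilogarithm divided by \<open>d^2\<close>; \<open>d >= 3\<close> makes this at most
  \<open>1 / (18 h)\<close>. Other \<open>r <= R0\<close> give geometric sums of size
  \<open>2 / p\<close>, and the tail beyond \<open>R0\<close> costs
  \<open>1 / (2 R0 h)\<close>.\<close>

lemma qterm_bound_high_denominator:
  fixes x h p :: real and d n :: nat
  defines "q \<equiv> exp (of_real (- h) + \<i> * of_real (pi * x))"
  assumes h: "0 < h" and d: "3 <= d" and R0: "1 <= R0" and p: "0 < p"
    and res: "\<And>r b. 1 <= r ==> r <= R0 ==> \<bar>real r * x - of_int b\<bar> < p ==> d dvd r"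
  shows "norm (qterm q n) <= exp (1 / (18 * h) + 2 * real R0 / p + 1 / (2 * real R0 * h))"
proof -
  have nq: "norm q = exp (- h)" by (simp add: q_def)
  have q1: "norm q < 1" using h nq by simp
  define a where "a = (\<lambda>r. norm (\<Sum>j=1..n. q ^ (2 * j * r)))"
  define f where "f = (\<lambda>r::nat. (1 - exp (- (2 * real r * h * real n))) / (2 * (real r)^2 * h))"
  have f0: "0 <= f r" for r unfolding f_def using h by (intro divide_nonneg_nonneg) auto
  have decay: "a r / real r <= f r" if "1 <= r" for r
  proof -
    have "a r / real r <= ((1 - exp (- (2 * real r * h * real n))) / (2 * real r * h)) / real r"
      unfolding a_def by (intro divide_right_mono power_sum_le_decay nq h that) simp
    also have "... = f r" by (simp add: f_def power2_eq_square mult_ac)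
    finally show ?thesis .
  qed
  have low: "a r / real r <= 2 / p + (if d dvd r then f r else 0)" if r: "1 <= r" "r <= R0" for r
  proof (cases "d dvd r")
    case True
    have "0 <= 2 / p" using p by simp
    then show ?thesis using decay[OF r(1)] unfolding if_P[OF True] by linarith
  next
    case False
    then have "p <= \<bar>real r * x - of_int b\<bar>" for b using res[OF r, of b] by force
    then have c: "2 * p <= norm (1 - cis (2 * pi * (real r * x)))" by (rule norm_one_minus_cis_ge)
    define u where "u = cis (2 * pi * (real r * x))"
    define g where "g = exp (- (2 * real r * h))"
    have g: "0 <= g" "g <= 1" using h by (auto simp: g_def)
    have qu: "q ^ (2 * r) = of_real g * u"
      unfolding q_def g_def u_def cis_conv_exp exp_of_real[symmetric] exp_of_nat_mult[symmetric] exp_add[symmetric]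
      by (rule arg_cong[of _ _ exp]) (simp add: algebra_simps)
    \<comment> \<open>Contracting a point \<open>u\<close> of the unit circle to
      \<open>g * u\<close> at most halves its distance from 1.\<close>
    have "norm (1 - u) <= norm (1 - of_real g * u) + norm ((of_real g - 1) * u)"
      using norm_triangle_ineq[of "1 - of_real g * u" "(of_real g - 1) * u"] by (simp add: algebra_simps)
    also have "norm ((of_real g - 1) * u) = 1 - g"
    proof -
      have "norm (of_real g - 1 :: complex) = norm (of_real (g - 1) :: complex)" by simp
      also have "... = 1 - g" unfolding norm_of_real using g by simp
      finally show ?thesis by (simp add: norm_mult u_def)
    qed
    also have "1 - g <= norm (1 - of_real g * u)"
      using norm_triangle_ineq2[of 1 "of_real g * u"] g by (simp add: norm_mult u_def)
    finally have "p <= norm (1 - q ^ (2 * r))" using c unfolding qu u_def[symmetric] by linarith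
    then have "a r <= 2 / p" unfolding a_def using q1 p by (intro power_sum_le_nonresonant) auto
    moreover have "a r / real r <= a r / 1" using r by (intro divide_left_mono) (auto simp: a_def)
    ultimately show ?thesis using False by simp
  qed
  define B where "B = 1 / (18 * h) + h * (real n)^2 / 2 + 2 * real R0 / p + 1 / (2 * real R0 * h)"
  have "(\<Sum>r=1..K. a r / real r) <= B" for K
  proof -
    have "(\<Sum>r=1..K. a r / real r) <= (\<Sum>r\<in>{1..R0} \<union> {R0+1..K}. a r / real r)"
      by (rule sum_mono2) (auto simp: a_def)
    also have "... = (\<Sum>r=1..R0. a r / real r) + (\<Sum>r=R0+1..K. a r / real r)"
      by (rule sum.union_disjoint) auto
    also have "(\<Sum>r=R0+1..K. a r / real r) <= (\<Sum>r=R0+1..K. 1 / (2 * h) * (1 / (real r)^2))"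
    proof (rule sum_mono)
      fix r assume r: "r \<in> {R0+1..K}"
      have "a r / real r <= f r" using r R0 by (intro decay) auto
      also have "... <= 1 / (2 * (real r)^2 * h)" unfolding f_def using h by (intro divide_right_mono) auto
      finally show "a r / real r <= 1 / (2 * h) * (1 / (real r)^2)" by (simp add: mult_ac)
    qed
    also have "... = 1 / (2 * h) * (\<Sum>r=R0+1..K. 1 / (real r)^2)" by (simp add: sum_distrib_left)
    also have "... <= 1 / (2 * h) * (1 / real R0)"
      using h by (intro mult_left_mono sum_inverse_squares_tail R0) auto
    also have "(\<Sum>r=1..R0. a r / real r) <= (\<Sum>r=1..R0. 2 / p + (if d dvd r then f r else 0))"
      by (intro sum_mono low) auto
    also have "... = 2 * real R0 / p + (\<Sum>r\<in>{r\<in>{1..R0}. d dvd r}. f r)"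
      by (subst sum.inter_filter) (auto simp: sum.distrib)
    also have "(\<Sum>r\<in>{r\<in>{1..R0}. d dvd r}. f r) <= (\<Sum>r\<in>(*) d ` {1..R0}. f r)"
    proof (rule sum_mono2)
      show "{r\<in>{1..R0}. d dvd r} \<subseteq> (*) d ` {1..R0}"
      proof
        fix r assume r: "r \<in> {r\<in>{1..R0}. d dvd r}"
        then obtain m where m: "r = d * m" by auto
        have "m \<noteq> 0" using r m by (metis (no_types, lifting) mem_Collect_eq atLeastAtMost_iff mult_0_right not_one_le_zero)
        moreover have "m <= R0"
        proof -
          have "1 * m <= d * m" using d by (intro mult_right_mono) auto
          also have "... <= R0" using r m by auto
          finally show ?thesis by simp
        qed
        ultimately have "m \<in> {1..R0}" by auto
        then show "r \<in> (*) d ` {1..R0}" using m by blast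
      qed
    qed (use f0 in auto)
    also have "(\<Sum>r\<in>(*) d ` {1..R0}. f r) = (\<Sum>m=1..R0. f (d * m))"
      using d by (subst sum.reindex) (auto simp: inj_on_def)
    also have "... = 1 / (2 * (real d)^2 * h) * (\<Sum>m=1..R0. (1 - exp (- (real m * (2 * real d * h * real n)))) / (real m)^2)"
      by (simp add: f_def sum_distrib_left power_mult_distrib mult_ac)
    \<comment> \<open>The quadratic term becomes \<open>h n^2 / 2\<close> whatever \<open>d\<close>
      is, and is cancelled by the factor \<open>norm q ^ (n * (n + 1) div 2)\<close> below.\<close>
    also have "... <= 1 / (2 * (real d)^2 * h) * (1 + (2 * real d * h * real n)^2 / 4)"
      using h by (intro mult_left_mono truncated_dilog_bound) auto
    also have "... = 1 / (2 * (real d)^2 * h) + h * (real n)^2 / 2"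
      using h d by (simp add: power2_eq_square field_simps)
    also have "1 / (2 * (real d)^2 * h) <= 1 / (18 * h)"
    proof -
      have "(3::real)^2 <= (real d)^2" using d by (intro power_mono) auto
      then show ?thesis using h d by (intro divide_left_mono) auto
    qed
    finally show ?thesis unfolding B_def by (simp add: mult_ac)
  qed
  then have "norm (qterm q n) <= norm q ^ (n * (n + 1) div 2) * exp B"
    unfolding a_def by (rule norm_qterm_le_series[OF q1])
  also have "norm q ^ (n * (n + 1) div 2) <= exp (- (h * (real n)^2 / 2))"
  proof -
    have "norm q ^ (n * (n + 1) div 2) = exp (- (real (n * (n + 1) div 2) * h))" unfolding nq by (simp flip: exp_of_nat_mult)
    also have "real (n * (n + 1) div 2) = real n * (real n + 1) / 2" by (simp add: real_of_nat_div algebra_simps)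
    also have "exp (- (real n * (real n + 1) / 2 * h)) <= exp (- (h * (real n)^2 / 2))"
      using h by (simp add: power2_eq_square algebra_simps)
    finally show ?thesis .
  qed
  then have "norm q ^ (n * (n + 1) div 2) * exp B <= exp (- (h * (real n)^2 / 2)) * exp B" by (intro mult_right_mono) auto
  also have "... = exp (1 / (18 * h) + 2 * real R0 / p + 1 / (2 * real R0 * h))"
    by (simp add: B_def flip: exp_add)
  finally show ?thesis .
qed


section \<open>Minor arcs adjacent to the points \<open>1\<close>, \<open>- 1\<close> and
  \<open>\<i>\<close>\<close>

lemma dilog_pos_arg: "0 <= t ==> t <= pi ==> 0 <= r ==> r <= 1 ==> 0 <= Im (dilog (of_real r * cis t))"
  using Im_dilog_radial[of t 0 r] by simp

text \<open>A Riemann sum comparison: \<open>F\<close> is a primitive of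
  \<open>L x = ln (norm (1 + exp (- 2 x z)))\<close>. The derivative of \<open>L\<close> is of order
  \<open>norm z * exp (- 2 h x)\<close>, so in the cone the total error is bounded.\<close>

lemma sum_ln_norm_ge:
  assumes M: "1 <= M"
  obtains C where "0 < C" "\<And>z n. z \<in> sector M ==> Re z <= 1 ==>
    Re ((dilog (- exp (- (2 * of_nat n * z))) + of_real (pi^2 / 12)) / (2 * z)) - C <= (\<Sum>j=1..n. ln (norm (1 + exp (- (2 * of_nat j * z)))))"
proof -
  obtain c where c: "0 < c" "\<And>w::complex. 0 <= Re w ==> \<bar>Im w\<bar> <= M * Re w ==> c <= norm (- 1 - exp (- (2 * pi * w)))"
    using dist_root_exp_sector[OF M, of "- 1"] by auto
  show ?thesis
  proof (rule that)
    show "0 < 3 * (1 + M) / c" using c M by simp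
    fix z :: complex and n :: nat
    assume z: "z \<in> sector M" "Re z <= 1"
    define h where "h = Re z"
    have h: "0 < h" "h <= 1" "\<bar>Im z\<bar> <= M * h" using z by (auto simp: sector_def h_def)
    have z0: "z \<noteq> 0" using sector_nonzero[OF z(1)] .
    have nz: "norm z <= (1 + M) * h" using cmod_le[of z] h by (simp add: h_def algebra_simps)
    define e where "e = (\<lambda>x::real. exp (- (2 * of_real x * z)))"
    define L where "L = (\<lambda>x. ln (norm (1 + e x)))"
    define F where "F = (\<lambda>x. Re (dilog (- e x) / (2 * z)))"
    have ne: "norm (e x) = exp (- (2 * x * h))" for x by (simp add: e_def h_def)
    have ce: "c <= norm (1 + e x)" if x: "0 <= x" for x
    proof -
      have "\<bar>Im (of_real (x / pi) * z)\<bar> <= M * Re (of_real (x / pi) * z)"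
        using mult_left_mono[OF h(3), of "x / pi"] x by (simp add: abs_mult h_def mult_ac)
      then have "c <= norm (- 1 - exp (- (2 * pi * (of_real (x / pi) * z))))"
        using x h by (intro c(2)) (auto simp: h_def)
      also have "2 * pi * (of_real (x / pi) * z) = 2 * of_real x * z" by simp
      also have "norm (- 1 - exp (- (2 * of_real x * z))) = norm (1 + e x)"
        unfolding e_def by (metis (no_types, lifting) minus_add_distrib norm_minus_cancel uminus_add_conv_diff add.commute diff_conv_add_uminus)
      finally show ?thesis .
    qed
    have dF: "(F has_real_derivative L x) (at x)" if x: "x > 0" for x
    proof -
      have lt: "norm (- e u) < 1" if "u > 0" for u using that h by (simp add: ne)
      have ne1: "- e u \<noteq> 1" if "u > 0" for u using lt[OF that] by (metis norm_one less_irrefl)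
      have "((\<lambda>x. - e x) has_vector_derivative (- (2 * z) * (- e x))) (at x)"
      proof -
        have "((\<lambda>u. - exp (- (2 * u * z))) has_field_derivative (- (2 * z) * (- e x))) (at (of_real x))"
          by (auto intro!: derivative_eq_intros simp: e_def)
        from has_vector_derivative_real_field[OF this] show ?thesis by (simp add: e_def)
      qed
      then have "((\<lambda>x. dilog (- e x)) has_vector_derivative (- (- (2 * z) * (- e x) * Ln (1 - (- e x)) / (- e x)))) (at x)"
        by (rule dilog_comp_has_vector_derivative[of _ _ _ "{0<..}"]) (use x less_imp_le[OF lt] ne1 in \<open>auto simp: e_def\<close>)
      then have "((\<lambda>x. dilog (- e x)) has_vector_derivative (2 * z * Ln (1 + e x))) (at x)"
        by (simp add: e_def mult.assoc)
      then have "((\<lambda>x. dilog (- e x) / (2 * z)) has_vector_derivative ((2 * z * Ln (1 + e x)) / (2 * z))) (at x)"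
        by (rule has_vector_derivative_divide)
      then have "((\<lambda>x. dilog (- e x) / (2 * z)) has_vector_derivative Ln (1 + e x)) (at x)" using z0 by simp
      from has_real_derivative_Re[OF this] have "(F has_real_derivative Re (Ln (1 + e x))) (at x)" unfolding F_def .
      moreover have "1 + e x \<noteq> 0" using ce[of x] x c(1) by auto
      ultimately show ?thesis unfolding L_def by simp
    qed
    have contF: "continuous_on {0..} F"
      unfolding F_def e_def
      by (intro continuous_intros continuous_on_dilog_comp) (use h z0 in \<open>auto simp: h_def\<close>)
    \<comment> \<open>The mean value theorem produces \<open>L\<close> at an interior point; moving
      it to the right end costs at most the bound on the derivative of \<open>L\<close>.\<close>
    have step: "F (real (Suc j)) - F (real j) <= L (real (Suc j)) + 2 * norm z / c * exp (- (2 * h * real j))" for j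
    proof -
      have "\<exists>l x. real j < x \<and> x < real (Suc j) \<and> DERIV F x :> l \<and> F (real (Suc j)) - F (real j) = (real (Suc j) - real j) * l"
      proof (rule MVT)
        show "continuous_on {real j..real (Suc j)} F" by (rule continuous_on_subset[OF contF]) auto
        show "F differentiable (at x)" if "real j < x" "x < real (Suc j)" for x
          using dF[of x] that by (meson le_less_trans of_nat_0_le_iff real_differentiable_def)
      qed simp
      then obtain l x where x: "real j < x" "x < real (Suc j)" "DERIV F x :> l" "F (real (Suc j)) - F (real j) = l" by auto
      have x0: "0 < x" using x(1) by (meson le_less_trans of_nat_0_le_iff)
      have l: "l = L x" using DERIV_unique[OF x(3) dF[OF x0]] .
      have "norm (L x - L (real (Suc j))) <= 2 * norm z / c * exp (- (2 * h * real j)) * norm (x - real (Suc j))"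
      proof (rule field_differentiable_bound[of "{real j..real (Suc j)}" L "\<lambda>u. Re (- (2 * z) * e u / (1 + e u))"])
        fix u assume u: "u \<in> {real j..real (Suc j)}"
        have u0: "0 <= u" using u by (meson atLeastAtMost_iff of_nat_0_le_iff order_trans)
        have nz1: "1 + e u \<noteq> 0" using ce[OF u0] c(1) by auto
        have d: "((\<lambda>x. 1 + e x) has_vector_derivative - (2 * z) * e u) (at u)"
        proof -
          have "((\<lambda>u. 1 + exp (- (2 * u * z))) has_field_derivative (- (2 * z) * e u)) (at (of_real u))"
            by (auto intro!: derivative_eq_intros simp: e_def)
          from has_vector_derivative_real_field[OF this] show ?thesis by (simp add: e_def)
        qed
        have dn: "((\<lambda>x. (norm (1 + e x))\<^sup>2) has_real_derivative 2 * Re (cnj (1 + e u) * (- (2 * z) * e u))) (at u)"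
        proof -
          have sq: "((\<lambda>x. (f x)\<^sup>2) has_real_derivative 2 * f u * f') (at u)" if "(f has_real_derivative f') (at u)" for f f'
            using DERIV_power[OF that, of 2] by (simp add: mult_ac)
          have "((\<lambda>x. (Re (1 + e x))\<^sup>2 + (Im (1 + e x))^2) has_real_derivative
              (2 * Re (1 + e u) * Re (- (2 * z) * e u) + 2 * Im (1 + e u) * Im (- (2 * z) * e u))) (at u)"
            by (intro DERIV_add sq has_real_derivative_Re[OF d] has_real_derivative_Im[OF d])
          then show ?thesis unfolding cmod_power2 by (simp add: algebra_simps)
        qed
        have "((\<lambda>x. ln ((norm (1 + e x))^2) / 2) has_real_derivative
            (1 / (norm (1 + e u))^2 * (2 * Re (cnj (1 + e u) * (- (2 * z) * e u)))) / 2) (at u)"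
          by (rule DERIV_cdivide, rule DERIV_chain2[OF DERIV_ln_divide dn]) (use nz1 in auto)
        moreover have "ln ((norm (1 + e x))^2) / 2 = L x" for x
          unfolding L_def by (cases "1 + e x = 0") (auto simp: ln_realpow)
        moreover have "(1 / (norm (1 + e u))^2 * (2 * Re (cnj (1 + e u) * (- (2 * z) * e u)))) / 2 = Re (- (2 * z) * e u / (1 + e u))"
        proof -
          have gen: "(1 / N * (2 * X)) / 2 = X / N" for N X :: real by simp
          show ?thesis
            unfolding gen complex_div_cnj[of "- (2 * z) * e u" "1 + e u"] of_real_power[symmetric] Re_divide_of_real
            by (simp only: mult.commute)
        qed
        ultimately have "(L has_real_derivative Re (- (2 * z) * e u / (1 + e u))) (at u)" by simp
        then show "(L has_real_derivative Re (- (2 * z) * e u / (1 + e u))) (at u within {real j..real (Suc j)})"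
          by (rule has_field_derivative_at_within)
        have "norm (Re (- (2 * z) * e u / (1 + e u))) <= norm (- (2 * z) * e u / (1 + e u))"
          by (simp only: real_norm_def abs_Re_le_cmod)
        also have "... = 2 * norm z * exp (- (2 * u * h)) / norm (1 + e u)" by (simp add: norm_mult norm_divide ne)
        also have "... <= 2 * norm z * exp (- (2 * h * real j)) / c"
          using ce[OF u0] c(1) u h by (intro frac_le mult_left_mono) auto
        finally show "norm (Re (- (2 * z) * e u / (1 + e u))) <= 2 * norm z / c * exp (- (2 * h * real j))" by (simp add: mult_ac)
      qed (use x in auto)
      also have "... <= 2 * norm z / c * exp (- (2 * h * real j)) * 1"
        using x c(1) by (intro mult_left_mono) auto
      finally have "L x <= L (real (Suc j)) + 2 * norm z / c * exp (- (2 * h * real j))" by (simp add: abs_le_iff)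
      then show ?thesis using x l by simp
    qed
    have tele: "F (real n) - F 0 <= (\<Sum>j<n. L (real (Suc j)) + 2 * norm z / c * exp (- (2 * h * real j)))"
    proof -
      have "(\<Sum>j<n. F (real (Suc j)) - F (real j)) <= (\<Sum>j<n. L (real (Suc j)) + 2 * norm z / c * exp (- (2 * h * real j)))"
        by (intro sum_mono step)
      then show ?thesis using sum_lessThan_telescope[of "\<lambda>j. F (real j)" n] by (simp only: of_nat_0)
    qed
    also have "... = (\<Sum>j<n. L (real (Suc j))) + 2 * norm z / c * (\<Sum>j<n. exp (- (2 * h * real j)))"
      by (simp add: sum.distrib sum_distrib_left)
    finally have 1: "F (real n) - F 0 <= (\<Sum>j<n. L (real (Suc j))) + 2 * norm z / c * (\<Sum>j<n. exp (- (2 * h * real j)))" .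
    have "(\<Sum>j<n. exp (- (2 * h * real j))) <= 1 + 1 / (2 * h)"
    proof -
      have "(\<Sum>j<n. exp (- (2 * h * real j))) <= (\<Sum>j\<in>insert 0 {1..n}. exp (- (2 * h * real j)))"
        by (rule sum_mono2) auto
      also have "... = 1 + (\<Sum>j=1..n. exp (- (2 * h * real j)))" by simp
      also have "(\<Sum>j=1..n. exp (- (2 * h * real j))) <= (1 - exp (- (2 * h * real n))) / (2 * h)"
        by (rule sum_exp_le) (use h in auto)
      also have "... <= 1 / (2 * h)" using h by (intro divide_right_mono) auto
      finally show ?thesis by simp
    qed
    then have "2 * norm z / c * (\<Sum>j<n. exp (- (2 * h * real j))) <= 2 * norm z / c * (1 + 1 / (2 * h))"
      using c(1) by (intro mult_left_mono) auto
    also have "2 * norm z / c * (1 + 1 / (2 * h)) <= 2 * ((1 + M) * h) / c * (1 + 1 / (2 * h))"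
      using nz c(1) h by (intro mult_right_mono divide_right_mono) auto
    also have "... = (1 + M) / c * (2 * h + 1)" using h c(1) by (simp add: divide_simps) (simp add: algebra_simps)?
    also have "... <= (1 + M) / c * 3" using h c(1) M by (intro mult_left_mono) auto
    finally have "F (real n) - F 0 <= (\<Sum>j<n. L (real (Suc j))) + (1 + M) / c * 3"
      using 1 by linarith
    moreover have "(\<Sum>j<n. L (real (Suc j))) = (\<Sum>j=1..n. ln (norm (1 + exp (- (2 * of_nat j * z)))))"
      unfolding L_def e_def by (rule sum.reindex_bij_witness[of _ "\<lambda>j. j - 1" Suc]) auto
    moreover have "F (real n) - F 0 = Re ((dilog (- exp (- (2 * of_nat n * z))) + of_real (pi^2 / 12)) / (2 * z))"
      by (simp add: F_def e_def dilog_minus_1 add_divide_distrib)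
    ultimately show "Re ((dilog (- exp (- (2 * of_nat n * z))) + of_real (pi^2 / 12)) / (2 * z)) - 3 * (1 + M) / c <= (\<Sum>j=1..n. ln (norm (1 + exp (- (2 * of_nat j * z)))))"
      by (simp add: mult.commute)
  qed
qed

text \<open>As long as \<open>2 n \<bar>Im z\<bar> <= pi\<close>, the point
  \<open>- exp (- 2 n z)\<close> lies in the closed half disc on the same side as \<open>z\<close>,
  where the imaginary part of the dilogarithm has the same sign.\<close>

lemma Im_dilog_times_Im_nonneg:
  assumes "0 <= Re z" "2 * real n * \<bar>Im z\<bar> <= pi"
  shows "0 <= Im (dilog (- exp (- (2 * of_nat n * z)))) * Im z"
proof -
  have e: "- exp (- (2 * of_nat n * w)) = of_real (exp (- (2 * real n * Re w))) * cis (pi - 2 * real n * Im w)" for w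
  proof -
    have "cis (pi - 2 * real n * Im w) = cis pi * cis (- (2 * real n * Im w))" unfolding cis_mult by simp
    then show ?thesis by (simp add: exp_eq_polar mult_ac)
  qed
  have pos: "0 <= Im (dilog (- exp (- (2 * of_nat n * w))))" if "0 <= Im w" "0 <= Re w" "2 * real n * Im w <= pi" for w
    unfolding e by (rule dilog_pos_arg) (use that in auto)
  show ?thesis
  proof (cases "Im z \<ge> 0")
    case True
    then show ?thesis using pos[of z] assms by (intro mult_nonneg_nonneg) auto
  next
    case False
    have ecnj: "- exp (- (2 * of_nat n * cnj z)) = cnj (- exp (- (2 * of_nat n * z)))" by (simp add: exp_cnj)
    then have "Im (dilog (- exp (- (2 * of_nat n * cnj z)))) = - Im (dilog (- exp (- (2 * of_nat n * z))))"
    proof -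
      have "dilog (cnj (- exp (- (2 * of_nat n * z)))) = cnj (dilog (- exp (- (2 * of_nat n * z))))"
        by (rule dilog_cnj) (use assms(1) in simp)
      then show ?thesis unfolding ecnj by (simp only: cnj.simps)
    qed
    then have "Im (dilog (- exp (- (2 * of_nat n * z)))) <= 0" using pos[of "cnj z"] assms False by simp
    then show ?thesis using False by (intro mult_nonpos_nonpos) auto
  qed
qed

text \<open>While \<open>2 n \<bar>Im z\<bar> <= pi\<close>, the imaginary part of \<open>D\<close>
  works in favour of the bound. Beyond that \<open>n >= pi / (2 \<bar>Im z\<bar>)\<close>, and the
  Gaussian decay \<open>h n^2 / 2\<close> outweighs
  \<open>\<bar>Im D\<bar> <= 8 vol <= 27/25\<close>.\<close>

lemma exponent_near_real:
  fixes z :: complex and n :: nat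
  assumes z: "0 < Re z"
  defines "D \<equiv> dilog (- exp (- (2 * of_nat n * z)))"
  shows "- (Re z * (real n)^2 / 2) - Re ((D + of_real (pi^2 / 12)) / (2 * z)) <= 3 / (50 * Re z)"
proof -
  define h y where "h = Re z" and "y = Im z"
  have h: "0 < h" using z by (simp add: h_def)
  have nz: "(norm z)^2 = h^2 + y^2" unfolding h_def y_def by (rule cmod_power2)
  have n0: "0 < h^2 + y^2" using h by (intro add_pos_nonneg) auto
  have D1: "norm (- exp (- (2 * of_nat n * z))) <= 1" using z by simp
  have "- Re ((D + of_real (pi^2 / 12)) / (2 * z)) = - ((Re D + pi^2 / 12) * h + Im D * y) / (2 * (norm z)^2)"
  proof -
    have "(D + of_real (pi^2 / 12)) / (2 * z) = ((D + of_real (pi^2 / 12)) / z) / of_real 2" by simp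
    then have "Re ((D + of_real (pi^2 / 12)) / (2 * z)) = Re ((D + of_real (pi^2 / 12)) / z) / 2" by (simp only: Re_divide_of_real)
    also have "Re ((D + of_real (pi^2 / 12)) / z) = ((Re D + pi^2 / 12) * h + Im D * y) / (norm z)^2"
      by (simp add: Re_divide h_def y_def cmod_power2)
    finally show ?thesis by (simp only: minus_divide_left divide_divide_eq_left mult.commute)
  qed
  also have "... <= - (Im D * y) / (2 * (norm z)^2)"
  proof (rule divide_right_mono)
    have "0 <= (Re D + pi^2 / 12) * h" using Re_dilog_ge[OF D1] h unfolding D_def by (intro mult_nonneg_nonneg) auto
    then show "- ((Re D + pi^2 / 12) * h + Im D * y) <= - (Im D * y)" by linarith
  qed simp
  finally have 1: "- Re ((D + of_real (pi^2 / 12)) / (2 * z)) <= - (Im D * y) / (2 * (norm z)^2)" .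
  show ?thesis
  proof (cases "2 * real n * \<bar>y\<bar> <= pi")
    case True
    then have "0 <= Im D * y" unfolding D_def y_def using z by (intro Im_dilog_times_Im_nonneg) auto
    then have "- (Im D * y) / (2 * (norm z)^2) <= 0" by (intro divide_nonpos_nonneg) auto
    moreover have "0 <= h * (real n)^2 / 2" "0 <= 3 / (50 * h)" using h by auto
    ultimately show ?thesis using 1 unfolding h_def[symmetric] by linarith
  next
    case False
    then have y0: "y \<noteq> 0" using pi_gt3 by auto
    define x where "x = 1 / \<bar>y\<bar>"
    have x: "0 < x" using y0 by (simp add: x_def)
    have "- (Im D * y) / (2 * (norm z)^2) <= 27 / 25 * \<bar>y\<bar> / (2 * y^2)"
    proof (rule frac_le)
      have "- (Im D * y) <= \<bar>Im D\<bar> * \<bar>y\<bar>" by (simp flip: abs_mult)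
      also have "... <= 27 / 25 * \<bar>y\<bar>" using abs_Im_dilog_le[OF D1] vol_upper unfolding D_def by (intro mult_right_mono) auto
      finally show "- (Im D * y) <= 27 / 25 * \<bar>y\<bar>" .
    qed (use y0 in \<open>auto simp: nz\<close>)
    also have "... = 27 / 50 * x" using y0 by (simp add: x_def power2_eq_square field_simps)
    finally have 2: "- (Im D * y) / (2 * (norm z)^2) <= 27 / 50 * x" .
    have "pi / 2 * x <= real n" using False y0 by (simp add: x_def field_simps)
    then have "(pi / 2 * x)^2 <= (real n)^2" using x by (intro power_mono) auto
    moreover have "(3 / 2 * x)^2 * (49 / 45) <= (pi / 2 * x)^2"
    proof -
      have "(314 / 100)^2 <= pi^2" using pi_approx by (intro power_mono) auto
      then have "9 * (49 / 45) * x^2 <= pi^2 * x^2" by (intro mult_right_mono) (auto simp: power2_eq_square)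
      then show ?thesis by (simp add: power_mult_distrib power_divide)
    qed
    ultimately have 3: "h * (49 / 40 * x^2) <= h * ((real n)^2 / 2)"
      using h by (intro mult_left_mono) (auto simp: power_mult_distrib power2_eq_square)
    \<comment> \<open>The coefficient 49/40 is \<open>9.8 / 8\<close>, from
      \<open>pi^2 >= 9.8\<close>. The maximum of \<open>27/50 x - 49/40 h x^2\<close> is about
      \<open>0.0595 / h\<close>, just below \<open>3 / (50 h)\<close>.\<close>
    have "50 * h * (27 / 50 * x - h * (49 / 40 * x^2)) <= 3"
    proof -
      have "0 <= (27 * (h * x) / 4 - 1 / 2 * 4 / 4 * 2 )^2" by simp
      have "27 * (h * x) - 245 / 4 * (h * x)^2 <= 3"
      proof -
        have "0 <= 245 / 4 * ((h * x) - 54 / 245)^2" by simp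
        then show ?thesis by (simp add: power2_eq_square algebra_simps)
      qed
      then show ?thesis by (simp add: power2_eq_square algebra_simps)
    qed
    then have "27 / 50 * x - h * (49 / 40 * x^2) <= 3 / (50 * h)" using h by (simp add: field_simps)
    then show ?thesis using 1 2 3 unfolding h_def[symmetric] by linarith
  qed
qed

text \<open>The denominators involve only \<open>q^2\<close>, so the neighbourhoods of
  \<open>1\<close> and \<open>- 1\<close> are treated together by the sign \<open>s\<close>.\<close>

lemma norm_qterm_near_real:
  assumes M: "1 <= M"
  obtains C where "0 < C" "\<And>z s n. z \<in> sector M ==> Re z <= 1 ==> s^2 = 1 ==>
    norm (qterm (s * exp (- z)) n) <= exp (3 / (50 * Re z) + C)"
proof -
  obtain C where C: "0 < C" "\<And>z n. z \<in> sector M ==> Re z <= 1 ==>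
    Re ((dilog (- exp (- (2 * of_nat n * z))) + of_real (pi^2 / 12)) / (2 * z)) - C <= (\<Sum>j=1..n. ln (norm (1 + exp (- (2 * of_nat j * z)))))"
    using sum_ln_norm_ge[OF M] by blast
  show ?thesis
  proof (rule that[OF C(1)])
    fix z s :: complex and n :: nat
    assume z: "z \<in> sector M" "Re z <= 1" and s: "s^2 = 1"
    have x: "0 < Re z" using z by (simp add: sector_def)
    have s1: "norm s = 1" using s by (auto simp: power2_eq_1_iff)
    have pw: "(s * exp (- z)) ^ (2 * j) = exp (- (2 * of_nat j * z))" for j
    proof -
      have "(s * exp (- z)) ^ (2 * j) = (s^2) ^ j * exp (of_nat (2 * j) * - z)"
        by (simp only: power_mult_distrib power_mult exp_of_nat_mult)
      then show ?thesis using s by (simp add: mult_ac)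
    qed
    have ne: "0 < norm (1 + exp (- (2 * of_nat j * z)))" if "j \<in> {1..n}" for j
    proof -
      have "norm (exp (- (2 * of_nat j * z))) < 1" using x that by simp
      then have "exp (- (2 * of_nat j * z)) \<noteq> - 1" by (metis norm_minus_cancel norm_one less_irrefl)
      then show ?thesis by (simp add: add_eq_0_iff)
    qed
    have "norm (\<Prod>j=1..n. 1 + (s * exp (- z)) ^ (2 * j)) = exp (\<Sum>j=1..n. ln (norm (1 + exp (- (2 * of_nat j * z)))))"
      unfolding prod_norm[symmetric] pw by (subst exp_sum) (auto intro!: prod.cong exp_ln[symmetric] ne)
    then have "norm (qterm (s * exp (- z)) n) = norm (s * exp (- z)) ^ (n * (n + 1) div 2) * exp (- (\<Sum>j=1..n. ln (norm (1 + exp (- (2 * of_nat j * z))))))"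
      unfolding qterm_def norm_divide norm_power by (simp only: exp_minus[of "sum _ _"] divide_inverse)
    also have "... <= exp (- (Re z * (real n)^2 / 2)) * exp (C - Re ((dilog (- exp (- (2 * of_nat n * z))) + of_real (pi^2 / 12)) / (2 * z)))"
    proof (rule mult_mono)
      have "norm (s * exp (- z)) ^ (n * (n + 1) div 2) = exp (- (real (n * (n + 1) div 2) * Re z))"
        using s1 by (simp add: norm_mult flip: exp_of_nat_mult)
      also have "real (n * (n + 1) div 2) = real n * (real n + 1) / 2" by (simp add: real_of_nat_div algebra_simps)
      also have "exp (- (real n * (real n + 1) / 2 * Re z)) <= exp (- (Re z * (real n)^2 / 2))"
        using x by (simp add: power2_eq_square algebra_simps)
      finally show "norm (s * exp (- z)) ^ (n * (n + 1) div 2) <= exp (- (Re z * (real n)^2 / 2))" .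
      show "exp (- (\<Sum>j=1..n. ln (norm (1 + exp (- (2 * of_nat j * z)))))) <= exp (C - Re ((dilog (- exp (- (2 * of_nat n * z))) + of_real (pi^2 / 12)) / (2 * z)))"
        using C(2)[OF z, of n] by (subst exp_le_cancel_iff) linarith
    qed auto
    also have "... = exp (- (Re z * (real n)^2 / 2) + (C - Re ((dilog (- exp (- (2 * of_nat n * z))) + of_real (pi^2 / 12)) / (2 * z))))"
      by (rule exp_add[symmetric])
    also have "... <= exp (3 / (50 * Re z) + C)"
      using exponent_near_real[OF x, of n] by (subst exp_le_cancel_iff) linarith
    finally show "norm (qterm (s * exp (- z)) n) <= exp (3 / (50 * Re z) + C)" .
  qed
qed

text \<open>The bounds on real and imaginary part of the dilogarithm give an exponent of at most
  \<open>(5/2 h + 27/25 y) / (8 (h^2 + y^2))\<close> with \<open>y = \<bar>Im z\<bar>\<close>. From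
  \<open>y = 4 h\<close> on this is below \<open>3 / (50 h)\<close>, which is why the major arc may
  end at slope 4.\<close>

lemma norm_qterm_near_i:
  assumes M: "1 <= M"
  obtains C where "0 < C" "\<And>z n. z \<in> sector M ==> Re z <= 1 ==> 4 * Re z <= \<bar>Im z\<bar> ==>
    norm (qterm (\<i> * exp (- z)) n) <= C * exp (3 / (50 * Re z) + C / sqrt (Re z))"
proof -
  obtain Cn where Cn: "0 < Cn" "\<And>z. z \<in> sector M ==> Re z <= 1 ==> norm (norm_factor z) <= Cn * exp (Re (of_real (pi^2 / 48) / z))"
    using norm_norm_factor_le[OF M] by blast
  obtain Cp where Cp: "0 < Cp" "\<And>z X. z \<in> sector M ==> norm X <= 1 ==> norm (prod_log_reg z X) <= Cp / sqrt (Re z)"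
    using norm_prod_log_reg_le[OF M] by metis
  define C where "C = max Cn Cp"
  have C: "0 < C" "Cn <= C" "Cp <= C" using Cn Cp by (auto simp: C_def)
  show ?thesis
  proof (rule that[OF C(1)])
    fix z :: complex and n :: nat
    assume z: "z \<in> sector M" "Re z <= 1" "4 * Re z <= \<bar>Im z\<bar>"
    define h y where "h = Re z" and "y = \<bar>Im z\<bar>"
    have h: "0 < h" "4 * h <= y" using z by (auto simp: sector_def h_def y_def)
    have z0: "z \<noteq> 0" using sector_nonzero[OF z(1)] .
    define X where "X = (- 1) ^ n * exp (- (of_nat (2 * n + 1) * z))"
    have X: "norm X <= 1" unfolding X_def by (rule norm_sign_exp_le) (use h in \<open>simp add: h_def\<close>)
    then have X2: "norm (X^2) <= 1" by (simp add: norm_power power_le_one)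
    define D where "D = dilog (X^2)"
    have "norm (qterm (\<i> * exp (- z)) n) = norm (norm_factor z) * exp (Re (- z * (of_nat n + 1 / 2)^2 / 2 + prod_log z X))"
      unfolding qterm_eq_prod_log[OF h(1)[unfolded h_def]] X_def by (simp add: norm_mult norm_power)
    also have "... <= (C * exp (Re (of_real (pi^2 / 48) / z))) * exp (C / sqrt h - Re (D / (8 * z)))"
    proof (rule mult_mono)
      show "norm (norm_factor z) <= C * exp (Re (of_real (pi^2 / 48) / z))"
        using Cn(2)[OF z(1,2)] C by (meson exp_ge_zero mult_right_mono order_trans)
      have "- z * (of_nat n + 1 / 2)^2 / 2 = - (of_real ((real n + 1 / 2)^2 / 2) * z)" by simp
      then have 1: "Re (- z * (of_nat n + 1 / 2)^2 / 2) = - ((real n + 1 / 2)^2 / 2 * h)" by (simp only: h_def) simp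
      have 2: "0 <= (real n + 1 / 2)^2 / 2 * h" using h by (intro mult_nonneg_nonneg) auto
      have "Re (prod_log_reg z X) <= Cp / sqrt h"
        using Cp(2)[OF z(1) X] complex_Re_le_cmod[of "prod_log_reg z X"] by (simp add: h_def)
      also have "... <= C / sqrt h" using C h by (intro divide_right_mono) auto
      finally have 3: "Re (prod_log_reg z X) <= C / sqrt h" .
      have "prod_log z X = prod_log_reg z X - D / (8 * z)" unfolding D_def by (rule prod_log_eq[OF z(1) M X])
      then show "exp (Re (- z * (of_nat n + 1 / 2)^2 / 2 + prod_log z X)) <= exp (C / sqrt h - Re (D / (8 * z)))"
        unfolding \<open>prod_log z X = _\<close> exp_le_cancel_iff plus_complex.simps minus_complex.simps 1 using 2 3 by linarith
    qed (use C in auto)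
    also have "... = C * exp (C / sqrt h + (Re (of_real (pi^2 / 48) / z) - Re (D / (8 * z))))"
      by (simp add: exp_add exp_diff)
    also have "... <= C * exp (C / sqrt h + 3 / (50 * h))"
    proof -
      have n0: "0 < h^2 + y^2" using h by (intro add_pos_nonneg) auto
      have "Re (of_real (pi^2 / 48) / z) - Re (D / (8 * z)) = ((pi^2 / 6 - Re D) * h - Im D * Im z) / (8 * (h^2 + y^2))"
      proof -
        have "of_real (pi^2 / 48) / z - D / (8 * z) = ((of_real (pi^2 / 6) - D) / z) / of_real 8"
          by (simp add: diff_divide_distrib)
        then have "Re (of_real (pi^2 / 48) / z) - Re (D / (8 * z)) = Re ((of_real (pi^2 / 6) - D) / z) / 8"
          by (metis Re_divide_of_real minus_complex.simps(1))
        also have "Re ((of_real (pi^2 / 6) - D) / z) = ((pi^2 / 6 - Re D) * h - Im D * Im z) / (h^2 + y^2)"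
          by (simp add: Re_divide h_def y_def)
        finally show ?thesis by (simp only: divide_divide_eq_left mult.commute)
      qed
      also have "... <= (5 / 2 * h + 27 / 25 * y) / (8 * (h^2 + y^2))"
      proof (rule divide_right_mono)
        have "pi^2 <= (315 / 100)^2" using pi_approx by (intro power_mono) auto
        then have "pi^2 / 6 - Re D <= 5 / 2" using Re_dilog_ge[OF X2] unfolding D_def by (simp add: power2_eq_square)
        then have "(pi^2 / 6 - Re D) * h <= 5 / 2 * h" using h by (intro mult_right_mono) auto
        moreover have "- (Im D * Im z) <= 27 / 25 * y"
        proof -
          have "- (Im D * Im z) <= \<bar>Im D\<bar> * y" unfolding y_def by (simp flip: abs_mult)
          also have "... <= 27 / 25 * y" using abs_Im_dilog_le[OF X2] vol_upper h unfolding D_def by (intro mult_right_mono) auto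
          finally show ?thesis .
        qed
        ultimately show "(pi^2 / 6 - Re D) * h - Im D * Im z <= 5 / 2 * h + 27 / 25 * y" by linarith
      qed (use n0 in simp)
      also have "... <= 3 / (50 * h)"
      proof -
        \<comment> \<open>In terms of the excess over \<open>4 h\<close> the polynomial inequality
          has nonnegative coefficients only.\<close>
        define s where "s = y - 4 * h"
        have s: "0 <= s" "y = 4 * h + s" using h by (auto simp: s_def)
        have "0 <= 67 * h^2 + 138 * (h * s) + 24 * s^2" using h s by simp
        then have "(5 / 2 * h + 27 / 25 * y) * (50 * h) <= 3 * (8 * (h^2 + y^2))"
          unfolding s(2) by (simp add: power2_eq_square algebra_simps)
        then show ?thesis using n0 h by (simp add: divide_simps mult_ac)
      qed
      finally show ?thesis using C by (intro mult_left_mono) auto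
    qed
    finally show "norm (qterm (\<i> * exp (- z)) n) <= C * exp (3 / (50 * Re z) + C / sqrt (Re z))"
      by (simp add: h_def add.commute)
  qed
qed

text \<open>If \<open>r\<close> and the least resonant \<open>d\<close> are both resonant, the
  integer \<open>a r - b d\<close> is smaller than \<open>2 R0 q < 1\<close> in absolute value,
  hence 0. A common factor of \<open>a\<close> and \<open>d\<close> could be divided out, against
  the minimality of \<open>d\<close>.\<close>

lemma minimal_resonance_dvd:
  fixes x q :: real and R0 :: nat
  defines "P \<equiv> \<lambda>r b. \<bar>real r * x - of_int b\<bar> < q"
  assumes q: "2 * real R0 * q < 1" and d: "1 <= d" "d <= R0" "P d a"
    and min: "\<And>r b. 1 <= r ==> r < d ==> \<not> P r b"
  shows "coprime a (int d)" "\<And>r b. 1 <= r ==> r <= R0 ==> P r b ==> d dvd r \<and> b * int d = a * int r"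
proof -
  have q0: "0 < q" using d(3) unfolding P_def by (smt (verit) abs_ge_zero)
  show cop: "coprime a (int d)"
  proof (rule ccontr)
    assume "\<not> coprime a (int d)"
    define g where "g = gcd a (int d)"
    have g: "g dvd a" "g dvd int d" "g > 0" using d(1) by (auto simp: g_def)
    have "g \<noteq> 1" using \<open>\<not> coprime a (int d)\<close> by (simp add: g_def coprime_iff_gcd_eq_1)
    then have g2: "g \<ge> 2" using g(3) by linarith
    obtain a' where a': "a = g * a'" using g(1) by auto
    obtain e where e: "int d = g * e" using g(2) by auto
    have e0: "e > 0" using e d(1) g(3) by (metis of_nat_0_less_iff zero_less_mult_pos less_le_trans zero_less_one)
    define r where "r = nat e"
    have r: "int r = e" "1 <= r" using e0 by (auto simp: r_def)
    have "2 * e <= g * e" using g2 e0 by (intro mult_right_mono) auto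
    then have "r < d" using e e0 r by linarith
    have rd: "real d = of_int g * real r" using e r by (metis of_int_mult of_int_of_nat_eq)
    have "of_int g * (real r * x - of_int a') = real d * x - of_int a" unfolding rd a' by (simp add: algebra_simps)
    then have "of_int g * \<bar>real r * x - of_int a'\<bar> < q"
      using d(3) g(3) unfolding P_def by (metis abs_mult abs_of_pos of_int_0_less_iff)
    moreover have "1 * \<bar>real r * x - of_int a'\<bar> <= of_int g * \<bar>real r * x - of_int a'\<bar>"
      using g2 by (intro mult_right_mono) auto
    ultimately have "P r a'" unfolding P_def mult_1 by linarith
    then show False using min[OF r(2) \<open>r < d\<close>] by blast
  qed
  fix r b assume r: "1 <= r" "r <= R0" "P r b"
  have "\<bar>of_int (int r * a - b * int d)\<bar> = \<bar>real d * (real r * x - of_int b) - real r * (real d * x - of_int a)\<bar>"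
    by (simp add: algebra_simps)
  also have "... <= real d * \<bar>real r * x - of_int b\<bar> + real r * \<bar>real d * x - of_int a\<bar>"
    by (rule order_trans[OF abs_triangle_ineq4]) (simp add: abs_mult)
  also have "... <= real R0 * q + real R0 * q"
    using r d unfolding P_def by (intro add_mono mult_mono) auto
  also have "... < 1" using q by (simp add: algebra_simps)
  finally have "\<bar>int r * a - b * int d\<bar> < 1" by (metis of_int_abs of_int_less_1_iff)
  then have eq: "b * int d = a * int r" by (simp add: mult.commute)
  have "int d dvd a * int r" by (metis eq dvd_triv_right)
  then have "int d dvd int r" using cop by (metis coprime_commute coprime_dvd_mult_right_iff)
  then show "d dvd r \<and> b * int d = a * int r" using eq by simp
qed

text \<open>A case distinction on the rational approximations of \<open>v = t / pi\<close> with
  denominator up to 1000. If there is none, or the least denominator is at least 3,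
  \<open>qterm_bound_high_denominator\<close> applies. Denominator 1 means a neighbourhood of
  \<open>\<plusminus> 1\<close>, denominator 2 one of \<open>\<i>\<close>, from which the major arc
  has been removed.\<close>

lemma minor_arc_bound:
  obtains C h0 where "0 < C" "0 < h0" "\<And>h t n. 0 < h ==> h <= h0 ==> 0 <= t ==> t <= pi ==> 4 * h <= \<bar>t - pi / 2\<bar> ==>
    norm (qterm (exp (of_real (- h) + \<i> * of_real t)) n) <= C * exp (3 / (50 * h) + C / sqrt h)"
proof -
  \<comment> \<open>With \<open>u = 10^6 h\<close> and \<open>R0 = 1000\<close> the high-denominator
    exponent is \<open>(1/18 + 1/500 + 1/2000) / h\<close>, below \<open>3 / (50 h)\<close>. The
    aperture is \<open>4 * 10^6\<close> because \<open>pi * u <= 4 * 10^6 * h\<close>.\<close>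
  define M1 :: real where "M1 = 10 ^ 6"
  define M :: real where "M = 4 * 10 ^ 6"
  have M: "1 <= M" by (simp add: M_def)
  obtain C1 where C1: "0 < C1" "\<And>z s n. z \<in> sector M ==> Re z <= 1 ==> s^2 = 1 ==>
    norm (qterm (s * exp (- z)) n) <= exp (3 / (50 * Re z) + C1)"
    using norm_qterm_near_real[OF M] by blast
  obtain C2 where C2: "0 < C2" "\<And>z n. z \<in> sector M ==> Re z <= 1 ==> 4 * Re z <= \<bar>Im z\<bar> ==>
    norm (qterm (\<i> * exp (- z)) n) <= C2 * exp (3 / (50 * Re z) + C2 / sqrt (Re z))"
    using norm_qterm_near_i[OF M] by blast
  define C where "C = max (exp C1) C2"
  have C: "1 <= C" "exp C1 <= C" "C2 <= C" using C1(1) by (auto simp: C_def le_max_iff_disj)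
  show ?thesis
  proof (rule that)
    show "0 < C" using C by simp
    show "(0::real) < 1 / 10 ^ 10" by simp
    fix h t :: real and n :: nat
    assume h: "0 < h" "h <= 1 / 10 ^ 10" and t: "0 <= t" "t <= pi" "4 * h <= \<bar>t - pi / 2\<bar>"
    define v where "v = t / pi"
    have tv: "t = pi * v" by (simp add: v_def)
    define u where "u = M1 * h"
    have u: "0 < u" "u <= 1 / 10 ^ 4" using h by (auto simp: u_def M1_def)
    \<comment> \<open>This scale makes \<open>2 * 1000 * q = 1/2 < 1\<close>, as
      \<open>minimal_resonance_dvd\<close> requires; \<open>h <= 1 / 10^10\<close> ensures
      \<open>u <= q\<close>.\<close>
    define q :: real where "q = 1 / 4000"
    have s0: "0 <= C / sqrt h" using C h by simp
    have final: "exp (3 / (50 * h)) <= C * exp (3 / (50 * h) + C / sqrt h)"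
    proof -
      have "1 * exp (3 / (50 * h)) <= C * exp (3 / (50 * h) + C / sqrt h)" using C s0 by (intro mult_mono) auto
      then show ?thesis by simp
    qed
    let ?G = "norm (qterm (exp (of_real (- h) + \<i> * of_real t)) n) <= C * exp (3 / (50 * h) + C / sqrt h)"
    have high: ?G if d: "3 <= d" and res: "\<And>r b. 1 <= r ==> r <= 1000 ==> \<bar>real r * v - of_int b\<bar> < u ==> d dvd r" for d :: nat
    proof -
      have "norm (qterm (exp (of_real (- h) + \<i> * of_real (pi * v))) n) <= exp (1 / (18 * h) + 2 * real 1000 / u + 1 / (2 * real 1000 * h))"
        using qterm_bound_high_denominator[OF h(1) d, of 1000 u v n] res u by auto
      also have "... <= exp (3 / (50 * h))"
        using h by (simp add: u_def M1_def field_simps)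
      finally show ?thesis using final unfolding tv by linarith
    qed
    show ?G
    proof (cases "\<exists>r b. 1 <= r \<and> r <= (1000::nat) \<and> \<bar>real r * v - of_int b\<bar> < u")
      case False
      then show ?thesis by (intro high[of 3]) auto
    next
      case True
      then obtain r0 b0 where r0: "1 <= r0" "r0 <= (1000::nat)" "\<bar>real r0 * v - of_int b0\<bar> < u" by blast
      \<comment> \<open>The least denominator is taken at the coarse scale \<open>q\<close>, which
        is independent of \<open>h\<close>; the fine scale \<open>u\<close> is recovered
        below.\<close>
      define Q where "Q = (\<lambda>r::nat. 1 <= r \<and> (\<exists>b::int. \<bar>real r * v - of_int b\<bar> < q))"
      have uq: "u <= q" using u by (simp add: q_def)
      have Qr0: "Q r0" unfolding Q_def using r0(1) less_le_trans[OF r0(3) uq] by blast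
      define d where "d = (LEAST r. Q r)"
      have Qd: "Q d" unfolding d_def by (rule LeastI[of Q, OF Qr0])
      have dr0: "d <= r0" unfolding d_def by (rule Least_le[of Q, OF Qr0])
      have min: "\<not> Q r" if "r < d" for r using that unfolding d_def by (rule not_less_Least)
      obtain a where a: "\<bar>real d * v - of_int a\<bar> < q" using Qd by (auto simp: Q_def)
      have d1: "1 <= d" "d <= 1000" using Qd dr0 r0 by (auto simp: Q_def)
      note res = minimal_resonance_dvd[of 1000 q d v a]
      have cop: "coprime a (int d)" by (rule res) (use d1 a min in \<open>auto simp: q_def Q_def\<close>)
      have dv: "d dvd r \<and> b * int d = a * int r" if "1 <= r" "r <= 1000" "\<bar>real r * v - of_int b\<bar> < u" for r b
        by (rule res) (use d1 a min that uq in \<open>auto simp: q_def Q_def\<close>)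
      show ?thesis
      proof (cases "3 <= d")
        case True
        then show ?thesis by (rule high) (use dv in blast)
      next
        case False
        obtain m where m: "r0 = d * m" using dv[OF r0] by auto
        have m1: "1 <= m" using r0(1) m by (cases m) auto
        have "b0 * int d = (a * int m) * int d" using dv[OF r0] m by (simp add: mult_ac)
        then have b0: "b0 = a * int m" using d1 by simp
        \<comment> \<open>The resonance of \<open>r0 = d m\<close> is \<open>m\<close> times that of
          \<open>d\<close>, so \<open>d\<close> itself is resonant at the fine scale
          \<open>u\<close>.\<close>
        have "real r0 * v - of_int b0 = real m * (real d * v - of_int a)" unfolding m b0 by (simp add: algebra_simps)
        then have "real m * \<bar>real d * v - of_int a\<bar> < u" using r0(3) by (simp add: abs_mult)
        moreover have "1 * \<bar>real d * v - of_int a\<bar> <= real m * \<bar>real d * v - of_int a\<bar>" using m1 by (intro mult_right_mono) auto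
        ultimately have au: "\<bar>real d * v - of_int a\<bar> < u" unfolding mult_1 by linarith
        define x where "x = pi * (real d * v - of_int a)"
        have x: "\<bar>x\<bar> <= M * h"
        proof -
          have "\<bar>x\<bar> = pi * \<bar>real d * v - of_int a\<bar>" by (simp add: x_def abs_mult)
          also have "... <= 4 * u" using au pi_less_4 by (intro mult_mono) auto
          finally show ?thesis by (simp add: u_def M_def M1_def)
        qed
        consider "d = 1" | "d = 2" using False d1 by linarith
        then show ?thesis
        proof cases
          case 1
          define z where "z = Complex h (- x)"
          have z: "z \<in> sector M" "Re z = h" using x h by (auto simp: z_def sector_def)
          define s where "s = cis (pi * of_int a)"
          have s: "s^2 = 1"
          proof -
            have "s^2 = cis (2 * pi * of_int a)" unfolding s_def power2_eq_square cis_mult by (rule arg_cong[of _ _ cis]) simp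
            also have "... = 1" by (rule cis_multiple_2pi) simp
            finally show ?thesis .
          qed
          have "exp (of_real (- h) + \<i> * of_real t) = s * exp (- z)"
          proof -
            have "t = pi * of_int a + x" by (simp add: x_def tv 1 algebra_simps)
            then have "of_real (- h) + \<i> * of_real t = \<i> * of_real (pi * of_int a) + - z"
              by (simp add: complex_eq_iff z_def)
            then show ?thesis unfolding s_def cis_conv_exp by (simp only: exp_add)
          qed
          then have "norm (qterm (exp (of_real (- h) + \<i> * of_real t)) n) <= exp (3 / (50 * h) + C1)"
            using C1(2)[OF z(1) _ s, of n] z h by simp
          also have "... = exp C1 * exp (3 / (50 * h))" by (simp add: exp_add)
          also have "... <= C * exp (3 / (50 * h) + C / sqrt h)" using C s0 by (intro mult_mono) auto
          finally show ?thesis .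
        next
          case 2
          have v: "0 <= v" "v <= 1" using t by (auto simp: v_def)
          have "\<bar>2 * v - of_int a\<bar> < 1" using au u 2 by simp
          then have "of_int (- 1) < (of_int a :: real)" "(of_int a :: real) < of_int 3" using v by auto
          then have "- 1 < a" "a < 3" unfolding of_int_less_iff by auto
          moreover have "odd a" using cop 2 by (simp add: coprime_right_2_iff_odd)
          ultimately have a1: "a = 1" by (cases "a = 0"; cases "a = 2") auto
          define z where "z = Complex h (- (x / 2))"
          have th: "t - pi / 2 = x / 2" by (simp add: x_def tv 2 a1 algebra_simps)
          have z: "z \<in> sector M" "Re z = h" "4 * Re z <= \<bar>Im z\<bar>" using x h t(3) th by (auto simp: z_def sector_def)
          have "exp (of_real (- h) + \<i> * of_real t) = \<i> * exp (- z)"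
          proof -
            have "of_real (- h) + \<i> * of_real t = \<i> * of_real (pi / 2) + - z"
              using th by (simp add: complex_eq_iff z_def algebra_simps)
            then have "exp (of_real (- h) + \<i> * of_real t) = cis (pi / 2) * exp (- z)" unfolding cis_conv_exp by (simp only: exp_add)
            then show ?thesis by simp
          qed
          then have "norm (qterm (exp (of_real (- h) + \<i> * of_real t)) n) <= C2 * exp (3 / (50 * h) + C2 / sqrt h)"
            using C2(2)[OF z(1) _ z(3), of n] z h by simp
          also have "... <= C * exp (3 / (50 * h) + C / sqrt h)"
            using C C2(1) h by (intro mult_mono) (auto intro!: divide_right_mono)
          finally show ?thesis .
        qed
      qed
    qed
  qed
qed

subsection \<open>The coefficients as circle integrals\<close>

definition fps_of_rat :: "rat fps \<Rightarrow> complex fps" where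
  "fps_of_rat f = Abs_fps (\<lambda>n. of_rat (fps_nth f n))"

lemma fps_of_rat_mult: "fps_of_rat (f * g) = fps_of_rat f * fps_of_rat g"
  by (simp add: fps_eq_iff fps_of_rat_def fps_mult_nth of_rat_sum of_rat_mult)

lemma fps_of_rat_X_power: "fps_of_rat (fps_X ^ k) = fps_X ^ k"
  by (simp add: fps_eq_iff fps_of_rat_def fps_X_power_nth)

lemma fps_of_rat_pochhammer:
  "fps_of_rat (q_pochhammer (- (fps_X ^ 2)) (fps_X ^ 2) m) = (\<Prod>j=1..m. 1 + fps_X ^ (2 * j))"
proof -
  have "fps_of_rat (\<Prod>j\<in>A. 1 + fps_X ^ (2 * j)) = (\<Prod>j\<in>A. 1 + fps_X ^ (2 * j))" if "finite A" for A :: "nat set"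
    using that
  proof (induction A)
    case empty
    show ?case by (simp add: fps_eq_iff fps_of_rat_def)
  next
    case (insert x A)
    have "fps_of_rat (1 + fps_X ^ (2 * x)) = 1 + fps_X ^ (2 * x)"
      by (simp add: fps_eq_iff fps_of_rat_def fps_X_power_nth of_rat_add)
    then show ?case using insert by (simp add: fps_of_rat_mult)
  qed
  then show ?thesis unfolding q_pochhammer_neg by simp
qed

lemma has_fps_expansion_qterm: "(\<lambda>q. qterm q m) has_fps_expansion fps_of_rat (V1_term m)"
proof -
  define P :: "complex fps" where "P = (\<Prod>j=1..m. 1 + fps_X ^ (2 * j))"
  have "(\<lambda>q. \<Prod>j=1..m. 1 + q ^ (2 * j)) has_fps_expansion P"
  proof -
    have "(\<lambda>q. 1 + q ^ (2 * j)) has_fps_expansion (1 + fps_X ^ (2 * j) :: complex fps)" for j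
      using has_fps_expansion_add[OF has_fps_expansion_const[of 1] has_fps_expansion_fps_X_power[of "2 * j"]] by simp
    then show ?thesis unfolding P_def by (rule has_fps_expansion_prod)
  qed
  moreover have P0: "fps_nth P 0 = 1"
    unfolding P_def fps_of_rat_pochhammer[symmetric] by (simp add: fps_of_rat_def q_pochhammer_nth_0)
  ultimately have "(\<lambda>q. qterm q m) has_fps_expansion fps_X ^ (m * (m + 1) div 2) / P"
    unfolding qterm_def by (intro has_fps_expansion_divide' has_fps_expansion_fps_X_power) auto
  moreover have "fps_X ^ (m * (m + 1) div 2) / P = fps_of_rat (V1_term m)"
  proof -
    have "V1_term m * q_pochhammer (- (fps_X ^ 2)) (fps_X ^ 2) m = fps_X ^ (m * (m + 1) div 2)"
      unfolding V1_term_altdef by (simp add: mult.assoc inverse_mult_eq_1 q_pochhammer_nth_0)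
    then have "fps_of_rat (V1_term m) * P = fps_X ^ (m * (m + 1) div 2)"
      unfolding P_def by (metis fps_of_rat_mult fps_of_rat_X_power fps_of_rat_pochhammer)
    moreover have "P \<noteq> 0" using P0 by auto
    ultimately show ?thesis by (metis nonzero_mult_div_cancel_right)
  qed
  ultimately show ?thesis by simp
qed

lemma one_plus_even_power_nonzero:
  fixes q :: complex
  assumes "norm q < 1" "1 <= j"
  shows "1 + q ^ (2 * j) \<noteq> 0"
proof
  assume "1 + q ^ (2 * j) = 0"
  then have "q ^ (2 * j) = - 1" by (simp add: add_eq_0_iff)
  then have "norm q ^ (2 * j) = 1" by (metis norm_power norm_minus_cancel norm_one)
  moreover have "norm q ^ (2 * j) < 1" using assms by (simp add: power_less_one_iff)
  ultimately show False by simp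
qed

text \<open>Summands of index above \<open>n\<close> do not reach the coefficient of
  \<open>q^n\<close>, so truncating loses nothing. The number of summands is even so that they split
  into two halves by parity.\<close>

definition arc_integrand :: "nat \<Rightarrow> real \<Rightarrow> real \<Rightarrow> complex" where
  "arc_integrand n h t = (\<Sum>m<2*Suc n. qterm (exp (of_real (- h) + \<i> * of_real t)) m) * exp (of_nat n * (of_real h - \<i> * of_real t))"

lemma continuous_on_arc_integrand:
  assumes "0 < h"
  shows "continuous_on A (arc_integrand n h)"
  unfolding arc_integrand_def qterm_def
  by (intro continuous_intros ballI) (use assms in \<open>auto simp: one_plus_even_power_nonzero\<close>)

lemma arc_integrand_has_integral:
  assumes "0 < h"
  shows "(arc_integrand n h has_integral of_real (2 * pi) * of_int (V1 n)) {0..2 * pi}"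
proof -
  define r where "r = exp (- h)"
  have r: "0 < r" "r < 1" using assms by (auto simp: r_def)
  define F where "F = (\<lambda>q::complex. \<Sum>m<2*Suc n. qterm q m)"
  have hol: "F holomorphic_on ball 0 1"
    unfolding F_def qterm_def by (intro holomorphic_intros ballI) (auto simp: one_plus_even_power_nonzero)
  have "F has_fps_expansion (\<Sum>m<2*Suc n. fps_of_rat (V1_term m))"
    unfolding F_def by (intro has_fps_expansion_sum has_fps_expansion_qterm)
  from fps_nth_fps_expansion[OF this, of n]
  have "(deriv ^^ n) F 0 / fact n = (\<Sum>m<2*Suc n. of_rat (fps_nth (V1_term m) n))"
    by (simp add: fps_sum_nth fps_of_rat_def)
  also have "... = (\<Sum>m\<le>n. of_rat (fps_nth (V1_term m) n))"
    by (rule sum.mono_neutral_right) (auto simp: V1_term_nth_eq_0)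
  also have "... = of_rat (fps_nth V1_gf n)" by (simp add: V1_gf_nth of_rat_sum)
  also have "... = of_int (V1 n)" by (simp flip: of_int_V1)
  finally have coeff: "(deriv ^^ n) F 0 / fact n = of_int (V1 n)" .
  have "((\<lambda>u. F u / (u - 0) ^ (Suc n)) has_contour_integral ((2 * pi * \<i>) / (fact n) * (deriv ^^ n) F 0)) (circlepath 0 r)"
    by (rule Cauchy_has_contour_integral_higher_derivative_circlepath)
       (use r in \<open>auto intro!: holomorphic_on_imp_continuous_on holomorphic_on_subset[OF hol]\<close>)
  then have "((\<lambda>t. F (0 + r * cis t) / (0 + r * cis t - 0) ^ (Suc n) * r * \<i> * cis t) has_integral ((2 * pi * \<i>) / (fact n) * (deriv ^^ n) F 0)) {0..2 * pi}"
    unfolding circlepath_def by (subst (asm) has_contour_integral_part_circlepath_iff) auto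
  moreover have "F (0 + r * cis t) / (0 + r * cis t - 0) ^ (Suc n) * r * \<i> * cis t = \<i> * arc_integrand n h t" for t
  proof -
    have q: "exp (of_real (- h) + \<i> * of_real t) = r * cis t"
      unfolding exp_add by (simp add: r_def cis_conv_exp flip: exp_of_real)
    have "exp (of_nat n * (of_real h - \<i> * of_real t)) = inverse ((r * cis t) ^ n)"
      unfolding q[symmetric] exp_of_nat_mult[symmetric] exp_minus[symmetric] by (simp add: algebra_simps)
    then have "arc_integrand n h t = F (r * cis t) * inverse ((r * cis t) ^ n)" unfolding arc_integrand_def q F_def by (simp only:)
    then show ?thesis using r by (simp add: field_simps)
  qed
  moreover have "(2 * pi * \<i>) / (fact n) * (deriv ^^ n) F 0 = \<i> * (of_real (2 * pi) * of_int (V1 n))"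
    unfolding coeff[symmetric] by simp
  ultimately have "((\<lambda>t. \<i> * arc_integrand n h t) has_integral \<i> * (of_real (2 * pi) * of_int (V1 n))) {0..2 * pi}" by (simp only:)
  from has_integral_mult_right[OF this, of "- \<i>"] show ?thesis by (simp flip: mult.assoc)
qed

lemma integral_affine_reflected:
  fixes f :: "real \<Rightarrow> complex"
  assumes f: "continuous_on {a..b} f" and k: "0 < k"
  shows "integral {a..b} f = k *\<^sub>R integral {(t - b) / k..(t - a) / k} (\<lambda>x. f (t - k * x))"
proof -
  have mem: "t - k * x \<in> {a..b} \<longleftrightarrow> x \<in> {(t - b) / k..(t - a) / k}" for x using k by (auto simp: field_simps)
  have f': "continuous_on {(t - b) / k..(t - a) / k} (\<lambda>x. f (t - k * x))"
    by (rule continuous_on_compose2[OF f]) (use mem in \<open>auto intro!: continuous_intros\<close>)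
  have "integral {a..b} f = (LINT x|lborel. indicator {a..b} x *\<^sub>R f x)"
    using set_borel_integral_eq_integral(2)[OF borel_integrable_atLeastAtMost'[OF f]] by (simp add: set_lebesgue_integral_def)
  also have "... = k *\<^sub>R (LINT x|lborel. indicator {a..b} (t + - k * x) *\<^sub>R f (t + - k * x))"
    using lborel_integral_real_affine[of "- k" "\<lambda>x. indicator {a..b} x *\<^sub>R f x" t] k by simp
  also have "(LINT x|lborel. indicator {a..b} (t + - k * x) *\<^sub>R f (t + - k * x)) = (LINT x|lborel. indicator {(t - b) / k..(t - a) / k} x *\<^sub>R f (t - k * x))"
    by (rule Bochner_Integration.integral_cong) (use mem in \<open>simp_all add: indicator_def\<close>)
  also have "... = integral {(t - b) / k..(t - a) / k} (\<lambda>x. f (t - k * x))"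
    using set_borel_integral_eq_integral(2)[OF borel_integrable_atLeastAtMost'[OF f']] by (simp add: set_lebesgue_integral_def)
  finally show ?thesis .
qed

lemma qterm_cnj: "qterm (cnj q) m = cnj (qterm q m)"
  by (simp add: qterm_def)

lemma arc_integrand_reflect: "arc_integrand n h (2 * pi - t) = cnj (arc_integrand n h t)"
proof -
  have 1: "exp (of_real (- h) + \<i> * of_real (2 * pi - t)) = cnj (exp (of_real (- h) + \<i> * of_real t))"
  proof -
    define u where "u = of_real (- h) + \<i> * of_real t"
    have "of_real (- h) + \<i> * of_real (2 * pi - t) = cnj u + 2 * of_real pi * \<i>"
      by (simp add: u_def complex_eq_iff)
    then have "exp (of_real (- h) + \<i> * of_real (2 * pi - t)) = cnj (exp u)"
      by (simp only: exp_add[of "cnj u"] exp_two_pi_i mult_1_right exp_cnj)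
    then show ?thesis by (simp only: u_def)
  qed
  have 2: "exp (of_nat n * (of_real h - \<i> * of_real (2 * pi - t))) = cnj (exp (of_nat n * (of_real h - \<i> * of_real t)))"
  proof -
    define u where "u = of_nat n * (of_real h - \<i> * of_real t)"
    have "of_nat n * (of_real h - \<i> * of_real (2 * pi - t)) = cnj u + of_nat n * (- (2 * of_real pi * \<i>))"
      by (simp add: u_def complex_eq_iff algebra_simps)
    moreover have "exp (of_nat n * (- (2 * of_real pi * \<i>))) = (1::complex)"
      unfolding exp_of_nat_mult exp_minus exp_two_pi_i by simp
    ultimately have "exp (of_nat n * (of_real h - \<i> * of_real (2 * pi - t))) = cnj (exp u)"
      by (simp only: exp_add[of "cnj u"] mult_1_right exp_cnj)
    then show ?thesis by (simp only: u_def)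
  qed
  show ?thesis unfolding arc_integrand_def 1 2 qterm_cnj by simp
qed

definition major_sum :: "nat \<Rightarrow> complex \<Rightarrow> complex" where
  "major_sum N z = (\<Sum>m<2*N. qterm (\<i> * exp (- z)) m)"

lemma continuous_on_major_sum:
  assumes "continuous_on A f" "\<And>x. x \<in> A ==> 0 < Re (f x)"
  shows "continuous_on A (\<lambda>x. major_sum N (f x))"
  unfolding major_sum_def qterm_def
  by (intro continuous_intros assms(1) ballI) (use assms(2) in \<open>auto simp: one_plus_even_power_nonzero norm_mult\<close>)

lemma arc_integrand_major:
  "arc_integrand n h (pi / 2 - h * t) = (- \<i>) ^ n * (major_sum (Suc n) (of_real h * (1 + \<i> * of_real t)) * exp (of_nat n * (of_real h * (1 + \<i> * of_real t))))"
proof -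
  define z where "z = of_real h * (1 + \<i> * of_real t)"
  have "cis (pi / 2) = \<i>" by simp
  then have ip: "exp (\<i> * of_real (pi / 2)) = \<i>" unfolding cis_conv_exp .
  have 1: "exp (of_real (- h) + \<i> * of_real (pi / 2 - h * t)) = \<i> * exp (- z)"
  proof -
    have "of_real (- h) + \<i> * of_real (pi / 2 - h * t) = \<i> * of_real (pi / 2) + - z" by (simp add: z_def complex_eq_iff)
    then show ?thesis by (simp only: exp_add ip)
  qed
  have 2: "exp (of_nat n * (of_real h - \<i> * of_real (pi / 2 - h * t))) = (- \<i>) ^ n * exp (of_nat n * z)"
  proof -
    have "of_nat n * (of_real h - \<i> * of_real (pi / 2 - h * t)) = of_nat n * (- (\<i> * of_real (pi / 2))) + of_nat n * z"
      by (simp add: z_def complex_eq_iff algebra_simps)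
    moreover have "exp (of_nat n * (- (\<i> * of_real (pi / 2)))) = (- \<i>) ^ n"
      unfolding exp_of_nat_mult exp_minus ip by simp
    ultimately show ?thesis by (simp only: exp_add)
  qed
  show ?thesis unfolding arc_integrand_def 1 2 major_sum_def z_def[symmetric] by (simp add: mult_ac)
qed

definition major_integral :: "nat \<Rightarrow> real \<Rightarrow> complex" where
  "major_integral n h = integral {-4..0} (\<lambda>t. major_sum (Suc n) (of_real h * (1 + \<i> * of_real t)) * exp (of_nat n * (of_real h * (1 + \<i> * of_real t))))"

text \<open>The half \<open>t > 0\<close> of the major arc, reflected to \<open>t < 0\<close> and
  conjugated, so that both halves have their saddle at \<open>t = - 1\<close>.\<close>

definition major_integral' :: "nat \<Rightarrow> real \<Rightarrow> complex" where
  "major_integral' n h = integral {-4..0} (\<lambda>t. cnj (major_sum (Suc n) (cnj (of_real h * (1 + \<i> * of_real t)))) * exp (of_nat n * (of_real h * (1 + \<i> * of_real t))))"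

text \<open>The integrand takes conjugate values at \<open>t\<close> and \<open>2 pi - t\<close>,
  which leaves the real part over the upper half circle. Cutting it at
  \<open>pi / 2 \<plusminus> 4 h\<close> isolates the major arc; the two outer pieces have total
  length below \<open>pi\<close>.\<close>

lemma V1_arc_decomposition:
  assumes h: "0 < h" "4 * h <= pi / 2"
    and B: "\<And>v. 0 <= v ==> v <= pi ==> 4 * h <= \<bar>v - pi / 2\<bar> ==> norm (arc_integrand n h v) <= B"
  shows "\<bar>pi * of_int (V1 n) - h * Re ((- \<i>) ^ n * (major_integral n h + cnj (major_integral' n h)))\<bar> <= B * pi"
proof -
  define g where "g = arc_integrand n h"
  have cont: "continuous_on A g" for A unfolding g_def by (rule continuous_on_arc_integrand[OF h(1)])
  have int: "g integrable_on {a..b}" for a b by (rule integrable_continuous_interval[OF cont])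
  have "of_real (2 * pi) * of_int (V1 n) = integral {0..2 * pi} g"
    using arc_integrand_has_integral[OF h(1), of n] unfolding g_def by (simp add: integral_unique)
  also have "... = integral {0..pi} g + integral {pi..2 * pi} g"
    by (rule Henstock_Kurzweil_Integration.integral_combine[symmetric]) (auto intro: int)
  also have "integral {pi..2 * pi} g = integral {0..pi} (\<lambda>x. cnj (g x))"
    using integral_affine_reflected[OF cont, of 1 pi "2 * pi" "2 * pi"] by (simp add: g_def arc_integrand_reflect)
  also have "... = cnj (integral {0..pi} g)"
    using integral_linear[OF int bounded_linear_cnj, of 0 pi] by (simp add: o_def)
  finally have "Re (of_real (2 * pi) * of_int (V1 n)) = 2 * Re (integral {0..pi} g)" by simp
  then have 1: "pi * of_int (V1 n) = Re (integral {0..pi} g)" by simp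
  define I1 I2 I3 where "I1 = integral {0..pi / 2 - 4 * h} g" and "I2 = integral {pi / 2 - 4 * h..pi / 2 + 4 * h} g"
    and "I3 = integral {pi / 2 + 4 * h..pi} g"
  have "integral {0..pi} g = integral {0..pi / 2 - 4 * h} g + integral {pi / 2 - 4 * h..pi} g"
    by (rule Henstock_Kurzweil_Integration.integral_combine[symmetric]) (use h in \<open>auto intro: int\<close>)
  also have "integral {pi / 2 - 4 * h..pi} g = I2 + I3"
    unfolding I2_def I3_def by (rule Henstock_Kurzweil_Integration.integral_combine[symmetric]) (use h in \<open>auto intro: int\<close>)
  finally have 2: "integral {0..pi} g = I1 + (I2 + I3)" by (simp add: I1_def)
  have B0: "0 <= B" using order_trans[OF norm_ge_zero B[of 0]] h by simp
  have b1: "norm I1 <= B * (pi / 2 - 4 * h - 0)"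
    unfolding I1_def by (rule integral_bound[OF _ cont]) (use h in \<open>auto intro!: B simp: g_def\<close>)
  have b3: "norm I3 <= B * (pi - (pi / 2 + 4 * h))"
    unfolding I3_def by (rule integral_bound[OF _ cont]) (use h in \<open>auto intro!: B simp: g_def\<close>)
  have "norm (I1 + I3) <= B * (pi / 2 - 4 * h - 0) + B * (pi - (pi / 2 + 4 * h))"
    by (rule norm_triangle_le[OF add_mono[OF b1 b3]])
  also have "... = B * (pi - 8 * h)" by (simp add: algebra_simps)
  also have "... <= B * pi" using B0 h by (intro mult_left_mono) auto
  finally have b: "norm (I1 + I3) <= B * pi" .
  have hc: "continuous_on A (\<lambda>t. g (pi / 2 - h * t))" for A
    by (rule continuous_on_compose2[OF cont[of UNIV]]) (auto intro!: continuous_intros)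
  have hi: "(\<lambda>t. g (pi / 2 - h * t)) integrable_on {a..b}" for a b by (rule integrable_continuous_interval[OF hc])
  have "I2 = h *\<^sub>R integral {-4..4} (\<lambda>t. g (pi / 2 - h * t))"
    unfolding I2_def using integral_affine_reflected[OF cont h(1), of "pi / 2 - 4 * h" "pi / 2 + 4 * h" "pi / 2"] h by simp
  also have "integral {-4..4} (\<lambda>t. g (pi / 2 - h * t)) = integral {-4..0} (\<lambda>t. g (pi / 2 - h * t)) + integral {0..4} (\<lambda>t. g (pi / 2 - h * t))"
    by (rule Henstock_Kurzweil_Integration.integral_combine[symmetric]) (auto intro: hi)
  also have "integral {0..4} (\<lambda>t. g (pi / 2 - h * t)) = integral {-4..0} (\<lambda>t. g (pi / 2 - h * (- t)))"
    using integral_affine_reflected[OF hc, of 1 0 4 0] by simp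
  also have "integral {-4..0} (\<lambda>t. g (pi / 2 - h * t)) = (- \<i>) ^ n * major_integral n h"
    unfolding g_def arc_integrand_major major_integral_def by simp
  also have "integral {-4..0} (\<lambda>t. g (pi / 2 - h * (- t))) = (- \<i>) ^ n * cnj (major_integral' n h)"
  proof -
    have z: "of_real h * (1 + \<i> * of_real (- t)) = cnj (of_real h * (1 + \<i> * of_real t))" for t by (simp add: complex_eq_iff)
    have "continuous_on {-4..0} (\<lambda>t. cnj (major_sum (Suc n) (cnj (of_real h * (1 + \<i> * of_real t)))) * exp (of_nat n * (of_real h * (1 + \<i> * of_real t))))"
      by (intro continuous_intros continuous_on_major_sum) (use h in auto)
    from integral_linear[OF integrable_continuous_interval[OF this] bounded_linear_cnj]
    have "cnj (major_integral' n h) = integral {-4..0} (\<lambda>t. major_sum (Suc n) (cnj (of_real h * (1 + \<i> * of_real t))) * exp (of_nat n * cnj (of_real h * (1 + \<i> * of_real t))))"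
      unfolding major_integral'_def by (simp add: o_def exp_cnj)
    then show ?thesis unfolding g_def arc_integrand_major z by simp
  qed
  finally have 3: "I2 = h *\<^sub>R ((- \<i>) ^ n * (major_integral n h + cnj (major_integral' n h)))" by (simp add: distrib_left)
  have "pi * of_int (V1 n) - h * Re ((- \<i>) ^ n * (major_integral n h + cnj (major_integral' n h))) = Re (I1 + I3)"
    unfolding 1 2 3 by simp
  then show ?thesis using b abs_Re_le_cmod[of "I1 + I3"] by linarith
qed

text \<open>With \<open>x = 1 / sqrt h\<close> the left side is \<open>x^6 exp (C x)\<close>. Use
  \<open>x^6 <= 6^6 exp x\<close>, then complete the square in
  \<open>(C + 1) x <= (C + 1)^2 / (4 b) + b x^2\<close>.\<close>

lemma exp_sqrt_absorb:
  fixes C b :: real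
  assumes "0 < C" "0 < b"
  obtains B where "0 < B" "\<And>h::real. 0 < h ==> h <= 1 ==> exp (C / sqrt h) / h ^ 3 <= B * exp (b / h)"
proof (rule that)
  show "0 < 6 ^ 6 * exp ((C + 1)^2 / (4 * b))" by simp
  fix h :: real assume h: "0 < h" "h <= 1"
  define x where "x = 1 / sqrt h"
  have x: "0 < x" using h by (simp add: x_def)
  have x2: "x^2 = 1 / h" using h by (simp add: x_def power_divide)
  have "x ^ 6 = (x^2) ^ 3" by (simp flip: power_mult)
  then have x6: "1 / h ^ 3 = x ^ 6" unfolding x2 by (simp add: power_divide)
  have "x / 6 <= exp (x / 6)" using exp_ge_add_one_self[of "x / 6"] by linarith
  then have "(x / 6) ^ 6 <= exp (x / 6) ^ 6" using x by (intro power_mono) auto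
  also have "exp (x / 6) ^ 6 = exp x" by (simp flip: exp_of_nat_mult)
  finally have p: "x ^ 6 <= 6 ^ 6 * exp x" by (simp add: power_divide field_simps)
  have q: "(C + 1) * x <= (C + 1)^2 / (4 * b) + b * x^2"
  proof -
    have "0 <= ((C + 1) - 2 * b * x)^2" by simp
    then have "4 * b * ((C + 1) * x) <= (C + 1)^2 + 4 * b * (b * x^2)" by (simp add: power2_eq_square algebra_simps)
    then show ?thesis using assms by (simp add: field_simps)
  qed
  have "exp (C / sqrt h) / h ^ 3 = exp (C * x) * x ^ 6" using x6 by (simp add: x_def divide_inverse)
  also have "... <= exp (C * x) * (6 ^ 6 * exp x)" using p by (intro mult_left_mono) auto
  also have "... = 6 ^ 6 * exp ((C + 1) * x)" by (simp add: distrib_right exp_add)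
  also have "... <= 6 ^ 6 * exp ((C + 1)^2 / (4 * b) + b * x^2)" using q by simp
  also have "... = 6 ^ 6 * exp ((C + 1)^2 / (4 * b)) * exp (b / h)" by (simp add: exp_add x2)
  finally show "exp (C / sqrt h) / h ^ 3 <= 6 ^ 6 * exp ((C + 1)^2 / (4 * b)) * exp (b / h)" .
qed

text \<open>\<open>3/50 <= 48/100 * vol\<close> because \<open>vol >= 1/8\<close>, and one more
  percent of \<open>vol\<close> pays for the subexponential factors and for \<open>N\<close>, which
  is at most \<open>2 / (Re z)^2\<close>. For \<open>Im z >= 0\<close> the direction is outside the
  saddle window, so the lower integral itself is negligible.\<close>

lemma half_sum_approx:
  assumes d: "0 < d" "d < 1"
  obtains B where "0 < B"
    "\<And>z p N. z \<in> sector 4 ==> Re z <= 1 / 50 ==> p^2 = 1 ==> 1 <= Re z * real N ==> real N * (Re z)^2 <= 2 ==>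
      norm (half_sum p d N z + \<i> / z * lower_integral p d z) <= B * exp (49 / 100 * vol / Re z)"
    "\<And>z p N. z \<in> sector 4 ==> Re z <= 1 / 50 ==> p^2 = 1 ==> 1 <= Re z * real N ==> real N * (Re z)^2 <= 2 ==> 0 <= Im z ==>
      norm (half_sum p d N z) <= B * exp (49 / 100 * vol / Re z)"
proof -
  obtain C1 where C1: "0 < C1" "\<And>z p N. z \<in> sector 4 ==> Re z <= 1 / 50 ==> p^2 = 1 ==> 1 <= Re z * real N ==>
      norm (half_sum p d N z + \<i> / z * lower_integral p d z) <= exp (3 / (50 * Re z) + C1 / sqrt (Re z)) * (2 * N + 2 / Re z)"
    using half_sum_lower_edge[OF d] unfolding lower_integral_def by blast
  obtain C2 where C2: "0 < C2" "\<And>z p. z \<in> sector 4 ==> Re z <= 1 ==> Im z < - 2 * Re z \<or> - Re z / 2 < Im z ==> p^2 = 1 ==>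
      norm (lower_integral p d z) <= C2 * exp (2 * vol / (5 * Re z) + C2 / sqrt (Re z))"
    using lower_integral_far_bound[OF d] by blast
  define C where "C = max C1 C2"
  have C: "0 < C" "C1 <= C" "C2 <= C" using C1(1) by (auto simp: C_def)
  have v: "0 < vol" "1 / 8 <= vol" using vol_lower by auto
  obtain B where B: "0 < B" "\<And>h::real. 0 < h ==> h <= 1 ==> exp (C / sqrt h) / h ^ 3 <= B * exp (vol / 100 / h)"
    using exp_sqrt_absorb[OF C(1), of "vol / 100"] v by auto
  have key: "K * exp (e + C' / sqrt h) * m <= (K * k * B) * exp (49 / 100 * vol / h)"
    if "0 < h" "h <= 1" "0 <= K" "0 <= m" "m <= k / h ^ 3" "0 <= k" "e <= 48 / 100 * vol / h" "C' <= C" for K e C' m k h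
  proof -
    have "K * exp (e + C' / sqrt h) * m <= K * exp (48 / 100 * vol / h + C / sqrt h) * (k / h ^ 3)"
      using that by (intro mult_mono mult_left_mono) (auto intro!: add_mono divide_right_mono)
    also have "... = K * k * exp (48 / 100 * vol / h) * (exp (C / sqrt h) / h ^ 3)" by (simp add: exp_add)
    also have "... <= K * k * exp (48 / 100 * vol / h) * (B * exp (vol / 100 / h))"
      using that by (intro mult_left_mono B) auto
    also have "... = (K * k * B) * exp (48 / 100 * vol / h + vol / 100 / h)" by (simp only: exp_add mult_ac)
    also have "48 / 100 * vol / h + vol / 100 / h = 49 / 100 * vol / h" by (simp flip: add_divide_distrib)
    finally show ?thesis .
  qed
  show ?thesis
  proof (rule that)
    show "0 < 1 * 6 * B + C2 * 1 * B" using B C2 by (intro add_pos_pos mult_pos_pos) auto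
    fix z p :: complex and N :: nat
    assume z: "z \<in> sector 4" "Re z <= 1 / 50" and p: "p^2 = 1" and N: "1 <= Re z * real N" "real N * (Re z)^2 <= 2"
    define h where "h = Re z"
    have h: "0 < h" "h <= 1" using z by (auto simp: sector_def h_def)
    have e3: "1 / h <= 1 / h ^ 3" "h ^ 3 <= h^2"
      using h power_decreasing[of 1 3 h] power_decreasing[of 2 3 h] by (auto intro!: divide_left_mono)
    have m: "2 * real N + 2 / Re z <= 6 / h ^ 3"
    proof -
      have "real N * h ^ 3 <= real N * h^2" using e3 by (intro mult_left_mono) auto
      then have "real N * h ^ 3 <= 2" using N(2) unfolding h_def by linarith
      then have "real N <= 2 / h ^ 3" using h by (simp add: pos_le_divide_eq)
      then show ?thesis using e3(1) unfolding h_def by argo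
    qed
    have e: "3 / (50 * Re z) <= 48 / 100 * vol / h" using v h by (simp add: h_def field_simps)
    have B2: "1 * 6 * B * exp (49 / 100 * vol / Re z) <= (1 * 6 * B + C2 * 1 * B) * exp (49 / 100 * vol / Re z)"
      using B C2(1) by (intro mult_right_mono) auto
    have "norm (half_sum p d N z + \<i> / z * lower_integral p d z) <= 1 * exp (3 / (50 * Re z) + C1 / sqrt (Re z)) * (2 * real N + 2 / Re z)"
      using C1(2)[OF z p N(1)] by simp
    also have "... <= 1 * 6 * B * exp (49 / 100 * vol / Re z)"
      using key[OF h, of 1 "2 * real N + 2 / Re z" 6 "3 / (50 * Re z)" C1] m e C h unfolding h_def by auto
    finally have a: "norm (half_sum p d N z + \<i> / z * lower_integral p d z) <= 1 * 6 * B * exp (49 / 100 * vol / Re z)" .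
    then show "norm (half_sum p d N z + \<i> / z * lower_integral p d z) <= (1 * 6 * B + C2 * 1 * B) * exp (49 / 100 * vol / Re z)"
      using B2 by linarith
    assume im: "0 <= Im z"
    have "norm (\<i> / z * lower_integral p d z) = (1 / norm z) * norm (lower_integral p d z)" by (simp add: norm_mult norm_divide)
    also have "... <= (1 / h) * (C2 * exp (2 * vol / (5 * Re z) + C2 / sqrt (Re z)))"
    proof (rule mult_mono)
      show "1 / norm z <= 1 / h" using complex_Re_le_cmod[of z] h by (intro divide_left_mono mult_pos_pos) (auto simp: h_def)
      show "norm (lower_integral p d z) <= C2 * exp (2 * vol / (5 * Re z) + C2 / sqrt (Re z))"
        by (rule C2(2)) (use z im p h in \<open>auto simp: h_def\<close>)
    qed (use h in auto)
    also have "... = C2 * exp (2 * vol / (5 * Re z) + C2 / sqrt (Re z)) * (1 / h)" by simp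
    also have "... <= (C2 * 1 * B) * exp (49 / 100 * vol / Re z)"
    proof -
      have "2 * vol / (5 * Re z) <= 48 / 100 * vol / h" using v h by (simp add: h_def field_simps)
      then show ?thesis using key[OF h, of C2 "1 / h" 1 "2 * vol / (5 * Re z)" C2] e3 C C2(1) h unfolding h_def by auto
    qed
    finally have b: "norm (\<i> / z * lower_integral p d z) <= (C2 * 1 * B) * exp (49 / 100 * vol / Re z)" .
    have "norm (half_sum p d N z) <= norm (half_sum p d N z + \<i> / z * lower_integral p d z) + norm (\<i> / z * lower_integral p d z)"
      using norm_triangle_ineq4[of "half_sum p d N z + \<i> / z * lower_integral p d z" "\<i> / z * lower_integral p d z"] by simp
    also have "... <= 1 * 6 * B * exp (49 / 100 * vol / Re z) + (C2 * 1 * B) * exp (49 / 100 * vol / Re z)" by (rule add_mono[OF a b])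
    finally show "norm (half_sum p d N z) <= (1 * 6 * B + C2 * 1 * B) * exp (49 / 100 * vol / Re z)" by (simp only: distrib_right)
  qed
qed

subsection \<open>Laplace's method on the major arc\<close>

text \<open>The function \<open>w / 2 - \<i> / w\<close> is stationary at \<open>1 - \<i>\<close>,
  since \<open>(1 - \<i>)^2 = - 2 \<i>\<close>, and its deviation from the value there is exactly
  \<open>(w - (1 - \<i>))^2 / (2 w)\<close>. So the normalised \<open>exp (m z)\<close> is the
  factor that compensates the saddle value times a Gaussian in \<open>t + 1\<close>.\<close>

lemma major_exponent:
  fixes h t m :: real
  assumes h: "0 < h" and m: "m * h = vol / (2 * h)"
  defines "w \<equiv> 1 + \<i> * of_real t"
  shows "of_real m * (of_real h * w) - of_real (vol / h) * (1 - \<i>) = \<i> * of_real vol / (of_real h * w) - of_real (vol / h * (t + 1)^2) / (2 * w)"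
proof -
  have w0: "w \<noteq> 0" by (simp add: w_def complex_eq_iff)
  have "of_real m * (of_real h * w) = of_real (m * h) * w" by simp
  also have "... = of_real (vol / h) * (w / 2)" unfolding m by simp
  finally have a: "of_real m * (of_real h * w) = of_real (vol / h) * (w / 2)" .
  have "of_real m * (of_real h * w) - of_real (vol / h) * (1 - \<i>) - \<i> * of_real vol / (of_real h * w) = of_real (vol / h) * (w / 2 - (1 - \<i>) - \<i> / w)"
  proof -
    have "\<i> * of_real vol / (of_real h * w) = of_real (vol / h) * (\<i> / w)" by simp
    then show ?thesis unfolding a by (simp only: right_diff_distrib)
  qed
  also have "w / 2 - (1 - \<i>) - \<i> / w = (w - (1 - \<i>))^2 / (2 * w)"
    using w0 by (simp add: field_simps power2_eq_square)
  also have "(w - (1 - \<i>))^2 = - of_real ((t + 1)^2)"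
  proof -
    have "w - (1 - \<i>) = \<i> * of_real (t + 1)" by (simp add: w_def algebra_simps)
    then show ?thesis by (simp add: power_mult_distrib)
  qed
  finally show ?thesis by (simp add: algebra_simps)
qed

definition gauss :: "complex \<Rightarrow> complex" where
  "gauss a = (LINT x|lborel. exp (- (a * of_real (x^2))))"

text \<open>\<open>S k\<close> stands for one half of the major arc, and its error term dies at rate
  \<open>exp (- vol / 100 / u k)\<close> after normalisation. On the scale
  \<open>t = - 1 + sqrt (u k) v\<close> the powers balance: \<open>sqrt (u k)\<close> from
  \<open>dt\<close>, another from the lower integral, \<open>1 / u k\<close> from
  \<open>1 / z\<close>. The result is the product of two Gaussian integrals.\<close>

lemma major_laplace:
  fixes u m :: "nat \<Rightarrow> real" and S :: "nat \<Rightarrow> real \<Rightarrow> complex" and c p :: complex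
  assumes b: "0 < b" "b < 1" and p: "p = 1 \<or> p = - 1"
    and u: "\<And>k. 0 < u k" "\<And>k. u k <= 1" "u \<longlonglongrightarrow> 0" and m: "\<And>k. m k * u k = vol / (2 * u k)"
    and S: "\<And>k. continuous_on {-4..0} (S k)"
      "\<And>k t. -4 <= t ==> t <= 0 ==> norm (S k t - c / (of_real (u k) * (1 + \<i> * of_real t)) * lower_integral p b (of_real (u k) * (1 + \<i> * of_real t))) <= B * exp (49 / 100 * vol / u k)"
  shows "(\<lambda>k. integral {-4..0} (\<lambda>t. S k t * exp (of_real (m k) * (of_real (u k) * (1 + \<i> * of_real t)))) * exp (- (of_real (vol / u k) * (1 - \<i>))))
    \<longlonglongrightarrow> c / (1 - \<i>) * (cis (pi * b / 2) * exp (reg_limit (p * cis (pi / 6))) * gauss (of_real (sqrt 3) * (1 - \<i>))) * gauss (of_real vol / (2 * (1 - \<i>)))"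
proof -
  have v: "0 < vol" using vol_lower by simp
  have p2: "p^2 = 1" using p by auto
  have B: "0 <= B"
  proof -
    have "0 <= B * exp (49 / 100 * vol / u 0)" using order_trans[OF norm_ge_zero S(2)[of 0 0]] by simp
    then show ?thesis by (simp add: zero_le_mult_iff)
  qed
  obtain C1 where C1: "0 < C1" "\<And>z p. z \<in> sector 4 ==> Re z <= 1 ==> - 2 * Re z <= Im z ==> Im z <= - Re z / 2 ==> p^2 = 1 ==>
      norm (lower_integral p b z * exp (\<i> * of_real vol / z)) <= C1 * sqrt (Re z)"
    using lower_integral_saddle_bound[OF b] by blast
  obtain C2 where C2: "0 < C2" "\<And>z p. z \<in> sector 4 ==> Re z <= 1 ==> Im z < - 2 * Re z \<or> - Re z / 2 < Im z ==> p^2 = 1 ==>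
      norm (lower_integral p b z) <= C2 * exp (2 * vol / (5 * Re z) + C2 / sqrt (Re z))"
    using lower_integral_far_bound[OF b] by blast
  \<comment> \<open>Outside the window the exponent is \<open>2/5 vol\<close> against the required
    \<open>1/2 vol\<close>; absorbing with \<open>vol / 20\<close> uses half of the gap.\<close>
  obtain B2 where B2: "0 < B2" "\<And>u::real. 0 < u ==> u <= 1 ==> exp (C2 / sqrt u) / u ^ 3 <= B2 * exp (vol / 20 / u)"
    using exp_sqrt_absorb[OF C2(1), of "vol / 20"] v by auto
  define z where "z = (\<lambda>k t. of_real (u k) * (1 + \<i> * of_real t) :: complex)"
  have zR: "Re (z k t) = u k" "Im (z k t) = u k * t" for k t by (simp_all add: z_def)
  have zs: "z k t \<in> sector 4" if "\<bar>t\<bar> <= 4" for k t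
    unfolding sector_def using that u(1)[of k] mult_left_mono[OF that, of "u k"] by (simp add: zR abs_mult mult.commute)
  have nz: "u k <= norm (z k t)" for k t using complex_Re_le_cmod[of "z k t"] by (simp add: zR)
  have z0: "z k t \<noteq> 0" for k t using nz[of k t] u(1)[of k] by auto
  define J where "J = (\<lambda>k t. lower_integral p b (z k t))"
  define T where "T = (\<lambda>k v. - 1 + sqrt (u k) * v)"
  define A where "A = (\<lambda>k v. exp (- (of_real (vol * v^2) / (2 * (1 + \<i> * of_real (T k v))))))"
  define h where "h = (\<lambda>k t. S k t * exp (of_real (m k) * z k t - of_real (vol / u k) * (1 - \<i>)))"
  define g where "g = (\<lambda>k v. indicator {-4..0} (T k v) *\<^sub>R (of_real (sqrt (u k)) * h k (T k v)))"
  have T1: "(T k v + 1)^2 = u k * v^2" for k v using u(1)[of k] by (simp add: T_def power_mult_distrib)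
  have expo: "exp (of_real (m k) * z k (T k v) - of_real (vol / u k) * (1 - \<i>)) = exp (\<i> * of_real vol / z k (T k v)) * A k v" for k v
    unfolding z_def major_exponent[OF u(1) m] T1 A_def exp_add[symmetric] using u(1)[of k] by simp
  have ReA: "norm (A k v) = exp (- (vol * v^2 / (2 * (1 + (T k v)^2))))" for k v
  proof -
    have "of_real (vol * v^2) / (2 * (1 + \<i> * of_real (T k v))) = of_real (vol * v^2 / 2) / (1 + \<i> * of_real (T k v))" by simp
    then have "Re (of_real (vol * v^2) / (2 * (1 + \<i> * of_real (T k v)))) = vol * v^2 / 2 / (1 + (T k v)^2)"
      by (simp only: Re_of_real_divide) (simp add: cmod_power2)
    then show ?thesis unfolding A_def norm_exp_eq_Re by simp
  qed
  have nexp: "norm (exp (of_real (m k) * z k t - of_real (vol / u k) * (1 - \<i>))) = exp (- (vol / (2 * u k)))" for k t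
  proof -
    have "m k * u k - vol / u k = - (vol / (2 * u k))" unfolding m by (simp add: field_simps)
    then show ?thesis unfolding norm_exp_eq_Re by (simp add: zR)
  qed
  \<comment> \<open>On the bounded range of \<open>t\<close>, \<open>u v^2 = (t + 1)^2 <= 9\<close>,
    so decay in \<open>1 / u\<close> implies Gaussian decay in \<open>v\<close>, uniformly in
    \<open>k\<close>.\<close>
  have dec: "exp (- (vol / 100 / u k)) <= exp (- (vol / 900 * v^2))" if "-4 <= T k v" "T k v <= 0" for k v
  proof -
    have "(T k v + 1)^2 <= 3^2" using that by (intro power2_le_iff_abs_le[THEN iffD2]) auto
    then have "u k * v^2 <= 9" unfolding T1 by simp
    then have "v^2 <= 9 / u k" using u(1)[of k] by (simp add: field_simps)
    then have "vol / 900 * v^2 <= vol / 900 * (9 / u k)" using v by (intro mult_left_mono) auto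
    then show ?thesis by simp
  qed
  have rest: "norm (of_real (sqrt (u k)) * ((S k t - c / z k t * J k t) * exp (of_real (m k) * z k t - of_real (vol / u k) * (1 - \<i>)))) <= B * exp (- (vol / 100 / u k))"
    if "-4 <= t" "t <= 0" for k t
  proof -
    have "norm (of_real (sqrt (u k)) * ((S k t - c / z k t * J k t) * exp (of_real (m k) * z k t - of_real (vol / u k) * (1 - \<i>))))
       = sqrt (u k) * (norm (S k t - c / z k t * J k t) * exp (- (vol / (2 * u k))))"
      unfolding norm_mult nexp using u(1)[of k] by simp
    also have "... <= 1 * (B * exp (49 / 100 * vol / u k) * exp (- (vol / (2 * u k))))"
      using S(2)[OF that, of k] u(1,2)[of k] B unfolding z_def J_def by (intro mult_mono) auto
    also have "... = B * exp (49 / 100 * vol / u k + - (vol / (2 * u k)))" by (simp only: exp_add mult_1 mult.assoc)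
    also have "49 / 100 * vol / u k + - (vol / (2 * u k)) = - (vol / 100 / u k)" using u(1)[of k] by (simp add: field_simps)
    finally show ?thesis .
  qed
  define main where "main = (\<lambda>k v. of_real (sqrt (u k)) * (c / z k (T k v) * J k (T k v) * exp (of_real (m k) * z k (T k v) - of_real (vol / u k) * (1 - \<i>))))"
  have split: "of_real (sqrt (u k)) * h k (T k v) = of_real (sqrt (u k)) * ((S k (T k v) - c / z k (T k v) * J k (T k v)) * exp (of_real (m k) * z k (T k v) - of_real (vol / u k) * (1 - \<i>))) + main k v" for k v
    unfolding h_def main_def by (simp add: algebra_simps)
  have near: "norm (main k v) <= norm c * C1 * exp (- (vol / 10 * v^2))" if t: "-2 <= T k v" "T k v <= - 1 / 2" for k v
  proof -
    have zc: "z k (T k v) \<in> sector 4" "Re (z k (T k v)) <= 1" "- 2 * Re (z k (T k v)) <= Im (z k (T k v))" "Im (z k (T k v)) <= - Re (z k (T k v)) / 2"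
    proof -
      show "z k (T k v) \<in> sector 4" by (rule zs) (use t in auto)
      show "Re (z k (T k v)) <= 1" using u(2) by (simp add: zR)
      have "0 <= u k" using u(1)[of k] by simp
      from mult_left_mono[OF t(1) this] mult_left_mono[OF t(2) this]
      show "- 2 * Re (z k (T k v)) <= Im (z k (T k v))" "Im (z k (T k v)) <= - Re (z k (T k v)) / 2" by (simp_all add: zR)
    qed
    have "norm (main k v) = sqrt (u k) * (norm c / norm (z k (T k v))) * norm (J k (T k v) * exp (\<i> * of_real vol / z k (T k v))) * norm (A k v)"
      unfolding main_def expo using u(1)[of k] by (simp add: norm_mult norm_divide)
    also have "... <= sqrt (u k) * (norm c / u k) * (C1 * sqrt (u k)) * exp (- (vol / 10 * v^2))"
    proof (intro mult_mono)
      show "norm c / norm (z k (T k v)) <= norm c / u k" using nz[of k "T k v"] u(1)[of k] by (intro divide_left_mono mult_pos_pos) auto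
      show "norm (J k (T k v) * exp (\<i> * of_real vol / z k (T k v))) <= C1 * sqrt (u k)"
        using C1(2)[OF zc p2] unfolding J_def zR .
      have "(T k v)^2 <= 2^2" using t by (intro power2_le_iff_abs_le[THEN iffD2]) auto
      then have "vol * v^2 / 10 <= vol * v^2 / (2 * (1 + (T k v)^2))" using v by (intro divide_left_mono mult_pos_pos add_pos_nonneg) auto
      then show "norm (A k v) <= exp (- (vol / 10 * v^2))" unfolding ReA by simp
    qed (use u(1)[of k] C1(1) in auto)
    also have "... = norm c * C1 * exp (- (vol / 10 * v^2))" using u(1)[of k] by (simp add: field_simps)
    finally show ?thesis .
  qed
  have far: "norm (main k v) <= norm c * C2 * B2 * exp (- (vol / 900 * v^2))"
    if t: "-4 <= T k v" "T k v <= 0" "T k v < -2 \<or> - 1 / 2 < T k v" for k v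
  proof -
    have e1: "norm (J k (T k v)) <= C2 * exp (2 * vol / (5 * u k) + C2 / sqrt (u k))"
    proof -
      have "Im (z k (T k v)) < - 2 * Re (z k (T k v)) \<or> - Re (z k (T k v)) / 2 < Im (z k (T k v))"
        using t(3)
      proof
        assume "T k v < - 2"
        from mult_strict_left_mono[OF this u(1)[of k]] show ?thesis by (simp add: zR)
      next
        assume "- 1 / 2 < T k v"
        from mult_strict_left_mono[OF this u(1)[of k]] show ?thesis by (simp add: zR)
      qed
      from C2(2)[OF zs _ this p2] show ?thesis unfolding J_def zR using t u(2) by simp
    qed
    have "norm (main k v) = sqrt (u k) * (norm c / norm (z k (T k v)) * norm (J k (T k v)) * exp (- (vol / (2 * u k))))"
      unfolding main_def norm_mult nexp norm_divide using u(1)[of k] by simp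
    also have "... <= 1 * (norm c / u k * (C2 * exp (2 * vol / (5 * u k) + C2 / sqrt (u k))) * exp (- (vol / (2 * u k))))"
    proof (intro mult_mono e1)
      show "norm c / norm (z k (T k v)) <= norm c / u k" using nz[of k "T k v"] u(1)[of k] by (intro divide_left_mono mult_pos_pos) auto
    qed (use u(1,2)[of k] C2(1) in auto)
    also have "... = norm c * C2 * (1 / u k * exp (C2 / sqrt (u k))) * (exp (2 * vol / (5 * u k)) * exp (- (vol / (2 * u k))))"
      by (simp add: exp_add)
    also have "... <= norm c * C2 * (B2 * exp (vol / 20 / u k)) * (exp (2 * vol / (5 * u k)) * exp (- (vol / (2 * u k))))"
    proof (intro mult_right_mono mult_left_mono)
      have "1 / u k <= 1 / u k ^ 3" using u(1,2)[of k] power_decreasing[of 1 3 "u k"] by (auto intro!: divide_left_mono)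
      then have "1 / u k * exp (C2 / sqrt (u k)) <= 1 / u k ^ 3 * exp (C2 / sqrt (u k))" by (intro mult_right_mono) auto
      also have "... <= B2 * exp (vol / 20 / u k)" using B2(2)[OF u(1,2), of k] by simp
      finally show "1 / u k * exp (C2 / sqrt (u k)) <= B2 * exp (vol / 20 / u k)" .
    qed (use C2(1) in auto)
    also have "... = norm c * C2 * B2 * exp (vol / 20 / u k + 2 * vol / (5 * u k) + - (vol / (2 * u k)))" by (simp only: exp_add mult.assoc)
    also have "vol / 20 / u k + 2 * vol / (5 * u k) + - (vol / (2 * u k)) = - (vol / 20 / u k)" using u(1)[of k] by (simp add: field_simps)
    also have "norm c * C2 * B2 * exp (- (vol / 20 / u k)) <= norm c * C2 * B2 * exp (- (vol / 100 / u k))"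
      using C2(1) B2(1) v u(1)[of k] by (intro mult_left_mono) (auto simp: field_simps)
    also have "... <= norm c * C2 * B2 * exp (- (vol / 900 * v^2))" using dec[OF t(1,2)] C2(1) B2(1) by (intro mult_left_mono) auto
    finally show ?thesis .
  qed
  define w where "w = (\<lambda>v. norm c * C1 * exp (- (vol / 10 * v^2)) + (B + norm c * C2 * B2) * exp (- (vol / 900 * v^2)))"
  define L where "L = c / (1 - \<i>) * (cis (pi * b / 2) * exp (reg_limit (p * cis (pi / 6))) * gauss (of_real (sqrt 3) * (1 - \<i>)))"
  have "(\<lambda>k. LINT v|lborel. g k v) \<longlonglongrightarrow> (LINT v|lborel. L * exp (- (of_real vol / (2 * (1 - \<i>)) * of_real (v^2))))"
  proof (rule integral_dominated_convergence[where w = w])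
    show "integrable lborel w"
      unfolding w_def using v by (intro Bochner_Integration.integrable_add integrable_mult_right integrable_exp_square) auto
    show "(\<lambda>v. L * exp (- (of_real vol / (2 * (1 - \<i>)) * of_real (v^2)))) \<in> borel_measurable lborel"
      by (auto intro!: borel_measurable_continuous_onI continuous_intros)
    show "g k \<in> borel_measurable lborel" for k
    proof -
      have "continuous_on {-4..0} (\<lambda>t. of_real (sqrt (u k)) * h k t)"
        unfolding h_def z_def by (intro continuous_intros S)
      then have "(\<lambda>t. indicator {-4..0} t *\<^sub>R (of_real (sqrt (u k)) * h k t)) \<in> borel_measurable borel"
        by (intro borel_measurable_continuous_on_indicator) auto
      from measurable_compose[OF _ this, of "T k" borel] show ?thesis unfolding g_def measurable_lborel2 by (simp add: T_def)
    qed
    show "AE v in lborel. norm (g k v) <= w v" for k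
    proof (rule AE_I2)
      fix v :: real
      have w0: "0 <= norm c * C1 * exp (- (vol / 10 * v^2))" "0 <= norm c * C2 * B2 * exp (- (vol / 900 * v^2))"
        using C1(1) C2(1) B2(1) by auto
      show "norm (g k v) <= w v"
      proof (cases "T k v \<in> {-4..0}")
        case True
        then have t: "-4 <= T k v" "T k v <= 0" by auto
        have "norm (g k v) = norm (of_real (sqrt (u k)) * h k (T k v))" using True by (simp add: g_def)
        also have "... <= B * exp (- (vol / 100 / u k)) + norm (main k v)"
          unfolding split by (intro norm_triangle_le add_mono rest t) simp
        also have "B * exp (- (vol / 100 / u k)) <= B * exp (- (vol / 900 * v^2))" using dec[OF t] B by (intro mult_left_mono) auto
        also have "norm (main k v) <= norm c * C1 * exp (- (vol / 10 * v^2)) + norm c * C2 * B2 * exp (- (vol / 900 * v^2))"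
        proof (cases "-2 <= T k v \<and> T k v <= - 1 / 2")
          case True
          then show ?thesis using near[of k v] w0 by linarith
        next
          case False
          then show ?thesis using far[OF t] w0 by linarith
        qed
        finally show ?thesis unfolding w_def by (simp add: algebra_simps)
      next
        case False
        then have "norm (g k v) = 0" by (simp add: g_def)
        moreover have "0 <= B * exp (- (vol / 900 * v^2))" using B by simp
        ultimately show ?thesis using w0 unfolding w_def distrib_right by linarith
      qed
    qed
    show "AE v in lborel. (\<lambda>k. g k v) \<longlonglongrightarrow> L * exp (- (of_real vol / (2 * (1 - \<i>)) * of_real (v^2)))"
    proof (rule AE_I2)
      fix v :: real
      have slim: "(\<lambda>k. sqrt (u k)) \<longlonglongrightarrow> 0" using tendsto_real_sqrt[OF u(3)] by simp
      have tlim: "(\<lambda>k. T k v) \<longlonglongrightarrow> - 1"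
      proof -
        have "(\<lambda>k. T k v) \<longlonglongrightarrow> - 1 + 0 * v" unfolding T_def by (intro tendsto_intros slim)
        then show ?thesis by simp
      qed
      have "\<forall>\<^sub>F k in sequentially. T k v \<in> {-2<..< - 1 / 2}" by (rule topological_tendstoD[OF tlim]) auto
      \<comment> \<open>\<open>lower_integral_tendsto\<close> wants the window condition for every
        index, hence the shift by \<open>K\<close>.\<close>
      then obtain K where K: "\<And>k. K <= k ==> T k v \<in> {-2<..< - 1 / 2}" by (auto simp: eventually_sequentially)
      have sh: "(\<lambda>k. u (k + K)) \<longlonglongrightarrow> 0" "(\<lambda>k. T (k + K) v) \<longlonglongrightarrow> - 1"
        by (rule LIMSEQ_ignore_initial_segment, rule u(3)) (rule LIMSEQ_ignore_initial_segment, rule tlim)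
      have Kt: "- 2 <= T (k + K) v" "T (k + K) v <= - 1 / 2" for k using K[of "k + K"] by auto
      have "(\<lambda>k. lower_integral p b (of_real (u (k + K)) * (1 + \<i> * of_real (T (k + K) v))) * exp (\<i> * of_real vol / (of_real (u (k + K)) * (1 + \<i> * of_real (T (k + K) v)))) / of_real (sqrt (u (k + K)))) \<longlonglongrightarrow>
          cis (pi * b / 2) * exp (reg_limit (p * cis (pi / 6))) * gauss (of_real (sqrt 3) * (1 - \<i>))"
        unfolding gauss_def by (rule lower_integral_tendsto[OF b p u(1) u(2) sh(1) Kt sh(2)])
      from LIMSEQ_offset[OF this[folded z_def, folded J_def]]
      have l1: "(\<lambda>k. J k (T k v) * exp (\<i> * of_real vol / z k (T k v)) / of_real (sqrt (u k))) \<longlonglongrightarrow> cis (pi * b / 2) * exp (reg_limit (p * cis (pi / 6))) * gauss (of_real (sqrt 3) * (1 - \<i>))"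
        by (simp add: J_def z_def)
      have w1: "(1 + \<i> * of_real (- 1)) \<noteq> (0::complex)" by (simp add: complex_eq_iff)
      have l2: "(\<lambda>k. c / (1 + \<i> * of_real (T k v))) \<longlonglongrightarrow> c / (1 + \<i> * of_real (- 1))"
        by (intro tendsto_intros tlim w1)
      have l3: "(\<lambda>k. A k v) \<longlonglongrightarrow> exp (- (of_real (vol * v^2) / (2 * (1 + \<i> * of_real (- 1)))))"
        unfolding A_def by (intro tendsto_intros tlim) (use w1 in simp)
      have "(\<lambda>k. c / (1 + \<i> * of_real (T k v)) * (J k (T k v) * exp (\<i> * of_real vol / z k (T k v)) / of_real (sqrt (u k))) * A k v)
         \<longlonglongrightarrow> c / (1 + \<i> * of_real (- 1)) * (cis (pi * b / 2) * exp (reg_limit (p * cis (pi / 6))) * gauss (of_real (sqrt 3) * (1 - \<i>))) * exp (- (of_real (vol * v^2) / (2 * (1 + \<i> * of_real (- 1)))))"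
        by (intro tendsto_mult l1 l2 l3)
      moreover have "c / (1 + \<i> * of_real (T k v)) * (J k (T k v) * exp (\<i> * of_real vol / z k (T k v)) / of_real (sqrt (u k))) * A k v = main k v" for k
      proof -
        define s :: complex where "s = of_real (sqrt (u k))"
        have s: "of_real (u k) = s * s" "s \<noteq> 0" using u(1)[of k] by (auto simp: s_def simp flip: of_real_mult)
        have cz: "c / z k (T k v) = c / (1 + \<i> * of_real (T k v)) / (s * s)" unfolding z_def s(1) by simp
        have gen: "d * (j * e / s) * a = s * (d / (s * s) * j * (e * a))" for d j e a using s(2) by (simp add: field_simps)
        show ?thesis unfolding main_def expo s_def[symmetric] cz by (rule gen)
      qed
      ultimately have lm: "(\<lambda>k. main k v) \<longlonglongrightarrow> L * exp (- (of_real vol / (2 * (1 - \<i>)) * of_real (v^2)))"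
        by (simp add: L_def)
      have r0: "(\<lambda>k. of_real (sqrt (u k)) * ((S k (T k v) - c / z k (T k v) * J k (T k v)) * exp (of_real (m k) * z k (T k v) - of_real (vol / u k) * (1 - \<i>)))) \<longlonglongrightarrow> 0"
      proof (rule Lim_null_comparison)
        have "filterlim (\<lambda>k. inverse (u k)) at_top sequentially"
          by (rule filterlim_inverse_at_top[OF u(3)]) (use u(1) in simp)
        moreover have "0 < vol / 100" using v by simp
        ultimately have "filterlim (\<lambda>k. vol / 100 * inverse (u k)) at_top sequentially"
          by (intro filterlim_tendsto_pos_mult_at_top[OF tendsto_const])
        then have "filterlim (\<lambda>k. vol / 100 / u k) at_top sequentially" by (simp only: divide_inverse)
        then have "(\<lambda>k. exp (- (vol / 100 / u k))) \<longlonglongrightarrow> 0"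
          by (intro filterlim_compose[OF exp_at_bot]) (simp add: filterlim_uminus_at_bot)
        from tendsto_mult_right_zero[OF this, of B] show "(\<lambda>k. B * exp (- (vol / 100 / u k))) \<longlonglongrightarrow> 0" .
        show "\<forall>\<^sub>F k in sequentially. norm (of_real (sqrt (u k)) * ((S k (T k v) - c / z k (T k v) * J k (T k v)) * exp (of_real (m k) * z k (T k v) - of_real (vol / u k) * (1 - \<i>)))) <= B * exp (- (vol / 100 / u k))"
          by (rule eventually_sequentiallyI[of K], rule rest) (use K in force)+
      qed
      from tendsto_add[OF r0 lm] have "(\<lambda>k. of_real (sqrt (u k)) * h k (T k v)) \<longlonglongrightarrow> L * exp (- (of_real vol / (2 * (1 - \<i>)) * of_real (v^2)))"
        unfolding split by simp
      moreover have "\<forall>\<^sub>F k in sequentially. of_real (sqrt (u k)) * h k (T k v) = g k v"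
      proof (rule eventually_sequentiallyI[of K])
        fix k assume "K <= k"
        from K[OF this] have "T k v \<in> {-4..0}" by auto
        then show "of_real (sqrt (u k)) * h k (T k v) = g k v" by (simp add: g_def)
      qed
      ultimately show "(\<lambda>k. g k v) \<longlonglongrightarrow> L * exp (- (of_real vol / (2 * (1 - \<i>)) * of_real (v^2)))"
        by (rule Lim_transform_eventually)
    qed
  qed
  moreover have "(LINT v|lborel. g k v) = integral {-4..0} (\<lambda>t. S k t * exp (of_real (m k) * (of_real (u k) * (1 + \<i> * of_real t)))) * exp (- (of_real (vol / u k) * (1 - \<i>)))" for k
  proof -
    have hc: "continuous_on {-4..0} (h k)" unfolding h_def z_def by (intro continuous_intros S)
    have "(LINT v|lborel. g k v) = sqrt (u k) *\<^sub>R (LINT v|lborel. indicator {-4..0} (- 1 + sqrt (u k) * v) *\<^sub>R h k (- 1 + sqrt (u k) * v))"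
      unfolding g_def T_def by (simp add: scaleR_conv_of_real mult.left_commute)
    also have "... = (LINT t|lborel. indicator {-4..0} t *\<^sub>R h k t)"
      using lborel_integral_real_affine[of "sqrt (u k)" "\<lambda>t. indicator {-4..0} t *\<^sub>R h k t" "- 1"] u(1)[of k] by simp
    also have "... = integral {-4..0} (h k)"
      using set_borel_integral_eq_integral(2)[OF borel_integrable_atLeastAtMost'[OF hc]] by (simp add: set_lebesgue_integral_def)
    also have "... = integral {-4..0} (\<lambda>t. S k t * exp (of_real (m k) * (of_real (u k) * (1 + \<i> * of_real t))) * exp (- (of_real (vol / u k) * (1 - \<i>))))"
      unfolding h_def z_def by (simp only: diff_conv_add_uminus exp_add mult.assoc)
    finally show ?thesis by simp
  qed
  ultimately show ?thesis unfolding L_def by (simp add: gauss_def)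
qed

subsection \<open>Sets of natural density zero\<close>

lemma natural_density_0_Un:
  assumes "natural_density_0 A" "natural_density_0 B"
  shows "natural_density_0 (A \<union> B)"
  unfolding natural_density_0_def
proof (rule Lim_null_comparison)
  show "(\<lambda>N. real (card (A \<inter> {1..N})) / real N + real (card (B \<inter> {1..N})) / real N) \<longlonglongrightarrow> 0"
    using tendsto_add[OF assms[unfolded natural_density_0_def]] by simp
  show "\<forall>\<^sub>F N in sequentially. norm (real (card ((A \<union> B) \<inter> {1..N})) / real N) <= real (card (A \<inter> {1..N})) / real N + real (card (B \<inter> {1..N})) / real N"
  proof (intro always_eventually allI)
    fix N
    have "card ((A \<union> B) \<inter> {1..N}) <= card (A \<inter> {1..N}) + card (B \<inter> {1..N})"
      unfolding Int_Un_distrib2 by (rule card_Un_le)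
    then have "real (card ((A \<union> B) \<inter> {1..N})) <= real (card (A \<inter> {1..N})) + real (card (B \<inter> {1..N}))"
      by (simp only: of_nat_add[symmetric] of_nat_le_iff)
    then show "norm (real (card ((A \<union> B) \<inter> {1..N})) / real N) <= real (card (A \<inter> {1..N})) / real N + real (card (B \<inter> {1..N})) / real N"
      by (simp add: divide_right_mono flip: add_divide_distrib)
  qed
qed

lemma natural_density_0_shift:
  assumes "natural_density_0 A"
  shows "natural_density_0 {n. Suc n \<in> A}"
  unfolding natural_density_0_def
proof (rule Lim_null_comparison)
  have "(\<lambda>N. 1 / real N) \<longlonglongrightarrow> 0" by (rule lim_1_over_n)
  from tendsto_add[OF assms[unfolded natural_density_0_def] this]
  show "(\<lambda>N. real (card (A \<inter> {1..N})) / real N + 1 / real N) \<longlonglongrightarrow> 0" by simp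
  show "\<forall>\<^sub>F N in sequentially. norm (real (card ({n. Suc n \<in> A} \<inter> {1..N})) / real N) <= real (card (A \<inter> {1..N})) / real N + 1 / real N"
  proof (intro always_eventually allI)
    fix N
    have "card ({n. Suc n \<in> A} \<inter> {1..N}) = card (Suc ` ({n. Suc n \<in> A} \<inter> {1..N}))" by (simp add: card_image)
    also have "... <= card (insert (Suc N) (A \<inter> {1..N}))" by (rule card_mono) auto
    also have "... <= card (A \<inter> {1..N}) + 1" by (simp add: card_insert_if)
    finally have "real (card ({n. Suc n \<in> A} \<inter> {1..N})) <= real (card (A \<inter> {1..N})) + 1" by linarith
    then show "norm (real (card ({n. Suc n \<in> A} \<inter> {1..N})) / real N) <= real (card (A \<inter> {1..N})) / real N + 1 / real N"
      by (simp add: divide_right_mono flip: add_divide_distrib)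
  qed
qed

lemma natural_density_0I:
  assumes "\<And>e. 0 < e ==> \<exists>K c1 c2. \<forall>N\<ge>K. real (card (E \<inter> {1..N})) <= e * real N + c1 * sqrt (real N) + c2"
  shows "natural_density_0 E"
  unfolding natural_density_0_def
proof (rule LIMSEQ_I)
  fix r :: real assume r: "0 < r"
  obtain K c1 c2 where K: "\<And>N. N \<ge> K ==> real (card (E \<inter> {1..N})) <= r / 2 * real N + c1 * sqrt (real N) + c2"
    using assms[of "r / 2"] r by auto
  have "(\<lambda>N. c1 * (sqrt (real N) / real N) + c2 * (1 / real N)) \<longlonglongrightarrow> c1 * 0 + c2 * 0"
  proof (intro tendsto_add tendsto_mult tendsto_const)
    show "(\<lambda>N. sqrt (real N) / real N) \<longlonglongrightarrow> 0" by real_asymp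
    show "(\<lambda>N. 1 / real N) \<longlonglongrightarrow> 0" by (rule lim_1_over_n)
  qed
  then have "\<forall>\<^sub>F N in sequentially. c1 * (sqrt (real N) / real N) + c2 * (1 / real N) < r / 2"
    by (rule order_tendstoD) (use r in simp)
  moreover have "\<forall>\<^sub>F N in sequentially. N \<ge> max K 1" by (rule eventually_ge_at_top)
  ultimately have "\<forall>\<^sub>F N in sequentially. norm (real (card (E \<inter> {1..N})) / real N - 0) < r"
  proof eventually_elim
    case (elim N)
    have "real (card (E \<inter> {1..N})) / real N <= (r / 2 * real N + c1 * sqrt (real N) + c2) / real N"
      using K[of N] elim by (intro divide_right_mono) auto
    also have "... = r / 2 + (c1 * (sqrt (real N) / real N) + c2 * (1 / real N))"
      using elim by (simp add: add_divide_distrib)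
    finally have f: "real (card (E \<inter> {1..N})) / real N <= r / 2 + (c1 * (sqrt (real N) / real N) + c2 * (1 / real N))" .
    have g: "0 <= real (card (E \<inter> {1..N})) / real N" by simp
    show ?case unfolding diff_0_right real_norm_def abs_of_nonneg[OF g] using f elim(1) by linarith
  qed
  then show "\<exists>no. \<forall>n\<ge>no. norm (real (card (E \<inter> {1..n})) / real n - 0) < r"
    by (simp add: eventually_sequentially)
qed

lemma card_nat_interval_le:
  fixes x y :: real
  assumes "x <= y"
  shows "finite {n::nat. x <= real n \<and> real n <= y}" "real (card {n::nat. x <= real n \<and> real n <= y}) <= y - x + 1"
proof -
  let ?A = "{n::nat. x <= real n \<and> real n <= y}"
  have sub: "int ` ?A \<subseteq> {\<lceil>x\<rceil>..\<lfloor>y\<rfloor>}" by (auto simp: ceiling_le_iff le_floor_iff)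
  then have fin: "finite (int ` ?A)" by (rule finite_subset) simp
  then show "finite ?A" by (rule finite_imageD) (simp add: inj_on_def)
  have "card ?A = card (int ` ?A)" by (simp add: card_image)
  also have "... <= card {\<lceil>x\<rceil>..\<lfloor>y\<rfloor>}" by (rule card_mono[OF _ sub]) simp
  also have "... = nat (\<lfloor>y\<rfloor> - \<lceil>x\<rceil> + 1)" by simp
  finally have "real (card ?A) <= real (nat (\<lfloor>y\<rfloor> - \<lceil>x\<rceil> + 1))" by simp
  also have "... <= y - x + 1"
  proof (cases "\<lfloor>y\<rfloor> - \<lceil>x\<rceil> + 1 \<ge> 0")
    case True
    then have "real (nat (\<lfloor>y\<rfloor> - \<lceil>x\<rceil> + 1)) = of_int (\<lfloor>y\<rfloor> - \<lceil>x\<rceil> + 1)" by simp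
    also have "... <= y - x + 1" by simp linarith
    finally show ?thesis .
  qed (use assms in simp)
  finally show "real (card ?A) <= y - x + 1" .
qed

lemma abs_sin_ge_dist:
  obtains k :: int where "\<bar>x - pi * of_int k\<bar> <= 2 * \<bar>sin x\<bar>" "\<bar>x - pi * of_int k\<bar> <= pi / 2"
proof -
  define k where "k = round (x / pi)"
  define d where "d = x - pi * of_int k"
  have d: "\<bar>d\<bar> <= pi / 2"
  proof -
    have "\<bar>x / pi - of_int k\<bar> <= 1 / 2" unfolding k_def using of_int_round_abs_le[of "x / pi"] by (simp add: abs_minus_commute)
    then have "pi * \<bar>x / pi - of_int k\<bar> <= pi * (1 / 2)" by (intro mult_left_mono) auto
    moreover have "pi * \<bar>x / pi - of_int k\<bar> = \<bar>pi * (x / pi - of_int k)\<bar>" by (simp add: abs_mult)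
    moreover have "pi * (x / pi - of_int k) = d" by (simp add: d_def algebra_simps)
    ultimately show ?thesis by simp
  qed
  have "sin x = sin (d + pi * of_int k)" by (simp add: d_def)
  also have "... = sin d * cos (pi * of_int k) + cos d * sin (pi * of_int k)" by (rule sin_add)
  also have "sin (pi * of_int k) = 0" by (simp add: sin_zero_iff_int2 mult.commute)
  finally have "sin x = sin d * cos (pi * of_int k)" by simp
  moreover have "\<bar>cos (pi * of_int k)\<bar> = 1"
    using sin_cos_squared_add[of "pi * of_int k"] \<open>sin (pi * of_int k) = 0\<close> by (simp add: power2_eq_1_iff abs_if)
  ultimately have "\<bar>sin x\<bar> = \<bar>sin d\<bar>" by (simp add: abs_mult)
  also have "\<bar>sin d\<bar> = sin \<bar>d\<bar>" using d sin_ge_zero[of "\<bar>d\<bar>"] pi_gt_zero by (cases "d \<ge> 0") (auto simp: abs_if)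
  finally have "\<bar>d\<bar> / 2 <= \<bar>sin x\<bar>" using sin_ge_half[of "\<bar>d\<bar>"] d by simp
  then show ?thesis using d by (intro that[of k]) (auto simp: d_def)
qed

text \<open>The real part is \<open>norm c * sin (p - sqrt (l n))\<close>, small only if
  \<open>sqrt (l n)\<close> is within \<open>d\<close> of some \<open>p - pi k\<close>. Up to
  \<open>N\<close> there are about \<open>sqrt (l N)\<close> such \<open>k\<close>, each allowing an
  interval of \<open>n\<close> of length about \<open>4 d sqrt (l N) / l\<close>: in total
  \<open>4 d N\<close> and lower-order terms.\<close>

lemma density_sqrt_phase:
  fixes l :: real and c :: complex and g :: "nat \<Rightarrow> real"
  assumes l: "0 < l" and c: "c \<noteq> 0" and g: "g \<longlonglongrightarrow> 0"
  shows "natural_density_0 {n. \<bar>Re (cis (- sqrt (l * real n)) * c)\<bar> <= g n}"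
proof (rule natural_density_0I)
  fix e :: real assume e: "0 < e"
  define E where "E = {n. \<bar>Re (cis (- sqrt (l * real n)) * c)\<bar> <= g n}"
  define p where "p = Arg c + pi / 2"
  \<comment> \<open>The leading term of the count is \<open>4 d N\<close>, so
    \<open>d <= e / 4\<close>.\<close>
  define d where "d = min (1 / 2) (e / 4)"
  have d: "0 < d" "d <= 1 / 2" "4 * d <= e" using e by (auto simp: d_def)
  have R: "Re (cis (- t) * c) = norm c * sin (p - t)" for t
  proof -
    have "c = of_real (norm c) * cis (Arg c)" by (metis rcis_cmod_Arg rcis_def)
    then have "Re (cis (- t) * c) = Re (of_real (norm c) * (cis (- t) * cis (Arg c)))" by (metis mult.left_commute)
    also have "... = norm c * cos (Arg c - t)" unfolding cis_mult by simp
    also have "cos (Arg c - t) = sin (p - t)"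
    proof -
      have "pi / 2 - (p - t) = - (Arg c - t)" by (simp add: p_def)
      then show ?thesis using sin_cos_eq[of "p - t"] by (simp only: of_real_eq_id id_apply cos_minus)
    qed
    finally show ?thesis .
  qed
  have "\<forall>\<^sub>F n in sequentially. g n < norm c * d / 2" using g by (rule order_tendstoD) (use c d in auto)
  then obtain K where K: "\<And>n. n \<ge> K ==> g n < norm c * d / 2" by (auto simp: eventually_sequentially)
  \<comment> \<open>The \<open>max\<close> keeps the left endpoint nonnegative, so that squaring
    preserves the order.\<close>
  define I where "I = (\<lambda>k::int. {n::nat. (max 0 (p - pi * of_int k - d))\<^sup>2 / l <= real n \<and> real n <= (p - pi * of_int k + d)^2 / l})"
  have bound: "real (card (E \<inter> {1..N})) <= 4 * d * real N + (8 * d / l + 4 * d / l + 1) * sqrt l * sqrt (real N) + (real K + 8 * d / l + 2)" for N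
  proof -
    define b where "b = sqrt (l * real N) + 1"
    have b: "1 <= b" using l by (simp add: b_def)
    define Ks where "Ks = {k::int. - d <= p - pi * of_int k \<and> p - pi * of_int k <= b}"
    have Esub: "E \<inter> {1..N} \<subseteq> {1..K} \<union> (\<Union>k\<in>Ks. I k)"
    proof
      fix n assume n: "n \<in> E \<inter> {1..N}"
      show "n \<in> {1..K} \<union> (\<Union>k\<in>Ks. I k)"
      proof (cases "n <= K")
        case False
        define t where "t = sqrt (l * real n)"
        have t: "0 <= t" "t^2 = l * real n" using l by (auto simp: t_def)
        have tb: "t <= b - 1" using n l by (simp add: t_def b_def)
        have "norm c * \<bar>sin (p - t)\<bar> <= g n"
        proof -
          have "\<bar>Re (cis (- t) * c)\<bar> <= g n" using n unfolding E_def t_def by blast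
          then show ?thesis unfolding R by (simp add: abs_mult)
        qed
        also have "... < norm c * d / 2" using K[of n] False by simp
        finally have "2 * \<bar>sin (p - t)\<bar> < d" using c by simp
        moreover obtain k where k: "\<bar>p - t - pi * of_int k\<bar> <= 2 * \<bar>sin (p - t)\<bar>" using abs_sin_ge_dist by blast
        ultimately have "\<bar>p - t - pi * of_int k\<bar> < d" by linarith
        then have kk: "p - pi * of_int k - d <= t" "t <= p - pi * of_int k + d" by (simp_all add: abs_less_iff)
        have "k \<in> Ks" unfolding Ks_def using kk t tb d by auto
        moreover have "n \<in> I k"
        proof -
          have "(max 0 (p - pi * of_int k - d))^2 <= t^2" using kk t by (intro power_mono) auto
          moreover have "t^2 <= (p - pi * of_int k + d)^2" using kk t by (intro power_mono) auto
          ultimately show ?thesis using l t by (simp add: I_def field_simps)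
        qed
        ultimately show ?thesis by blast
      qed (use n in auto)
    qed
    have Ksub: "Ks \<subseteq> {\<lceil>(p - b) / pi\<rceil>..\<lfloor>(p + d) / pi\<rfloor>}"
    proof
      fix k assume "k \<in> Ks"
      then have "(p - b) / pi <= of_int k" "of_int k <= (p + d) / pi" by (simp_all add: Ks_def field_simps)
      then show "k \<in> {\<lceil>(p - b) / pi\<rceil>..\<lfloor>(p + d) / pi\<rfloor>}" by (simp add: ceiling_le_iff le_floor_iff)
    qed
    have finK: "finite Ks" by (rule finite_subset[OF Ksub]) simp
    have cardK: "real (card Ks) <= b + 1"
    proof -
      have "card Ks <= nat (\<lfloor>(p + d) / pi\<rfloor> - \<lceil>(p - b) / pi\<rceil> + 1)" using card_mono[OF _ Ksub] by simp
      then have "real (card Ks) <= real (nat (\<lfloor>(p + d) / pi\<rfloor> - \<lceil>(p - b) / pi\<rceil> + 1))" by simp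
      also have "... <= (b + d) / pi + 1"
      proof (cases "\<lfloor>(p + d) / pi\<rfloor> - \<lceil>(p - b) / pi\<rceil> + 1 \<ge> 0")
        case True
        then have "real (nat (\<lfloor>(p + d) / pi\<rfloor> - \<lceil>(p - b) / pi\<rceil> + 1)) = of_int (\<lfloor>(p + d) / pi\<rfloor> - \<lceil>(p - b) / pi\<rceil> + 1)" by simp
        also have "... <= (p + d) / pi - (p - b) / pi + 1"
          unfolding of_int_add of_int_diff of_int_1
          using of_int_floor_le[of "(p + d) / pi"] le_of_int_ceiling[of "(p - b) / pi"] by linarith
        also have "... = (b + d) / pi + 1" by (simp add: field_simps)
        finally show ?thesis .
      qed (use b d in simp)
      also have "(b + d) / pi <= b"
      proof -
        have "b + d <= b * 3" using b d by simp
        also have "... <= b * pi" using b pi_gt3 by (intro mult_left_mono) auto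
        finally show ?thesis by (simp add: pos_divide_le_eq)
      qed
      finally show ?thesis by simp
    qed
    have Ik: "finite (I k) \<and> real (card (I k)) <= 4 * b * d / l + 1" if "k \<in> Ks" for k
    proof -
      define a where "a = p - pi * of_int k"
      have a: "- d <= a" "a <= b" using that by (auto simp: Ks_def a_def)
      have le: "(max 0 (a - d))^2 <= (a + d)^2" using a d by (intro power_mono) auto
      have diff: "(a + d)^2 - (max 0 (a - d))\<^sup>2 <= 4 * b * d"
      proof (cases "a \<ge> d")
        case True
        then have "(a + d)^2 - (max 0 (a - d))\<^sup>2 = 4 * a * d" by (simp add: power2_eq_square algebra_simps)
        also have "... <= 4 * b * d" using a d by (intro mult_right_mono) auto
        finally show ?thesis .
      next
        case False
        then have "(a + d)^2 <= (2 * d)^2" using a by (intro power_mono) auto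
        also have "... = 4 * d * d" by (simp add: power2_eq_square)
        also have "... <= 4 * b * d" using b d by (intro mult_right_mono) auto
        finally show ?thesis using False by simp
      qed
      have "(max 0 (a - d))^2 / l <= (a + d)^2 / l" using le l by (intro divide_right_mono) auto
      note I = card_nat_interval_le[OF this]
      have "(a + d)^2 / l - (max 0 (a - d))\<^sup>2 / l <= 4 * b * d / l"
        using divide_right_mono[OF diff, of l] l by (simp add: diff_divide_distrib)
      then show ?thesis using I unfolding I_def a_def by linarith
    qed
    have "finite ({1..K} \<union> (\<Union>k\<in>Ks. I k))" using finK Ik by auto
    then have "card (E \<inter> {1..N}) <= card ({1..K} \<union> (\<Union>k\<in>Ks. I k))"
      using Esub by (intro card_mono)
    also have "... <= card {1..K} + card (\<Union>k\<in>Ks. I k)" by (rule card_Un_le)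
    also have "card (\<Union>k\<in>Ks. I k) <= (\<Sum>k\<in>Ks. card (I k))" by (rule card_UN_le[OF finK])
    finally have "real (card (E \<inter> {1..N})) <= real K + (\<Sum>k\<in>Ks. real (card (I k)))"
      by (simp only: card_atLeastAtMost of_nat_sum[symmetric] of_nat_add[symmetric] of_nat_le_iff) simp
    also have "(\<Sum>k\<in>Ks. real (card (I k))) <= (\<Sum>k\<in>Ks. 4 * b * d / l + 1)"
      by (intro sum_mono) (use Ik in blast)
    also have "... = real (card Ks) * (4 * b * d / l + 1)" by simp
    also have "... <= (b + 1) * (4 * b * d / l + 1)" using cardK b d l by (intro mult_right_mono) auto
    also have "real K + (b + 1) * (4 * b * d / l + 1) = 4 * d * real N + (8 * d / l + 4 * d / l + 1) * sqrt l * sqrt (real N) + (real K + 8 * d / l + 2)"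
    proof -
      define s where "s = sqrt l * sqrt (real N)"
      have s: "b = s + 1" by (simp add: b_def s_def real_sqrt_mult)
      have "s * s = l * real N" using l by (simp add: s_def mult_ac flip: real_sqrt_mult)
      then have ss: "4 * (s * s) * d / l = 4 * d * real N" using l by simp
      have expand: "(b + 1) * (4 * b * d / l + 1) = 4 * (s * s) * d / l + (8 * d / l + 4 * d / l + 1) * s + (8 * d / l + 2)"
        unfolding s by (simp add: algebra_simps add_divide_distrib)
      show ?thesis unfolding expand ss unfolding s_def by (simp add: mult.assoc)
    qed
    finally show ?thesis by simp
  qed
  show "\<exists>K c1 c2. \<forall>N\<ge>K. real (card ({n. \<bar>Re (cis (- sqrt (l * real n)) * c)\<bar> <= g n} \<inter> {1..N})) <= e * real N + c1 * sqrt (real N) + c2"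
  proof (intro exI allI impI)
    fix N
    have "4 * d * real N <= e * real N" using d by (intro mult_right_mono) auto
    then show "real (card ({n. \<bar>Re (cis (- sqrt (l * real n)) * c)\<bar> <= g n} \<inter> {1..N})) <= e * real N
      + (8 * d / l + 4 * d / l + 1) * sqrt l * sqrt (real N) + (real K + 8 * d / l + 2)"
      using bound[of N] unfolding E_def by linarith
  qed
qed

text \<open>From \<open>n\<close> to \<open>n + 2\<close> the parity stays, the sign
  \<open>(- 1)^(n div 2)\<close> flips and the phase moves by a null sequence. So if the main term
  at \<open>n\<close> exceeds all errors, \<open>a n\<close> and \<open>a (n + 2)\<close> have
  opposite signs; used at \<open>n\<close> and \<open>n + 1\<close> this gives two signs of each
  kind.\<close>

lemma sign_pattern_from_asymptotic:
  fixes a :: "nat \<Rightarrow> int" and c :: "bool \<Rightarrow> complex" and w e :: "nat \<Rightarrow> real"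
  assumes l: "0 < l" and c: "\<And>b. c b \<noteq> 0" and w: "\<And>n. 0 < w n" "w \<longlonglongrightarrow> 0" and e: "e \<longlonglongrightarrow> 0"
    and asym: "\<And>n. (- 1) ^ (n div 2) * w n * of_int (a n) = Re (cis (- sqrt (l * real n)) * c (even n)) + e n"
  shows "for_almost_all (\<lambda>n. card {i \<in> {0..3}. a (n + i) > 0} = 2 \<and> card {i \<in> {0..3}. a (n + i) < 0} = 2)"
    and "\<exists>E. natural_density_0 E \<and> filterlim (\<lambda>n. \<bar>a n\<bar>) at_top (inf sequentially (principal (- E)))"
proof -
  define R where "R = (\<lambda>n. Re (cis (- sqrt (l * real n)) * c (even n)))"
  have dR: "(\<lambda>n. R (n + 2) - R n) \<longlonglongrightarrow> 0"
  proof (rule Lim_null_comparison)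
    have "(\<lambda>n. sqrt (l * (real n + 2)) - sqrt (l * real n)) \<longlonglongrightarrow> 0" using l by real_asymp
    then have "(\<lambda>n. cis (- (sqrt (l * (real n + 2)) - sqrt (l * real n)))) \<longlonglongrightarrow> cis (- 0)"
      unfolding cis_conv_exp by (intro tendsto_intros)
    then have "(\<lambda>n. cis (- (sqrt (l * (real n + 2)) - sqrt (l * real n))) - 1) \<longlonglongrightarrow> 0" using LIM_zero by fastforce
    then have "(\<lambda>n. norm (cis (- (sqrt (l * (real n + 2)) - sqrt (l * real n))) - 1) * (norm (c True) + norm (c False))) \<longlonglongrightarrow> 0"
      by (intro tendsto_mult_left_zero tendsto_norm_zero)
    then show "(\<lambda>n. norm (cis (- (sqrt (l * (real n + 2)) - sqrt (l * real n))) - 1) * (norm (c True) + norm (c False))) \<longlonglongrightarrow> 0" .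
    show "\<forall>\<^sub>F n in sequentially. norm (R (n + 2) - R n) <= norm (cis (- (sqrt (l * (real n + 2)) - sqrt (l * real n))) - 1) * (norm (c True) + norm (c False))"
    proof (intro always_eventually allI)
      fix n
      define t s where "t = sqrt (l * real n)" and "s = sqrt (l * (real n + 2))"
      have "cis (- s) = cis (- (s - t)) * cis (- t)" unfolding cis_mult by simp
      then have "R (n + 2) - R n = Re ((cis (- (s - t)) - 1) * (cis (- t) * c (even n)))"
      proof -
        have a: "R (n + 2) = Re (cis (- s) * c (even n))" unfolding R_def s_def by (simp add: add.commute)
        have b: "R n = Re (cis (- t) * c (even n))" unfolding R_def t_def ..
        have "cis (- s) * c (even n) - cis (- t) * c (even n) = (cis (- (s - t)) - 1) * (cis (- t) * c (even n))"
          unfolding \<open>cis (- s) = _\<close> by (simp add: algebra_simps)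
        then show ?thesis unfolding a b minus_complex.simps(1)[symmetric] by (rule arg_cong)
      qed
      also have "norm ... <= norm ((cis (- (s - t)) - 1) * (cis (- t) * c (even n)))"
        unfolding real_norm_def by (rule abs_Re_le_cmod)
      also have "... = norm (cis (- (s - t)) - 1) * norm (c (even n))" by (simp add: norm_mult)
      also have "... <= norm (cis (- (s - t)) - 1) * (norm (c True) + norm (c False))"
        by (intro mult_left_mono) (cases "even n"; simp)+
      finally show "norm (R (n + 2) - R n) <= norm (cis (- (sqrt (l * (real n + 2)) - sqrt (l * real n))) - 1) * (norm (c True) + norm (c False))"
        by (simp only: t_def s_def)
    qed
  qed
  \<comment> \<open>The last summand is for the growth statement: a main term above
    \<open>sqrt (w n)\<close> forces \<open>\<bar>a n\<bar> >= 1 / sqrt (w n)\<close>.\<close>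
  define g where "g = (\<lambda>n. \<bar>e n\<bar> + \<bar>e (n + 2)\<bar> + \<bar>R (n + 2) - R n\<bar> + sqrt (w n))"
  have g: "g \<longlonglongrightarrow> 0"
  proof -
    have "(\<lambda>n. sqrt (w n)) \<longlonglongrightarrow> 0" using tendsto_real_sqrt[OF w(2)] by simp
    moreover have "(\<lambda>n. e (n + 2)) \<longlonglongrightarrow> 0" by (rule LIMSEQ_ignore_initial_segment[OF e])
    ultimately have "g \<longlonglongrightarrow> 0 + 0 + 0 + 0"
      unfolding g_def by (intro tendsto_add tendsto_rabs_zero e dR)
    then show ?thesis by simp
  qed
  define E where "E = {n. \<bar>Re (cis (- sqrt (l * real n)) * c True)\<bar> <= g n} \<union> {n. \<bar>Re (cis (- sqrt (l * real n)) * c False)\<bar> <= g n}"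
  have E: "natural_density_0 E" unfolding E_def by (intro natural_density_0_Un density_sqrt_phase l c g)
  have notE: "g n < \<bar>R n\<bar>" if "n \<notin> E" for n using that unfolding E_def R_def by (cases "even n") auto
  have asym': "(- 1) ^ (n div 2) * w n * of_int (a n) = R n + e n" for n using asym[of n] by (simp add: R_def)
  have sw: "0 < sqrt (w n)" for n using w(1) by simp
  have opp: "(0 < a n \<and> a (n + 2) < 0) \<or> (a n < 0 \<and> 0 < a (n + 2))" if n: "n \<notin> E" for n
  proof -
    define s :: real where "s = (- 1) ^ (n div 2)"
    have s: "s = 1 \<or> s = - 1" unfolding s_def by (metis minus_one_power_iff)
    have 1: "s * w n * of_int (a n) = R n + e n" using asym'[of n] by (simp add: s_def)
    have 2: "- (s * w (n + 2) * of_int (a (n + 2))) = R (n + 2) + e (n + 2)" using asym'[of "n + 2"] by (simp add: s_def)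
    have pos: "0 < w m * of_int x \<longleftrightarrow> 0 < x" "w m * of_int x < 0 \<longleftrightarrow> x < 0" for m x
      using w(1)[of m] by (simp_all add: zero_less_mult_iff mult_less_0_iff)
    have gR: "\<bar>e n\<bar> + \<bar>e (n + 2)\<bar> + \<bar>R (n + 2) - R n\<bar> < \<bar>R n\<bar>" using notE[OF n] sw[of n] unfolding g_def by linarith
    show ?thesis
    proof (cases "R n > 0")
      case True
      then have "0 < R n + e n" using gR by linarith
      moreover have "0 < R (n + 2) + e (n + 2)" using gR True by linarith
      ultimately
      show ?thesis using s 1 2 pos[of n "a n"] pos[of "n + 2" "a (n + 2)"] by auto
    next
      case False
      then have "R n + e n < 0" using gR by linarith
      moreover have "R (n + 2) + e (n + 2) < 0" using gR False by linarith
      ultimately show ?thesis using s 1 2 pos[of n "a n"] pos[of "n + 2" "a (n + 2)"] by auto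
    qed
  qed
  show "for_almost_all (\<lambda>n. card {i \<in> {0..3}. a (n + i) > 0} = 2 \<and> card {i \<in> {0..3}. a (n + i) < 0} = 2)"
    unfolding for_almost_all_def
  proof (intro exI[of _ "E \<union> {n. Suc n \<in> E}"] conjI allI impI)
    show "natural_density_0 (E \<union> {n. Suc n \<in> E})" by (intro natural_density_0_Un E natural_density_0_shift)
    fix n assume "n \<notin> E \<union> {n. Suc n \<in> E}"
    then have o: "(0 < a n \<and> a (n + 2) < 0) \<or> (a n < 0 \<and> 0 < a (n + 2))"
      "(0 < a (n + 1) \<and> a (n + 3) < 0) \<or> (a (n + 1) < 0 \<and> 0 < a (n + 3))"
      using opp[of n] opp[of "n + 1"] by (auto simp: numeral_3_eq_3 numeral_2_eq_2)
    have three: "{0..3} = {0, 1, 2, 3::nat}" by auto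
    have filter: "{i \<in> insert x A. P i} = (if P x then insert x {i \<in> A. P i} else {i \<in> A. P i})" for x :: nat and A P by auto
    show "card {i \<in> {0..3}. a (n + i) > 0} = 2" "card {i \<in> {0..3}. a (n + i) < 0} = 2"
      unfolding three filter using o by auto
  qed
  show "\<exists>E. natural_density_0 E \<and> filterlim (\<lambda>n. \<bar>a n\<bar>) at_top (inf sequentially (principal (- E)))"
  proof (intro exI[of _ E] conjI E)
    have big: "1 / sqrt (w n) <= of_int \<bar>a n\<bar>" if n: "n \<notin> E" for n
    proof -
      have "\<bar>(- 1) ^ (n div 2) * w n * of_int (a n)\<bar> = w n * of_int \<bar>a n\<bar>" using w(1)[of n] by (simp add: abs_mult power_abs)
      moreover have "sqrt (w n) <= \<bar>R n + e n\<bar>" using notE[OF n] by (simp add: g_def)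
      ultimately have "sqrt (w n) <= w n * of_int \<bar>a n\<bar>" using asym'[of n] by simp
      also have "... = sqrt (w n) * (sqrt (w n) * of_int \<bar>a n\<bar>)" using w(1)[of n] by (simp flip: mult.assoc)
      finally have "sqrt (w n) * 1 <= sqrt (w n) * (sqrt (w n) * of_int \<bar>a n\<bar>)" by (simp only: mult_1_right)
      then have "1 <= sqrt (w n) * of_int \<bar>a n\<bar>" using sw[of n] by (simp only: mult_le_cancel_left_pos)
      then show ?thesis using sw[of n] by (simp add: field_simps)
    qed
    have "filterlim (\<lambda>n. inverse (sqrt (w n))) at_top sequentially"
      by (rule filterlim_inverse_at_top) (use tendsto_real_sqrt[OF w(2)] sw in auto)
    then have lim: "filterlim (\<lambda>n. 1 / sqrt (w n)) at_top sequentially" by (simp add: inverse_eq_divide)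
    show "filterlim (\<lambda>n. \<bar>a n\<bar>) at_top (inf sequentially (principal (- E)))"
      unfolding filterlim_at_top eventually_inf_principal
    proof
      fix Z :: int
      have "\<forall>\<^sub>F n in sequentially. of_int Z <= 1 / sqrt (w n)" using lim by (auto simp: filterlim_at_top)
      then show "\<forall>\<^sub>F n in sequentially. n \<in> - E \<longrightarrow> Z <= \<bar>a n\<bar>"
      proof eventually_elim
        case (elim n)
        show ?case
        proof
          assume "n \<in> - E"
          then have "(of_int Z :: real) <= of_int \<bar>a n\<bar>" using big[of n] elim by simp
          then show "Z <= \<bar>a n\<bar>" by (simp only: of_int_le_iff)
        qed
      qed
    qed
  qed
qed

subsection \<open>The asymptotic formula\<close>

text \<open>\<open>(- \<i>)^n\<close> is \<open>(- 1)^(n div 2)\<close> times 1 or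
  \<open>- \<i>\<close>. Under the real part the conjugate of \<open>W\<close> may be replaced by
  \<open>W\<close> in the even case and by \<open>- W\<close> in the odd one.\<close>

lemma Re_rotate:
  "(- 1) ^ (n div 2) * Re ((- \<i>) ^ n * (U + cnj W)) = Re (if even n then U + W else - \<i> * (U - W))"
proof -
  have i2: "(- \<i>) ^ (2 * m) = of_real ((- 1) ^ m)" for m by (simp add: power_mult)
  have s: "(- 1) ^ m * ((- 1) ^ m * x) = (x::real)" for m x by (simp flip: mult.assoc power_add mult_2)
  show ?thesis
  proof (cases "even n")
    case True
    then obtain m where m: "n = 2 * m" by auto
    show ?thesis using True unfolding m i2 by (simp add: s)
  next
    case False
    then obtain m where m: "n = 2 * m + 1" using oddE by blast
    have "Re ((- \<i>) ^ n * (U + cnj W)) = (- 1) ^ m * (Im U - Im W)" unfolding m power_add i2 by simp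
    then show ?thesis using False m by (simp add: s)
  qed
qed

text \<open>The real part is a multiple of \<open>ln (norm (1 + X)) - ln (norm (1 - X))\<close>, and
  the norms differ because \<open>Re X > 0\<close>.\<close>

lemma reg_limit_saddle_nonzero: "Re (reg_limit (cis (pi / 6))) \<noteq> 0"
proof
  define X where "X = cis (pi / 6)"
  have X: "Re X = sqrt 3 / 2" "Im X = 1 / 2" by (auto simp: X_def cos_30 sin_30)
  have ne: "1 + X \<noteq> 0" "1 - X \<noteq> 0" using X by (auto simp: complex_eq_iff)
  assume "Re (reg_limit (cis (pi / 6))) = 0"
  then have "ln (norm (1 + X)) = ln (norm (1 - X))"
    unfolding reg_limit_def X_def[symmetric] using ne by simp
  then have "norm (1 + X) = norm (1 - X)" using ne by simp
  then have "(norm (1 + X))^2 = (norm (1 - X))^2" by simp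
  then show False unfolding cmod_power2 by (simp add: X power2_eq_square algebra_simps)
qed

lemma reg_limit_minus: "reg_limit (- X) = - reg_limit X"
  by (simp add: reg_limit_def field_simps)

text \<open>With \<open>h = sqrt (vol / (2 n))\<close> the integrand has its saddle at
  \<open>z = h (1 - \<i>)\<close>, and there the exponent is \<open>(vol / h) (1 - \<i>)\<close>:
  growth and phase are both \<open>vol / h = sqrt (2 vol n)\<close>.\<close>

lemma V1_asymptotic:
  obtains c :: "bool \<Rightarrow> complex" and w e :: "nat \<Rightarrow> real"
  where "\<And>b. c b \<noteq> 0" "\<And>n. 0 < w n" "w \<longlonglongrightarrow> 0" "e \<longlonglongrightarrow> 0"
    "\<And>n. (- 1) ^ (n div 2) * w n * of_int (V1 n) = Re (cis (- sqrt (2 * vol * real n)) * c (even n)) + e n"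
proof -
  have v: "0 < vol" "1 / 8 <= vol" "vol <= 27 / 200" using vol_lower vol_upper by auto
  obtain B1 where B1: "0 < B1"
    "\<And>z p N. z \<in> sector 4 ==> Re z <= 1 / 50 ==> p^2 = 1 ==> 1 <= Re z * real N ==> real N * (Re z)^2 <= 2 ==>
      norm (half_sum p (1 / 4) N z + \<i> / z * lower_integral p (1 / 4) z) <= B1 * exp (49 / 100 * vol / Re z)"
    "\<And>z p N. z \<in> sector 4 ==> Re z <= 1 / 50 ==> p^2 = 1 ==> 1 <= Re z * real N ==> real N * (Re z)^2 <= 2 ==> 0 <= Im z ==>
      norm (half_sum p (1 / 4) N z) <= B1 * exp (49 / 100 * vol / Re z)"
    by (rule half_sum_approx[of "1 / 4"]) auto
  obtain B2 where B2: "0 < B2"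
    "\<And>z p N. z \<in> sector 4 ==> Re z <= 1 / 50 ==> p^2 = 1 ==> 1 <= Re z * real N ==> real N * (Re z)^2 <= 2 ==>
      norm (half_sum p (3 / 4) N z + \<i> / z * lower_integral p (3 / 4) z) <= B2 * exp (49 / 100 * vol / Re z)"
    "\<And>z p N. z \<in> sector 4 ==> Re z <= 1 / 50 ==> p^2 = 1 ==> 1 <= Re z * real N ==> real N * (Re z)^2 <= 2 ==> 0 <= Im z ==>
      norm (half_sum p (3 / 4) N z) <= B2 * exp (49 / 100 * vol / Re z)"
    by (rule half_sum_approx[of "3 / 4"]) auto
  obtain Cm h0 where Cm: "0 < Cm" "0 < h0" "\<And>h r n. 0 < h ==> h <= h0 ==> 0 <= r ==> r <= pi ==> 4 * h <= \<bar>r - pi / 2\<bar> ==>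
    norm (qterm (exp (of_real (- h) + \<i> * of_real r)) n) <= Cm * exp (3 / (50 * h) + Cm / sqrt h)"
    using minor_arc_bound by blast
  obtain B3 where B3: "0 < B3" "\<And>h::real. 0 < h ==> h <= 1 ==> exp (Cm / sqrt h) / h ^ 3 <= B3 * exp (vol / 100 / h)"
    using exp_sqrt_absorb[OF Cm(1), of "vol / 100"] v by auto
  \<comment> \<open>The solution of the saddle equation \<open>n h = vol / (2 h)\<close>.\<close>
  define H where "H = (\<lambda>n. sqrt (vol / (2 * real n)))"
  have Hlim: "H \<longlonglongrightarrow> 0" unfolding H_def using v by real_asymp
  have "\<forall>\<^sub>F n in sequentially. H n < min (1 / 50) h0" using Hlim by (rule order_tendstoD) (use Cm in simp)
  then have "\<forall>\<^sub>F n in sequentially. H n < min (1 / 50) h0 \<and> 16 <= n" using eventually_ge_at_top[of 16] by eventually_elim auto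
  then obtain K where K: "\<And>n. K <= n ==> H n < min (1 / 50) h0 \<and> 16 <= n" by (auto simp: eventually_sequentially)
  define h where "h = (\<lambda>k. H (k + K))"
  have n16: "16 <= k + K" for k using K[of "k + K"] by simp
  have h: "0 < h k" "h k <= 1 / 50" "h k <= h0" "h k <= 1" for k
    using K[of "k + K"] v n16[of k] by (auto simp: h_def H_def)
  have hlim: "h \<longlonglongrightarrow> 0" unfolding h_def by (rule LIMSEQ_ignore_initial_segment[OF Hlim])
  have h2: "(h k)^2 * (2 * real (k + K)) = vol" for k
  proof -
    have "(h k)^2 = vol / (2 * real (k + K))" unfolding h_def H_def using v by (intro real_sqrt_pow2) auto
    then show ?thesis using n16[of k] by simp
  qed
  have m: "real (k + K) * h k = vol / (2 * h k)" for k
    using h2[of k] h(1)[of k] by (simp add: field_simps power2_eq_square)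
  have phase: "vol / h k = sqrt (2 * vol * real (k + K))" for k
  proof (rule real_sqrt_unique[symmetric])
    have "(vol / h k)^2 = vol * vol / (h k)^2" by (simp add: power2_eq_square)
    also have "... = vol * ((h k)^2 * (2 * real (k + K))) / (h k)^2" by (simp only: h2)
    also have "... = 2 * vol * real (k + K)" using h(1)[of k] by simp
    finally show "(vol / h k)^2 = 2 * vol * real (k + K)" .
  qed (use v h(1)[of k] in auto)
  have N2: "real (Suc (k + K)) * (h k)^2 <= 2" for k
  proof -
    have "real (Suc (k + K)) * (h k)^2 <= (2 * real (k + K)) * (h k)^2" using n16[of k] by (intro mult_right_mono) auto
    then show ?thesis using h2[of k] v by (simp add: mult.commute)
  qed
  \<comment> \<open>\<open>(h n)^2 = vol n / 2\<close>, which is at least 1 for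
    \<open>n >= 16\<close> since \<open>vol >= 1/8\<close>.\<close>
  have N1: "1 <= h k * real (Suc (k + K))" for k
  proof (rule power2_le_imp_le)
    have "1 <= vol / 2 * 16" using v by simp
    also have "... <= vol / 2 * real (k + K)" using v n16[of k] by (intro mult_left_mono) auto
    also have "... = (h k * real (k + K))^2" using h2[of k, symmetric] by (simp add: power2_eq_square mult_ac)
    also have "... <= (h k * real (Suc (k + K)))^2" using h(1)[of k] by (intro power_mono mult_left_mono) auto
    finally show "1^2 <= (h k * real (Suc (k + K)))^2" by simp
  qed (use h(1)[of k] in simp)
  define z where "z = (\<lambda>k t. of_real (h k) * (1 + \<i> * of_real t) :: complex)"
  have zR: "Re (z k t) = h k" "Im (z k t) = h k * t" "Re (cnj (z k t)) = h k" for k t by (simp_all add: z_def)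
  have zs: "z k t \<in> sector 4" "cnj (z k t) \<in> sector 4" "0 <= Im (cnj (z k t))" if "-4 <= t" "t <= 0" for k t
  proof -
    have "\<bar>t\<bar> <= 4" using that by simp
    then have "h k * \<bar>t\<bar> <= h k * 4" using h(1)[of k] by (intro mult_left_mono) auto
    then show "z k t \<in> sector 4" "cnj (z k t) \<in> sector 4"
      unfolding sector_def using h(1)[of k] by (simp_all add: zR abs_mult)
    show "0 <= Im (cnj (z k t))" using that h(1)[of k] by (simp add: zR mult_nonneg_nonpos)
  qed
  have sum1: "major_sum N u = half_sum 1 (1 / 4) N u + cnj (- \<i> * half_sum (- 1) (3 / 4) N (cnj u))" if "0 < Re u" for N u
    unfolding major_sum_def by (rule sum_qterm_split[OF that])
  define S1 S2 where "S1 = (\<lambda>k t. major_sum (Suc (k + K)) (z k t))" and "S2 = (\<lambda>k t. cnj (major_sum (Suc (k + K)) (cnj (z k t))))"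
  \<comment> \<open>For \<open>t <= 0\<close> the odd half is evaluated at \<open>cnj z\<close> with
    nonnegative imaginary part, where it is negligible. In \<open>S2\<close> the roles of the two
    halves are exchanged.\<close>
  have S1: "norm (S1 k t - - \<i> / z k t * lower_integral 1 (1 / 4) (z k t)) <= (B1 + B2) * exp (49 / 100 * vol / h k)" if t: "-4 <= t" "t <= 0" for k t
  proof -
    have "S1 k t - - \<i> / z k t * lower_integral 1 (1 / 4) (z k t) = (half_sum 1 (1 / 4) (Suc (k + K)) (z k t) + \<i> / z k t * lower_integral 1 (1 / 4) (z k t)) + cnj (- \<i> * half_sum (- 1) (3 / 4) (Suc (k + K)) (cnj (z k t)))"
      unfolding S1_def using sum1[of "z k t"] h(1)[of k] by (simp add: zR)
    also have "norm ... <= B1 * exp (49 / 100 * vol / Re (z k t)) + B2 * exp (49 / 100 * vol / Re (cnj (z k t)))"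
    proof (rule order_trans[OF norm_triangle_ineq add_mono])
      show "norm (half_sum 1 (1 / 4) (Suc (k + K)) (z k t) + \<i> / z k t * lower_integral 1 (1 / 4) (z k t)) <= B1 * exp (49 / 100 * vol / Re (z k t))"
        by (rule B1(2)) (use zs[OF t] h(2) N1 N2 in \<open>simp_all only: zR, auto\<close>)
      have "norm (half_sum (- 1) (3 / 4) (Suc (k + K)) (cnj (z k t))) <= B2 * exp (49 / 100 * vol / Re (cnj (z k t)))"
        by (rule B2(3)) (use zs[OF t] h(2) N1 N2 in \<open>simp_all only: zR, auto\<close>)
      then show "norm (cnj (- \<i> * half_sum (- 1) (3 / 4) (Suc (k + K)) (cnj (z k t)))) <= B2 * exp (49 / 100 * vol / Re (cnj (z k t)))"
        by (simp add: norm_mult)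
    qed
    finally show ?thesis by (simp only: zR distrib_right)
  qed
  have S2: "norm (S2 k t - - 1 / z k t * lower_integral (- 1) (3 / 4) (z k t)) <= (B1 + B2) * exp (49 / 100 * vol / h k)" if t: "-4 <= t" "t <= 0" for k t
  proof -
    have "S2 k t = cnj (half_sum 1 (1 / 4) (Suc (k + K)) (cnj (z k t))) + - \<i> * half_sum (- 1) (3 / 4) (Suc (k + K)) (z k t)"
      unfolding S2_def using sum1[of "cnj (z k t)"] h(1)[of k] by (simp add: zR)
    then have "S2 k t - - 1 / z k t * lower_integral (- 1) (3 / 4) (z k t) = cnj (half_sum 1 (1 / 4) (Suc (k + K)) (cnj (z k t))) + - \<i> * (half_sum (- 1) (3 / 4) (Suc (k + K)) (z k t) + \<i> / z k t * lower_integral (- 1) (3 / 4) (z k t))"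
      by (simp add: algebra_simps)
    also have "norm ... <= B1 * exp (49 / 100 * vol / Re (cnj (z k t))) + B2 * exp (49 / 100 * vol / Re (z k t))"
    proof (rule order_trans[OF norm_triangle_ineq add_mono])
      have "norm (half_sum 1 (1 / 4) (Suc (k + K)) (cnj (z k t))) <= B1 * exp (49 / 100 * vol / Re (cnj (z k t)))"
        by (rule B1(3)) (use zs[OF t] h(2) N1 N2 in \<open>simp_all only: zR, auto\<close>)
      then show "norm (cnj (half_sum 1 (1 / 4) (Suc (k + K)) (cnj (z k t)))) <= B1 * exp (49 / 100 * vol / Re (cnj (z k t)))" by simp
      have "norm (half_sum (- 1) (3 / 4) (Suc (k + K)) (z k t) + \<i> / z k t * lower_integral (- 1) (3 / 4) (z k t)) <= B2 * exp (49 / 100 * vol / Re (z k t))"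
        by (rule B2(2)) (use zs[OF t] h(2) N1 N2 in \<open>simp_all only: zR, auto\<close>)
      then show "norm (- \<i> * (half_sum (- 1) (3 / 4) (Suc (k + K)) (z k t) + \<i> / z k t * lower_integral (- 1) (3 / 4) (z k t))) <= B2 * exp (49 / 100 * vol / Re (z k t))"
        by (simp only: norm_mult norm_minus_cancel norm_ii mult_1)
    qed
    finally show ?thesis by (simp only: zR distrib_right)
  qed
  have contS: "continuous_on {-4..0} (S1 k)" "continuous_on {-4..0} (S2 k)" for k
    unfolding S1_def S2_def z_def by (intro continuous_intros continuous_on_major_sum; use h(1)[of k] in simp)+
  define X1 X2 where "X1 = (\<lambda>k. major_integral (k + K) (h k) * exp (- (of_real (vol / h k) * (1 - \<i>))))"
    and "X2 = (\<lambda>k. major_integral' (k + K) (h k) * exp (- (of_real (vol / h k) * (1 - \<i>))))"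
  define L where "L = gauss (of_real (sqrt 3) * (1 - \<i>)) * gauss (of_real vol / (2 * (1 - \<i>)))"
  define A1 A2 where "A1 = - \<i> / (1 - \<i>) * cis (pi * (1 / 4) / 2) * exp (reg_limit (cis (pi / 6))) * L"
    and "A2 = - 1 / (1 - \<i>) * cis (pi * (3 / 4) / 2) * exp (- reg_limit (cis (pi / 6))) * L"
  have X1: "X1 \<longlonglongrightarrow> A1"
  proof -
    have "(\<lambda>k. integral {-4..0} (\<lambda>t. S1 k t * exp (of_real (real (k + K)) * (of_real (h k) * (1 + \<i> * of_real t)))) * exp (- (of_real (vol / h k) * (1 - \<i>))))
    \<longlonglongrightarrow> - \<i> / (1 - \<i>) * (cis (pi * (1 / 4) / 2) * exp (reg_limit (1 * cis (pi / 6))) * gauss (of_real (sqrt 3) * (1 - \<i>))) * gauss (of_real vol / (2 * (1 - \<i>)))"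
      by (rule major_laplace[OF _ _ _ h(1) h(4) hlim m contS(1) S1[unfolded z_def]]) auto
    then show ?thesis unfolding X1_def major_integral_def A1_def L_def S1_def z_def by (simp add: mult_ac)
  qed
  have X2: "X2 \<longlonglongrightarrow> A2"
  proof -
    have "(\<lambda>k. integral {-4..0} (\<lambda>t. S2 k t * exp (of_real (real (k + K)) * (of_real (h k) * (1 + \<i> * of_real t)))) * exp (- (of_real (vol / h k) * (1 - \<i>))))
    \<longlonglongrightarrow> - 1 / (1 - \<i>) * (cis (pi * (3 / 4) / 2) * exp (reg_limit (- 1 * cis (pi / 6))) * gauss (of_real (sqrt 3) * (1 - \<i>))) * gauss (of_real vol / (2 * (1 - \<i>)))"
      by (rule major_laplace[OF _ _ _ h(1) h(4) hlim m contS(2) S2[unfolded z_def]]) auto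
    then show ?thesis unfolding X2_def major_integral'_def A2_def L_def S2_def z_def by (simp add: mult_ac reg_limit_minus)
  qed
  \<comment> \<open>Unimodular factors and the common nonzero \<open>L\<close> drop out; what
    remains is \<open>exp\<close> of plus and of minus the real part of \<open>reg_limit\<close> at
    the saddle.\<close>
  have norms: "norm A1 \<noteq> norm A2"
  proof -
    have "L \<noteq> 0"
      unfolding L_def gauss_def using v by (intro no_zero_divisors gaussian_integral_nonzero) (auto simp: Re_divide)
    moreover have "norm (1 - \<i>) \<noteq> 0" by (simp add: complex_eq_iff)
    ultimately show ?thesis
      using reg_limit_saddle_nonzero by (simp add: A1_def A2_def norm_mult norm_divide)
  qed
  define c where "c = (\<lambda>b. if b then A1 + A2 else - \<i> * (A1 - A2))"
  have c0: "c b \<noteq> 0" for b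
  proof
    assume "c b = 0"
    then have "A1 = - A2 \<or> A1 = A2" by (auto simp: c_def add_eq_0_iff2 split: if_splits)
    then show False using norms by auto
  qed
  \<comment> \<open>The normalisation of \<open>major_laplace\<close> together with the factor
    \<open>h / pi\<close> of the arc decomposition. Below \<open>K\<close> any positive value will
    do.\<close>
  define w where "w = (\<lambda>n. if K <= n then pi * exp (- (vol / H n)) / H n else 1)"
  have w0: "0 < w n" for n
    using h(1)[of "n - K"] by (auto simp: w_def h_def)
  have wlim: "w \<longlonglongrightarrow> 0"
  proof -
    have "(\<lambda>n. pi * exp (- (vol / sqrt (vol / (2 * real n)))) / sqrt (vol / (2 * real n))) \<longlonglongrightarrow> 0" using v by real_asymp
    then show ?thesis
      by (rule Lim_transform_eventually) (auto simp: w_def H_def intro!: eventually_sequentiallyI[of K])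
  qed
  \<comment> \<open>Taken as the difference, so that the formula holds for every \<open>n\<close>
    and only the limit needs proof.\<close>
  define e where "e = (\<lambda>n. (- 1) ^ (n div 2) * w n * of_int (V1 n) - Re (cis (- sqrt (2 * vol * real n)) * c (even n)))"
  have "e \<longlonglongrightarrow> 0"
  proof (rule LIMSEQ_offset[of _ K], rule Lim_null_comparison)
    have "filterlim (\<lambda>k. inverse (h k)) at_top sequentially"
      by (rule filterlim_inverse_at_top[OF hlim]) (use h(1) in simp)
    moreover have "0 < vol / 100" using v by simp
    ultimately have "filterlim (\<lambda>k. vol / 100 * inverse (h k)) at_top sequentially"
      by (intro filterlim_tendsto_pos_mult_at_top[OF tendsto_const])
    then have "filterlim (\<lambda>k. vol / 100 / h k) at_top sequentially" by (simp only: divide_inverse)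
    then have "(\<lambda>k. exp (- (vol / 100 / h k))) \<longlonglongrightarrow> 0"
      by (intro filterlim_compose[OF exp_at_bot]) (simp add: filterlim_uminus_at_bot)
    then have "(\<lambda>k. 4 * Cm * B3 * pi * exp (- (vol / 100 / h k)) + (norm (X1 k - A1) + norm (X2 k - A2))) \<longlonglongrightarrow> 4 * Cm * B3 * pi * 0 + (0 + 0)"
      by (intro tendsto_intros tendsto_norm_zero LIM_zero X1 X2)
    then show "(\<lambda>k. 4 * Cm * B3 * pi * exp (- (vol / 100 / h k)) + (norm (X1 k - A1) + norm (X2 k - A2))) \<longlonglongrightarrow> 0" by simp
    show "\<forall>\<^sub>F k in sequentially. norm (e (k + K)) <= 4 * Cm * B3 * pi * exp (- (vol / 100 / h k)) + (norm (X1 k - A1) + norm (X2 k - A2))"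
    proof (intro always_eventually allI)
      fix k
      define n where "n = k + K"
      define f where "f = vol / h k"
      define E where "E = exp (- f)"
      define s :: real where "s = (- 1) ^ (n div 2)"
      have s1: "\<bar>s\<bar> = 1" by (simp add: s_def power_abs)
      have wn: "w n = pi * E / h k" by (simp add: w_def n_def E_def f_def h_def)
      define B where "B = 2 * real (Suc n) * (Cm * exp (3 / (50 * h k) + Cm / sqrt (h k))) * exp (real n * h k)"
      have arc: "\<bar>pi * of_int (V1 n) - h k * Re ((- \<i>) ^ n * (major_integral n (h k) + cnj (major_integral' n (h k))))\<bar> <= B * pi"
      proof (rule V1_arc_decomposition[OF h(1)])
        show "4 * h k <= pi / 2" using h(2)[of k] pi_gt3 by simp
        fix r assume r: "0 <= r" "r <= pi" "4 * h k <= \<bar>r - pi / 2\<bar>"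
        have "norm (arc_integrand n (h k) r) = norm (\<Sum>m<2*Suc n. qterm (exp (of_real (- h k) + \<i> * of_real r)) m) * exp (real n * h k)"
          unfolding arc_integrand_def norm_mult norm_exp_eq_Re by simp
        also have "... <= (\<Sum>m<2*Suc n. Cm * exp (3 / (50 * h k) + Cm / sqrt (h k))) * exp (real n * h k)"
          by (intro mult_right_mono sum_norm_le Cm(3) h r) auto
        also have "... = B" by (simp add: B_def)
        finally show "norm (arc_integrand n (h k) r) <= B" .
      qed
      have XM: "of_real E * major_integral n (h k) = cis (- f) * X1 k" "of_real E * major_integral' n (h k) = cis (- f) * X2 k"
      proof -
        have "- (of_real (vol / h k) * (1 - \<i>)) = of_real (- f) + \<i> * of_real f"
        proof -
          have "- (a * (1 - \<i>)) = - a + \<i> * a" for a by (simp add: algebra_simps)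
          then show ?thesis unfolding f_def of_real_minus .
        qed
        then have "exp (- (of_real (vol / h k) * (1 - \<i>))) = of_real E * cis f" by (simp only: exp_add exp_of_real E_def cis_conv_exp)
        moreover have "cis (- f) * cis f = 1" by (simp add: cis_mult)
        ultimately show "of_real E * major_integral n (h k) = cis (- f) * X1 k" "of_real E * major_integral' n (h k) = cis (- f) * X2 k"
          unfolding X1_def X2_def n_def[symmetric] by (simp_all add: mult.left_commute[of "cis (- f)"] mult.commute)
      qed
      define d where "d = (if even n then X1 k + X2 k else - \<i> * (X1 k - X2 k))"
      have "Re ((- \<i>) ^ n * (major_integral n (h k) + cnj (major_integral' n (h k)))) * E = Re ((- \<i>) ^ n * (of_real E * major_integral n (h k) + cnj (of_real E * major_integral' n (h k))))"
      proof -
        have "(- \<i>) ^ n * (of_real E * major_integral n (h k) + cnj (of_real E * major_integral' n (h k))) = of_real E * ((- \<i>) ^ n * (major_integral n (h k) + cnj (major_integral' n (h k))))"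
          by (simp add: algebra_simps)
        moreover have "Re (of_real E * G) = Re G * E" for G by simp
        ultimately show ?thesis by (simp only:)
      qed
      then have "s * (Re ((- \<i>) ^ n * (major_integral n (h k) + cnj (major_integral' n (h k)))) * E) = Re (if even n then cis (- f) * X1 k + cis (- f) * X2 k else - \<i> * (cis (- f) * X1 k - cis (- f) * X2 k))"
        unfolding XM s_def by (simp only: Re_rotate)
      also have "... = Re (cis (- f) * d)" by (simp only: d_def if_distrib[of Re] if_distrib[of "\<lambda>x. cis (- f) * x"]) (simp add: algebra_simps)
      finally have rot: "s * (Re ((- \<i>) ^ n * (major_integral n (h k) + cnj (major_integral' n (h k)))) * E) = Re (cis (- f) * d)" .
      define R where "R = Re ((- \<i>) ^ n * (major_integral n (h k) + cnj (major_integral' n (h k))))"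
      have "s * w n * of_int (V1 n) - Re (cis (- f) * d) = s * (E / h k) * (pi * of_int (V1 n) - h k * R)"
        unfolding rot[symmetric] R_def[symmetric] wn using h(1)[of k] by (simp add: field_simps)
      then have "\<bar>s * w n * of_int (V1 n) - Re (cis (- f) * d)\<bar> = (E / h k) * \<bar>pi * of_int (V1 n) - h k * R\<bar>"
        using s1 h(1)[of k] by (simp add: abs_mult E_def)
      also have "... <= (E / h k) * (B * pi)" using arc h(1)[of k] unfolding R_def by (intro mult_left_mono) (auto simp: E_def)
      also have "... <= 4 * Cm * B3 * pi * exp (- (vol / 100 / h k))"
      proof -
        have N: "2 * real (Suc n) <= 4 / (h k)^2"
        proof -
          have "2 * (real (Suc n) * (h k)^2) <= 2 * 2" unfolding n_def by (intro mult_left_mono N2) simp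
          also have "2 * 2 = (4::real)" by simp
          finally have "2 * real (Suc n) * (h k)^2 <= 4" by (simp only: mult.assoc)
          moreover have "0 < (h k)^2" using h(1)[of k] by simp
          ultimately show ?thesis by (simp only: pos_le_divide_eq)
        qed
        \<comment> \<open>In percent of \<open>vol / h\<close>: the minor arcs contribute 48,
          \<open>exp (n h)\<close> contributes 50 and the normalisation subtracts 100. Of the
          remaining 2, one is spent on the subexponential factors.\<close>
        have ex: "- f + (3 / (50 * h k) + real n * h k) <= - (2 * vol / 100 / h k)"
        proof -
          have "3 / (50 * h k) <= 48 / 100 * vol / h k" using v h(1)[of k] by (simp add: field_simps)
          moreover have "real n * h k = 50 / 100 * vol / h k" using m[of k] h(1)[of k] by (simp add: n_def)
          moreover have "f = 100 / 100 * vol / h k" by (simp add: f_def)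
          moreover have "48 / 100 * vol / h k + 50 / 100 * vol / h k - 100 / 100 * vol / h k = - (2 * vol / 100 / h k)"
            using h(1)[of k] by (simp add: field_simps)
          ultimately show ?thesis by linarith
        qed
        have "(E / h k) * (B * pi) = pi * Cm * (2 * real (Suc n) / h k) * exp (Cm / sqrt (h k)) * exp (- f + (3 / (50 * h k) + real n * h k))"
          unfolding B_def E_def exp_add by (simp add: mult_ac)
        also have "... <= pi * Cm * (4 / (h k)^2 / h k) * exp (Cm / sqrt (h k)) * exp (- (2 * vol / 100 / h k))"
          using N ex Cm(1) h(1)[of k] by (intro mult_mono mult_left_mono divide_right_mono) auto
        also have "... = 4 * pi * Cm * exp (- (2 * vol / 100 / h k)) * (exp (Cm / sqrt (h k)) / h k ^ 3)"
          by (simp add: power2_eq_square power3_eq_cube mult_ac)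
        also have "... <= 4 * pi * Cm * exp (- (2 * vol / 100 / h k)) * (B3 * exp (vol / 100 / h k))"
          using B3(2)[OF h(1) h(4), of k] Cm(1) by (intro mult_left_mono) auto
        also have "... = 4 * Cm * B3 * pi * exp (- (2 * vol / 100 / h k) + vol / 100 / h k)" by (simp only: exp_add mult_ac)
        also have "- (2 * vol / 100 / h k) + vol / 100 / h k = - (vol / 100 / h k)" using h(1)[of k] by (simp add: field_simps)
        finally show ?thesis .
      qed
      finally have e1: "\<bar>s * w n * of_int (V1 n) - Re (cis (- f) * d)\<bar> <= 4 * Cm * B3 * pi * exp (- (vol / 100 / h k))" .
      have e2: "\<bar>Re (cis (- f) * d) - Re (cis (- f) * c (even n))\<bar> <= norm (X1 k - A1) + norm (X2 k - A2)"
      proof -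
        have "\<bar>Re (cis (- f) * d) - Re (cis (- f) * c (even n))\<bar> = \<bar>Re (cis (- f) * (d - c (even n)))\<bar>"
          by (simp only: right_diff_distrib minus_complex.simps)
        also have "... <= norm (cis (- f) * (d - c (even n)))" by (rule abs_Re_le_cmod)
        also have "... = norm (d - c (even n))" by (simp add: norm_mult)
        also have "... <= norm (X1 k - A1) + norm (X2 k - A2)"
        proof (cases "even n")
          case True
          have "d - c (even n) = (X1 k - A1) + (X2 k - A2)" using True by (simp add: d_def c_def)
          then show ?thesis using norm_triangle_ineq[of "X1 k - A1" "X2 k - A2"] by (simp only:)
        next
          case False
          have "d - c (even n) = - \<i> * ((X1 k - A1) - (X2 k - A2))" using False by (simp add: d_def c_def algebra_simps)
          then have "norm (d - c (even n)) = norm ((X1 k - A1) - (X2 k - A2))" by (simp only: norm_mult norm_minus_cancel norm_ii mult_1)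
          then show ?thesis using norm_triangle_ineq4[of "X1 k - A1" "X2 k - A2"] by (simp only:)
        qed
        finally show ?thesis .
      qed
      have "e n = (s * w n * of_int (V1 n) - Re (cis (- f) * d)) + (Re (cis (- f) * d) - Re (cis (- f) * c (even n)))"
        unfolding e_def s_def f_def phase n_def by simp
      then show "norm (e (k + K)) <= 4 * Cm * B3 * pi * exp (- (vol / 100 / h k)) + (norm (X1 k - A1) + norm (X2 k - A2))"
        using e1 e2 unfolding n_def[symmetric] real_norm_def by linarith
    qed
  qed
  then show ?thesis by (rule that[of c w e, OF c0 w0 wlim]) (simp add: e_def)
qed

theorem theorem1p1:
  shows "for_almost_all (\<lambda>n. card {i \<in> {0..3}. V1 (n + i) > 0} = 2 \<and>
                             card {i \<in> {0..3}. V1 (n + i) < 0} = 2) \<and>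
         (\<exists>E. natural_density_0 E \<and>
           filterlim (\<lambda>n. \<bar>V1 n\<bar>) at_top (inf sequentially (principal (- E))))"
proof -
  obtain c :: "bool \<Rightarrow> complex" and w e :: "nat \<Rightarrow> real"
    where "\<And>b. c b \<noteq> 0" "\<And>n. 0 < w n" "w \<longlonglongrightarrow> 0" "e \<longlonglongrightarrow> 0"
    "\<And>n. (- 1) ^ (n div 2) * w n * of_int (V1 n) = Re (cis (- sqrt (2 * vol * real n)) * c (even n)) + e n"
    using V1_asymptotic by blast
  moreover have "0 < 2 * vol" using vol_lower by simp
  ultimately show ?thesis using sign_pattern_from_asymptotic[of "2 * vol" c w e V1] by blast
qed

end
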